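(* Let $W$ be of type $\tilde G_2$ with $L(s_1)=a$, $L(s_0)=L(s_2)=b$ ($a,b\ge1$ integers). Lusztig's $\mathbf a$-function on $W$ is given as follows: for each two-sided cell $\Gamma$ and each $w\in\Gamma$ one has $\mathbf a(w)=\mathbf a_{\pi_\Gamma}$, where (i) $\mathbf a_{\pi_{\Gamma_0}}=L(\mathsf w_0)=3a+3b$; (ii) $\mathbf a_{\pi_{\Gamma_1}}=a+b$ if $a\ge2b$, and $\mathbf a_{\pi_{\Gamma_1}}=3b$ if $a\le2b$; (iii) $\mathbf a_{\pi_{\Gamma_2}}=3a-2b$ if $2a\ge3b$, and $\mathbf a_{\pi_{\Gamma_2}}=a+b$ if $2a\le3b$; (iv) if $\Gamma$ is a finite two-sided cell, $\mathbf a_{\pi_\Gamma}=\tilde{\mathbf a}_\Gamma$.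
   Context: $W$ is the Coxeter group with generators $s_0,s_1,s_2$ and relations $s_i^2=e$, $(s_1s_2)^6=(s_0s_2)^3=(s_0s_1)^2=e$; $L:W\to\mathbb N$ is additive on length-additive products; $r=a/b$; $\mathsf w_0$ is the longest element of $\langle s_1,s_2\rangle$. $R=\mathbb Z[q,q^{-1}]$; the Hecke algebra $\mathcal H$ is the $R$-algebra with basis $\{T_w\}$ and $T_wT_s=T_{ws}$ if $\ell(ws)>\ell(w)$, $T_wT_s=T_{ws}+(q^{L(s)}-q^{-L(s)})T_w$ otherwise. The Kazhdan--Lusztig basis $\{C_w\}$ is the unique basis with $\overline{C_w}=C_w$ (bar involution: $\overline q=q^{-1}$, $\overline{T_w}=T_{w^{-1}}^{-1}$) and $C_w\in T_w+\sum_{y<w}q^{-1}\mathbb Z[q^{-1}]T_y$; $C_xC_y=\sum_zh_{x,y,z}C_z$. Lusztig's $\mathbf a$-function: $\mathbf a(z)=\min\{n\in\mathbb N\mid q^{-n}h_{x,y,z}\in\mathbb Z[q^{-1}]\ \forall x,y\in W\}$. Two-sided cells are the equivalence classes of the preorder $\le_{\mathcal{LR}}$, the transitive closure of: $x\le y$ if $C_x$ appears in the Kazhdan--Lusztig expansion of $hC_yh'$ for some $h,h'\in\mathcal H$. There are (for each choice of $a,b$) exactly three infinite two-sided cells: $\Gamma_0$, containing $\mathsf w_0$; $\Gamma_1$, containing $s_0s_1$ if $r\ge2$ and $s_0s_2s_0$ if $r\le2$; $\Gamma_2$, containing $s_1s_2s_1s_2s_1$ if $r\ge3/2$ and $s_0s_1$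 if $r\le3/2$. Every finite two-sided cell $\Gamma$ meets some dihedral standard parabolic subgroup $W_I$ ($|I|=2$), and $\tilde{\mathbf a}_\Gamma:=\mathbf a_I(z)$ for any such $I$ and any $z\in\Gamma\cap W_I$, where $\mathbf a_I$ is Lusztig's $\mathbf a$-function of $(W_I,I,L|_{W_I})$ (this does not depend on the choices). *)

theory Defs
  imports "HOL-Algebra.Generated_Groups" "HOL-Library.Poly_Mapping" "HOL-Library.FuncSet"
begin

section \<open>Laurent polynomials\<close>

text \<open>
  The ring of integral Laurent polynomials in \<open>q\<close> is the group ring of the additive group of
  integers, i.e. the type of finitely supported functions \<open>int \<Rightarrow> int\<close> with convolution as
  product; the coefficient of \<open>q\<close> to the power \<open>n\<close> in \<open>p\<close> is \<open>Poly_Mapping.lookup p n\<close>.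
\<close>

type_synonym laurent = "int \<Rightarrow>\<^sub>0 int"

definition qpow :: "int \<Rightarrow> laurent" where
  "qpow n = Poly_Mapping.single n 1"

definition laurent_bar :: "laurent \<Rightarrow> laurent" where
  "laurent_bar p = Poly_Mapping.map_key uminus p"

definition poly_q_inv :: "laurent set" where
  "poly_q_inv = {p. Poly_Mapping.keys p \<subseteq> {..0}}"

definition q_inv_poly_q_inv :: "laurent set" where
  "q_inv_poly_q_inv = {p. Poly_Mapping.keys p \<subseteq> {..<0}}"

definition scale :: "laurent \<Rightarrow> ('w \<Rightarrow>\<^sub>0 laurent) \<Rightarrow> ('w \<Rightarrow>\<^sub>0 laurent)" where
  "scale c h = Poly_Mapping.map ((*) c) h"


section \<open>Weighted Coxeter groups, Hecke algebras and cells\<close>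

text \<open>
  The notions below make sense for a group \<open>W\<close>, a set \<open>S\<close> of generators and a function \<open>L\<close>;
  they have their usual meaning when \<open>(W, S)\<close> is a Coxeter system and \<open>L\<close> a positive weight
  function. The locale deliberately carries no assumptions: it is used both for the whole group
  and for its standard parabolic subgroups.
\<close>

locale weighted_group =
  fixes W :: "'w monoid" (structure)
    and S :: "'w set"
    and L :: "'w \<Rightarrow> nat"
begin

definition len :: "'w \<Rightarrow> nat" where
  "len w = (LEAST n. \<exists>ss. set ss \<subseteq> S \<and> length ss = n \<and> foldr (\<otimes>) ss \<one> = w)"

definition weight_function :: bool where
  "weight_function \<longleftrightarrow>
     (\<forall>x\<in>carrier W. \<forall>y\<in>carrier W. len (x \<otimes> y) = len x + len y \<longrightarrow> L (x \<otimes> y) = L x + L y)"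

definition reflections :: "'w set" where
  "reflections = {w \<otimes> s \<otimes> inv w | w s. w \<in> carrier W \<and> s \<in> S}"

definition bruhat_less :: "('w \<times> 'w) set" where
  "bruhat_less = {(y, y \<otimes> t) | y t. y \<in> carrier W \<and> t \<in> reflections \<and> len y < len (y \<otimes> t)}\<^sup>+"

definition longest_element :: "'w set \<Rightarrow> 'w" where
  "longest_element I =
     (THE w. w \<in> generate W I \<and> (\<forall>v\<in>generate W I. len v \<le> len w))"

text \<open>The free module on the basis \<open>T w\<close>, for \<open>w\<close> in \<open>W\<close>.\<close>

definition hecke_carrier :: "('w \<Rightarrow>\<^sub>0 laurent) set" where
  "hecke_carrier = {h. Poly_Mapping.keys h \<subseteq> carrier W}"

definition T :: "'w \<Rightarrow> ('w \<Rightarrow>\<^sub>0 laurent)" where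
  "T w = Poly_Mapping.single w 1"

text \<open>
  The first conjunct fixes a product on the whole type by making it zero off the carrier of
  the algebra, so that there is exactly one such product.
\<close>

definition is_hecke_mult ::
  "(('w \<Rightarrow>\<^sub>0 laurent) \<Rightarrow> ('w \<Rightarrow>\<^sub>0 laurent) \<Rightarrow> ('w \<Rightarrow>\<^sub>0 laurent)) \<Rightarrow> bool" where
  "is_hecke_mult M \<longleftrightarrow>
     (\<forall>g h. g \<notin> hecke_carrier \<or> h \<notin> hecke_carrier \<longrightarrow> M g h = 0) \<and>
     (\<forall>g\<in>hecke_carrier. \<forall>h\<in>hecke_carrier. M g h \<in> hecke_carrier) \<and>
     (\<forall>f\<in>hecke_carrier. \<forall>g\<in>hecke_carrier. \<forall>h\<in>hecke_carrier.
        M (f + g) h = M f h + M g h \<and> M f (g + h) = M f g + M f h \<and>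
        M (M f g) h = M f (M g h)) \<and>
     (\<forall>c. \<forall>g\<in>hecke_carrier. \<forall>h\<in>hecke_carrier.
        M (scale c g) h = scale c (M g h) \<and> M g (scale c h) = scale c (M g h)) \<and>
     (\<forall>h\<in>hecke_carrier. M (T \<one>) h = h \<and> M h (T \<one>) = h) \<and>
     (\<forall>w\<in>carrier W. \<forall>s\<in>S.
        M (T w) (T s) =
          (if len (w \<otimes> s) > len w then T (w \<otimes> s)
           else T (w \<otimes> s) + scale (qpow (int (L s)) - qpow (- int (L s))) (T w)))"

definition hecke_mult :: "('w \<Rightarrow>\<^sub>0 laurent) \<Rightarrow> ('w \<Rightarrow>\<^sub>0 laurent) \<Rightarrow> ('w \<Rightarrow>\<^sub>0 laurent)"
  (infixl \<open>\<star>\<close> 70) where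
  "hecke_mult = (THE M. is_hecke_mult M)"

definition hecke_inv :: "('w \<Rightarrow>\<^sub>0 laurent) \<Rightarrow> ('w \<Rightarrow>\<^sub>0 laurent)" where
  "hecke_inv h = (THE g. g \<in> hecke_carrier \<and> h \<star> g = T \<one> \<and> g \<star> h = T \<one>)"

definition bar :: "('w \<Rightarrow>\<^sub>0 laurent) \<Rightarrow> ('w \<Rightarrow>\<^sub>0 laurent)" where
  "bar h = (\<Sum>w\<in>Poly_Mapping.keys h. scale (laurent_bar (Poly_Mapping.lookup h w)) (hecke_inv (T (inv w))))"

definition lincomb :: "('w \<Rightarrow>\<^sub>0 laurent) \<Rightarrow> ('w \<Rightarrow> ('w \<Rightarrow>\<^sub>0 laurent)) \<Rightarrow> ('w \<Rightarrow>\<^sub>0 laurent)" where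
  "lincomb c B = (\<Sum>w\<in>Poly_Mapping.keys c. scale (Poly_Mapping.lookup c w) (B w))"

definition is_basis :: "('w \<Rightarrow> ('w \<Rightarrow>\<^sub>0 laurent)) \<Rightarrow> bool" where
  "is_basis B \<longleftrightarrow>
     (\<forall>w\<in>carrier W. B w \<in> hecke_carrier) \<and>
     (\<forall>h\<in>hecke_carrier. \<exists>!c. c \<in> hecke_carrier \<and> h = lincomb c B)"

definition is_KL_basis :: "('w \<Rightarrow> ('w \<Rightarrow>\<^sub>0 laurent)) \<Rightarrow> bool" where
  "is_KL_basis B \<longleftrightarrow>
     B \<in> extensional (carrier W) \<and> is_basis B \<and>
     (\<forall>w\<in>carrier W.
        bar (B w) = B w \<and>
        Poly_Mapping.keys (B w - T w) \<subseteq> {y. (y, w) \<in> bruhat_less} \<and>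
        (\<forall>y. Poly_Mapping.lookup (B w - T w) y \<in> q_inv_poly_q_inv))"

definition C :: "'w \<Rightarrow> ('w \<Rightarrow>\<^sub>0 laurent)" where
  "C = (THE B. is_KL_basis B)"

definition KL_coeff :: "('w \<Rightarrow>\<^sub>0 laurent) \<Rightarrow> 'w \<Rightarrow> laurent" where
  "KL_coeff h = Poly_Mapping.lookup (THE c. c \<in> hecke_carrier \<and> h = lincomb c C)"

definition struct_const :: "'w \<Rightarrow> 'w \<Rightarrow> 'w \<Rightarrow> laurent" where
  "struct_const x y z = KL_coeff (C x \<star> C y) z"

definition lusztig_a :: "'w \<Rightarrow> nat" where
  "lusztig_a z =
     (LEAST n. \<forall>x\<in>carrier W. \<forall>y\<in>carrier W.
        qpow (- int n) * struct_const x y z \<in> poly_q_inv)"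

definition le_LR :: "('w \<times> 'w) set" where
  "le_LR =
     {(x, y). x \<in> carrier W \<and> y \<in> carrier W \<and>
        (\<exists>h\<in>hecke_carrier. \<exists>h'\<in>hecke_carrier. KL_coeff (h \<star> C y \<star> h') x \<noteq> 0)}\<^sup>+"

definition two_sided_cells :: "'w set set" where
  "two_sided_cells = carrier W // {(x, y). (x, y) \<in> le_LR \<and> (y, x) \<in> le_LR}"

definition parabolic_a :: "'w set \<Rightarrow> 'w \<Rightarrow> nat" where
  "parabolic_a I = weighted_group.lusztig_a (W\<lparr>carrier := generate W I\<rparr>) I L"

definition a_tilde :: "'w set \<Rightarrow> nat" where
  "a_tilde \<Gamma> =
     (THE n. \<exists>I z. I \<subseteq> S \<and> card I = 2 \<and> z \<in> \<Gamma> \<inter> generate W I \<and> n = parabolic_a I z)"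

end


section \<open>The affine Weyl group of type \<open>G\<^sub>2\<close>\<close>

text \<open>
  The monoid presented by the alphabet \<open>'g\<close> and the relations \<open>r = 1\<close> for \<open>r\<close> in \<open>R\<close>. If all
  words \<open>[g, g]\<close> are in \<open>R\<close>, every generator is its own inverse and this is also
  the group with that presentation.
\<close>

inductive word_eq :: "'g list set \<Rightarrow> 'g list \<Rightarrow> 'g list \<Rightarrow> bool" for R where
  relator: "r \<in> R \<Longrightarrow> word_eq R r []"
| refl: "word_eq R u u"
| sym: "word_eq R u v \<Longrightarrow> word_eq R v u"
| trans: "word_eq R u v \<Longrightarrow> word_eq R v w \<Longrightarrow> word_eq R u w"
| append: "word_eq R u v \<Longrightarrow> word_eq R u' v' \<Longrightarrow> word_eq R (u @ u') (v @ v')"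

definition word_class :: "'g list set \<Rightarrow> 'g list \<Rightarrow> 'g list set" where
  "word_class R u = {v. word_eq R u v}"

definition presented :: "'g list set \<Rightarrow> 'g list set monoid" where
  "presented R =
     \<lparr>carrier = range (word_class R),
      mult = (\<lambda>A B. {w. \<exists>u\<in>A. \<exists>v\<in>B. word_eq R (u @ v) w}),
      one = word_class R []\<rparr>"

lemma word_class_eq_iff: "word_class R u = word_class R v \<longleftrightarrow> word_eq R u v"
  unfolding word_class_def by (auto intro: word_eq.intros)

lemma presented_mult:
  "word_class R u \<otimes>\<^bsub>presented R\<^esub> word_class R v = word_class R (u @ v)"
proof -
  have "(\<exists>u'. word_eq R u u' \<and> (\<exists>v'. word_eq R v v' \<and> word_eq R (u' @ v') w))
      \<longleftrightarrow> word_eq R (u @ v) w" for w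
    by (meson word_eq.append word_eq.refl word_eq.trans)
  then show ?thesis
    by (auto simp: presented_def word_class_def)
qed

lemma group_presented:
  assumes "\<And>g. [g, g] \<in> R"
  shows "group (presented R)"
proof (rule groupI)
  fix x assume "x \<in> carrier (presented R)"
  then obtain u where u: "x = word_class R u" by (auto simp: presented_def)
  have "word_eq R (rev u @ u) []"
  proof (induction u)
    case (Cons g u)
    have "word_eq R (rev u @ [g, g] @ u) (rev u @ [] @ u)"
      by (intro word_eq.append word_eq.refl word_eq.relator assms)
    then show ?case using Cons by (auto intro: word_eq.trans)
  qed (auto intro: word_eq.refl)
  then have "word_class R (rev u) \<otimes>\<^bsub>presented R\<^esub> x = \<one>\<^bsub>presented R\<^esub>"
    unfolding u presented_mult by (simp add: presented_def word_class_eq_iff)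
  then show "\<exists>y\<in>carrier (presented R). y \<otimes>\<^bsub>presented R\<^esub> x = \<one>\<^bsub>presented R\<^esub>"
    by (auto simp: presented_def)
next
  fix x y z
  assume "x \<in> carrier (presented R)" "y \<in> carrier (presented R)" "z \<in> carrier (presented R)"
  then obtain u v w where "x = word_class R u" "y = word_class R v" "z = word_class R w"
    by (auto simp: presented_def)
  then show "x \<otimes>\<^bsub>presented R\<^esub> y \<otimes>\<^bsub>presented R\<^esub> z
      = x \<otimes>\<^bsub>presented R\<^esub> (y \<otimes>\<^bsub>presented R\<^esub> z)"
    by (simp add: presented_mult)
next
  fix x y
  assume "x \<in> carrier (presented R)" "y \<in> carrier (presented R)"
  then obtain u v where "x = word_class R u" "y = word_class R v"
    by (auto simp: presented_def)
  then have "x \<otimes>\<^bsub>presented R\<^esub> y = word_class R (u @ v)" by (simp add: presented_mult)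
  then show "x \<otimes>\<^bsub>presented R\<^esub> y \<in> carrier (presented R)" by (simp add: presented_def)
next
  show "\<one>\<^bsub>presented R\<^esub> \<in> carrier (presented R)" by (simp add: presented_def)
next
  fix x assume "x \<in> carrier (presented R)"
  then obtain u where u: "x = word_class R u" by (auto simp: presented_def)
  have "\<one>\<^bsub>presented R\<^esub> = word_class R []" by (simp add: presented_def)
  then show "\<one>\<^bsub>presented R\<^esub> \<otimes>\<^bsub>presented R\<^esub> x = x"
    unfolding u by (simp add: presented_mult)
qed

datatype gen = G0 | G1 | G2

definition G2t_relators :: "gen list set" where
  "G2t_relators =
     {[G0, G0], [G1, G1], [G2, G2],
      concat (replicate 6 [G1, G2]), concat (replicate 3 [G0, G2]), concat (replicate 2 [G0, G1])}"

definition G2t :: "gen list set monoid" where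
  "G2t = presented G2t_relators"

definition elt :: "gen list \<Rightarrow> gen list set" where
  "elt u = word_class G2t_relators u"

definition G2t_gens :: "gen list set set" where
  "G2t_gens = {elt [G0], elt [G1], elt [G2]}"

lemma group_G2t: "group G2t"
  unfolding G2t_def
proof (rule group_presented)
  fix g show "[g, g] \<in> G2t_relators" by (cases g) (auto simp: G2t_relators_def)
qed

lemma elt_append: "elt (u @ v) = elt u \<otimes>\<^bsub>G2t\<^esub> elt v"
  by (simp add: elt_def G2t_def presented_mult)


definition w0_G2 :: "gen list set" where
  "w0_G2 = weighted_group.longest_element G2t G2t_gens {elt [G1], elt [G2]}"

text \<open>
  The elements identifying the three infinite two-sided cells, the thresholds for \<open>a / b\<close> being
  written without division. When \<open>a = 2 * b\<close> (for \<open>\<Gamma>\<^sub>1\<close>) or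
  \<open>2 * a = 3 * b\<close> (for \<open>\<Gamma>\<^sub>2\<close>), either of the two elements identifies the cell.
\<close>

definition is_Gamma0 :: "gen list set set \<Rightarrow> bool" where
  "is_Gamma0 \<Gamma> \<longleftrightarrow> w0_G2 \<in> \<Gamma>"

definition is_Gamma1 :: "nat \<Rightarrow> nat \<Rightarrow> gen list set set \<Rightarrow> bool" where
  "is_Gamma1 a b \<Gamma> \<longleftrightarrow>
     (a \<ge> 2 * b \<and> elt [G0, G1] \<in> \<Gamma>) \<or> (a \<le> 2 * b \<and> elt [G0, G2, G0] \<in> \<Gamma>)"

definition is_Gamma2 :: "nat \<Rightarrow> nat \<Rightarrow> gen list set set \<Rightarrow> bool" where
  "is_Gamma2 a b \<Gamma> \<longleftrightarrow>
     (2 * a \<ge> 3 * b \<and> elt [G1, G2, G1, G2, G1] \<in> \<Gamma>) \<or> (2 * a \<le> 3 * b \<and> elt [G0, G1] \<in> \<Gamma>)"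

end

theory Submission imports Defs begin

text \<open>
  Write \<open>\<pi>\<^sub>i\<close> for the cell representations of Guilhot and Parkinson. If \<open>\<pi>\<close> has entries of degree at most
  \<open>\<alpha>\<close> on the standard basis, the coefficients of \<open>q\<^sup>\<alpha>\<close> multiply like the leading terms of the
  products \<open>C\<^sub>x C\<^sub>y\<close>. If these leading matrices vanish outside a set \<open>\<Gamma>\<close> and are linearly independent on it, then
  every \<open>h\<^bsub>x,y,z\<^esub>\<close> with \<open>z\<close> in \<open>\<Gamma>\<close> has degree at most \<open>\<alpha>\<close>, as soon as \<open>\<pi>\<close> kills
  the parts of \<open>C\<^sub>x C\<^sub>y\<close> that lie below \<open>\<Gamma>\<close>; and an identity between leading matrices yields nonzero leading coefficients,
  hence both the value of the \<open>a\<close>-function and the cells. Outside the lowest cell, which is treated by degrees of products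
  \<open>T\<^sub>x T\<^sub>y\<close>, the group consists of finitely many words and two families
  \<open>u\<^sup>-\<^sup>1 d t\<^sup>n v\<close>, so every hypothesis reduces to a finite computation with Laurent polynomials, in which
  only the face containing \<open>(a, b)\<close> of the arrangement \<open>a = 2b\<close>, \<open>2a = 3b\<close>, \<open>a = b\<close> matters.
\<close>

text \<open>\<open>W\<close> is infinite, so no list of products can be inspected, and the
  Kazhdan--Lusztig polynomials are never computed. Instead, \<open>C w\<close> is \<open>T w\<close>
  plus terms with coefficients in negative powers of q; under a matrix representation of bounded
  degree it therefore has the leading matrix of \<open>T w\<close>. That a representation kills
  \<open>C w\<close> is tested on a bar-invariant combination of products of the \<open>Cs s\<close>
  whose top term sits at a factor of w; bar-invariance then removes the error terms. The infinite
  families can be treated for all n at once because t acts on leading matrices through a recursion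
  with coefficient \<zeta> + \<zeta>^-1: on an infinite cell the leading matrices are matrix units
  times characters of SL_2, and Clebsch--Gordan supplies the products. The lowest cell escapes this
  scheme since its value 3a + 3b is the largest degree that any \<open>T x ** T y\<close> can have.
  All exponents are linear forms in a and b, and an inequality between two such forms holds on an
  open face as soon as it holds on the rays that span it, strictly if it is strict on one of them;
  this is why seven faces account for all a and b.\<close>

abbreviation "coef \<equiv> Poly_Mapping.lookup"
abbreviation "supp \<equiv> Poly_Mapping.keys"
abbreviation "sgl \<equiv> Poly_Mapping.single"
abbreviation "GW \<equiv> carrier G2t"
abbreviation ginv (\<open>ginv _\<close> [81] 80) where "ginv x \<equiv> inv\<^bsub>G2t\<^esub> x"
abbreviation (in weighted_group) "HC \<equiv> hecke_carrier"
lemmas (in weighted_group) HC_def = hecke_carrier_def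
notation (in weighted_group) hecke_mult (infixl \<open>**\<close> 70)
abbreviation (in weighted_group) "WW \<equiv> carrier W"
abbreviation (in weighted_group) wm (infixl \<open><*>\<close> 70) where "x <*> y \<equiv> x \<otimes> y"
abbreviation "lbar \<equiv> laurent_bar"
abbreviation (input) iff_ascii (infixr \<open><->\<close> 25) where "p <-> q \<equiv> p = (q :: bool)"
type_synonym 'a hk = "'a \<Rightarrow>\<^sub>0 laurent"

section \<open>Coxeter groups with a reflection cocycle\<close>

text \<open>\<open>N x\<close> plays the role of the inversion set, the reflections t with l(xt) <
  l(x), as \<open>N_reflection_iff\<close> confirms; \<open>N_mult\<close> is its cocycle rule.
  Exchange, Bruhat lifting and the Hecke algebra all follow from this cocycle, and it restricts
  unchanged to standard parabolic subgroups. \<open>L_conj\<close> makes L constant on conjugate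
  generators, which lets left and right multiplication by generators commute.\<close>

locale coxeter = weighted_group W S L + group W for W (structure) and S and L +
 fixes N :: "'a => 'a set"
 assumes S_carrier: "S <= WW"
 and S_sq: "s : S ==> s<*>s = \<one>"
 and S_gen: "x : WW ==> EX ss. set ss <= S & foldr (<*>) ss \<one> = x"
 and N_mult: "x : WW ==> y : WW ==>
 N (x<*>y) = sym_diff (N y) ((%t. inv y<*>t<*>y) ` N x)"
 and N_gen: "s : S ==> N s = {s}"
 and N_carrier: "x : WW ==> N x <= WW"
 and L_pos: "s : S ==> 0 < L s"
 and L_conj: "s : S ==> t : S ==> w : WW ==> s<*>w = w<*>t ==> L s = L t"
begin

lemma S_in [simp, intro]: "s : S ==> s : WW"
 using S_carrier by auto

lemma inv_S [simp]: "s : S ==> inv s = s"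
 using S_sq by (simp add: inv_equality)

abbreviation "wprod ss \<equiv> foldr (<*>) ss \<one>"

lemma wprod_closed [simp]: "set ss <= S ==> wprod ss : WW"
 by (induction ss) auto
lemma wprod_append: "set us <= S ==> set vs <= S ==> wprod (us @ vs) = wprod us<*>wprod vs"
 by (induction us) (auto simp: m_assoc)
lemma wprod_snoc: "set us <= S ==> s : S ==> wprod (us @ [s]) = wprod us<*>s"
 by (simp add: wprod_append del: foldr_append)
lemma wprod_inv: "set us <= S ==> inv (wprod us) = wprod (rev us)"
 by (induction us) (auto simp: inv_mult_group wprod_snoc simp del: foldr_append)

lemma len_le: "set ss <= S ==> len (wprod ss) <= length ss"
 unfolding len_def by (rule Least_le) auto

lemma reduced_word: assumes "x : WW"
 obtains ss where "set ss <= S" "length ss = len x" "wprod ss = x"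
proof -
 have "EX n ss. set ss <= S & length ss = n & wprod ss = x" using S_gen[OF assms] by auto
 from LeastI_ex[OF this] show ?thesis using that unfolding len_def by auto
qed

lemma len_one [simp]: "len \<one> = 0"
 using len_le[of "[]"] by simp

lemma len_0_iff: "x : WW ==> len x = 0 <-> x = \<one>"
 by (metis len_one reduced_word foldr.simps(1) id_apply length_0_conv)
lemma len_mult_le: "x : WW ==> y : WW ==> len (x<*>y) <= len x + len y"
 by (metis reduced_word wprod_append len_le length_append set_append Un_least)

lemma len_inv [simp]: assumes "x : WW" shows "len (inv x) = len x"
proof -
 have *: "len (inv y) <= len y" if y: "y : WW" for y
 by (metis reduced_word[OF y] wprod_inv len_le length_rev set_rev)
 show ?thesis using *[OF assms] *[of "inv x"] assms by simp
qed

lemma len_S_le: "s : S ==> len s <= 1"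
 using len_le[of "[s]"] by simp

lemma N_one [simp]: "N \<one> = {}"
 using N_mult[of \<one> \<one>] N_carrier[of \<one>] by (force simp: image_iff)

lemma S_ne_one: "s : S ==> s ~= \<one>"
 using N_gen N_one by force

lemma inv_cancel [simp]: "y : WW ==> z : WW ==> inv y<*>(y<*>z) = z"
 "y : WW ==> z : WW ==> y<*>(inv y<*>z) = z"
 by (simp_all add: m_assoc[symmetric])

lemma conj_image_mem: assumes "X <= WW" "t : WW" "y : WW"
 shows "t : (%t. inv y<*>t<*>y) ` X <-> y<*>t<*>inv y : X"
proof
 assume "t : (%t. inv y<*>t<*>y) ` X"
 then obtain u where u: "u : X" "t = inv y<*>u<*>y" by auto
 hence "u : WW" using assms by auto
 hence "y<*>t<*>inv y = u" using u assms by (simp add: m_assoc)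
 thus "y<*>t<*>inv y : X" using u by simp
next
 assume *: "y<*>t<*>inv y : X"
 have "t = inv y<*>(y<*>t<*>inv y)<*>y" using assms by (simp add: m_assoc)
 thus "t : (%t. inv y<*>t<*>y) ` X" using * by blast
qed

lemma N_mult_mem: assumes "x : WW" "y : WW" "t : WW"
 shows "t : N (x<*>y) <-> ((t : N y) ~= (y<*>t<*>inv y : N x))"
 using assms N_mult[of x y] conj_image_mem[OF N_carrier[OF assms(1)] assms(3,2)] by auto

text \<open>Reading the word from the right, the cocycle rule carries t to its conjugate by each
  letter passed, until it equals a letter; that letter is the one deleted.\<close>

lemma exchange: assumes "set us <= S" "t : N (wprod us)"
 shows "EX vs. set vs <= S & Suc (length vs) = length us & wprod vs = wprod us<*>t"
 using assms
proof (induction us arbitrary: t rule: rev_induct)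
 case Nil thus ?case by simp
next
 case (snoc u us)
 let ?x = "wprod us"
 have us: "set us <= S" and u: "u : S" using snoc.prems by auto
 have x: "?x : WW" using us by simp
 have w: "wprod (us @ [u]) = ?x<*>u" using us u by (rule wprod_snoc)
 have tN: "t : N (?x<*>u)" using snoc.prems w by simp
 hence t: "t : WW" using N_carrier[of "?x<*>u"] x u by auto
 show ?case
 proof (cases "t = u")
 case True
 have "?x<*>u<*>u = ?x" using x u by (simp add: m_assoc S_sq)
 thus ?thesis using us w True by (intro exI[of _ us]) auto
 next
 case False
 hence "u<*>t<*>u : N ?x" using tN x u t by (simp add: N_mult_mem N_gen)
 then obtain vs where vs: "set vs <= S" "Suc (length vs) = length us"
 "wprod vs = ?x<*>(u<*>t<*>u)" using snoc.IH us by blast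
 have "?x<*>(u<*>t<*>u)<*>u = ?x<*>u<*>t" using x u t by (simp add: m_assoc S_sq)
 hence "wprod (vs @ [u]) = ?x<*>u<*>t" using vs u by (simp only: wprod_snoc)
 thus ?thesis using vs u w by (intro exI[of _ "vs @ [u]"]) auto
 qed
qed
lemma len_less_if_N: "x : WW ==> t : N x ==> len (x<*>t) < len x"
 by (metis exchange reduced_word len_le Suc_le_eq less_Suc_eq_le)
lemma reflections_carrier: "t : reflections ==> t : WW"
 by (auto simp: reflections_def)

lemma reflection_sq: "t : reflections ==> t<*>t = \<one>"
proof -
 assume "t : reflections"
 then obtain w s where ws: "t = w<*>s<*>inv w" "w : WW" "s : S" by (auto simp: reflections_def)
 have "t<*>t = w<*>(s<*>(inv w<*>w)<*>s)<*>inv w" using ws by (simp only: m_assoc m_closed inv_closed S_in)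
 thus ?thesis using ws by (simp add: S_sq)
qed

text \<open>For t = w s w^-1 the memberships contributed by w and by w^-1 are those that cancel in
  \<open>N (w <*> inv w) = {}\<close>, so only the contribution of s survives.\<close>

lemma reflection_N_self: assumes "t : reflections" shows "t : N t"
proof -
 obtain w s where ws: "t = w<*>s<*>inv w" "w : WW" "s : S"
 using assms by (auto simp: reflections_def)
 have tc: "t : WW" using reflections_carrier[OF assms] .
 have s: "s = inv w<*>t<*>w" using ws by (simp add: m_assoc)
 have tw: "inv w<*>t<*>inv (inv w) = s" using ws(2) s by simp
 have a: "t : N ((w<*>s)<*>inv w) <-> ((t : N (inv w)) ~= (s : N (w<*>s)))"
 using N_mult_mem[of "w<*>s" "inv w" t] ws(2,3) tc tw by simp
 have ss: "s<*>s<*>inv s = s" using ws(3) by (simp add: S_sq m_assoc)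
 have b: "s : N (w<*>s) <-> (True ~= (s : N w))"
 using N_mult_mem[of w s s] ws(2,3) ss by (simp add: N_gen)
 have "t : N (w<*>inv w) <-> ((t : N (inv w)) ~= (s : N w))"
 using N_mult_mem[of w "inv w" t] ws(2) tc tw by simp
 hence "t : N (inv w) <-> s : N w" using ws(2) by simp
 thus ?thesis using a b ws(1) by simp
qed

text \<open>If t is not in \<open>N x\<close>, it is in \<open>N (x <*> t)\<close> because t lies in
  \<open>N t\<close>; then \<open>len_less_if_N\<close>, applied to x t, shows that passing back to
  x shortens.\<close>

lemma N_reflection_iff: assumes "x : WW" "t : reflections"
 shows "t : N x <-> len (x<*>t) < len x" "t ~: N x <-> len x < len (x<*>t)"
proof -
 have t: "t : WW" "t<*>t = \<one>" using assms(2) reflections_carrier reflection_sq by auto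
 have "inv t = t" using t by (simp add: inv_equality)
 hence "t : N (x<*>t)" if "t ~: N x"
 using N_mult_mem[OF assms(1) t(1) t(1)] reflection_N_self[OF assms(2)] that t assms(1)
 by (simp add: m_assoc)
 moreover have "x<*>t<*>t = x" using t assms(1) by (simp add: m_assoc)
 ultimately have "len x < len (x<*>t)" if "t ~: N x"
 using len_less_if_N[of "x<*>t" t] that t assms(1) by auto
 moreover have "len (x<*>t) < len x" if "t : N x" using len_less_if_N assms that by auto
 ultimately show "t : N x <-> len (x<*>t) < len x" "t ~: N x <-> len x < len (x<*>t)" by force+
qed

lemma S_reflections: "s : S ==> s : reflections"
 unfolding reflections_def by (rule CollectI, rule exI[of _ \<one>], rule exI[of _ s]) auto

lemma len_mult_S: assumes "x : WW" "s : S"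
 shows "len (x<*>s) = (if s : N x then len x - 1 else len x + 1)" "s : N x ==> 0 < len x"
proof -
 have 1: "len (x<*>s) <= len x + 1" using len_mult_le[of x s] len_S_le assms by fastforce
 have "len x <= len (x<*>s) + 1" using len_mult_le[of "x<*>s" s] len_S_le[of s] assms
 by (simp add: m_assoc S_sq)
 with 1 show "len (x<*>s) = (if s : N x then len x - 1 else len x + 1)" "s : N x ==> 0 < len x"
 using N_reflection_iff[OF assms(1) S_reflections[OF assms(2)]] by auto
qed

lemma len_up_iff: "x : WW ==> s : S ==> len x < len (x<*>s) <-> s ~: N x"
 using N_reflection_iff S_reflections by blast

lemma len_up: "x : WW ==> s : S ==> s ~: N x ==> len (x<*>s) = Suc (len x)"
 using len_mult_S by simp

lemma len_down: "x : WW ==> s : S ==> s : N x ==> len x = Suc (len (x<*>s))"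
 using len_mult_S(1)[of x s] len_mult_S(2)[of x s] by auto

lemma mult_S_S [simp]: "x : WW ==> s : S ==> x<*>s<*>s = x"
 by (simp add: m_assoc S_sq)
lemma S_S_mult [simp]: "x : WW ==> s : S ==> s<*>(s<*>x) = x"
 by (metis S_in S_sq l_one m_assoc)

lemma N_mult_S: "x : WW ==> s : S ==> s : N (x<*>s) <-> s ~: N x"
 using N_mult_mem[of x s s] by (simp add: N_gen S_sq m_assoc)

lemma right_induct [consumes 1, case_names one step]:
 assumes "x : WW" "P \<one>"
 "!!x s. x : WW ==> s : S ==> s ~: N x ==> P x ==> P (x<*>s)"
 shows "P x"
 using assms(1)
proof (induction "len x" arbitrary: x)
 case 0 thus ?case using len_0_iff assms(2) by simp
next
 case (Suc n)
 obtain ss where ss: "set ss <= S" "length ss = len x" "wprod ss = x" using reduced_word Suc.prems by blast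
 then obtain us s where us: "ss = us @ [s]" using Suc(2) by (metis append_butlast_last_id length_0_conv nat.distinct(1))
 let ?y = "wprod us"
 have us': "set us <= S" and s: "s : S" using ss us by auto
 have y: "?y : WW" using us' by simp
 have x: "x = ?y<*>s" using ss us wprod_snoc[OF us' s] by simp
 have "len ?y <= n" using len_le[OF us'] ss us Suc(2) by simp
 moreover have "len x <= len ?y + 1" using x len_mult_le[of ?y s] len_S_le[OF s] y s by fastforce
 ultimately have n: "len ?y = n" "len x = len ?y + 1" using Suc(2) by auto
 hence "s ~: N ?y" using len_mult_S[OF y s] x by (auto split: if_splits)
 thus ?case using assms(3)[OF y s _ Suc(1)[OF _ y]] n x by simp
qed

lemma len_mult_left: assumes "x : WW" "s : S"
 shows "len x < len (s<*>x) <-> s ~: N (inv x)" "s ~: N (inv x) ==> len (s<*>x) = Suc (len x)"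
 "s : N (inv x) ==> len x = Suc (len (s<*>x))"
proof -
 have "len (s<*>x) = len (inv x<*>s)"
 using len_inv[of "s<*>x"] assms by (simp add: inv_mult_group)
 thus "len x < len (s<*>x) <-> s ~: N (inv x)" "s ~: N (inv x) ==> len (s<*>x) = Suc (len x)"
 "s : N (inv x) ==> len x = Suc (len (s<*>x))"
 using len_up_iff[of "inv x" s] len_up[of "inv x" s] len_down[of "inv x" s] assms by auto
qed

lemma two_sided_coincidence: \<comment> \<open>the only obstruction to treating left and right descents independently\<close>
 assumes x: "x : WW" and s: "s : S" and t: "t : S"
 and "(t ~: N x) ~= (t ~: N (s<*>x))"
 shows "s<*>x = x<*>t"
proof -
 have "t : N (s<*>x) <-> ((t : N x) ~= (x<*>t<*>inv x = s))"
 using N_mult_mem[of s x t] x s t N_gen[OF s] by simp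
 hence "x<*>t<*>inv x = s" using assms(4) by blast
 hence "s<*>x = x<*>t<*>inv x<*>x" by simp
 thus ?thesis using x t by (simp add: m_assoc)
qed

section \<open>Bruhat order and the lifting property\<close>

lemma bruhat_len: "(y, w) : bruhat_less ==> len y < len w"
 unfolding bruhat_less_def by (induction rule: trancl_induct) auto

lemma bruhat_carrier: "(y, w) : bruhat_less ==> y : WW & w : WW"
 unfolding bruhat_less_def by (induction rule: trancl_induct) (auto simp: reflections_carrier)

lemma bruhat_trans: "(x, y) : bruhat_less ==> (y, z) : bruhat_less ==> (x, z) : bruhat_less"
 unfolding bruhat_less_def by (rule trancl_trans)

lemma bruhat_step: "y : WW ==> t : reflections ==> len y < len (y<*>t) ==> (y, y<*>t) : bruhat_less"
 unfolding bruhat_less_def by auto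

lemma bruhat_S: "y : WW ==> s : S ==> s ~: N y ==> (y, y<*>s) : bruhat_less"
 using bruhat_step len_up_iff S_reflections by blast

lemma reflection_conj: assumes "t : reflections" "s : S" shows "s<*>t<*>s : reflections"
proof -
 obtain w r where wr: "t = w<*>r<*>inv w" "w : WW" "r : S"
 using assms by (auto simp: reflections_def)
 have "s<*>t<*>s = (s<*>w)<*>r<*>inv (s<*>w)" using wr assms by (simp add: inv_mult_group m_assoc)
 thus ?thesis using wr assms unfolding reflections_def by blast
qed

text \<open>Conjugation by s turns a step y < y t into the step y s < (y s)(s t s). The only
  exception is t = s, where y s is itself the upper end of the step; this accounts for the
  alternatives.\<close>

lemma bruhat_lift: assumes "(y, w) : bruhat_less" "s : S"
 shows "y<*>s = w | (y<*>s, w) : bruhat_less | (y<*>s, w<*>s) : bruhat_less"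
proof -
 have st: "y<*>s = z | (y<*>s, z<*>s) : bruhat_less"
 if y: "y : WW" and t: "t : reflections" and l: "len y < len (y<*>t)" and z: "z = y<*>t" for y z t
 proof (cases "t = s")
 case True thus ?thesis using z by simp
 next
 case False
 note tc = reflections_carrier[OF t]
 let ?t = "s<*>t<*>s"
 have t': "?t : reflections" using reflection_conj t assms by blast
 have "s <*> ?t<*>s = t" using tc assms(2) by (simp add: m_assoc S_sq)
 moreover have "?t ~= s" using False tc assms(2)
 by (metis calculation S_in S_sq l_one)
 moreover have "t ~: N y" using N_reflection_iff[OF y t] l by simp
 ultimately have "?t ~: N (y<*>s)" using N_mult_mem[of y s ?t] y assms(2) tc by (simp add: N_gen)
 moreover have "y<*>s <*> ?t = z<*>s" using z y tc assms(2) by (simp add: m_assoc)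
 ultimately show ?thesis using bruhat_step[of "y<*>s" ?t] N_reflection_iff[of "y<*>s" ?t] t' y assms(2) by auto
 qed
 show ?thesis using assms(1) unfolding bruhat_less_def
 proof (induction rule: trancl_induct)
 case (base z)
 thus ?case using st unfolding bruhat_less_def by fast
 next
 case (step z w)
 from step.hyps(2) obtain t where t: "t : reflections" "z : WW" "w = z<*>t" "len z < len (z<*>t)" by auto
 have zw: "(z, w) : bruhat_less" using t bruhat_step by simp
 have zw': "z<*>s = w | (z<*>s, w<*>s) : bruhat_less" using st t by blast
 show ?case using step.IH zw zw' bruhat_trans unfolding bruhat_less_def[symmetric] by metis
 qed
qed

end

section \<open>The Hecke algebra\<close>

lemma lookup_scale [simp]: "coef (scale c h) w = c * coef h w"
 unfolding scale_def by transfer (simp add: when_def)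

lemma scale_add_right: "scale c (g + h) = scale c g + scale c h"
 by (rule poly_mapping_eqI) (simp add: lookup_add algebra_simps)
lemma scale_add_left: "scale (c + d) h = scale c h + scale d h"
 by (rule poly_mapping_eqI) (simp add: lookup_add algebra_simps)
lemma scale_diff_right: "scale c (g - h) = scale c g - scale c h"
 by (rule poly_mapping_eqI) (simp add: lookup_minus algebra_simps)
lemma scale_scale [simp]: "scale c (scale d h) = scale (c * d) h"
 by (rule poly_mapping_eqI) (simp add: algebra_simps)

lemma scale_1 [simp]: "scale 1 h = h" by (rule poly_mapping_eqI) simp
lemma scale_0 [simp]: "scale 0 h = 0" by (rule poly_mapping_eqI) simp
lemma scale_zero [simp]: "scale c 0 = 0" by (rule poly_mapping_eqI) simp
lemma scale_minus_1: "scale (-1) h = - h" by (rule poly_mapping_eqI) simp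

lemma scale_sum_right: "scale c (\<Sum>x\<in>A. f x) = (\<Sum>x\<in>A. scale c (f x))"
 by (rule poly_mapping_eqI) (simp add: lookup_sum sum_distrib_left)
lemma keys_scale: "supp (scale c h) <= supp h"
 by (auto simp: in_keys_iff)
lemma keys_lookup_sum: "supp (\<Sum>x\<in>A. f x) <= (\<Union>x\<in>A. supp (f x))"
 by (auto simp: in_keys_iff lookup_sum intro: ccontr elim!: sum.not_neutral_contains_not_neutral)
lemma keys_minus_subset: "supp (g - h :: 'a \<Rightarrow>\<^sub>0 'b :: ab_group_add) <= supp g \<union> supp h"
 by (auto simp: in_keys_iff lookup_minus)

definition linear_H :: "('a hk => ('b \<Rightarrow>\<^sub>0 laurent)) => bool" where
 "linear_H f <-> (ALL g h. f (g + h) = f g + f h) & (ALL c h. f (scale c h) = scale c (f h))"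

lemma linear_HD: assumes "linear_H f" shows "f (g + h) = f g + f h" "f (scale c h) = scale c (f h)"
 using assms unfolding linear_H_def by auto

lemma linear_H_0: "linear_H f ==> f 0 = 0"
 using linear_HD(2)[of f 0 0] by simp

lemma linear_H_sum: "linear_H f ==> f (\<Sum>x\<in>A. g x) = (\<Sum>x\<in>A. f (g x))"
 by (induction A rule: infinite_finite_induct) (auto simp: linear_H_0 linear_HD)

lemma linear_H_comp: "linear_H f ==> linear_H g ==> linear_H (%x. f (g x))"
 unfolding linear_H_def by simp

context weighted_group begin

lemma lookup_T: "coef (T w) v = (if v = w then 1 else 0)"
 unfolding T_def by (simp add: lookup_single when_def)

lemma keys_T [simp]: "supp (T w) = {w}"
 unfolding T_def by simp

lemma lincomb_superset: "finite A ==> supp c <= A ==>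
 lincomb c B = (\<Sum>w\<in>A. scale (coef c w) (B w))"
 unfolding lincomb_def by (intro sum.mono_neutral_left) (auto simp: in_keys_iff)

lemma linear_lincomb: "linear_H (%h. lincomb h B)"
 unfolding linear_H_def
proof (intro conjI allI)
 fix g h :: "'w \<Rightarrow>\<^sub>0 laurent"
 let ?A = "supp g \<union> supp h"
 have "lincomb f B = (\<Sum>w\<in>?A. scale (coef f w) (B w))" if "f : {g, h, g + h}" for f
 using that keys_add[of g h] by (intro lincomb_superset) auto
 thus "lincomb (g + h) B = lincomb g B + lincomb h B"
 by (simp add: sum.distrib lookup_add scale_add_left)
next
 fix c and h :: "'w \<Rightarrow>\<^sub>0 laurent"
 show "lincomb (scale c h) B = scale c (lincomb h B)"
 using keys_scale[of c h] by (simp add: lincomb_superset[of "supp h"] scale_sum_right)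
qed

lemmas lincomb_add = linear_HD(1)[OF linear_lincomb] and lincomb_scale = linear_HD(2)[OF linear_lincomb]
 and lincomb_0 [simp] = linear_H_0[OF linear_lincomb] and lincomb_sum = linear_H_sum[OF linear_lincomb]

lemma lincomb_T [simp]: "lincomb (T w) B = B w"
 by (simp add: lincomb_def lookup_T)
lemma lincomb_basis_T: "lincomb h T = h"
 by (rule poly_mapping_eqI)
 (simp add: lincomb_def lookup_sum lookup_T sum.delta in_keys_iff if_distrib cong: if_cong)

lemma T_expansion: "h = (\<Sum>w\<in>supp h. scale (coef h w) (T w))"
 using lincomb_basis_T[of h] unfolding lincomb_def by simp

lemma linear_H_lincomb: assumes "linear_H f" shows "f h = lincomb h (%w. f (T w))"
 by (subst T_expansion) (simp add: linear_H_sum[OF assms] linear_HD[OF assms] lincomb_def)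

lemma lincomb_cong: "(!!w. w : supp h ==> B w = D w) ==> lincomb h B = lincomb h D"
 unfolding lincomb_def by simp

lemma hecke_carrier_add [simp]: "g : HC ==> h : HC ==> g + h : HC"
 unfolding HC_def using keys_add[of g h] by auto
lemma hecke_carrier_diff [simp]: "g : HC ==> h : HC ==> g - h : HC"
 unfolding HC_def using keys_minus_subset[of g h] by auto
lemma hecke_carrier_0 [simp]: "0 : HC" unfolding HC_def by simp
lemma hecke_carrier_scale [simp]: "h : HC ==> scale c h : HC"
 unfolding HC_def using keys_scale[of c h] by auto
lemma hecke_carrier_sum [simp]: "(!!x. x : A ==> f x : HC) ==> (\<Sum>x\<in>A. f x) : HC"
 by (induction A rule: infinite_finite_induct) auto
lemma hecke_carrier_T [simp]: "T w : HC <-> w : WW"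
 unfolding HC_def by simp
lemma hecke_carrier_lincomb: "h : HC ==> (!!w. w : WW ==> B w : HC) ==> lincomb h B : HC"
 unfolding lincomb_def HC_def[of] by (rule hecke_carrier_sum[unfolded HC_def]) (auto simp: hecke_carrier_scale[unfolded HC_def] intro!: subsetD[OF keys_scale])

end

context coxeter begin

section \<open>The Hecke algebra built from commuting left and right multiplications\<close>

definition xi :: "'a => laurent" where "xi s = qpow (int (L s)) - qpow (- int (L s))"

text \<open>Left and right multiplication by T_s are written down on the free module, where no
  product is available yet. That the two families of operators commute is what produces an
  associative product.\<close>

definition lbase :: "'a => 'a => 'a hk" where
 "lbase s w = (if s : N (inv w) then T (s<*>w) + scale (xi s) (T w) else T (s<*>w))"
definition rbase :: "'a => 'a => 'a hk" where
 "rbase s w = (if s : N w then T (w<*>s) + scale (xi s) (T w) else T (w<*>s))"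
definition lam :: "'a => 'a hk => 'a hk" where "lam s h = lincomb h (lbase s)"
definition rho :: "'a => 'a hk => 'a hk" where "rho s h = lincomb h (rbase s)"

lemma linear_lam: "linear_H (lam s)" and linear_rho: "linear_H (rho s)"
 unfolding lam_def[abs_def] rho_def[abs_def] by (rule linear_lincomb)+

lemma lam_T [simp]: "lam s (T w) = lbase s w" and rho_T [simp]: "rho s (T w) = rbase s w"
 unfolding lam_def rho_def by simp_all

lemma lbase_closed: "s : S ==> w : WW ==> lbase s w : HC"
 and rbase_closed: "s : S ==> w : WW ==> rbase s w : HC"
 unfolding lbase_def rbase_def by auto

lemma lam_closed: "s : S ==> h : HC ==> lam s h : HC"
 and rho_closed: "s : S ==> h : HC ==> rho s h : HC"
 unfolding lam_def rho_def by (auto intro: hecke_carrier_lincomb lbase_closed rbase_closed)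

text \<open>By \<open>two_sided_coincidence\<close>, left multiplication by s changes whether t is a
  right descent only if s w = w t. Away from that case both sides expand in the same way; in it, the
  scalars \<open>xi s\<close> and \<open>xi t\<close> agree because s and t are conjugate.\<close>

lemma lam_rho_T: assumes w: "w : WW" and s: "s : S" and t: "t : S"
 shows "lam s (rho t (T w)) = rho t (lam s (T w))"
proof -
 note lin = linear_HD[OF linear_lam] linear_HD[OF linear_rho]
 have inv1: "inv (s<*>w) = inv w<*>s" "inv (w<*>t) = t<*>inv w" using w s t by (auto simp: inv_mult_group)
 have m: "s<*>(w<*>t) = s<*>w<*>t" using w s t by (simp add: m_assoc)
 show ?thesis
 proof (cases "s<*>w = w<*>t")
 case False
 hence 1: "t : N (s<*>w) <-> t : N w" using two_sided_coincidence[OF w s t] by blast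
 have "inv (s<*>w) ~= inv (w<*>t)" using False w s t by (metis S_in inv_inv m_closed)
 hence "t<*>inv w ~= inv w<*>s" using inv1 by simp
 hence 2: "s : N (t<*>inv w) <-> s : N (inv w)"
 using two_sided_coincidence[of "inv w" t s] w s t by blast
 show ?thesis using 1 2 m w s t
 by (simp add: lbase_def rbase_def lin inv1 scale_add_right mult.commute add_ac)
 next
 case True
 have ww: "s<*>(w<*>t) = w" "s<*>w<*>t = w" "s<*>(s<*>w) = w" "w<*>t<*>t = w"
 using True[symmetric] m w s t by simp_all
 have L: "xi s = xi t" unfolding xi_def using L_conj[OF s t w True] by simp
 have "t : N w <-> s : N (inv w)"
 using len_up_iff[OF w t] len_mult_left(1)[OF w s] True by auto
 moreover have "t : N (w<*>t) <-> t ~: N w" using N_mult_S w t by simp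
 moreover have "s : N (inv w<*>s) <-> s ~: N (inv w)" using N_mult_S[of "inv w" s] w s by simp
 moreover have "t<*>inv w = inv w<*>s" using True inv1 by simp
 ultimately show ?thesis using w s t ww True
 by (simp add: lbase_def rbase_def lin inv1 L scale_add_right)
 qed
qed

lemma lam_rho: assumes h: "h : HC" and s: "s : S" and t: "t : S"
 shows "lam s (rho t h) = rho t (lam s h)"
proof -
 have "lam s (rho t h) = lincomb h (%w. lam s (rho t (T w)))"
 by (rule linear_H_lincomb[OF linear_H_comp[OF linear_lam linear_rho]])
 also have "\<dots> = lincomb h (%w. rho t (lam s (T w)))"
 using h by (intro lincomb_cong lam_rho_T) (auto simp: HC_def s t)
 also have "\<dots> = rho t (lam s h)"
 by (rule linear_H_lincomb[OF linear_H_comp[OF linear_rho linear_lam], symmetric])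
 finally show ?thesis .
qed

text \<open>These maps are the endomorphisms of the regular right module. Each is determined by its
  value at the basis element of the identity, so that identities between them are compared at a
  single vector.\<close>

definition commuting :: "('a hk => 'a hk) => bool" where
 "commuting P <-> linear_H P & (ALL h:hecke_carrier. P h : HC) &
 (ALL h:hecke_carrier. ALL t:S. P (rho t h) = rho t (P h))"

lemma commuting_comp: "commuting P ==> commuting Q ==> commuting (%x. P (Q x))"
 unfolding commuting_def by (simp add: linear_H_comp)

lemma commuting_unique: assumes "commuting P" "commuting Q" "P (T \<one>) = Q (T \<one>)" "h : HC"
 shows "P h = Q h"
proof -
 have *: "P (T y) = Q (T y)" if "y : WW" for y
 using that
 proof (induction y rule: right_induct)
 case one thus ?case using assms by simp
 next
 case (step x s)
 hence e: "T (x<*>s) = rho s (T x)" by (simp add: rbase_def)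
 show ?case unfolding e using step assms(1,2) by (simp add: commuting_def del: rho_T)
 qed
 have "P h = lincomb h (%w. P (T w))" "Q h = lincomb h (%w. Q (T w))"
 using assms(1,2) by (auto intro!: linear_H_lincomb simp: commuting_def)
 moreover have "lincomb h (%w. P (T w)) = lincomb h (%w. Q (T w))"
 using * assms(4) by (intro lincomb_cong) (auto simp: HC_def)
 ultimately show ?thesis by simp
qed

lemma commuting_word: "set ss <= S ==> commuting (foldr lam ss)"
proof (induction ss)
 case Nil thus ?case by (simp add: commuting_def linear_H_def)
next
 case (Cons s ss)
 have "commuting (lam s)" using Cons by (simp add: commuting_def linear_lam lam_closed lam_rho)
 thus ?case using commuting_comp Cons by (fastforce simp: comp_def)
qed

lemma commuting_exists: assumes "x : WW" shows "EX P. commuting P & P (T \<one>) = T x"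
proof -
 have "EX P. commuting P & P (T \<one>) = T (inv x)" if "x : WW" for x
 using that
 proof (induction x rule: right_induct)
 case one
 show ?case by (rule exI[of _ id]) (simp add: commuting_def linear_H_def)
 next
 case (step x s)
 then obtain P where P: "commuting P" "P (T \<one>) = T (inv x)" by blast
 have "commuting (%h. lam s (P h))"
 using commuting_comp[OF commuting_word[of "[s]"] P(1)] step by simp
 moreover have "lam s (P (T \<one>)) = T (inv (x<*>s))" using step P
 by (simp add: lbase_def inv_mult_group)
 ultimately show ?case by blast
 qed
 from this[of "inv x"] assms show ?thesis by simp
qed

definition Lam :: "'a => 'a hk => 'a hk" where
 "Lam x = (SOME P. commuting P & P (T \<one>) = T x)"

lemma Lam: assumes "x : WW" shows "commuting (Lam x)" "Lam x (T \<one>) = T x"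
 using someI_ex[OF commuting_exists[OF assms]] unfolding Lam_def by auto

definition hmul :: "'a hk => 'a hk => 'a hk" where
 "hmul g h = (if g : HC & h : HC then lincomb g (%x. Lam x h) else 0)"

lemma commuting_lincomb: assumes "g : HC" shows "commuting (%h. lincomb g (%x. Lam x h))"
proof -
 have 1: "linear_H (Lam x)" "!!h. h : HC ==> Lam x h : HC"
 "!!h t. h : HC ==> t : S ==> Lam x (rho t h) = rho t (Lam x h)"
 if "x : supp g" for x
 using Lam(1)[of x] that assms by (auto simp: commuting_def HC_def)
 have "linear_H (%h. lincomb g (%x. Lam x h))" unfolding linear_H_def lincomb_def
 by (simp add: linear_HD[OF 1(1)] scale_add_right sum.distrib scale_sum_right mult.commute)
 moreover have "lincomb g (%x. Lam x h) : HC" if "h : HC" for h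
 unfolding lincomb_def using 1(2) that by simp
 moreover have "lincomb g (%x. Lam x (rho t h)) = rho t (lincomb g (%x. Lam x h))"
 if "h : HC" "t : S" for h t
 unfolding lincomb_def using 1(3) that by (simp add: linear_H_sum[OF linear_rho] linear_HD[OF linear_rho])
 ultimately show ?thesis unfolding commuting_def by blast
qed

lemma hmul_T_one: "g : HC ==> lincomb g (%x. Lam x (T \<one>)) = g"
proof -
 assume "g : HC"
 hence "lincomb g (%x. Lam x (T \<one>)) = lincomb g T"
 by (intro lincomb_cong) (auto simp: HC_def Lam)
 thus ?thesis by (simp add: lincomb_basis_T)
qed

lemma is_hecke_mult_hmul: "is_hecke_mult hmul"
 unfolding is_hecke_mult_def
proof (intro conjI ballI allI impI)
 fix g h assume "g ~: HC | h ~: HC" thus "hmul g h = 0" by (auto simp: hmul_def)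
next
 fix g h assume gh: "g : HC" "h : HC"
 show c: "hmul g h : HC" using commuting_lincomb gh by (auto simp: hmul_def commuting_def)
 fix c
 show "hmul (scale c g) h = scale c (hmul g h)" "hmul g (scale c h) = scale c (hmul g h)"
 using gh linear_HD[of "%h. lincomb g (%x. Lam x h)"] commuting_lincomb
 by (auto simp: hmul_def lincomb_scale commuting_def)
next
 fix f g h assume fgh: "f : HC" "g : HC" "h : HC"
 have c: "hmul f g : HC" "hmul g h : HC"
 using commuting_lincomb fgh by (auto simp: hmul_def commuting_def)
 show "hmul (f + g) h = hmul f h + hmul g h" using fgh by (simp add: hmul_def lincomb_add)
 show "hmul f (g + h) = hmul f g + hmul f h"
 using fgh linear_HD[of "%h. lincomb f (%x. Lam x h)"] commuting_lincomb by (simp add: hmul_def commuting_def)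
 \<comment> \<open>Associativity: as operators in h both sides commute with right multiplication, so
   it is enough that they agree at the identity, where both give the product of f and g.\<close>
 have "lincomb (hmul f g) (%x. Lam x h) = lincomb f (%x. Lam x (lincomb g (%x. Lam x h)))"
 by (rule commuting_unique[OF commuting_lincomb commuting_comp[OF commuting_lincomb commuting_lincomb]])
 (use fgh c in \<open>auto simp: hmul_T_one hmul_def\<close>)
 thus "hmul (hmul f g) h = hmul f (hmul g h)" using fgh c by (simp add: hmul_def)
next
 fix h assume h: "h : HC"
 show "hmul (T \<one>) h = h" using h
 commuting_unique[OF Lam(1)[of \<one>] _ _ h, of "%x. x"] by (simp add: hmul_def Lam commuting_def linear_H_def)
 show "hmul h (T \<one>) = h" using h by (simp add: hmul_def hmul_T_one)
next
 fix w s assume ws: "w : WW" "s : S"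
 have "T s = rho s (T \<one>)" using ws by (simp add: rbase_def)
 moreover have "Lam w (rho s (T \<one>)) = rho s (Lam w (T \<one>))"
 using ws Lam(1)[of w] by (simp add: commuting_def del: rho_T)
 ultimately have "hmul (T w) (T s) = rho s (Lam w (T \<one>))" using ws
 by (simp add: hmul_def rho_closed del: rho_T)
 thus "hmul (T w) (T s) = (if len w < len (w<*>s) then T (w<*>s)
 else T (w<*>s) + scale (qpow (int (L s)) - qpow (- int (L s))) (T w))"
 using ws len_up_iff[of w s] by (simp add: Lam rbase_def xi_def)
qed

lemma hecke_mult_additive: assumes "is_hecke_mult M" "finite A" "!!x. x : A ==> f x : HC" "g : HC"
 shows "M g (\<Sum>x\<in>A. f x) = (\<Sum>x\<in>A. M g (f x))" "M (\<Sum>x\<in>A. f x) g = (\<Sum>x\<in>A. M (f x) g)"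
proof -
 have a: "M g (x + y) = M g x + M g y" "M (x + y) g = M x g + M y g"
 if "x : HC" "y : HC" for x y
 using assms(1,4) that unfolding is_hecke_mult_def by blast+
 have z: "M g 0 = 0" "M 0 g = 0" using a[of 0 0] by simp_all
 show "M g (\<Sum>x\<in>A. f x) = (\<Sum>x\<in>A. M g (f x))" "M (\<Sum>x\<in>A. f x) g = (\<Sum>x\<in>A. M (f x) g)"
 using assms(2,3) by (induction) (simp_all add: z a)
qed

text \<open>The product is a definite description, so existence alone does not give access to it.
  Bilinearity and the rule for a generator on the right determine all values along a reduced
  word.\<close>

lemma hecke_mult_unique: assumes M: "is_hecke_mult M" and M': "is_hecke_mult M'" shows "M = M'"
proof -
 have exp_r: "K g h = lincomb h (%y. K g (T y))" and exp_l: "K g h = lincomb g (%y. K (T y) h)"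
 if K: "is_hecke_mult K" and gh: "g : HC" "h : HC" for K g h
 proof -
 have c: "!!w. w : supp g \<union> supp h ==> w : WW" using gh by (auto simp: HC_def)
 show "K g h = lincomb h (%y. K g (T y))"
 by (subst (1) T_expansion[of h], subst hecke_mult_additive[OF K])
 (use c gh K in \<open>auto simp: lincomb_def is_hecke_mult_def\<close>)
 show "K g h = lincomb g (%y. K (T y) h)"
 by (subst (1) T_expansion[of g], subst hecke_mult_additive[OF K])
 (use c gh K in \<open>auto simp: lincomb_def is_hecke_mult_def\<close>)
 qed
 have S: "M g (T s) = M' g (T s)" if "g : HC" "s : S" for g s
 using that exp_l[OF M, of g "T s"] exp_l[OF M', of g "T s"] M M'
 by (auto simp: is_hecke_mult_def HC_def intro!: lincomb_cong)
 have T: "M g (T y) = M' g (T y)" if g: "g : HC" and y: "y : WW" for g y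
 using y
 proof (induction y rule: right_induct)
 case one thus ?case using M M' g by (simp add: is_hecke_mult_def)
 next
 case (step x s)
 have e: "K g (T (x<*>s)) = K (K g (T x)) (T s)" if K: "is_hecke_mult K" for K
 proof -
 have "T (x<*>s) = K (T x) (T s)" using K step len_up_iff[of x s] by (simp add: is_hecke_mult_def)
 thus ?thesis using K step g by (simp add: is_hecke_mult_def)
 qed
 have "M g (T x) : HC" using M step(1) g unfolding is_hecke_mult_def by auto
 thus ?case using e[OF M] e[OF M'] step S by simp
 qed
 show ?thesis
 proof (intro ext)
 fix g h show "M g h = M' g h"
 proof (cases "g : HC & h : HC")
 case True
 thus ?thesis using exp_r[OF M, of g h] exp_r[OF M', of g h] T
 by (auto simp: HC_def intro!: lincomb_cong)
 next
 case False thus ?thesis using M M' by (auto simp: is_hecke_mult_def)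
 qed
 qed
qed

lemma is_hecke_mult: "is_hecke_mult hecke_mult"
 unfolding hecke_mult_def
 by (rule theI[where P = is_hecke_mult, OF is_hecke_mult_hmul]) (rule hecke_mult_unique[OF _ is_hecke_mult_hmul])

notation hecke_mult (infixl \<open>**\<close> 70)

lemma hm_closed [simp]: "g : HC ==> h : HC ==> g**h : HC"
 and hm_add_left: "f : HC ==> g : HC ==> h : HC ==> (f + g)**h = f**h + g**h"
 and hm_add_right: "f : HC ==> g : HC ==> h : HC ==> f**(g + h) = f**g + f**h"
 and hm_assoc: "f : HC ==> g : HC ==> h : HC ==> f**g**h = f**(g**h)"
 and hm_scale_left: "g : HC ==> h : HC ==> scale c g**h = scale c (g**h)"
 and hm_scale_right: "g : HC ==> h : HC ==> g**scale c h = scale c (g**h)"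
 and hm_one_left [simp]: "h : HC ==> T \<one> ** h = h"
 and hm_one_right [simp]: "h : HC ==> h**T \<one> = h"
 using is_hecke_mult unfolding is_hecke_mult_def by auto

lemma hm_T_S: "w : WW ==> s : S ==>
 T w**T s = (if s : N w then T (w<*>s) + scale (xi s) (T w) else T (w<*>s))"
 using is_hecke_mult len_up_iff[of w s] unfolding is_hecke_mult_def xi_def by simp

lemmas hm_sum_right = hecke_mult_additive(1)[OF is_hecke_mult]
 and hm_sum_left = hecke_mult_additive(2)[OF is_hecke_mult]

lemma hm_diff_left: "f : HC ==> g : HC ==> h : HC ==> (f - g)**h = f**h - g**h"
 by (metis add_diff_cancel_right' diff_add_cancel hecke_carrier_diff hm_add_left)
lemma hm_diff_right: "f : HC ==> g : HC ==> h : HC ==> f**(g - h) = f**g - f**h"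
 by (metis add_diff_cancel_right' diff_add_cancel hecke_carrier_diff hm_add_right)

lemma hm_lincomb_left: assumes "g : HC" "h : HC"
 shows "g**h = lincomb g (%x. T x**h)"
proof -
 have c: "x : WW" if "x : supp g" for x using that assms by (auto simp: HC_def)
 show ?thesis by (subst (1) T_expansion[of g], subst hm_sum_left)
 (use c assms in \<open>auto simp: lincomb_def hm_scale_left\<close>)
qed

lemma hm_lincomb_right: assumes "g : HC" "h : HC"
 shows "g**h = lincomb h (%x. g**T x)"
proof -
 have c: "x : WW" if "x : supp h" for x using that assms by (auto simp: HC_def)
 show ?thesis by (subst (1) T_expansion[of h], subst hm_sum_right)
 (use c assms in \<open>auto simp: lincomb_def hm_scale_right\<close>)
qed

lemma hm_T_T: assumes "x : WW" "y : WW" "len (x<*>y) = len x + len y"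
 shows "T x**T y = T (x<*>y)"
 using assms(2,1,3)
proof (induction y arbitrary: x rule: right_induct)
 case one thus ?case by simp
next
 case (step y s)
 have ys: "len (y<*>s) = Suc (len y)" using step len_up by simp
 have xy: "len (x<*>y) = len x + len y"
 proof (rule antisym)
 show "len (x<*>y) <= len x + len y" using len_mult_le step by simp
 have "len (x<*>(y<*>s)) <= len (x<*>y) + 1"
 using len_mult_le[of "x<*>y" s] len_S_le[of s] step by (simp add: m_assoc)
 thus "len x + len y <= len (x<*>y)" using step ys by simp
 qed
 have a: "x<*>y<*>s = x<*>(y<*>s)" using step by (simp add: m_assoc)
 have "len (x<*>y<*>s) = Suc (len (x<*>y))" unfolding a using step.prems(2) ys xy by linarith
 hence n: "s ~: N (x<*>y)" using len_up_iff[of "x<*>y" s] step.hyps step.prems(1) by simp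
 have "T x**T (y<*>s) = T x**(T y**T s)" using step by (simp add: hm_T_S)
 also have "\<dots> = T (x<*>y)**T s" using step xy by (simp add: hm_assoc[symmetric])
 also have "\<dots> = T (x<*>(y<*>s))" using n step a by (simp add: hm_T_S)
 finally show ?case .
qed

text \<open>The defining rules speak of generators on the right. On the left, the descent case comes
  from splitting T_s off T_w and using the quadratic relation for its square.\<close>

lemma hm_S_T: assumes "w : WW" "s : S"
 shows "T s**T w = (if s : N (inv w) then T (s<*>w) + scale (xi s) (T w) else T (s<*>w))"
proof -
 have 1: "len s = 1" using len_S_le[of s] S_ne_one[of s] len_0_iff[of s] assms by force
 show ?thesis
 proof (cases "s : N (inv w)")
 case False
 thus ?thesis using hm_T_T[of s w] len_mult_left(2)[OF assms] assms 1 by simp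
 next
 case True
 let ?v = "s<*>w"
 have v: "?v : WW" "s <*> ?v = w" using assms by simp_all
 have "T w = T s**T ?v" using hm_T_T[of s ?v] len_mult_left(3)[OF assms True] assms v 1 by simp
 hence "T s**T w = (T s**T s)**T ?v" using assms v by (simp add: hm_assoc)
 also have "\<dots> = T ?v + scale (xi s) (T s**T ?v)"
 using hm_T_S[of s s] assms v by (simp add: N_gen S_sq hm_add_left hm_scale_left)
 finally show ?thesis using True \<open>T w = T s**T ?v\<close> by simp
 qed
qed

end

lemma finite_max_elt: assumes "finite A" "A ~= {}" shows "EX y:A. ALL z:A. f z <= (f y :: 'b :: linorder)"
proof -
 have "Max (f ` A) : f ` A" using assms by simp
 then obtain y where "y : A" "Max (f ` A) = f y" by auto
 thus ?thesis using assms(1) by (metis Max_ge finite_imageI imageI)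
qed

section \<open>Laurent polynomials: degrees and the bar involution\<close>

definition dle :: "int => (int \<Rightarrow>\<^sub>0 'c::zero) => bool" where
 "dle n p <-> (ALL k>n. coef p k = 0)"

lemma dle_0 [simp]: "dle n 0" by (simp add: dle_def)
lemma dle_add: "dle n p ==> dle n r ==> dle n (p + r)" by (simp add: dle_def lookup_add)
lemma dle_diff: "dle n p ==> dle n r ==> dle n (p - r :: int \<Rightarrow>\<^sub>0 'c :: ab_group_add)" by (simp add: dle_def lookup_minus)
lemma dle_uminus: "dle n (p :: int \<Rightarrow>\<^sub>0 'c :: ab_group_add) ==> dle n (- p)" by (simp add: dle_def)
lemma dle_sum: "(!!x. x : A ==> dle n (f x)) ==> dle n (\<Sum>x\<in>A. f x)" by (simp add: dle_def lookup_sum)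
lemma dle_mono: "dle n p ==> n <= m ==> dle m p" by (simp add: dle_def)
lemma dle_single: "dle n (sgl k c) <-> k <= n | c = 0"
 by (auto simp: dle_def lookup_single when_def not_le)
lemma dle_keys: "dle n p <-> supp p <= {..n}"
 by (auto simp: dle_def in_keys_iff not_le[symmetric]) 

lemma dle_exists: "EX n. dle n p"
proof (cases "p = 0")
 case False
 hence "supp p <= {..Max (supp p)}" by auto
 thus ?thesis by (auto simp: dle_keys)
qed auto

lemma dle_mult: fixes p r :: "int \<Rightarrow>\<^sub>0 'c::comm_ring_1"
 assumes "dle m p" "dle n r" shows "dle (m + n) (p * r)"
proof -
 have "supp (p * r) <= {a + b |a b. a : supp p & b : supp r}"
 by (rule keys_mult)
 also have "\<dots> <= {..m + n}" using assms by (auto simp: dle_keys intro!: add_mono)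
 finally show ?thesis by (simp add: dle_keys)
qed

lemma lookup_single_mult: fixes r :: "int \<Rightarrow>\<^sub>0 'c::comm_ring_1"
 shows "coef (sgl k c * r) j = c * coef r (j - k)"
proof -
 have "sgl k c * r = (\<Sum>i\<in>supp r. sgl k c * sgl i (coef r i))"
 proof -
 have "r = (\<Sum>i\<in>supp r. sgl i (coef r i))"
 by (rule poly_mapping_eqI) (simp add: lookup_sum lookup_single when_def in_keys_iff sum.delta')
 thus ?thesis by (metis sum_distrib_left)
 qed
 also have "coef \<dots> j = (\<Sum>i\<in>supp r. if i = j - k then c * coef r i else 0)"
 unfolding lookup_sum by (rule sum.cong) (auto simp: mult_single lookup_single when_def)
 also have "\<dots> = c * coef r (j - k)" by (simp add: in_keys_iff)
 finally show ?thesis .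
qed

lemma lookup_mult_top: fixes p r :: "int \<Rightarrow>\<^sub>0 'c::comm_ring_1"
 assumes "dle m p" "dle n r"
 shows "coef (p * r) (m + n) = coef p m * coef r n"
proof -
 define p' where "p' = p - sgl m (coef p m)"
 have "dle (m - 1) p'" using assms(1)
 by (auto simp: dle_def p'_def lookup_minus lookup_single when_def)
 hence "dle (m - 1 + n) (p' * r)" using assms(2) by (rule dle_mult)
 hence "coef (p' * r) (m + n) = 0" by (simp add: dle_def)
 moreover have "p * r = sgl m (coef p m) * r + p' * r"
 by (simp add: p'_def algebra_simps)
 ultimately show ?thesis by (simp add: lookup_add lookup_single_mult)
qed
lemma laurent_expansion: "p = (\<Sum>i\<in>supp p. sgl i (coef p i))"
 by (rule poly_mapping_eqI) (simp add: lookup_sum lookup_single when_def in_keys_iff sum.delta')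

lemma lookup_laurent_bar [simp]: "coef (lbar p) n = coef p (- n)"
 unfolding laurent_bar_def by (subst map_key.rep_eq) (auto simp: inj_def)

lemma laurent_bar_add: "lbar (p + r) = lbar p + lbar r"
 by (rule poly_mapping_eqI) (simp add: lookup_add)
lemma laurent_bar_diff: "lbar (p - r) = lbar p - lbar r"
 by (rule poly_mapping_eqI) (simp add: lookup_minus)
lemma laurent_bar_0 [simp]: "lbar 0 = 0" by (rule poly_mapping_eqI) simp
lemma laurent_bar_sum: "lbar (\<Sum>x\<in>A. f x) = (\<Sum>x\<in>A. lbar (f x))"
 by (rule poly_mapping_eqI) (simp add: lookup_sum)
lemma laurent_bar_single: "lbar (sgl k c) = sgl (- k) c"
 by (rule poly_mapping_eqI) (auto simp: lookup_single when_def)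
lemma laurent_bar_qpow [simp]: "lbar (qpow k) = qpow (- k)"
 by (simp add: qpow_def laurent_bar_single)
lemma qpow_0: "qpow 0 = 1" by (simp add: qpow_def)
lemma qpow_mult: "qpow m * qpow n = qpow (m + n)" by (simp add: qpow_def mult_single)
lemma laurent_bar_1 [simp]: "lbar 1 = 1" using laurent_bar_qpow[of 0] by (simp add: qpow_0)

lemma laurent_bar_mult: "lbar (p * r) = lbar p * lbar r"
proof -
 have 1: "lbar (sgl k c * r) = lbar (sgl k c) * lbar r" for k c
 by (rule poly_mapping_eqI) (simp add: laurent_bar_single lookup_single_mult add.commute)
 have "lbar (p * r) = lbar ((\<Sum>i\<in>supp p. sgl i (coef p i)) * r)"
 using laurent_expansion[of p] by simp
 also have "\<dots> = (\<Sum>i\<in>supp p. lbar (sgl i (coef p i))) * lbar r"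
 by (simp add: sum_distrib_right laurent_bar_sum 1)
 also have "\<dots> = lbar p * lbar r"
 using laurent_expansion[of p] by (simp add: laurent_bar_sum[symmetric])
 finally show ?thesis .
qed

lemma dle_qpow: "dle n (qpow k) <-> k <= n" by (simp add: qpow_def dle_single)

lemma q_inv_poly_q_inv_iff: "p : q_inv_poly_q_inv <-> dle (-1) p"
proof -
 have "{..<0::int} = {..-1}" by auto
 thus ?thesis unfolding q_inv_poly_q_inv_def dle_keys by simp
qed

lemma poly_q_inv_iff: "p : poly_q_inv <-> dle 0 p"
 unfolding poly_q_inv_def dle_keys by simp

lemma bar_neg_zero: "lbar p = p ==> dle (-1) p ==> p = 0"
proof (rule poly_mapping_eqI)
 fix k assume a: "lbar p = p" "dle (-1) p"
 have "coef p k = coef p (- k)" using a(1) by (metis lookup_laurent_bar)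
 moreover have "coef p k = 0 | coef p (- k) = 0 "
 using a(2) unfolding dle_def by (cases "k > -1") auto
 ultimately show "coef p k = coef 0 k" by auto
qed

text \<open>The coefficients at exponents \<ge> 0 are kept and the positive ones mirrored; what
  remains has negative exponents only. The element m is the correction used in building the
  Kazhdan--Lusztig basis.\<close>

lemma bar_inv_part: "EX m. lbar m = m & dle (-1) (p - m)"
proof -
 define S where "S = {k\<in>supp p. k > 0}"
 define u where "u = (\<Sum>k\<in>S. sgl k (coef p k))"
 define m where "m = sgl 0 (coef p 0) + (u + lbar u)"
 have lu: "coef u k = (if k > 0 then coef p k else 0)" for k
 by (auto simp: u_def S_def lookup_sum lookup_single when_def in_keys_iff sum.delta')
 have "lbar m = m"
 by (rule poly_mapping_eqI) (simp add: m_def lookup_add lookup_single when_def)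
 moreover have "dle (-1) (p - m)"
 unfolding dle_def
 proof (intro allI impI)
 fix k :: int assume "-1 < k"
 then consider "k > 0" | "k = 0" by linarith
 thus "coef (p - m) k = 0"
 by cases (auto simp: m_def lookup_add lookup_minus lu lookup_single when_def)
 qed
 ultimately show ?thesis by blast
qed

section \<open>The bar involution and the Kazhdan--Lusztig basis\<close>

context coxeter begin

lemma xi_bar: "lbar (xi s) = - xi s"
 by (simp add: xi_def laurent_bar_diff)

text \<open>By the quadratic relation this is the inverse of \<open>T s\<close>.\<close>

definition Tsi :: "'a => 'a hk" where "Tsi s = T s - scale (xi s) (T \<one>)"

lemma Tsi_closed [simp]: "s : S ==> Tsi s : HC" by (simp add: Tsi_def)

lemma T_Tsi: assumes "s : S" shows "T s**Tsi s = T \<one>" "Tsi s**T s = T \<one>"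
 using hm_T_S[of s s] assms
 by (simp_all add: Tsi_def hm_diff_right hm_diff_left hm_scale_right hm_scale_left N_gen S_sq)

lemma hecke_inv_unique: assumes "g : HC" "h : HC" "h**g = T \<one>" "g**h = T \<one>"
 shows "hecke_inv h = g"
 unfolding hecke_inv_def
proof (rule the_equality)
 fix k assume k: "k : HC & h**k = T \<one> & k**h = T \<one>"
 hence "k = (g**h)**k" using assms by simp
 also have "\<dots> = g**(h**k)" using k assms by (intro hm_assoc) auto
 also have "\<dots> = g" using k assms by simp
 finally show "k = g" .
qed (use assms in auto)

definition bT :: "'a => 'a hk" where "bT w = hecke_inv (T (inv w))"

lemma bT_props: assumes "w : WW"
 shows "bT w : HC & bT w**T (inv w) = T \<one> & T (inv w)**bT w = T \<one>"
 "ALL s:S. s ~: N w --> bT (w<*>s) = bT w**Tsi s"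
proof -
 have st: "bT (x<*>s) = bT x**Tsi s & bT (x<*>s) : HC & bT (x<*>s)**T (inv (x<*>s)) = T \<one>
 & T (inv (x<*>s))**bT (x<*>s) = T \<one>"
 if x: "x : WW" and s: "s : S" "s ~: N x"
 and b: "bT x : HC" "bT x**T (inv x) = T \<one>" "T (inv x)**bT x = T \<one>" for x s
 proof -
 have "T (inv (x<*>s)) = T s**T (inv x)" using hm_S_T[of "inv x" s] x s by (simp add: inv_mult_group)
 moreover have "(T s**T (inv x))**(bT x**Tsi s) = T \<one>"
 proof -
 have "T (inv x)**(bT x**Tsi s) = Tsi s" using x s b hm_assoc[of "T (inv x)" "bT x" "Tsi s"] by simp
 thus ?thesis using x s b(1) T_Tsi by (simp add: hm_assoc)
 qed
 moreover have "(bT x**Tsi s)**(T s**T (inv x)) = T \<one>"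
 proof -
 have "Tsi s**(T s**T (inv x)) = T (inv x)"
 using x s T_Tsi hm_assoc[of "Tsi s" "T s" "T (inv x)"] by simp
 thus ?thesis using x s b by (simp add: hm_assoc)
 qed
 ultimately show ?thesis using hecke_inv_unique[of "bT x**Tsi s" "T (inv (x<*>s))"] x s b
 by (simp add: bT_def)
 qed
 show 1: "bT w : HC & bT w**T (inv w) = T \<one> & T (inv w)**bT w = T \<one>"
 using assms
 proof (induction w rule: right_induct)
 case one
 have "bT \<one> = T \<one>" using hecke_inv_unique[of "T \<one>" "T \<one>"] by (simp add: bT_def)
 thus ?case by simp
 next
 case (step x s) thus ?case using st[of x s] by blast
 qed
 show "ALL s:S. s ~: N w --> bT (w<*>s) = bT w**Tsi s" using st 1 assms by blast
qed

lemma bT_closed [simp]: "w : WW ==> bT w : HC" using bT_props by blast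
lemma bT_mult: "w : WW ==> s : S ==> s ~: N w ==> bT (w<*>s) = bT w**Tsi s" using bT_props by blast
lemma bT_one [simp]: "bT \<one> = T \<one>" using hecke_inv_unique[of "T \<one>" "T \<one>"] by (simp add: bT_def)

lemma bar_superset: "finite A ==> supp h <= A ==>
 bar h = (\<Sum>w\<in>A. scale (lbar (coef h w)) (bT w))"
 unfolding bar_def bT_def by (intro sum.mono_neutral_left) (auto simp: in_keys_iff)

lemma bar_closed [simp]: "h : HC ==> bar h : HC"
proof -
 assume h: "h : HC"
 have "bar h = (\<Sum>w\<in>supp h. scale (lbar (coef h w)) (bT w))"
 by (rule bar_superset) auto
 also have "\<dots> : HC" using h
 by (intro hecke_carrier_sum hecke_carrier_scale bT_closed) (auto simp: HC_def)
 finally show ?thesis .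
qed

lemma bar_add: "bar (g + h) = bar g + bar h"
proof -
 let ?A = "supp g \<union> supp h"
 have "bar f = (\<Sum>w\<in>?A. scale (lbar (coef f w)) (bT w))" if "f : {g, h, g + h}" for f
 using that keys_add[of g h] by (intro bar_superset) auto
 thus ?thesis by (simp add: lookup_add laurent_bar_add scale_add_left sum.distrib)
qed

lemma bar_scale: "bar (scale c h) = scale (lbar c) (bar h)"
 using keys_scale[of c h] by (simp add: bar_superset[of "supp h"] laurent_bar_mult scale_sum_right)

lemma bar_0 [simp]: "bar 0 = 0" using bar_scale[of 0 0] by simp
lemma bar_diff: "bar (g - h) = bar g - bar h"
 using bar_add[of "g - h" h] by simp
lemma bar_sum: "bar (\<Sum>x\<in>A. f x) = (\<Sum>x\<in>A. bar (f x))"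
 by (induction A rule: infinite_finite_induct) (auto simp: bar_add)
lemma bar_T: "bar (T w) = bT w"
 using bar_superset[of "{w}" "T w"] by (simp add: lookup_T)

lemma bar_mult_S: assumes "h : HC" "s : S" shows "bar (h**T s) = bar h**Tsi s"
proof -
 have sc: "s : WW" using assms by auto
 have *: "bar (T w**T s) = bT w**Tsi s" if w: "w : WW" for w
 proof (cases "s : N w")
 case False thus ?thesis using w assms by (simp add: hm_T_S bar_T bT_mult)
 next
 case True
 let ?v = "w<*>s"
 have v: "?v : WW" "?v<*>s = w" "s ~: N ?v" using w assms True N_mult_S by auto
 have b: "bT w = bT ?v**Tsi s" using bT_mult[of ?v s] v assms by simp
 have "Tsi s = T s - scale (xi s) (T \<one>)" by (simp add: Tsi_def)
 hence "Tsi s**Tsi s = T \<one> - scale (xi s) (Tsi s)"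
 using assms sc T_Tsi[OF assms(2)] by (metis Tsi_closed hecke_carrier_T hecke_carrier_scale hm_diff_right hm_one_right hm_scale_right one_closed)
 hence "bT w**Tsi s = bT ?v - scale (xi s) (bT w)"
 unfolding b using v assms by (simp add: hm_assoc hm_diff_right hm_scale_right)
 moreover have "bar (T w**T s) = bT ?v - scale (xi s) (bT w)"
 using w assms True by (simp add: hm_T_S bar_add bar_scale bar_T xi_bar) (metis diff_conv_add_uminus mult_minus1 scale_minus_1 scale_scale)
 ultimately show ?thesis by simp
 qed
 have c: "x : WW" if "x : supp h" for x using that assms by (auto simp: HC_def)
 have "bar (h**T s) = (\<Sum>w\<in>supp h. scale (lbar (coef h w)) (bT w**Tsi s))"
 using c by (subst hm_lincomb_left) (auto simp: assms lincomb_def bar_sum bar_scale * intro!: sum.cong)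
 also have "\<dots> = bar h**Tsi s"
 using c assms by (simp add: bar_superset[of "supp h" h] hm_sum_left hm_scale_left)
 finally show ?thesis .
qed

lemma bar_mult: assumes "g : HC" "h : HC" shows "bar (g**h) = bar g**bar h"
proof -
 have *: "bar (g**T w) = bar g**bT w" if "w : WW" for w
 using that
 proof (induction w rule: right_induct)
 case one thus ?case using assms by simp
 next
 case (step x s)
 have "T (x<*>s) = T x**T s" using step by (simp add: hm_T_S)
 thus ?case using step assms bar_mult_S[of "g**T x" s] by (simp add: hm_assoc[symmetric] bT_mult)
 qed
 have c: "x : WW" if "x : supp h" for x using that assms by (auto simp: HC_def)
 show ?thesis using c assms
 by (subst hm_lincomb_right) (auto simp: lincomb_def bar_sum bar_scale * bar_superset[of "supp h" h]
 hm_sum_right hm_scale_right intro!: sum.cong)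
qed

definition Cs :: "'a => 'a hk" where "Cs s = T s + scale (qpow (- int (L s))) (T \<one>)"

lemma Cs_closed [simp]: "s : S ==> Cs s : HC" by (simp add: Cs_def)

lemma bar_Cs: assumes "s : S" shows "bar (Cs s) = Cs s"
proof -
 have "bT s = Tsi s" using bT_mult[of \<one> s] assms by simp
 have "bar (Cs s) = T s - scale (xi s) (T \<one>) + scale (qpow (int (L s))) (T \<one>)"
 by (simp add: Cs_def bar_add bar_scale bar_T \<open>bT s = Tsi s\<close> Tsi_def)
 also have "\<dots> = T s + scale (qpow (int (L s)) - xi s) (T \<one>)"
 by (rule poly_mapping_eqI) (simp add: lookup_add lookup_minus algebra_simps)
 finally show ?thesis by (simp add: Cs_def xi_def)
qed

definition low :: "nat => 'a hk set" where
 "low n = {h : hecke_carrier. ALL w:supp h. len w < n}"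

lemma low_add: "g : low n ==> h : low n ==> g + h : low n"
 unfolding low_def using keys_add[of g h] by auto
lemma low_diff: "g : low n ==> h : low n ==> g - h : low n"
 unfolding low_def using keys_minus_subset[of g h] by auto
lemma low_scale: "h : low n ==> scale c h : low n"
 unfolding low_def using keys_scale[of c h] by auto
lemma low_sum: "(!!x. x : A ==> f x : low n) ==> (\<Sum>x\<in>A. f x) : low n"
 by (induction A rule: infinite_finite_induct) (simp_all add: low_add, simp_all add: low_def)
lemma low_mono: "h : low n ==> n <= m ==> h : low m" unfolding low_def by auto
lemma low_T: "w : WW ==> len w < n ==> T w : low n" unfolding low_def by simp
lemma low_closed: "h : low n ==> h : HC" unfolding low_def by simp

lemma low_mult_S: assumes "h : low n" "s : S" shows "h**T s : low (Suc n)"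
proof -
 have "T w**T s : low (Suc n)" if "w : WW" "len w < n" for w
 using that assms(2) len_mult_S[of w s] by (auto simp: hm_T_S intro!: low_add low_scale low_T)
 moreover have "h**T s = lincomb h (%x. T x**T s)"
 using assms hm_lincomb_left low_closed by simp
 ultimately show ?thesis using assms(1) unfolding lincomb_def
 by (auto simp: low_def[of n] HC_def intro!: low_sum low_scale)
qed

lemma bT_low: "w : WW ==> bT w - T w : low (len w)"
proof (induction w rule: right_induct)
 case one thus ?case by (simp add: low_def)
next
 case (step x s)
 let ?d = "bT x - T x"
 have l: "len (x<*>s) = Suc (len x)" using step len_up by simp
 have "bT (x<*>s) = (T x + ?d)**Tsi s" using step bT_mult by simp
 also have "\<dots> = T x**Tsi s + ?d**Tsi s" using step by (intro hm_add_left) auto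
 also have "T x**Tsi s = T (x<*>s) - scale (xi s) (T x)"
 using step by (simp add: Tsi_def hm_diff_right hm_scale_right hm_T_S)
 also have "?d**Tsi s = ?d**T s - scale (xi s) ?d"
 using step by (simp add: Tsi_def hm_diff_right hm_scale_right)
 finally have "bT (x<*>s) - T (x<*>s) = (?d**T s - scale (xi s) ?d) - scale (xi s) (T x)" by simp
 moreover have "(?d**T s - scale (xi s) ?d) - scale (xi s) (T x) : low (Suc (len x))"
 using step by (intro low_diff[OF low_diff[OF low_mult_S[OF step.IH] low_scale[OF low_mono[OF step.IH]]] low_scale[OF low_T]]) auto
 ultimately show ?case unfolding l by simp
qed

text \<open>At an element of maximal length in the support, \<open>bar\<close> only applies the
  scalar bar to the coefficient, since \<open>bT w\<close> is \<open>T w\<close> up to shorter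
  terms. That coefficient is thus bar-invariant with negative exponents only, hence 0.\<close>

lemma bar_neg_unique: assumes h: "h : HC" "bar h = h" and neg: "!!y. dle (-1) (coef h y)"
 shows "h = 0"
proof (rule ccontr)
 assume "h ~= 0"
 hence ne: "supp h ~= {}" by auto
 obtain y where y: "y : supp h" "!!z. z : supp h ==> len z <= len y"
 using finite_max_elt[OF finite_keys ne, of len] by blast
 have c: "x : WW" if "x : supp h" for x using that h by (auto simp: HC_def)
 have b: "coef (bT w) y = (if w = y then 1 else 0)" if "w : supp h" for w
 proof -
 have "y ~: supp (bT w - T w)" using bT_low[of w] c[OF that] y(2)[OF that]
 by (auto simp: low_def)
 hence "coef (bT w) y = coef (T w) y" by (simp add: in_keys_iff lookup_minus)
 thus ?thesis by (auto simp: lookup_T)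
 qed
 have "coef (bar h) y = (\<Sum>w\<in>supp h. lbar (coef h w) * (if w = y then 1 else 0))"
 using b by (simp add: bar_superset[of "supp h" h] lookup_sum)
 also have "\<dots> = (\<Sum>w\<in>supp h. if w = y then lbar (coef h w) else 0)"
 by (rule sum.cong) auto
 also have "\<dots> = lbar (coef h y)" using y(1) by simp
 finally have "coef h y = 0" using bar_neg_zero neg h(2) by metis
 thus False using y(1) by (simp add: in_keys_iff)
qed

section \<open>Existence and uniqueness of the Kazhdan--Lusztig basis\<close>

definition KL_elt :: "'a => 'a hk => bool" where
 "KL_elt w c <-> c : HC & bar c = c & supp (c - T w) <= {y. (y, w) : bruhat_less} &
 (ALL y. dle (-1) (coef (c - T w) y))"

text \<open>The element g is corrected downwards in length: from each coefficient its bar-invariant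
  part is removed by subtracting that multiple of the element already known for y. Such a
  subtraction leaves the other coefficients of the same or larger length untouched.\<close>

lemma KL_elt_reduce:
 assumes w: "w : WW" and g: "g : HC" "bar g = g" "supp (g - T w) <= {y. (y, w) : bruhat_less}"
 and IH: "!!y. (y, w) : bruhat_less ==> EX c. KL_elt y c"
 shows "EX c. KL_elt w c"
proof -
 have "EX c. c : HC & bar c = c & supp (c - T w) <= {y. (y, w) : bruhat_less} &
 (ALL y. len y \<ge> len w - n --> dle (-1) (coef (c - T w) y))" for n
 proof (induction n)
 case 0
 have "dle (-1) (coef (g - T w) y)" if "len w <= len y" for y
 proof -
 have "y ~: supp (g - T w)" using g(3) bruhat_len that by force
 thus ?thesis by (simp add: in_keys_iff)
 qed
 thus ?case using g by auto
 next
 case (Suc n)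
 then obtain c where c: "c : HC" "bar c = c" "supp (c - T w) <= {y. (y, w) : bruhat_less}"
 "!!y. len y \<ge> len w - n ==> dle (-1) (coef (c - T w) y)" by blast
 obtain K where K: "!!y. (y, w) : bruhat_less ==> KL_elt y (K y)" using IH by metis
 obtain m where m: "!!p. lbar (m p) = m p & dle (-1) (p - m p)" using bar_inv_part by metis
 let ?Y = "{y : supp (c - T w). len y = len w - Suc n}"
 let ?m = "%y. m (coef (c - T w) y)"
 define c' where "c' = c - (\<Sum>y\<in>?Y. scale (?m y) (K y))"
 have Yb: "(y, w) : bruhat_less" if "y : ?Y" for y using that c(3) by auto
 have KY: "K y : HC" "bar (K y) = K y" "supp (K y - T y) <= {z. (z, y) : bruhat_less}"
 if "y : ?Y" for y using K[OF Yb[OF that]] unfolding KL_elt_def by auto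
 have Kkeys: "z = y | (z, y) : bruhat_less" if "z : supp (K y)" "y : ?Y" for z y
 proof -
 have "supp (K y) <= supp (K y - T y) \<union> {y}"
 using keys_add[of "K y - T y" "T y"] by simp
 thus ?thesis using that KY(3)[OF that(2)] by auto
 qed
 have 1: "c' : HC" unfolding c'_def using c KY by (intro hecke_carrier_diff hecke_carrier_sum hecke_carrier_scale) auto
 have 2: "bar c' = c'" unfolding c'_def bar_diff bar_sum c(2) using KY m by (auto simp: bar_scale intro!: sum.cong)
 have c't: "c' - T w = (c - T w) - (\<Sum>y\<in>?Y. scale (?m y) (K y))" by (simp add: c'_def)
 have "supp (\<Sum>y\<in>?Y. scale (?m y) (K y)) <= {y. (y, w) : bruhat_less}"
 proof
 fix z assume "z : supp (\<Sum>y\<in>?Y. scale (?m y) (K y))"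
 from subsetD[OF keys_lookup_sum this] obtain y
 where y: "y : ?Y" "z : supp (scale (?m y) (K y))" by (rule UN_E)
 have "z = y | (z, y) : bruhat_less" by (rule Kkeys[OF subsetD[OF keys_scale y(2)] y(1)])
 thus "z : {y. (y, w) : bruhat_less}" using Yb[OF y(1)] bruhat_trans[of z y w] by auto
 qed
 hence 3: "supp (c' - T w) <= {y. (y, w) : bruhat_less}"
 unfolding c't using c(3) keys_minus_subset[of "c - T w"] by blast
 have 4: "dle (-1) (coef (c' - T w) y)" if ly: "len y \<ge> len w - Suc n" for y
 proof -
 have Ky: "coef (K z) y = (if y = z then 1 else 0)" if z: "z : ?Y" for z
 proof -
 have "y ~: supp (K z - T z)" using KY(3)[OF z] z ly bruhat_len[of y z] by auto
 hence "coef (K z) y = coef (T z) y" by (simp add: in_keys_iff lookup_minus)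
 thus ?thesis by (auto simp: lookup_T)
 qed
 have "coef (\<Sum>z\<in>?Y. scale (?m z) (K z)) y = (\<Sum>z\<in>?Y. if z = y then ?m z else 0)"
 unfolding lookup_sum by (rule sum.cong) (simp_all add: Ky)
 also have "\<dots> = (if y : ?Y then ?m y else 0)" by (rule sum.delta) simp
 finally have e: "coef (c' - T w) y = coef (c - T w) y - (if y : ?Y then ?m y else 0)"
 by (simp add: c't lookup_minus)
 show ?thesis
 proof (cases "y : ?Y")
 case True thus ?thesis using e m by simp
 next
 case False
 hence "len y \<ge> len w - n | y ~: supp (c - T w)" using ly by auto
 thus ?thesis using e False c(4)[of y] by (auto simp: in_keys_iff)
 qed
 qed
 show ?case using 1 2 3 4 by blast
 qed
 \<comment> \<open>For n equal to the length of w the truncated difference is 0, so the degree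
   condition covers every y.\<close>
 from this[of "len w"] show ?thesis unfolding KL_elt_def by auto
qed

lemma KL_elt_keys: "KL_elt w c ==> z : supp c ==> z = w | (z, w) : bruhat_less"
 using keys_add[of "c - T w" "T w"] unfolding KL_elt_def by auto

text \<open>Multiplication by \<open>Cs s\<close> produces z and z s from each z below x; both lie
  below x s, the second by the lifting property.\<close>

lemma KL_elt_mult_Cs_keys:
 assumes "KL_elt x c" "x : WW" "s : S" "s ~: N x"
 shows "supp (c**Cs s - T (x<*>s)) <= {y. (y, x<*>s) : bruhat_less}"
proof -
 have c: "c : HC" using assms by (simp add: KL_elt_def)
 define d where "d = c - T x"
 have d: "d : HC" using c assms by (simp add: d_def)
 have xs: "(x, x<*>s) : bruhat_less" using bruhat_S assms by blast
 have dk: "(z, x) : bruhat_less" if "z : supp d" for z using that assms by (auto simp: d_def KL_elt_def)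
 have "c**Cs s = (T x + d)**T s + scale (qpow (- int (L s))) c"
 using c assms by (simp add: Cs_def hm_add_right hm_scale_right d_def)
 also have "(T x + d)**T s = T (x<*>s) + d**T s"
 using d assms by (simp add: hm_add_left hm_T_S)
 finally have e: "c**Cs s - T (x<*>s) = d**T s + scale (qpow (- int (L s))) c" by simp
 have "supp (d**T s) <= {y. (y, x<*>s) : bruhat_less}"
 proof -
 have "d**T s = (\<Sum>z\<in>supp d. scale (coef d z) (T z**T s))"
 using hm_lincomb_left[of d "T s"] d assms by (simp add: lincomb_def)
 moreover have "supp (T z**T s) <= {y. (y, x<*>s) : bruhat_less}" if z: "z : supp d" for z
 proof -
 have zc: "z : WW" using bruhat_carrier dk[OF z] by blast
 have "supp (T z**T s) <= {z<*>s, z}"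
 using zc assms keys_add[of "T (z<*>s)" "scale (xi s) (T z)"] keys_scale[of "xi s" "T z"] by (auto simp: hm_T_S)
 moreover have "(z, x<*>s) : bruhat_less" using bruhat_trans[OF dk[OF z] xs] .
 moreover have "(z<*>s, x<*>s) : bruhat_less"
 using bruhat_lift[OF dk[OF z] assms(3)] xs bruhat_trans by blast
 ultimately show ?thesis by auto
 qed
 ultimately show ?thesis using keys_lookup_sum[of "%z. scale (coef d z) (T z**T s)" "supp d"] keys_scale by fastforce
 qed
 moreover have "supp (scale (qpow (- int (L s))) c) <= {y. (y, x<*>s) : bruhat_less}"
 using keys_scale[of _ c] KL_elt_keys[OF assms(1)] xs bruhat_trans by blast
 ultimately show ?thesis unfolding e using keys_add[of "d**T s" "scale (qpow (- int (L s))) c"] by blast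
qed
lemma ex_right_factor: "w : WW ==> w ~= \<one> ==> EX x:WW. EX s:S. s ~: N x & w = x<*>s"
 by (induction w rule: right_induct) auto

lemma KL_elt_exists: "w : WW ==> EX c. KL_elt w c"
proof (induction "len w" arbitrary: w rule: less_induct)
 case less
 have IH: "!!y. (y, w) : bruhat_less ==> EX c. KL_elt y c" using less.hyps bruhat_len bruhat_carrier by blast
 show ?case
 proof (cases "w = \<one>")
 case True
 have "KL_elt \<one> (T \<one>)" by (simp add: KL_elt_def bar_T)
 thus ?thesis using True by blast
 next
 case False
 then obtain x s where xs: "x : WW" "s : S" "s ~: N x" "w = x<*>s"
 using less.prems ex_right_factor by blast
 obtain c where c: "KL_elt x c" using IH bruhat_S[of x s] xs by blast
 have "c**Cs s : HC" "bar (c**Cs s) = c**Cs s"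
 using c xs bar_mult[of c "Cs s"] bar_Cs by (auto simp: KL_elt_def)
 thus ?thesis using KL_elt_reduce[OF less.prems _ _ _ IH, of "c**Cs s"] KL_elt_mult_Cs_keys[OF c] xs by simp
 qed
qed

lemma KL_elt_unique: assumes "KL_elt w c" "h : HC" "bar h = h" "!!y. dle (-1) (coef (h - T w) y)"
 shows "h = c"
proof -
 have "dle (-1) (coef (h - c) y)" for y
 using dle_diff[of "-1" "coef (h - T w) y" "coef (c - T w) y"] assms
 by (simp add: lookup_minus KL_elt_def)
 hence "h - c = 0" using bar_neg_unique[of "h - c"] assms by (simp add: KL_elt_def bar_diff)
 thus ?thesis by simp
qed

text \<open>Existence of coordinates peels off the terms of largest length; for uniqueness, at a
  longest element of the support only one basis element contributes.\<close>

lemma lincomb_unitriangular: assumes B: "!!w. w : WW ==> B w : HC"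
 and tri: "!!w. w : WW ==> B w - T w : low (len w)"
 shows "is_basis B"
 unfolding is_basis_def
proof (intro conjI ballI)
 fix h assume h: "h : HC"
 have ex: "EX c. c : HC & h = lincomb c B" if "h : low n" for n h
 using that
 proof (induction n arbitrary: h)
 case 0
 hence "h = 0" by (auto simp: low_def)
 thus ?case by (intro exI[of _ 0]) simp
 next
 case (Suc n)
 let ?Y = "{y : supp h. len y = n}"
 define e where "e = (\<Sum>y\<in>?Y. scale (coef h y) (T y))"
 have Y: "y : WW" if "y : ?Y" for y using that Suc.prems by (auto simp: low_def HC_def)
 have ec: "e : HC" unfolding e_def using Y by (intro hecke_carrier_sum hecke_carrier_scale) auto
 have le: "coef e y = (if len y = n then coef h y else 0)" for y
 proof -
 have "coef e y = (\<Sum>z\<in>?Y. if z = y then coef h z else 0)"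
 unfolding e_def lookup_sum by (rule sum.cong) (auto simp: lookup_T)
 also have "\<dots> = (if y : ?Y then coef h y else 0)" by (rule sum.delta) simp
 finally show ?thesis by (auto simp: in_keys_iff)
 qed
 have "h - e : low n"
 using Suc.prems ec by (auto simp: low_def in_keys_iff lookup_minus le less_Suc_eq split: if_splits)
 moreover have "e - lincomb e B : low n"
 proof -
 have "lincomb e B = (\<Sum>y\<in>?Y. scale (coef h y) (B y))"
 by (simp add: e_def lincomb_sum lincomb_scale)
 hence "e - lincomb e B = (\<Sum>y\<in>?Y. scale (- coef h y) (B y - T y))"
 by (simp add: e_def sum_subtractf[symmetric] scale_diff_right)
 (rule sum.cong, simp, rule poly_mapping_eqI, simp add: lookup_minus algebra_simps)
 also have "\<dots> : low n" using tri Y by (intro low_sum low_scale) fastforce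
 finally show ?thesis .
 qed
 ultimately have "(h - e) + (e - lincomb e B) : low n" by (rule low_add)
 hence "h - lincomb e B : low n" by simp
 then obtain c where "c : HC" "h - lincomb e B = lincomb c B" using Suc.IH by blast
 thus ?case using ec by (intro exI[of _ "c + e"]) (auto simp: lincomb_add algebra_simps)
 qed
 obtain n where "h : low n"
 proof -
 have "EX n. ALL w:supp h. len w < n"
 using finite_nat_set_iff_bounded[of "len ` supp h"] by auto
 thus ?thesis using that h by (auto simp: low_def)
 qed
 then obtain c where c: "c : HC" "h = lincomb c B" using ex by blast
 have z: "d = 0" if d: "d : HC" "lincomb d B = 0" for d
 proof (rule ccontr)
 assume "d ~= 0"
 hence "supp d ~= {}" by simp
 then obtain y where y: "y : supp d" "!!z. z : supp d ==> len z <= len y"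
 using finite_max_elt[OF finite_keys, of d len] by blast
 have b: "coef (B w) y = (if w = y then 1 else 0)" if "w : supp d" for w
 proof -
 have "w : WW" using that d by (auto simp: HC_def)
 hence "y ~: supp (B w - T w)" using tri[of w] y(2)[OF that] by (auto simp: low_def)
 hence "coef (B w) y = coef (T w) y" by (simp add: in_keys_iff lookup_minus)
 thus ?thesis by (auto simp: lookup_T)
 qed
 have "coef (lincomb d B) y = (\<Sum>w\<in>supp d. if w = y then coef d w else 0)"
 unfolding lincomb_def lookup_sum by (rule sum.cong) (auto simp: b)
 also have "\<dots> = coef d y" using y(1) by simp
 finally show False using d y(1) by (simp add: in_keys_iff)
 qed
 show "EX! c. c : HC & h = lincomb c B"
 proof (rule ex1I[of _ c])
 fix c' assume "c' : HC & h = lincomb c' B"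
 hence "lincomb (c' - c) B = 0" "c' - c : HC"
 using c lincomb_add[of "c' - c" c B] by auto
 thus "c' = c" using z[of "c' - c"] by simp
 qed (use c in auto)
qed (rule B)

lemma KL_elt_low: "KL_elt w c ==> w : WW ==> c - T w : low (len w)"
 unfolding KL_elt_def low_def using bruhat_len by auto

lemma KL_basis_unique: assumes "is_KL_basis B" "is_KL_basis D" shows "B = D"
proof
 fix w show "B w = D w"
 proof (cases "w : WW")
 case True
 have "KL_elt w (B w)" "KL_elt w (D w)"
 using assms True by (auto simp: is_KL_basis_def is_basis_def KL_elt_def q_inv_poly_q_inv_iff)
 thus ?thesis using KL_elt_unique unfolding KL_elt_def by metis
 next
 case False
 thus ?thesis using assms by (simp add: is_KL_basis_def extensional_def)
 qed
qed

lemma KL_basis_exists: "EX B. is_KL_basis B"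
proof -
 obtain K where K: "!!w. w : WW ==> KL_elt w (K w)" using KL_elt_exists by metis
 let ?B = "restrict K (WW)"
 have "is_basis ?B" using K KL_elt_low by (intro lincomb_unitriangular) (auto simp: KL_elt_def)
 hence "is_KL_basis ?B" using K
 by (auto simp: is_KL_basis_def KL_elt_def q_inv_poly_q_inv_iff)
 thus ?thesis by blast
qed

lemma is_KL_basis_C: "is_KL_basis C"
 unfolding C_def using KL_basis_exists KL_basis_unique by (metis the_equality)

lemma C_KL_elt: "w : WW ==> KL_elt w (C w)"
 using is_KL_basis_C by (auto simp: is_KL_basis_def is_basis_def KL_elt_def q_inv_poly_q_inv_iff)

lemma C_closed [simp]: "w : WW ==> C w : HC"
 and bar_C [simp]: "w : WW ==> bar (C w) = C w"
 using C_KL_elt by (auto simp: KL_elt_def)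

lemma C_neg: "w : WW ==> y ~= w ==> dle (-1) (coef (C w) y)"
 and C_diag [simp]: "w : WW ==> coef (C w) w = 1"
proof -
 assume w: "w : WW"
 have k: "KL_elt w (C w)" using C_KL_elt[OF w] .
 show "y ~= w ==> dle (-1) (coef (C w) y)"
 using k unfolding KL_elt_def by (metis (no_types, lifting) diff_zero lookup_T lookup_minus)
 have "w ~: supp (C w - T w)" using KL_elt_low[OF k w] by (auto simp: low_def)
 thus "coef (C w) w = 1" by (simp add: in_keys_iff lookup_minus lookup_T)
qed

lemma C_low: "w : WW ==> C w - T w : low (len w)"
 using KL_elt_low C_KL_elt by blast

lemma C_len: "w : WW ==> y : supp (C w) ==> y ~= w ==> len y < len w"
 using KL_elt_keys[OF C_KL_elt] bruhat_len by blast

lemma C_unique: "w : WW ==> h : HC ==> bar h = h ==>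
 (!!y. dle (-1) (coef (h - T w) y)) ==> C w = h"
 using KL_elt_unique[OF C_KL_elt] by metis

definition KLc :: "'a hk => 'a hk" where
 "KLc h = (THE c. c : HC & h = lincomb c C)"

lemma KL_coeff_KLc: "KL_coeff h = coef (KLc h)"
 unfolding KL_coeff_def KLc_def ..

lemma KLc: assumes "h : HC" shows "KLc h : HC" "lincomb (KLc h) C = h"
proof -
 have "EX! c. c : HC & h = lincomb c C" using is_KL_basis_C assms by (simp add: is_KL_basis_def is_basis_def)
 from theI'[OF this] show "KLc h : HC" "lincomb (KLc h) C = h" unfolding KLc_def by auto
qed
lemma lincomb_C_closed [simp]: "c : HC ==> lincomb c C : HC"
 by (rule hecke_carrier_lincomb) auto

lemma KLc_lincomb: assumes "c : HC" shows "KLc (lincomb c C) = c"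
proof -
 have "EX! d. d : HC & lincomb c C = lincomb d C"
 using is_KL_basis_C lincomb_C_closed[OF assms] by (simp add: is_KL_basis_def is_basis_def)
 thus ?thesis unfolding KLc_def using assms by (simp add: the1_equality)
qed
lemma KLc_add: "g : HC ==> h : HC ==> KLc (g + h) = KLc g + KLc h"
 by (metis KLc KLc_lincomb hecke_carrier_add lincomb_add)
lemma KLc_scale: "h : HC ==> KLc (scale c h) = scale c (KLc h)"
 by (metis KLc KLc_lincomb hecke_carrier_scale lincomb_scale)
lemma KLc_diff: "g : HC ==> h : HC ==> KLc (g - h) = KLc g - KLc h"
 by (metis KLc_add diff_add_cancel eq_diff_eq hecke_carrier_diff)
lemma KLc_0 [simp]: "KLc 0 = 0" using KLc_scale[of 0 0] by simp
lemma KLc_C [simp]: "w : WW ==> KLc (C w) = T w"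
 using KLc_lincomb[of "T w"] by simp
lemma KLc_bar: assumes h: "h : HC" "bar h = h"
 shows "lbar (coef (KLc h) z) = coef (KLc h) z"
proof -
 let ?c = "KLc h"
 define d where "d = (\<Sum>w\<in>supp ?c. scale (lbar (coef ?c w)) (T w))"
 have cc: "w : WW" if "w : supp ?c" for w using KLc(1)[OF h(1)] that by (auto simp: HC_def)
 have "h = bar (lincomb ?c C)" using h KLc by simp
 also have "\<dots> = lincomb d C"
 using cc by (simp add: lincomb_def[of ?c] bar_sum bar_scale d_def lincomb_sum lincomb_scale)
 finally have "KLc h = d"
 using KLc_lincomb[of d] cc unfolding d_def by (simp add: hecke_carrier_sum)
 moreover have "coef d z = lbar (coef ?c z)"
 proof -
 have "coef d z = (\<Sum>w\<in>supp ?c. if w = z then lbar (coef ?c w) else 0)"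
 unfolding d_def lookup_sum by (rule sum.cong) (auto simp: lookup_T)
 thus ?thesis by (simp add: in_keys_iff)
 qed
 ultimately show ?thesis by simp
qed

section \<open>Degrees of coefficients in the Kazhdan--Lusztig basis\<close>

definition dleH :: "int => 'a hk => bool" where
 "dleH n h <-> (ALL y. dle n (coef h y))"

lemma dleH_exists: "EX n. dleH n h"
proof -
 define f where "f y = (SOME n. dle n (coef h y))" for y
 have f: "dle (f y) (coef h y)" for y unfolding f_def by (rule someI_ex[OF dle_exists])
 have "dle (Max (f ` supp h)) (coef h y)" for y
 by (cases "y : supp h") (auto intro: dle_mono[OF f] simp: in_keys_iff)
 thus ?thesis unfolding dleH_def by blast
qed

text \<open>The transition from the basis \<open>C\<close> to the basis \<open>T\<close> is the
  identity up to negative powers of q, so coefficients in the top degree are the same in both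
  bases.\<close>

lemma top_lincomb_C: assumes "c : HC" "dleH n c"
 shows "dleH n (lincomb c C)" "coef (coef (lincomb c C) y) n = coef (coef c y) n"
proof -
 have cc: "w : WW" if "w : supp c" for w using assms that by (auto simp: HC_def)
 have dc: "dle n (coef c w)" for w using assms by (simp add: dleH_def)
 have off: "dle (n - 1) (coef c w * coef (C w) y)"
 if "w : supp c" "w ~= y" for w y
 using dle_mult[OF dc C_neg[OF cc[OF that(1)]], of y w] that by simp
 have "dle n (coef c w * coef (C w) y)" if "w : supp c" for w y
 using off[OF that, of y] cc[OF that] dc by (cases "w = y") (auto intro: dle_mono)
 thus "dleH n (lincomb c C)" unfolding dleH_def lincomb_def by (auto simp: lookup_sum intro!: dle_sum)
 have "coef (coef (lincomb c C) y) n =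
 (\<Sum>w\<in>supp c. if w = y then coef (coef c w) n else 0)"
 unfolding lincomb_def lookup_sum
 proof (rule sum.cong)
 fix w assume w: "w : supp c"
 show "coef (coef (scale (coef c w) (C w)) y) n =
 (if w = y then coef (coef c w) n else 0)"
 using off[OF w, of y] cc[OF w] by (auto simp: dle_def)
 qed simp
 also have "\<dots> = coef (coef c y) n" by (simp add: in_keys_iff)
 finally show "coef (coef (lincomb c C) y) n = coef (coef c y) n" .
qed

text \<open>Some bound exists by finiteness of the support. While it exceeds n, the coefficients in
  that degree equal those of h and vanish, so the bound can be lowered by one.\<close>

lemma dleH_KLc: assumes "h : HC" "dleH n h" shows "dleH n (KLc h)"
proof -
 obtain m where m: "dleH m (KLc h)" using dleH_exists by blast
 have "dleH (n + int k) (KLc h) ==> dleH n (KLc h)" for k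
 proof (induction k)
 case (Suc k)
 let ?m = "n + int (Suc k)"
 have "coef (coef (KLc h) y) ?m = 0" for y
 using top_lincomb_C(2)[OF KLc(1)[OF assms(1)] Suc.prems, of y] KLc(2)[OF assms(1)] assms(2)
 by (simp add: dleH_def dle_def)
 hence "coef (coef (KLc h) y) j = 0" if "j > n + int k" for y j
 using Suc.prems that unfolding dleH_def dle_def by (cases "j = ?m") auto
 hence "dleH (n + int k) (KLc h)" unfolding dleH_def dle_def by blast
 thus ?case by (rule Suc.IH)
 qed simp
 moreover have "dleH (n + int (nat (m - n))) (KLc h)" using m unfolding dleH_def by (auto intro: dle_mono)
 ultimately show ?thesis by blast
qed

lemma top_KLc: assumes "h : HC" "dleH n h"
 shows "coef (coef (KLc h) y) n = coef (coef h y) n"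
 using top_lincomb_C(2)[OF KLc(1)[OF assms(1)] dleH_KLc[OF assms], of y] KLc(2)[OF assms(1)] by simp

lemma KLc_low: assumes "h : low n" shows "KLc h : low n"
proof -
 have h: "h : HC" using assms low_closed by blast
 note c = KLc[OF h]
 have "len y < n" if y: "y : supp (KLc h)" for y
 proof -
 have "supp (KLc h) ~= {}" using y by auto
 then obtain z where z: "z : supp (KLc h)" "!!x. x : supp (KLc h) ==> len x <= len z"
 using finite_max_elt[OF finite_keys, of "KLc h" len] by blast
 have cc: "w : WW" if "w : supp (KLc h)" for w using c(1) that by (auto simp: HC_def)
 have "coef (C w) z = (if w = z then 1 else 0)" if "w : supp (KLc h)" for w
 using C_len[OF cc[OF that], of z] z(2)[OF that] cc[OF that] by (auto simp: in_keys_iff)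
 hence "coef (lincomb (KLc h) C) z = (\<Sum>w\<in>supp (KLc h). if w = z then coef (KLc h) w else 0)"
 unfolding lincomb_def lookup_sum by (intro sum.cong) auto
 hence "coef h z ~= 0" using c z(1) by (simp add: in_keys_iff)
 hence "len z < n" using assms by (auto simp: low_def in_keys_iff)
 thus ?thesis using z(2)[OF y] by simp
 qed
 thus ?thesis using c by (simp add: low_def)
qed

end

context coxeter begin

section \<open>Products of Kazhdan--Lusztig elements and the preorder\<close>

text \<open>A substitute for \<open>C w\<close>: bar-invariance and leading term \<open>T w\<close>
  persist when factors \<open>Cs s\<close> are multiplied on along a reduced word, so such elements
  can be written down explicitly.\<close>

definition top_elt :: "'a => 'a hk => bool" where
 "top_elt w h <-> w : WW & h : HC & bar h = h & h - T w : low (len w)"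

lemma top_elt_C: "w : WW ==> top_elt w (C w)"
 by (simp add: top_elt_def C_low)
lemma top_elt_one: "top_elt \<one> (T \<one>)"
 by (simp add: top_elt_def bar_T low_def)

lemma low_mult_S_left: assumes "h : low n" "s : S" shows "T s**h : low (Suc n)"
proof -
 have "T s**T w : low (Suc n)" if "w : WW" "len w < n" for w
 using that assms(2) len_mult_left(2,3)[of w s] by (cases "s : N (inv w)") (auto simp: hm_S_T intro!: low_add low_scale low_T)
 moreover have "T s**h = lincomb h (%x. T s**T x)"
 using assms hm_lincomb_right low_closed by simp
 ultimately show ?thesis using assms(1) unfolding lincomb_def
 by (auto simp: low_def[of n] HC_def intro!: low_sum low_scale)
qed

lemma top_elt_right: assumes "top_elt w h" "s : S" "s ~: N w" shows "top_elt (w<*>s) (h**Cs s)"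
proof -
 have w: "w : WW" "h : HC" "bar h = h" "h - T w : low (len w)" using assms by (auto simp: top_elt_def)
 have l: "len (w<*>s) = Suc (len w)" using len_up assms w by simp
 let ?d = "h - T w"
 have "h**Cs s = (T w + ?d)**T s + scale (qpow (- int (L s))) h"
 using w assms by (simp add: Cs_def hm_add_right hm_scale_right)
 also have "(T w + ?d)**T s = T (w<*>s) + ?d**T s"
 by (subst hm_add_left) (use w assms in \<open>auto simp: hm_T_S\<close>)
 finally have e: "h**Cs s - T (w<*>s) = ?d**T s + scale (qpow (- int (L s))) h" by simp
 have "T w + ?d : low (Suc (len w))" by (rule low_add[OF low_T low_mono[OF w(4)]]) (use w in auto)
 hence "h : low (Suc (len w))" by simp
 thus ?thesis using w assms bar_mult bar_Cs low_add[OF low_mult_S[OF w(4) assms(2)] low_scale]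
 by (simp add: top_elt_def e l)
qed

lemma top_elt_left: assumes "top_elt w h" "s : S" "s ~: N (inv w)" shows "top_elt (s<*>w) (Cs s**h)"
proof -
 have w: "w : WW" "h : HC" "bar h = h" "h - T w : low (len w)" using assms by (auto simp: top_elt_def)
 have l: "len (s<*>w) = Suc (len w)" using len_mult_left(2) assms w by simp
 let ?d = "h - T w"
 have "Cs s**h = T s**(T w + ?d) + scale (qpow (- int (L s))) h"
 using w assms by (simp add: Cs_def hm_add_left hm_scale_left)
 also have "T s**(T w + ?d) = T (s<*>w) + T s ** ?d"
 by (subst hm_add_right) (use w assms in \<open>auto simp: hm_S_T\<close>)
 finally have e: "Cs s**h - T (s<*>w) = T s ** ?d + scale (qpow (- int (L s))) h" by simp
 have "T w + ?d : low (Suc (len w))" by (rule low_add[OF low_T low_mono[OF w(4)]]) (use w in auto)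
 hence "h : low (Suc (len w))" by simp
 thus ?thesis using w assms bar_mult bar_Cs low_add[OF low_mult_S_left[OF w(4) assms(2)] low_scale]
 by (simp add: top_elt_def e l)
qed

lemma len_mult_prefix: assumes "x : WW" "y : WW" "s : S" "s ~: N y"
 "len (x<*>(y<*>s)) = len x + len (y<*>s)"
 shows "len (x<*>y) = len x + len y" "s ~: N (x<*>y)"
proof -
 have l: "len (y<*>s) = Suc (len y)" using len_up assms by simp
 have e: "x<*>(y<*>s) = x<*>y<*>s" using assms by (simp add: m_assoc)
 have "len (x<*>y) <= len x + len y" using len_mult_le assms by simp
 moreover have "len (x<*>y<*>s) <= len (x<*>y) + 1" using len_mult_le[of "x<*>y" s] len_S_le[of s] assms by simp
 ultimately show 1: "len (x<*>y) = len x + len y" using assms(5) l unfolding e by linarith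
 hence "len (x<*>y) < len (x<*>y<*>s)" using assms(5) l unfolding e by linarith
 thus "s ~: N (x<*>y)" using len_up_iff[of "x<*>y" s] assms by simp
qed

lemma top_elt_ext_right: assumes "top_elt d b" "y : WW" "len (d<*>y) = len d + len y"
 shows "EX P:hecke_carrier. top_elt (d<*>y) (b**P)"
 using assms(2,3)
proof (induction y rule: right_induct)
 case one thus ?case using assms by (intro bexI[of _ "T \<one>"]) (auto simp: top_elt_def)
next
 case (step y s)
 have d: "d : WW" "b : HC" using assms by (auto simp: top_elt_def)
 note p = len_mult_prefix[OF d(1) step(1-3) step.prems]
 obtain P where P: "P : HC" "top_elt (d<*>y) (b**P)" using step.IH p by blast
 have "top_elt (d<*>y<*>s) (b**P**Cs s)" using top_elt_right[OF P(2) step(2) p(2)] .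
 moreover have "b**P**Cs s = b**(P**Cs s)" using d P step by (intro hm_assoc) auto
 moreover have "d<*>y<*>s = d<*>(y<*>s)" using d step by (simp add: m_assoc)
 ultimately show ?case using P step by (intro bexI[of _ "P**Cs s"]) auto
qed

lemma top_elt_ext_left: assumes "top_elt d b" "x : WW" "len (x<*>d) = len x + len d"
 shows "EX P:hecke_carrier. top_elt (x<*>d) (P**b)"
proof -
 have d: "d : WW" "b : HC" using assms by (auto simp: top_elt_def)
 have "len (inv y<*>d) = len y + len d --> (EX P:hecke_carrier. top_elt (inv y<*>d) (P**b))"
 if "y : WW" for y
 using that
 proof (induction y rule: right_induct)
 case one thus ?case using assms d by (auto simp: intro!: bexI[of _ "T \<one>"])
 next
 case (step y s)
 show ?case
 proof
 assume *: "len (inv (y<*>s)<*>d) = len (y<*>s) + len d"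
 have e1: "inv (y<*>s)<*>d = s<*>(inv y<*>d)" using step d by (simp add: inv_mult_group m_assoc)
 have i: "inv (s<*>(inv y<*>d)) = inv d<*>(y<*>s)" using step d by (simp add: inv_mult_group m_assoc)
 have "len (s<*>(inv y<*>d)) = len (inv d<*>(y<*>s))"
 using len_inv[of "s<*>(inv y<*>d)"] i step d by simp
 hence l: "len (inv d<*>(y<*>s)) = len (inv d) + len (y<*>s)" using * e1 d by simp
 note p = len_mult_prefix[OF inv_closed[OF d(1)] step(1-3) l]
 have i2: "inv (inv y<*>d) = inv d<*>y" using step d by (simp add: inv_mult_group)
 have "len (inv y<*>d) = len y + len d" using p(1) len_inv[of "inv y<*>d"] i2 step d by simp
 then obtain P where P: "P : HC" "top_elt (inv y<*>d) (P**b)" using step.IH by blast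
 have "top_elt (s<*>(inv y<*>d)) (Cs s**(P**b))" using top_elt_left[OF P(2) step(2)] p(2) i2 by simp
 moreover have "Cs s**(P**b) = Cs s**P**b" using d P step by (intro hm_assoc[symmetric]) auto
 ultimately show "EX P:hecke_carrier. top_elt (inv (y<*>s)<*>d) (P**b)"
 unfolding e1 using P step by (intro bexI[of _ "Cs s**P"]) auto
 qed
 qed
 from this[of "inv x"] assms show ?thesis by simp
qed

text \<open>The element found lies in the two-sided ideal generated by b, so whatever kills b kills
  an element with leading term at x d y.\<close>

lemma top_elt_ext: assumes b: "top_elt d b" and x: "x : WW" and y: "y : WW"
 and l: "len (x<*>d<*>y) = len x + len d + len y"
 shows "EX P:hecke_carrier. EX Q:hecke_carrier. top_elt (x<*>d<*>y) (P**b**Q)"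
proof -
 have d: "d : WW" using b by (simp add: top_elt_def)
 have "len (x<*>d) = len x + len d"
 using len_mult_le[of "x<*>d" y] len_mult_le[of x d] x y d l by simp
 then obtain P where "P : HC" "top_elt (x<*>d) (P**b)" using top_elt_ext_left[OF b x] by blast
 moreover have "len (x<*>d<*>y) = len (x<*>d) + len y" using l \<open>len (x<*>d) = _\<close> by simp
 ultimately show ?thesis using top_elt_ext_right[of "x<*>d" "P**b" y] y by blast
qed

lemma top_elt_KLc: assumes "top_elt w h" shows "KLc h - T w : low (len w)" "coef (KLc h) w = 1"
proof -
 have w: "w : WW" "h : HC" "h - T w : low (len w)" using assms by (auto simp: top_elt_def)
 have "h - C w = (h - T w) - (C w - T w)" by simp
 hence "h - C w : low (len w)" using w C_low low_diff by metis
 hence "KLc (h - C w) : low (len w)" by (rule KLc_low)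
 thus 1: "KLc h - T w : low (len w)" using w by (simp add: KLc_diff)
 hence "w ~: supp (KLc h - T w)" by (auto simp: low_def)
 thus "coef (KLc h) w = 1" by (simp add: in_keys_iff lookup_minus lookup_T)
qed

lemma le_LR_I: "x : WW ==> y : WW ==> h : HC ==> h' : HC ==>
 coef (KLc (h**C y**h')) x ~= 0 ==> (x, y) : le_LR"
 unfolding le_LR_def KL_coeff_KLc by (rule r_into_trancl) blast

lemma le_LR_trans: "(x, y) : le_LR ==> (y, z) : le_LR ==> (x, z) : le_LR"
 unfolding le_LR_def by (rule trancl_trans)

lemma le_LR_carrier: "(x, y) : le_LR ==> x : WW & y : WW"
 unfolding le_LR_def by (induction rule: trancl_induct) auto

lemma le_LR_refl: "x : WW ==> (x, x) : le_LR"
 by (rule le_LR_I[of x x "T \<one>" "T \<one>"]) (auto simp: lookup_T)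

lemma le_LR_factor: assumes "x : WW" "d : WW" "y : WW" "len (x<*>d<*>y) = len x + len d + len y"
 shows "(x<*>d<*>y, d) : le_LR"
proof -
 obtain P Q where PQ: "P : HC" "Q : HC" "top_elt (x<*>d<*>y) (P**C d**Q)"
 using top_elt_ext[OF top_elt_C[OF assms(2)] assms(1,3,4)] by blast
 show ?thesis using le_LR_I[of "x<*>d<*>y" d P Q] PQ top_elt_KLc(2)[OF PQ(3)] assms by simp
qed

lemma struct_const_KLc: "struct_const x y z = coef (KLc (C x**C y)) z"
 unfolding struct_const_def KL_coeff_KLc ..

lemma le_LR_struct: assumes "x : WW" "y : WW" "struct_const x y z ~= 0"
 shows "(z, x) : le_LR" "(z, y) : le_LR"
proof -
 have "KLc (C x**C y) : HC" using assms KLc(1) by simp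
 hence z: "z : WW" using assms(3) unfolding struct_const_KLc HC_def
 by (metis (mono_tags, lifting) in_keys_iff mem_Collect_eq subsetD)
 show "(z, x) : le_LR" using le_LR_I[of z x "T \<one>" "C y"] assms z by (simp add: struct_const_KLc)
 show "(z, y) : le_LR" using le_LR_I[of z y "C x" "T \<one>"] assms z by (simp add: struct_const_KLc)
qed

lemma qpow_poly: "qpow (- int n) * p : poly_q_inv <-> dle (int n) p"
proof
 assume "qpow (- int n) * p : poly_q_inv"
 hence "dle 0 (qpow (- int n) * p)" by (simp add: poly_q_inv_iff)
 hence "dle (int n + 0) (qpow (int n) * (qpow (- int n) * p))" by (intro dle_mult) (simp_all add: dle_qpow)
 thus "dle (int n) p" by (simp add: mult.assoc[symmetric] qpow_mult qpow_0)
next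
 assume "dle (int n) p"
 hence "dle (- int n + int n) (qpow (- int n) * p)" by (intro dle_mult) (simp_all add: dle_qpow)
 thus "qpow (- int n) * p : poly_q_inv" by (simp add: poly_q_inv_iff)
qed

lemma lusztig_a_eqI:
 assumes "!!x y. x : WW ==> y : WW ==> dle (int n) (struct_const x y z)"
 and "x : WW" "y : WW" "coef (struct_const x y z) (int n) ~= 0"
 shows "lusztig_a z = n"
 unfolding lusztig_a_def qpow_poly
proof (rule Least_equality)
 fix m assume "ALL x:WW. ALL y:WW. dle (int m) (struct_const x y z)"
 hence "dle (int m) (struct_const x y z)" using assms by blast
 thus "n <= m" using assms(4) unfolding dle_def by (meson not_le of_nat_less_iff)
qed (use assms in blast)

lemma top_coeff_bar: assumes h: "h : HC" "bar h = h" and y: "y : supp h"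
 "!!z. z : supp h ==> len z <= len y"
 shows "lbar (coef h y) = coef h y"
proof -
 have c: "x : WW" if "x : supp h" for x using that h by (auto simp: HC_def)
 have b: "coef (bT w) y = (if w = y then 1 else 0)" if "w : supp h" for w
 proof -
 have "y ~: supp (bT w - T w)" using bT_low[of w] c[OF that] y(2)[OF that]
 by (auto simp: low_def)
 hence "coef (bT w) y = coef (T w) y" by (simp add: in_keys_iff lookup_minus)
 thus ?thesis by (auto simp: lookup_T)
 qed
 have "coef (bar h) y = (\<Sum>w\<in>supp h. if w = y then lbar (coef h w) else 0)"
 unfolding bar_superset[OF finite_keys order.refl, of h] lookup_sum by (rule sum.cong) (auto simp: b)
 also have "\<dots> = lbar (coef h y)" using y(1) by simp
 finally show ?thesis using h by simp
qed

lemma lookup_mult_T_S: assumes "h : HC" "s : S" "y : WW"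
 shows "coef (h**T s) y =
 coef h (y<*>s) + (if s : N y then xi s * coef h y else 0)"
proof -
 have cc: "w : WW" if "w : supp h" for w using assms that by (auto simp: HC_def)
 have ne: "y<*>s ~= y" using assms S_ne_one by (metis S_in l_cancel_one)
 have "coef (h**T s) y = (\<Sum>w\<in>supp h. coef h w * coef (T w**T s) y)"
 by (subst hm_lincomb_left) (use assms in \<open>auto simp: lincomb_def lookup_sum\<close>)
 also have "\<dots> = (\<Sum>w\<in>supp h. (if w = y<*>s then coef h w else 0)
 + (if w = y then (if s : N y then xi s * coef h y else 0) else 0))"
 proof (rule sum.cong)
 fix w assume w: "w : supp h"
 have "y = w<*>s <-> w = y<*>s" using cc[OF w] assms by auto
 thus "coef h w * coef (T w**T s) y =
 (if w = y<*>s then coef h w else 0)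
 + (if w = y then (if s : N y then xi s * coef h y else 0) else 0)"
 using cc[OF w] assms ne by (auto simp: hm_T_S lookup_add lookup_T mult.commute)
 qed simp
 also have "\<dots> = coef h (y<*>s) + (if s : N y then xi s * coef h y else 0)"
 by (simp add: sum.distrib in_keys_iff)
 finally show ?thesis .
qed

lemma lookup_mult_Cs: assumes "h : HC" "s : S" "y : WW"
 shows "coef (h**Cs s) y =
 coef h (y<*>s) + qpow (if s : N y then int (L s) else - int (L s)) * coef h y"
proof -
 have "h**Cs s = h**T s + scale (qpow (- int (L s))) h"
 using assms by (simp add: Cs_def hm_add_right hm_scale_right)
 thus ?thesis using assms by (simp add: lookup_add lookup_mult_T_S xi_def algebra_simps)
qed

text \<open>Equivalent to the fact that \<open>C x ** Cs s\<close> is \<open>C x\<close> times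
  q^L(s) + q^-L(s). The difference h of the two is bar-invariant; a longest z in its support has s
  as descent, which makes the coefficient at z of negative degree, hence 0.\<close>

lemma C_descent: assumes x: "x : WW" and s: "s : S" "s : N x" and y: "y : WW" "s : N y"
 shows "coef (C x) (y<*>s) = qpow (- int (L s)) * coef (C x) y"
proof -
 let ?q = "qpow (int (L s))" and ?q' = "qpow (- int (L s))"
 have qq: "?q * ?q' = 1" by (simp add: qpow_mult qpow_0)
 define h where "h = C x**Cs s - scale (?q + ?q') (C x)"
 have hc: "h : HC" "bar h = h"
 using x s by (simp_all add: h_def bar_diff bar_mult bar_Cs bar_scale laurent_bar_add add.commute)
 let ?u = "%y. coef (C x) (y<*>s) - ?q' * coef (C x) y"
 have up: "coef h y = ?u y" if "y : WW" "s : N y" for y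
 using that x s by (simp add: h_def lookup_minus lookup_mult_Cs algebra_simps)
 have dn: "coef h (y<*>s) = - ?q * ?u y" if "y : WW" "s : N y" for y
 proof -
 have "s ~: N (y<*>s)" using N_mult_S that s by simp
 hence "coef h (y<*>s) = coef (C x) y - ?q * coef (C x) (y<*>s)"
 using that x s by (simp add: h_def lookup_minus lookup_mult_Cs algebra_simps)
 thus ?thesis using qq by (simp add: algebra_simps mult.assoc[symmetric])
 qed
 have "h = 0"
 proof (rule ccontr)
 assume "h ~= 0"
 then obtain z where z: "z : supp h" "!!v. v : supp h ==> len v <= len z"
 using finite_max_elt[OF finite_keys, of h len] by auto
 have zc: "z : WW" using z hc by (auto simp: HC_def)
 have zs: "s : N z"
 proof (rule ccontr)
 assume n: "s ~: N z"
 hence n': "s : N (z<*>s)" using N_mult_S zc s by simp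
 have "z<*>s ~: supp h" using z(2)[of "z<*>s"] len_up[OF zc s(1) n] by auto
 hence "?u (z<*>s) = 0" using up[of "z<*>s"] zc s n' by (simp add: in_keys_iff)
 hence "coef h z = 0" using dn[of "z<*>s"] zc s n' by simp
 thus False using z(1) by (simp add: in_keys_iff)
 qed
 have "z<*>s ~= x" using N_mult_S[OF zc s(1)] zs s(2) by auto
 hence "dle (-1) (coef (C x) (z<*>s))" using C_neg x by blast
 moreover have "dle (-1) (?q' * coef (C x) z)"
 proof -
 have "dle 0 (coef (C x) z)"
 proof (cases "z = x")
 case True
 thus ?thesis using x dle_single[of 0 0 1] by (simp add: single_one[symmetric] del: single_one)
 next
 case False thus ?thesis using C_neg[OF x False] dle_mono by fastforce
 qed
 hence "dle (- int (L s) + 0) (?q' * coef (C x) z)" by (intro dle_mult) (simp_all add: dle_qpow)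
 thus ?thesis using L_pos[OF s(1)] by (auto intro: dle_mono)
 qed
 ultimately have "dle (-1) (coef h z)" using up[OF zc zs] dle_diff by simp
 hence "coef h z = 0" using bar_neg_zero top_coeff_bar[OF hc z] by blast
 thus False using z(1) by (simp add: in_keys_iff)
 qed
 thus ?thesis using up[OF y] by simp
qed

end

section \<open>Matrix representations of bounded degree\<close>

text \<open>Matrix entries are Laurent polynomials in q over Z[\<zeta>, \<zeta>^-1]: in the type
  \<open>int hk\<close> the outer exponent belongs to q and the inner one to \<zeta>. Scalars are
  embedded as constants in \<zeta>.\<close>

definition emb :: "laurent => int hk" where "emb p = Poly_Mapping.map of_int p"

lemma lookup_emb [simp]: "coef (emb p) k = of_int (coef p k)"
 unfolding emb_def by (simp add: Poly_Mapping.map.rep_eq when_def)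

lemma emb_add: "emb (p + r) = emb p + emb r"
 and emb_diff: "emb (p - r) = emb p - emb r"
 and emb_0 [simp]: "emb 0 = 0"
 by (rule poly_mapping_eqI, simp add: lookup_add lookup_minus)+
lemma emb_single: "emb (sgl k c) = sgl k (of_int c)"
 by (rule poly_mapping_eqI) (simp add: lookup_single when_def)

lemma emb_1 [simp]: "emb 1 = 1"
 using emb_single[of 0 1] by simp

lemma emb_sum: "emb (\<Sum>x\<in>A. f x) = (\<Sum>x\<in>A. emb (f x))"
 by (induction A rule: infinite_finite_induct) (auto simp: emb_add)

lemma emb_mult: "emb (p * r) = emb p * emb r"
proof -
 have 1: "emb (sgl k c * r) = emb (sgl k c) * emb r" for k c
 by (rule poly_mapping_eqI) (simp add: emb_single lookup_single_mult)
 have "emb (p * r) = (\<Sum>i\<in>supp p. emb (sgl i (coef p i) * r))"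
 by (subst laurent_expansion[of p]) (simp add: emb_sum sum_distrib_right)
 also have "\<dots> = emb (\<Sum>i\<in>supp p. sgl i (coef p i)) * emb r"
 by (simp only: 1 emb_sum sum_distrib_right)
 also have "\<dots> = emb p * emb r" by (simp only: laurent_expansion[of p, symmetric])
 finally show ?thesis .
qed
lemma dle_emb: "dle n p ==> dle n (emb p)"
 by (simp add: dle_def)

definition repr :: "('a => nat => nat => int hk) => 'a hk => nat => nat => int hk" where
 "repr R h p j = (\<Sum>w\<in>supp h. emb (coef h w) * R w p j)"

lemma repr_superset: "finite A ==> supp h <= A ==>
 repr R h p j = (\<Sum>w\<in>A. emb (coef h w) * R w p j)"
 unfolding repr_def by (intro sum.mono_neutral_left) (auto simp: in_keys_iff)

lemma repr_add: "repr R (g + h) p j = repr R g p j + repr R h p j"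
proof -
 let ?A = "supp g \<union> supp h"
 have "repr R f p j = (\<Sum>w\<in>?A. emb (coef f w) * R w p j)" if "f : {g, h, g + h}" for f
 using that keys_add[of g h] by (intro repr_superset) auto
 thus ?thesis by (simp add: lookup_add emb_add algebra_simps sum.distrib)
qed

lemma repr_scale: "repr R (scale c h) p j = emb c * repr R h p j"
 using keys_scale[of c h] by (simp add: repr_superset[of "supp h"] emb_mult sum_distrib_left mult.assoc)

lemma repr_0 [simp]: "repr R 0 p j = 0" by (simp add: repr_def)

lemma repr_diff: "repr R (g - h) p j = repr R g p j - repr R h p j"
 using repr_add[of R "g - h" h p j] by simp

lemma repr_sum: "repr R (\<Sum>x\<in>A. f x) p j = (\<Sum>x\<in>A. repr R (f x) p j)"
 by (induction A rule: infinite_finite_induct) (auto simp: repr_add)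

lemma repr_top: assumes "!!w. dle m (coef h w)" "!!w. w : supp h ==> dle n (R w p j)"
 shows "dle (m + n) (repr R h p j)"
 "coef (repr R h p j) (m + n) =
 (\<Sum>w\<in>supp h. of_int (coef (coef h w) m) * coef (R w p j) n)"
 unfolding repr_def lookup_sum
 by (intro dle_sum dle_mult dle_emb assms, assumption)
 (rule sum.cong, simp, subst lookup_mult_top[OF dle_emb[OF assms(1)] assms(2)], simp_all)

context coxeter begin

lemma repr_T [simp]: "repr R (T w) p j = R w p j"
 by (simp add: repr_def lookup_T)
lemma repr_lincomb: "repr R (lincomb c B) p j = (\<Sum>w\<in>supp c. emb (coef c w) * repr R (B w) p j)"
 by (simp add: lincomb_def repr_sum repr_scale)

end

text \<open>A matrix is prescribed for every group element, linked to those of the generators along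
  length-increasing products. Together with the quadratic relation this makes \<open>repr\<close>
  multiplicative, see \<open>repr_mult\<close>.\<close>

locale hecke_rep = coxeter +
 fixes R :: "'a => nat => nat => int hk" and d :: nat
 assumes R_one: "p < d ==> j < d ==> R \<one> p j = (if p = j then 1 else 0)"
 and R_step: "w : WW ==> s : S ==> s ~: N w ==> p < d ==> j < d ==>
 R (w<*>s) p j = (\<Sum>m<d. R w p m * R s m j)"
 and R_quad: "s : S ==> p < d ==> j < d ==>
 (\<Sum>m<d. R s p m * R s m j) = (if p = j then 1 else 0) + emb (xi s) * R s p j"
begin

lemma mat_assoc: "(\<Sum>m<d. (\<Sum>k<d. A k * B k m) * D m) = (\<Sum>k<d. A k * (\<Sum>m<d. B k m * (D m :: 'x :: comm_ring_1)))"
 unfolding sum_distrib_left sum_distrib_right mult.assoc by (rule sum.swap)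

lemma repr_mult_T_S: assumes w: "w : WW" and s: "s : S" and pj: "p < d" "j < d"
 shows "repr R (T w**T s) p j = (\<Sum>m<d. R w p m * R s m j)"
proof (cases "s : N w")
 case False thus ?thesis using assms by (simp add: hm_T_S R_step)
next
 case True
 let ?v = "w<*>s"
 have v: "?v : WW" "s ~: N ?v" "w = ?v<*>s" using w s True N_mult_S by auto
 have "(\<Sum>m<d. R w p m * R s m j) = (\<Sum>m<d. (\<Sum>k<d. R ?v p k * R s k m) * R s m j)"
 using R_step[OF v(1) s v(2) pj(1)] v(3) by simp
 also have "\<dots> = (\<Sum>k<d. R ?v p k * ((if k = j then 1 else 0) + emb (xi s) * R s k j))"
 unfolding mat_assoc by (simp add: R_quad s pj)
 also have "\<dots> = (\<Sum>k<d. (if k = j then R ?v p j else 0) + emb (xi s) * (R ?v p k * R s k j))"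
 by (rule sum.cong) (auto simp: algebra_simps)
 also have "\<dots> = R ?v p j + emb (xi s) * (\<Sum>k<d. R ?v p k * R s k j)"
 using pj by (simp add: sum.distrib sum_distrib_left)
 also have "(\<Sum>k<d. R ?v p k * R s k j) = R w p j" using R_step[OF v(1) s v(2) pj] v(3) by simp
 finally show ?thesis using True w s by (simp add: hm_T_S repr_add repr_scale)
qed

lemma repr_mult_S: assumes h: "h : HC" and s: "s : S" and pj: "p < d" "j < d"
 shows "repr R (h**T s) p j = (\<Sum>m<d. repr R h p m * R s m j)"
proof -
 have c: "w : WW" if "w : supp h" for w using h that by (auto simp: HC_def)
 have "repr R (h**T s) p j = (\<Sum>w\<in>supp h. emb (coef h w) * (\<Sum>m<d. R w p m * R s m j))"
 using h s by (subst hm_lincomb_left) (simp_all add: repr_lincomb repr_mult_T_S c pj)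
 also have "\<dots> = (\<Sum>m<d. repr R h p m * R s m j)"
 unfolding repr_def sum_distrib_left sum_distrib_right mult.assoc by (rule sum.swap)
 finally show ?thesis .
qed

lemma repr_mult_T: assumes y: "y : WW" and h: "h : HC" and pj: "p < d" "j < d"
 shows "repr R (h**T y) p j = (\<Sum>m<d. repr R h p m * R y m j)"
 using y pj(2)
proof (induction y arbitrary: j rule: right_induct)
 case one
 have "(\<Sum>m<d. repr R h p m * R \<one> m j) = (\<Sum>m<d. if m = j then repr R h p j else 0)"
 using one by (intro sum.cong) (auto simp: R_one)
 thus ?case using h one by simp
next
 case (step y s)
 have "T (y<*>s) = T y**T s" using step by (simp add: hm_T_S)
 hence "h**T (y<*>s) = h**T y**T s" using step h by (simp add: hm_assoc)
 hence "repr R (h**T (y<*>s)) p j = (\<Sum>m<d. (\<Sum>k<d. repr R h p k * R y k m) * R s m j)"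
 using step h pj repr_mult_S[of "h**T y" s p j] by simp
 also have "\<dots> = (\<Sum>k<d. repr R h p k * R (y<*>s) k j)"
 unfolding mat_assoc using step by (simp add: R_step)
 finally show ?case .
qed

lemma repr_mult: assumes g: "g : HC" and h: "h : HC" and pj: "p < d" "j < d"
 shows "repr R (g**h) p j = (\<Sum>m<d. repr R g p m * repr R h m j)"
proof -
 have c: "w : WW" if "w : supp h" for w using h that by (auto simp: HC_def)
 have "repr R (g**h) p j = (\<Sum>w\<in>supp h. emb (coef h w) * (\<Sum>m<d. repr R g p m * R w m j))"
 using g h by (subst hm_lincomb_right) (simp_all add: repr_lincomb repr_mult_T c pj)
 also have "\<dots> = (\<Sum>m<d. repr R g p m * repr R h m j)"
 unfolding repr_def[of R h] sum_distrib_left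
 by (subst sum.swap) (simp add: mult.left_commute)
 finally show ?thesis .
qed

definition kills :: "'a hk => bool" where
 "kills h <-> (ALL p<d. ALL j<d. repr R h p j = 0)"

lemma kills_mult: assumes "g : HC" "h : HC" "kills g | kills h" shows "kills (g**h)"
 using assms by (auto simp: kills_def repr_mult)

end

text \<open>A cell datum: a partition of \<open>W\<close> by \<open>cell\<close>, one class of which is killed by all the
 representations while the others are separated by leading coefficients.\<close>

locale cell_reps = coxeter +
 fixes II :: "nat set" and R :: "nat => 'a => nat => nat => int hk" and d :: "nat => nat"
 and alpha :: "nat => nat" and cell :: "'a => nat"
 assumes rep: "i : II ==> hecke_rep W S L N (R i) (d i)"
 and bounded: "i : II ==> w : WW ==> p < d i ==> j < d i ==> dle (int (alpha i)) (R i w p j)"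
 and lead_0: "i : II ==> w : WW ==> cell w ~= i ==> p < d i ==> j < d i ==>
 coef (R i w p j) (int (alpha i)) = 0"
 and lead_indep: "i : II ==> finite A ==> A <= {w : WW. cell w = i} ==>
 (!!p j. p < d i ==> j < d i ==> (\<Sum>w\<in>A. of_int (c w) * coef (R i w p j) (int (alpha i))) = 0) ==>
 w : A ==> c w = (0 :: int)"
 and killed: "w : WW ==> EX x e y b. x : WW & e : WW & y : WW & w = x<*>e<*>y &
 len (x<*>e<*>y) = len x + len e + len y & top_elt e b &
 (ALL i:II. i ~= cell w --> (cell w : II --> alpha i <= alpha (cell w)) --> hecke_rep.kills (R i) (d i) b)"
begin

abbreviation "lead i w p j \<equiv> coef (R i w p j) (int (alpha i))"

text \<open>The indices whose representations have to annihilate \<open>C w\<close>. If the cell of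
  w is not in \<open>II\<close>, as will be the case for the lowest cell, these are all of
  \<open>II\<close>.\<close>

definition below :: "'a => nat set" where
 "below w = {i : II. i ~= cell w & (cell w : II --> alpha i <= alpha (cell w))}"

lemma lead_C: assumes "i : II" "w : WW" "p < d i" "j < d i"
 shows "dle (int (alpha i)) (repr (R i) (C w) p j)"
 "coef (repr (R i) (C w) p j) (int (alpha i)) = lead i w p j"
proof -
 have c: "v : WW" if "v : supp (C w)" for v using that C_closed[OF assms(2)] by (auto simp: HC_def)
 have 0: "dle 0 (coef (C w) v)" for v
 proof (cases "v = w")
 case True
 thus ?thesis using assms(2) dle_single[of 0 0 1] by (simp add: single_one[symmetric] del: single_one)
 next
 case False thus ?thesis using dle_mono[OF C_neg[OF assms(2) False]] by simp
 qed
 have 1: "coef (coef (C w) v) 0 = (if v = w then 1 else 0)" for v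
 using C_neg[OF assms(2), of v] assms(2) by (auto simp: dle_def)
 note t = repr_top[of 0 "C w" "int (alpha i)" "R i" p j, OF 0 bounded[OF assms(1) c assms(3,4)]]
 show "dle (int (alpha i)) (repr (R i) (C w) p j)" using t(1) by simp
 have "coef (repr (R i) (C w) p j) (int (alpha i)) = (\<Sum>v\<in>supp (C w). if v = w then lead i w p j else 0)"
 unfolding t(2)[simplified] by (rule sum.cong) (auto simp: 1)
 also have "\<dots> = lead i w p j" using assms(2) by (simp add: in_keys_iff)
 finally show "coef (repr (R i) (C w) p j) (int (alpha i)) = lead i w p j" .
qed

lemma lead_C_0: assumes "i : II" "w : WW" "p < d i" "j < d i" "cell w ~= i"
 shows "dle (int (alpha i) - 1) (repr (R i) (C w) p j)"
proof -
 have "coef (repr (R i) (C w) p j) k = 0" if "k > int (alpha i) - 1" for k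
 using that lead_C[OF assms(1-4)] lead_0[OF assms(1,2,5,3,4)]
 by (cases "k = int (alpha i)") (auto simp: dle_def)
 thus ?thesis by (simp add: dle_def)
qed

text \<open>Comparing coefficients of \<open>q\<^sup>n\<close> in \<open>\<pi>\<^sub>i(h)\<close> for an expansion \<open>h = \<Sum> c\<^sub>z C\<^sub>z\<close>.\<close>

lemma top_expansion: assumes i: "i : II" and pj: "p < d i" "j < d i" and c: "c : HC"
 and deg: "!!z. z : supp c ==> cell z = i ==> dle n (coef c z)"
 and other: "!!z. z : supp c ==> cell z ~= i ==>
 dle n (coef c z) | repr (R i) (C z) p j = 0"
 shows "dle (n + int (alpha i)) (repr (R i) (lincomb c C) p j)"
 "coef (repr (R i) (lincomb c C) p j) (n + int (alpha i)) =
 (\<Sum>z\<in>{z : supp c. cell z = i}. of_int (coef (coef c z) n) * lead i z p j)"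
proof -
 have cc: "z : WW" if "z : supp c" for z using c that by (auto simp: HC_def)
 let ?f = "%z. emb (coef c z) * repr (R i) (C z) p j"
 have 1: "dle (n + int (alpha i)) (?f z) &
 coef (?f z) (n + int (alpha i)) =
 (if cell z = i then of_int (coef (coef c z) n) * lead i z p j else 0)"
 if z: "z : supp c" for z
 proof (cases "repr (R i) (C z) p j = 0")
 case True
 hence "lead i z p j = 0" using lead_C(2)[OF i cc[OF z] pj] by simp
 thus ?thesis using True by simp
 next
 case False
 hence dz: "dle n (coef c z)" using z deg other by blast
 note l = lead_C[OF i cc[OF z] pj]
 show ?thesis using dle_mult[OF dle_emb[OF dz] l(1)] lookup_mult_top[OF dle_emb[OF dz] l(1)] l(2)
 lead_0[OF i cc[OF z] _ pj] by auto
 qed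
 show "dle (n + int (alpha i)) (repr (R i) (lincomb c C) p j)"
 unfolding repr_lincomb using 1 by (intro dle_sum) blast
 have "coef (repr (R i) (lincomb c C) p j) (n + int (alpha i)) =
 (\<Sum>z\<in>supp c. if cell z = i then of_int (coef (coef c z) n) * lead i z p j else 0)"
 unfolding repr_lincomb lookup_sum using 1 by (intro sum.cong) auto
 thus "coef (repr (R i) (lincomb c C) p j) (n + int (alpha i)) =
 (\<Sum>z\<in>{z : supp c. cell z = i}. of_int (coef (coef c z) n) * lead i z p j)"
 by (simp add: sum.inter_filter)
qed

lemma lincomb_diff: "lincomb (c - c') B = lincomb c B - lincomb c' B"
 using lincomb_add[of "c - c'" c' B] by simp

lemma dle_step: assumes "dle (n + 1) p" "coef p (n + 1) = 0" shows "dle n p"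
 using assms unfolding dle_def by (metis zless_imp_add1_zle less_le)

text \<open>Induction on the value \<open>alpha\<close> of the cell. Under the representation i,
  terms from other cells are killed or already bounded by induction. The top coefficients on the
  cell i then satisfy a linear relation between leading matrices and vanish, so a bound above m can
  be lowered until m is reached.\<close>

lemma bounded_expansion:
 assumes c: "c : HC" and B: "B <= II"
 and down: "!!k k'. k : B ==> k' : II ==> alpha k' < alpha k ==> k' : B"
 and kills: "!!z k. z : supp c ==> k : below z ==> hecke_rep.kills (R k) (d k) (C z)"
 and small: "!!k p j. k : B ==> p < d k ==> j < d k ==> dle (m + int (alpha k)) (repr (R k) (lincomb c C) p j)"
 and z: "cell z : B"
 shows "dle m (coef c z)"
 using z
proof (induction "alpha (cell z)" arbitrary: z rule: less_induct)
 case less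
 define i where "i = cell z"
 have i: "i : II" "i : B" using less.prems B by (auto simp: i_def)
 interpret r: hecke_rep W S L N "R i" "d i" using rep i by simp
 have other: "dle m (coef c v) | repr (R i) (C v) p j = 0"
 if v: "v : supp c" "cell v ~= i" and pj: "p < d i" "j < d i" for v p j
 proof (cases "i : below v")
 case True
 thus ?thesis using kills[OF v(1) True] pj by (simp add: r.kills_def)
 next
 case False
 hence "cell v : II" "alpha (cell v) < alpha i" using v(2) i by (auto simp: below_def)
 thus ?thesis using less.hyps[of v] down i by (simp add: i_def)
 qed
 obtain M where M: "dleH M c" using dleH_exists by blast
 have *: "ALL z. cell z = i --> dle (m + int k) (coef c z) ==> ALL z. cell z = i --> dle m (coef c z)" for k
 proof (induction k)
 case (Suc k)
 let ?n = "m + int k + 1" and ?A = "{z : supp c. cell z = i}"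
 have pr: "dle ?n (coef c z)" if "cell z = i" for z using Suc.prems that by (simp add: add_ac)
 have "(\<Sum>z\<in>?A. of_int (coef (coef c z) ?n) * lead i z p j) = 0" if pj: "p < d i" "j < d i" for p j
 proof -
 have "dle ?n (coef c v) | repr (R i) (C v) p j = 0" if "v : supp c" "cell v ~= i" for v
 using other[OF that pj] dle_mono[of m _ ?n] by auto
 from top_expansion(2)[OF i(1) pj c pr this] small[OF i(2) pj]
 show ?thesis by (simp add: dle_def)
 qed
 hence "coef (coef c v) ?n = 0" if "v : ?A" for v
 using lead_indep[OF i(1), of ?A "%z. coef (coef c z) ?n" v] that c
 by (auto simp: HC_def)
 hence "coef (coef c v) ?n = 0" if "cell v = i" for v
 using that by (cases "v : supp c") (auto simp: in_keys_iff)
 thus ?case using Suc.IH dle_step pr by blast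
 qed simp
 have "dle (m + int (nat (M - m))) (coef c v)" for v
 using M dle_mono[of M "coef c v"] by (simp add: dleH_def)
 hence "ALL z. cell z = i --> dle m (coef c z)" using *[of "nat (M - m)"] by blast
 thus ?case by (simp add: i_def)
qed

text \<open>The element f has leading term \<open>T w\<close> and is killed by all indices below w.
  In the expansion of f - C w, the coefficients at cells below w have degree at most -1 by
  \<open>bounded_expansion\<close>, and being bar-invariant they vanish. For every remaining z the
  index k is also below z, and z is shorter, so induction applies.\<close>

lemma kill: assumes "w : WW" "k : below w" shows "hecke_rep.kills (R k) (d k) (C w)"
 using assms
proof (induction "len w" arbitrary: w k rule: less_induct)
 case less
 note w = less.prems(1)
 obtain x e y b where xy: "x : WW" "e : WW" "y : WW" "w = x<*>e<*>y"
 "len (x<*>e<*>y) = len x + len e + len y" "top_elt e b"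
 and kb: "!!i. i : below w ==> hecke_rep.kills (R i) (d i) b"
 using killed[OF w] unfolding below_def by blast
 obtain P Q where PQ: "P : HC" "Q : HC" "top_elt w (P**b**Q)"
 using top_elt_ext[OF xy(6,1,3,5)] xy(4) by blast
 have b: "b : HC" using xy(6) by (simp add: top_elt_def)
 define f where "f = P**b**Q"
 have f: "f : HC" "bar f = f" using PQ by (auto simp: top_elt_def f_def)
 have kf: "repr (R i) f p j = 0" if "i : below w" "p < d i" "j < d i" for i p j
 proof -
 interpret r: hecke_rep W S L N "R i" "d i" using rep that by (simp add: below_def)
 have "r.kills f" unfolding f_def using PQ b kb[OF that(1)] r.kills_mult by simp
 thus ?thesis using that by (simp add: r.kills_def)
 qed
 define c where "c = KLc f - T w"
 have cf: "KLc f : HC" "lincomb (KLc f) C = f" using KLc[OF f(1)] .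
 have c: "c : HC" "lincomb c C = f - C w" using cf w by (simp_all add: c_def lincomb_diff)
 have cl: "c : low (len w)" using top_elt_KLc(1)[OF PQ(3)] by (simp add: c_def f_def)
 hence cz: "z : WW & len z < len w" if "z : supp c" for z
 using that by (auto simp: low_def HC_def)
 have kills: "hecke_rep.kills (R k) (d k) (C z)" if "z : supp c" "k : below z" for z k
 using less.hyps cz that by blast
 have 0: "coef c z = 0" if z: "cell z : below w" for z
 proof -
 have "dle (-1) (coef c z)"
 proof (rule bounded_expansion[OF c(1) _ _ kills _ z])
 fix k p j assume k: "k : below w" "p < d k" "j < d k"
 show "dle (- 1 + int (alpha k)) (repr (R k) (lincomb c C) p j)"
 using lead_C_0[of k w p j] k w kf by (auto simp: c(2) repr_diff below_def intro: dle_uminus)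
 qed (auto simp: below_def)
 moreover have "lbar (coef c z) = coef c z"
 unfolding c_def using KLc_bar[OF f] by (simp add: lookup_minus laurent_bar_diff lookup_T)
 ultimately show ?thesis using bar_neg_zero by blast
 qed
 have k: "k : II" using less.prems by (simp add: below_def)
 interpret r: hecke_rep W S L N "R k" "d k" using rep k by simp
 have "repr (R k) (C z) p j = 0" if z: "z : supp c" and pj: "p < d k" "j < d k" for z p j
 proof -
 have "cell z ~: below w" using 0 z by (auto simp: in_keys_iff)
 hence "k : below z" using less.prems(2) by (auto simp: below_def)
 hence "r.kills (C z)" by (rule kills[OF z])
 thus ?thesis using pj by (simp add: r.kills_def)
 qed
 hence "repr (R k) (lincomb c C) p j = 0" if "p < d k" "j < d k" for p j
 using that by (simp add: repr_lincomb)
 thus ?case using kf[OF less.prems(2)] by (auto simp: r.kills_def c(2) repr_diff)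
qed

lemma le_LR_cell: assumes "(x, y) : le_LR" shows "cell x ~: below y"
proof -
 have step0: "cell x ~: below y" if y: "y : WW" and h: "h : HC" "h' : HC"
 and ne: "coef (KLc (h**C y**h')) x ~= 0" for x y h h'
 proof
 assume xy: "cell x : below y"
 let ?f = "h**C y**h'"
 have f: "?f : HC" using y h by simp
 note c = KLc[OF f]
 \<comment> \<open>All representations indexed below y kill \<open>?f\<close>, so the degree bound
   holds for every integer m, however negative; only 0 satisfies this.\<close>
 have "dle m (coef (KLc ?f) x)" for m
 proof (rule bounded_expansion[OF c(1) _ _ _ _ xy])
 fix z k assume "z : supp (KLc ?f)" "k : below z"
 thus "hecke_rep.kills (R k) (d k) (C z)" using kill c(1) by (auto simp: HC_def)
 next
 fix k p j assume k: "k : below y" "p < d k" "j < d k"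
 interpret r: hecke_rep W S L N "R k" "d k" using rep k by (simp add: below_def)
 have "r.kills ?f" using kill[OF y k(1)] y h r.kills_mult by simp
 thus "dle (m + int (alpha k)) (repr (R k) (lincomb (KLc ?f) C) p j)" using k by (simp add: c(2) r.kills_def)
 qed (auto simp: below_def)
 hence "coef (KLc ?f) x = 0"
 by (intro poly_mapping_eqI) (simp add: dle_def, metis lt_ex)
 thus False using ne by simp
 qed
 have tr: "cell x ~: below z" if "cell x ~: below y" "cell y ~: below z" for x y z
 using that by (auto simp: below_def)
 show ?thesis using assms unfolding le_LR_def
 proof (induction rule: trancl_induct)
 case (base y) thus ?case using step0 unfolding KL_coeff_KLc by blast
 next
 case (step y z)
 hence "cell y ~: below z" using step0 unfolding KL_coeff_KLc by blast
 thus ?case by (rule tr[OF step.IH])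
 qed
qed

text \<open>If alpha k \<le> alpha (cell z), the image of the product has degree at most 2 alpha k,
  hence at most alpha (cell z) + alpha k. This is what \<open>bounded_expansion\<close> asks
  for.\<close>

lemma struct_dle: assumes x: "x : WW" and y: "y : WW" and z: "cell z : II"
 shows "dle (int (alpha (cell z))) (struct_const x y z)"
 unfolding struct_const_KLc
proof -
 let ?B = "{k : II. alpha k <= alpha (cell z)}" and ?f = "C x**C y"
 have f: "?f : HC" using x y by simp
 note c = KLc[OF f]
 show "dle (int (alpha (cell z))) (coef (KLc ?f) z)"
 proof (rule bounded_expansion[OF c(1), of ?B])
 fix v k assume "v : supp (KLc ?f)" "k : below v"
 thus "hecke_rep.kills (R k) (d k) (C v)" using kill c(1) by (auto simp: HC_def)
 next
 fix k p j assume k: "k : ?B" "p < d k" "j < d k"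
 interpret r: hecke_rep W S L N "R k" "d k" using rep k by simp
 have "dle (int (alpha k) + int (alpha k)) (repr (R k) ?f p j)"
 unfolding r.repr_mult[OF C_closed[OF x] C_closed[OF y] k(2,3)]
 using x y k by (intro dle_sum dle_mult lead_C(1)) auto
 thus "dle (int (alpha (cell z)) + int (alpha k)) (repr (R k) (lincomb (KLc ?f) C) p j)"
 using k by (auto simp: c(2) elim: dle_mono)
 qed (use z in auto)
qed

text \<open>In degree 2 alpha, the image of C_x C_y is the product of the leading matrices of x and
  y, and also a combination of leading matrices weighted by the wanted coefficients. Independence
  lets the two be compared term by term.\<close>

lemma lead_mult:
 assumes x: "x : WW" and y: "y : WW" and i: "i : II" and A: "finite A" "A <= {w : WW. cell w = i}"
 and eq: "!!p j. p < d i ==> j < d i ==>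
 (\<Sum>m<d i. lead i x p m * lead i y m j) = (\<Sum>z\<in>A. of_int (g z) * lead i z p j)"
 and z: "z : A"
 shows "coef (struct_const x y z) (int (alpha i)) = g z"
proof -
 interpret r: hecke_rep W S L N "R i" "d i" using rep i by simp
 let ?f = "C x**C y"
 have f: "?f : HC" using x y by simp
 note c = KLc[OF f]
 have cs: "coef (KLc ?f) v = struct_const x y v" for v by (simp add: struct_const_KLc)
 let ?K = "{v : supp (KLc ?f). cell v = i}" and ?a = "int (alpha i)"
 have K: "finite ?K" "?K <= {w : WW. cell w = i}" using c(1) by (auto simp: HC_def)
 let ?h = "%v. coef (struct_const x y v) ?a"
 have top: "(\<Sum>m<d i. lead i x p m * lead i y m j) = (\<Sum>v\<in>?K. of_int (?h v) * lead i v p j)"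
 if pj: "p < d i" "j < d i" for p j
 proof -
 have "coef (repr (R i) ?f p j) (?a + ?a) = (\<Sum>m<d i. lead i x p m * lead i y m j)"
 unfolding r.repr_mult[OF C_closed[OF x] C_closed[OF y] pj] lookup_sum
 proof (rule sum.cong)
 fix m assume "m : {..<d i}"
 hence m: "m < d i" by simp
 show "coef (repr (R i) (C x) p m * repr (R i) (C y) m j) (?a + ?a) = lead i x p m * lead i y m j"
 unfolding lookup_mult_top[OF lead_C(1)[OF i x pj(1) m] lead_C(1)[OF i y m pj(2)]]
 by (simp add: lead_C(2)[OF i x pj(1) m] lead_C(2)[OF i y m pj(2)])
 qed simp
 moreover have "dle ?a (coef (KLc ?f) v) | repr (R i) (C v) p j = 0"
 if v: "v : supp (KLc ?f)" "cell v ~= i" for v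
 proof (cases "i : below v")
 case True
 hence "r.kills (C v)" using kill[OF _ True] v c(1) by (auto simp: HC_def)
 thus ?thesis using pj by (simp add: r.kills_def)
 next
 case False
 hence "cell v : II" "alpha (cell v) < alpha i" using v i by (auto simp: below_def)
 thus ?thesis using dle_mono[OF struct_dle[OF x y, of v], of ?a] by (simp add: cs)
 qed
 moreover have "dle ?a (coef (KLc ?f) v)" if "cell v = i" for v
 using struct_dle[OF x y, of v] i that by (simp add: cs)
 ultimately show ?thesis using top_expansion(2)[OF i pj c(1), of ?a] by (simp add: c(2) cs)
 qed
 let ?U = "A \<union> ?K"
 let ?g = "%v. (if v : A then g v else 0) - ?h v"
 have "?g z = 0"
 proof (rule lead_indep[OF i, of ?U])
 fix p j assume pj: "p < d i" "j < d i"
 have "(\<Sum>v\<in>?U. of_int (if v : A then g v else 0) * lead i v p j) = (\<Sum>v\<in>A. of_int (g v) * lead i v p j)"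
 using A K by (intro sum.mono_neutral_cong_right) auto
 moreover have "(\<Sum>v\<in>?U. of_int (?h v) * lead i v p j) = (\<Sum>v\<in>?K. of_int (?h v) * lead i v p j)"
 using A K by (intro sum.mono_neutral_right) (auto simp: in_keys_iff cs)
 ultimately show "(\<Sum>v\<in>?U. of_int (?g v) * lead i v p j) = 0"
 unfolding of_int_diff left_diff_distrib sum_subtractf by (simp only: eq[OF pj, symmetric] top[OF pj, symmetric] diff_self)
 qed (use A K z in auto)
 thus ?thesis using z by simp
qed

lemma lead_mult_le: assumes "x : WW" "y : WW" "z : WW" "cell z : II"
 and "!!p j. p < d (cell z) ==> j < d (cell z) ==>
 (\<Sum>m<d (cell z). lead (cell z) x p m * lead (cell z) y m j) = lead (cell z) z p j"
 shows "lusztig_a z = alpha (cell z)" "(z, x) : le_LR" "(z, y) : le_LR"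
proof -
 have 1: "coef (struct_const x y z) (int (alpha (cell z))) = 1"
 using lead_mult[OF assms(1,2,4), of "{z}" "%_. 1" z] assms(3,5) by simp
 show "lusztig_a z = alpha (cell z)" using lusztig_a_eqI[OF struct_dle[OF _ _ assms(4)] assms(1,2)] 1 by simp
 have "struct_const x y z ~= 0" using 1 by auto
 thus "(z, x) : le_LR" "(z, y) : le_LR" using le_LR_struct assms(1,2) by blast+
qed

end

section \<open>Dihedral subgroups and Matsumoto's theorem\<close>

text \<open>The word is built from its right end, so that s is the last letter; this suits right
  descents and \<open>fold\<close>.\<close>

fun alt :: "nat => 'g => 'g => 'g list" where
 "alt 0 s t = []"
| "alt (Suc k) s t = alt k t s @ [s]"

lemma length_alt [simp]: "length (alt k s t) = k"
 by (induction k arbitrary: s t) auto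
lemma set_alt: "set (alt k s t) <= {s, t}"
 by (induction k arbitrary: s t) auto

lemma alt_split: "EX p. set p <= {s, t} & alt (j + m) s t = p @ alt m s t"
proof (induction m arbitrary: s t)
 case 0 thus ?case using set_alt[of j s t] by auto
next
 case (Suc m)
 obtain p where "set p <= {t, s}" "alt (j + m) t s = p @ alt m t s" using Suc[of t s] by blast
 thus ?case by (intro exI[of _ p]) auto
qed

context coxeter begin

lemma alt_S [simp]: "s : S ==> t : S ==> set (alt k s t) <= S"
 using set_alt[of k s t] by auto

lemma wprod_alt_Suc: "s : S ==> t : S ==> wprod (alt (Suc k) s t) = wprod (alt k t s)<*>s"
 by (simp add: wprod_snoc del: foldr_append)

text \<open>The factor u is the shortest element in the coset of x modulo the subgroup generated by
  s and t. Descents in s and t are stripped off one after the other, and length rules out that a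
  letter repeats.\<close>

lemma dihedral_decomp: assumes "x : WW" "s : S" "t : S"
 shows "EX u k. u : WW & s ~: N u & t ~: N u & len x = len u + k &
 (x = u<*>wprod (alt k s t) | x = u<*>wprod (alt k t s))"
 using assms
proof (induction "len x" arbitrary: x s t rule: less_induct)
 case less
 have *: "EX u k. u : WW & a ~: N u & b ~: N u & len x = len u + k & x = u<*>wprod (alt k a b)"
 if ab: "a : S" "b : S" "{a, b} = {s, t}" "a : N x" for a b
 proof -
 let ?y = "x<*>a"
 have y: "?y : WW" "len x = Suc (len ?y)" "a ~: N ?y" using less.prems ab len_down N_mult_S by auto
 obtain u k where u: "u : WW" "a ~: N u" "b ~: N u" "len ?y = len u + k"
 "?y = u<*>wprod (alt k a b) | ?y = u<*>wprod (alt k b a)"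
 using less.hyps[of ?y a b] y ab by auto
 have "?y = u<*>wprod (alt k b a)"
 proof (rule ccontr)
 assume n: "?y ~= u<*>wprod (alt k b a)"
 then obtain k' where k: "k = Suc k'" using u(5) by (cases k) auto
 have e: "?y = u<*>wprod (alt k' b a)<*>a"
 using u ab n unfolding k wprod_alt_Suc[OF ab(1,2)] by (simp add: m_assoc)
 hence "?y<*>a = u<*>wprod (alt k' b a)" using u ab by simp
 hence "len (?y<*>a) <= len u + k'"
 using len_mult_le[of u "wprod (alt k' b a)"] len_le[of "alt k' b a"] u ab by simp
 thus False using u(4) k y ab less.prems by simp
 qed
 hence "?y<*>a = u<*>wprod (alt (Suc k) a b)"
 using u ab unfolding wprod_alt_Suc[OF ab(1,2)] by (simp add: m_assoc)
 thus ?thesis using u y ab less.prems by (intro exI[of _ u] exI[of _ "Suc k"]) simp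
 qed
 consider "s : N x" | "t : N x" | "s ~: N x" "t ~: N x" by blast
 thus ?case
 proof cases
 case 1 thus ?thesis using *[of s t] less.prems by blast
 next
 case 2 thus ?thesis using *[of t s] less.prems by blast
 next
 case 3 thus ?thesis using less.prems by (intro exI[of _ x] exI[of _ 0]) simp
 qed
qed

text \<open>If the last letters s and t differ, both are descents, so the element is u times an
  alternating word of length k \<ge> m. It thus has reduced words ending in either alternating word
  of length m: these endings are exchanged by the braid hypothesis, and the words are compared with
  the given ones by induction after removing the last letter.\<close>

lemma matsumoto:
 fixes act :: "'a => 'x => 'x"
 assumes braid: "!!s t. s : S ==> t : S ==> s ~= t ==> EX m>0. (ALL v. fold act (alt m s t) v = fold act (alt m t s) v) &
 wprod (alt m s t) = wprod (alt m t s) &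
 (ALL u:WW. ALL k<m. s ~: N u --> t ~: N u --> t ~: N (u<*>wprod (alt k s t)) & s ~: N (u<*>wprod (alt k t s)))"
 and "set ss <= S" "set ss' <= S" "wprod ss = wprod ss'" "length ss = len (wprod ss)" "length ss' = len (wprod ss')"
 shows "fold act ss v = fold act ss' v"
 using assms(2-)
proof (induction "length ss" arbitrary: ss ss' rule: less_induct)
 case less
 show ?case
 proof (cases ss rule: rev_cases)
 case Nil thus ?thesis using less.prems by simp
 next
 case (snoc us s)
 hence "length ss' ~= 0" using less.prems by simp
 then obtain us' t where ss': "ss' = us' @ [t]" by (cases ss' rule: rev_cases) auto
 have m: "s : S" "t : S" "set us <= S" "set us' <= S" using less.prems snoc ss' by auto
 define x where "x = wprod ss"
 have x: "x : WW" "x = wprod us<*>s" "x = wprod us'<*>t" "len x = Suc (length us)" "len x = Suc (length us')"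
 using less.prems snoc ss' m by (simp_all add: x_def wprod_snoc del: foldr_append)
 have xs: "x<*>s = wprod us" using x(2) mult_S_S[OF wprod_closed[OF m(3)] m(1)] by (simp only:)
 have xt: "x<*>t = wprod us'" using x(3) mult_S_S[OF wprod_closed[OF m(4)] m(2)] by (simp only:)
 have N: "s : N x" "len (wprod us) = length us" "t : N x" "len (wprod us') = length us'"
 proof -
 have "len (x<*>s) < len x" "len (x<*>t) < len x"
 using len_le[OF m(3)] len_le[OF m(4)] x(4,5) unfolding xs xt by linarith+
 thus 1: "s : N x" "t : N x" using N_reflection_iff(1) S_reflections x(1) m by blast+
 show "len (wprod us) = length us" "len (wprod us') = length us'"
 using len_down[OF x(1) m(1) 1(1)] len_down[OF x(1) m(2) 1(2)] x(4,5) unfolding xs xt by linarith+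
 qed
 show ?thesis
 proof (cases "s = t")
 case True
 hence "wprod us = wprod us'" using xs xt by (simp only:)
 hence "fold act us v = fold act us' v"
 by (intro less.hyps) (simp_all add: snoc m(3,4) N(2,4)[symmetric])
 thus ?thesis using snoc ss' True by simp
 next
 case False
 obtain m where mm: "m > 0" "!!v. fold act (alt m s t) v = fold act (alt m t s) v" "wprod (alt m s t) = wprod (alt m t s)"
 and up: "!!u k. u : WW ==> k < m ==> s ~: N u ==> t ~: N u ==>
 t ~: N (u<*>wprod (alt k s t)) & s ~: N (u<*>wprod (alt k t s))"
 using braid[OF m(1,2) False] by blast
 obtain u k where u: "u : WW" "s ~: N u" "t ~: N u" "len x = len u + k"
 "x = u<*>wprod (alt k s t) | x = u<*>wprod (alt k t s)"
 using dihedral_decomp[OF x(1) m(1,2)] by blast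
 \<comment> \<open>Both s and t are descents of x, which the hypothesis on alternating words shorter
   than m excludes for k < m.\<close>
 have km: "m <= k" using up[OF u(1) _ u(2,3), of k] u(5) N by (metis not_le)
 have "EX p. set p <= S & length p = k - m & x = u<*>wprod (p @ alt m s t)"
 using u(5)
 proof
 assume e: "x = u<*>wprod (alt k s t)"
 obtain p where p: "set p <= {s, t}" "alt k s t = p @ alt m s t" using alt_split[of s t "k - m" m] km by auto
 have "length p + m = k" using arg_cong[OF p(2), of length] by simp
 thus ?thesis using p e m by (intro exI[of _ p]) auto
 next
 assume e: "x = u<*>wprod (alt k t s)"
 obtain p where p: "set p <= {t, s}" "alt k t s = p @ alt m t s" using alt_split[of t s "k - m" m] km by auto
 have pS: "set p <= S" using p m by auto
 hence "wprod (p @ alt m s t) = wprod (p @ alt m t s)" using mm(3) m by (simp add: wprod_append del: foldr_append)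
 moreover have "length p + m = k" using arg_cong[OF p(2), of length] by simp
 ultimately show ?thesis using p e pS by (intro exI[of _ p]) auto
 qed
 then obtain p where p: "set p <= S" "length p = k - m" "x = u<*>wprod (p @ alt m s t)" by blast
 obtain q where q: "set q <= S" "length q = len u" "wprod q = u" using reduced_word[OF u(1)] .
 define r where "r = q @ p"
 have r: "set r <= S" "length r = len x - m" "len x \<ge> m" using p q u(4) km by (auto simp: r_def)
 have xr: "x = wprod (r @ alt m s t)" "x = wprod (r @ alt m t s)"
 using p q m mm(3) by (simp_all add: r_def wprod_append m_assoc del: foldr_append)
 obtain m' where m': "m = Suc m'" using mm(1) by (cases m) auto
 have *: "fold act (vs @ [a]) v = fold act (r @ alt m a b) v"
 if ab: "a : S" "b : S" "x = wprod (r @ alt m a b)" and vs: "set vs <= S" "wprod vs = x<*>a" "Suc (length vs) = len x"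
 "len (wprod vs) = length vs" and lt: "length vs < length ss" for a b vs
 proof -
 let ?r = "r @ alt m' b a"
 have rS: "set ?r <= S" using r ab by simp
 have "x = wprod (?r @ [a])" using ab(3) by (simp add: m')
 hence "x = wprod ?r<*>a" using wprod_snoc[OF rS ab(1)] by simp
 hence "wprod vs = wprod ?r" using vs(2) mult_S_S[OF wprod_closed[OF rS] ab(1)] by simp
 moreover have "length ?r = len (wprod vs)" using r vs m' by simp
 ultimately have "fold act vs v = fold act ?r v" using less.hyps[OF lt vs(1) rS] vs by simp
 thus ?thesis by (simp add: m')
 qed
 have "fold act ss v = fold act (r @ alt m s t) v"
 unfolding snoc by (rule *) (use m xr xs xt x(1,4,5) N snoc in simp_all)
 moreover have "fold act ss' v = fold act (r @ alt m t s) v"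
 unfolding ss' by (rule *) (use m xr xs xt x(1,4,5) N snoc in simp_all)
 ultimately show ?thesis by (simp add: mm(2))
 qed
 qed
qed

end

section \<open>Standard parabolic subgroups\<close>

context coxeter begin

text \<open>The same cocycle serves: along a word in I, each reflection in \<open>N\<close> is a
  conjugate of a letter by elements of the subgroup.\<close>

lemma coxeter_parabolic: assumes I: "I <= S"
 shows "coxeter (W\<lparr>carrier := generate W I\<rparr>) I L N"
proof -
 let ?W = "W\<lparr>carrier := generate W I\<rparr>"
 have IW: "I <= WW" using I S_carrier by auto
 have g: "subgroup (generate W I) W" using generate_is_subgroup[OF IW] .
 have gW: "generate W I <= WW" using subgroup.subset[OF g] .
 have gr: "group ?W" using subgroup.subgroup_is_group[OF g] by (simp add: group_axioms)
 have words: "EX ss. set ss <= I & wprod ss = x" if "x : generate W I" for x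
 using that
 proof (induction x rule: generate.induct)
 case one thus ?case by (intro exI[of _ "[]"]) simp
 next
 case (incl h) thus ?case using IW by (intro exI[of _ "[h]"]) auto
 next
 case (inv h) thus ?case using IW I by (intro exI[of _ "[h]"]) auto
 next
 case (eng h1 h2)
 then obtain us vs where "set us <= I" "wprod us = h1" "set vs <= I" "wprod vs = h2" by blast
 thus ?case using I by (intro exI[of _ "us @ vs"]) (auto simp: wprod_append subset_trans simp del: foldr_append)
 qed
 have NI: "N (wprod ss) <= generate W I" if "set ss <= I" for ss
 using that
 proof (induction ss rule: rev_induct)
 case (snoc s ss)
 have s: "s : I" "s : S" "set ss <= S" using snoc.prems I by auto
 have "N (wprod (ss @ [s])) = sym_diff (N s) ((%t. s<*>t<*>s) ` N (wprod ss))"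
 using s N_mult[of "wprod ss" s] by (simp add: wprod_snoc del: foldr_append)
 moreover have "s : generate W I" using s by (simp add: generate.incl)
 ultimately show ?case using snoc s by (auto simp: N_gen intro!: generate.eng)
 qed simp
 show ?thesis
 proof (intro coxeter.intro coxeter_axioms.intro gr)
 show "I <= carrier ?W" using generate.incl by auto
 show "!!s. s : I ==> s \<otimes>\<^bsub>?W\<^esub> s = \<one>\<^bsub>?W\<^esub>" using I S_sq by auto
 show "EX ss. set ss <= I & foldr (\<otimes>\<^bsub>?W\<^esub>) ss \<one>\<^bsub>?W\<^esub> = x" if "x : carrier ?W" for x using words that by simp
 show "N (x \<otimes>\<^bsub>?W\<^esub> y) = sym_diff (N y) ((%t. inv\<^bsub>?W\<^esub> y \<otimes>\<^bsub>?W\<^esub> t \<otimes>\<^bsub>?W\<^esub> y) ` N x)"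
 if "x : carrier ?W" "y : carrier ?W" for x y
 proof -
 have "inv\<^bsub>?W\<^esub> y = inv y" using m_inv_consistent[OF g] that by simp
 thus ?thesis using N_mult[of x y] that gW by auto
 qed
 show "!!s. s : I ==> N s = {s}" using I N_gen by auto
 show "N x <= carrier ?W" if "x : carrier ?W" for x using words[of x] NI that by auto
 show "!!s. s : I ==> 0 < L s" using I L_pos by auto
 show "L s = L t" if "s : I" "t : I" "w : carrier ?W" "s \<otimes>\<^bsub>?W\<^esub> w = w \<otimes>\<^bsub>?W\<^esub> t" for s t w
 by (rule L_conj[of s t w]) (use that I gW in auto)
 qed
qed

text \<open>Product and bar involution of the subgroup are restrictions of those of W, and
  \<open>C_unique\<close> then identifies the Kazhdan--Lusztig elements. Degree bounds proved in W
  hence apply to the parabolic a-function.\<close>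

lemma parabolic_struct_const:
 assumes I: "I <= S" and x: "x : generate W I" and y: "y : generate W I"
 shows "weighted_group.struct_const (W\<lparr>carrier := generate W I\<rparr>) I L x y z = struct_const x y z"
 and "supp (C x) <= generate W I"
proof -
 let ?W = "W\<lparr>carrier := generate W I\<rparr>"
 interpret P: coxeter ?W I L N by (rule coxeter_parabolic[OF I])
 have IW: "I <= WW" using I S_carrier by auto
 have gW: "generate W I <= WW" using subgroup.subset[OF generate_is_subgroup[OF IW]] .
 have HI: "h : HC" if "h : P.hecke_carrier" for h
 using that gW by (auto simp: HC_def P.HC_def)
 have TS: "P.hecke_mult (T w) (T s) = T w**T s" if "w : generate W I" "s : I" for w s
 using P.hm_T_S[of w s] hm_T_S[of w s] that subsetD[OF gW] subsetD[OF I] by simp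
 have HS: "P.hecke_mult g (T s) = g**T s" if g: "g : P.hecke_carrier" and s: "s : I" for g s
 proof -
 have sW: "s : generate W I" "s : WW" using s IW by (auto intro: generate.incl)
 have "P.hecke_mult g (T s) = P.lincomb g (%w. P.hecke_mult (T w) (T s))"
 using g sW by (intro P.hm_lincomb_left) simp_all
 also have "\<dots> = lincomb g (%w. T w**T s)"
 using g s TS unfolding P.lincomb_def lincomb_def by (intro sum.cong) (auto simp: P.HC_def)
 also have "\<dots> = g**T s" using HI[OF g] sW by (intro hm_lincomb_left[symmetric]) simp_all
 finally show ?thesis .
 qed
 have HT: "P.hecke_mult g (T w) = g**T w" if w: "w : carrier ?W" and g: "g : P.hecke_carrier" for w g
 using w
 proof (induction w rule: P.right_induct)
 case one thus ?case using g HI[OF g] P.hm_one_right by simp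
 next
 case (step w s)
 have wW: "w : WW" "s : S" "w : generate W I" "s : WW" using step gW I by auto
 have e: "T (w<*>s) = T w**T s" using step wW by (simp add: hm_T_S)
 hence e': "T (w<*>s) = P.hecke_mult (T w) (T s)" using TS wW step by simp
 have "P.hecke_mult g (T (w<*>s)) = P.hecke_mult (P.hecke_mult g (T w)) (T s)"
 unfolding e' using step g by (intro P.hm_assoc[symmetric]) (auto intro: generate.incl)
 also have "\<dots> = P.hecke_mult g (T w)**T s" using step g by (intro HS P.hm_closed) simp_all
 also have "\<dots> = g**T w**T s" using step by simp
 also have "\<dots> = g**T (w<*>s)" unfolding e using wW HI[OF g] by (intro hm_assoc) simp_all
 finally show ?case by simp
 qed
 have HH: "P.hecke_mult g h = g**h" if g: "g : P.hecke_carrier" and h: "h : P.hecke_carrier" for g h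
 proof -
 have "P.hecke_mult g h = P.lincomb h (%w. P.hecke_mult g (T w))" by (rule P.hm_lincomb_right[OF g h])
 also have "\<dots> = lincomb h (%w. g**T w)"
 using g h HT unfolding P.lincomb_def lincomb_def by (intro sum.cong) (auto simp: P.HC_def)
 also have "\<dots> = g**h" using HI g h by (intro hm_lincomb_right[symmetric]) simp_all
 finally show ?thesis .
 qed
 have bT: "P.bT w = bT w" if "w : carrier ?W" for w
 using that
 proof (induction w rule: P.right_induct)
 case one thus ?case using P.bT_one bT_one by simp
 next
 case (step w s)
 have wW: "w : WW" "s : S" using step gW I by auto
 have "P.Tsi s = Tsi s" by (simp add: P.Tsi_def Tsi_def)
 moreover have "P.bT (w<*>s) = P.hecke_mult (P.bT w) (P.Tsi s)" using P.bT_mult[of w s] step by simp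
 moreover have "\<dots> = P.bT w**P.Tsi s" by (rule HH[OF P.bT_closed[OF step(1)] P.Tsi_closed[OF step(2)]])
 ultimately show ?case using bT_mult[of w s] step wW by simp
 qed
 have bar: "P.bar h = bar h" if h: "h : P.hecke_carrier" for h
 using P.bar_superset[of "supp h" h] bar_superset[of "supp h" h] h bT
 by (simp add: P.HC_def subset_iff)
 have C: "P.C w = C w" if w: "w : generate W I" for w
 proof -
 have Cw: "P.C w : P.hecke_carrier" "P.bar (P.C w) = P.C w" using w by simp_all
 have "dle (-1) (coef (P.C w - T w) v)" for v
 using P.C_neg[of w v] w P.C_diag[of w] by (cases "v = w") (auto simp: lookup_minus lookup_T)
 hence "C w = P.C w" using w gW Cw HI by (intro C_unique) (auto simp: bar[symmetric])
 thus ?thesis by simp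
 qed
 have CC: "P.hecke_mult (P.C x) (P.C y) = C x**C y"
 proof -
 have "P.C x : P.hecke_carrier" "P.C y : P.hecke_carrier" using x y by simp_all
 from HH[OF this] show ?thesis by (simp only: C[OF x] C[OF y])
 qed
 have K: "P.KLc (C x**C y) = KLc (C x**C y)"
 proof -
 have "P.hecke_mult (P.C x) (P.C y) : P.hecke_carrier" using x y by simp
 note c = P.KLc[OF this, unfolded CC]
 have "lincomb (P.KLc (C x**C y)) C = P.lincomb (P.KLc (C x**C y)) P.C"
 unfolding lincomb_def P.lincomb_def using C c(1) by (intro sum.cong) (auto simp: P.HC_def)
 hence "lincomb (P.KLc (C x**C y)) C = C x**C y" using c(2) by simp
 thus ?thesis using KLc_lincomb[OF HI[OF c(1)]] by simp
 qed
 show "P.struct_const x y z = struct_const x y z" unfolding P.struct_const_KLc struct_const_KLc CC K ..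
 have "P.C x : P.hecke_carrier" using x by simp
 thus "supp (C x) <= generate W I" using C[OF x] by (simp add: P.HC_def)
qed

lemma parabolic_a_eqI: assumes I: "I <= S"
 and "!!x y. x : WW ==> y : WW ==> dle (int n) (struct_const x y z)"
 and "x : generate W I" "y : generate W I" "coef (struct_const x y z) (int n) ~= 0"
 shows "parabolic_a I z = n"
proof -
 interpret P: coxeter "W\<lparr>carrier := generate W I\<rparr>" I L N by (rule coxeter_parabolic[OF I])
 have "generate W I <= WW" using I S_carrier generate_incl by simp
 hence "P.lusztig_a z = n"
 using assms by (intro P.lusztig_a_eqI[of n z x y]) (simp_all add: parabolic_struct_const(1) subset_iff)
 thus ?thesis by (simp add: parabolic_a_def)
qed

end

section \<open>The trace form and products of maximal degree\<close>

context coxeter begin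

lemma left_induct [consumes 1, case_names one step]:
 assumes "x : WW" "P \<one>"
 "!!x s. x : WW ==> s : S ==> s ~: N (inv x) ==> P x ==> P (s<*>x)"
 shows "P x"
proof -
 have "P (inv y)" if "y : WW" for y
 using that
 proof (induction y rule: right_induct)
 case (step y s)
 hence "inv (y<*>s) = s<*>inv y" by (simp add: inv_mult_group)
 thus ?case using assms(3)[of "inv y" s] step by simp
 qed (simp add: assms(2))
 from this[of "inv x"] assms(1) show ?thesis by simp
qed
lemma T_left: "x : WW ==> s : S ==> s ~: N (inv x) ==> T (s<*>x) = T s**T x"
 by (simp add: hm_S_T)

lemma lookup_one_mult_T: assumes "y : WW" "h : HC"
 shows "coef (h**T y) \<one> = coef h (inv y)"
 using assms
proof (induction y arbitrary: h rule: left_induct)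
 case one thus ?case by simp
next
 case (step y s)
 have "h**T (s<*>y) = h**T s**T y" using step by (simp add: T_left hm_assoc)
 thus ?case using step by (simp add: lookup_mult_T_S inv_mult_group)
qed

lemma trace_T: assumes "x : WW" "y : WW"
 shows "coef (T x**T y) \<one> = coef (T y**T x) \<one>"
proof -
 have "inv y = x <-> inv x = y" using assms by auto
 thus ?thesis using assms by (simp add: lookup_one_mult_T lookup_T)
qed

lemma trace_commute: assumes g: "g : HC" and h: "h : HC"
 shows "coef (g**h) \<one> = coef (h**g) \<one>"
proof -
 have c: "w : WW" if "w : supp f" "f : HC" for w f using that by (auto simp: HC_def)
 have *: "coef (T x**h) \<one> = coef (h**T x) \<one>" if "x : WW" for x
 using hm_lincomb_right[of "T x" h] hm_lincomb_left[of h "T x"] that h c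
 by (simp add: lincomb_def lookup_sum trace_T[OF that] cong: sum.cong)
 show ?thesis
 using hm_lincomb_left[OF g h] hm_lincomb_right[OF h g] c[OF _ g]
 by (simp add: lincomb_def lookup_sum * cong: sum.cong)
qed

text \<open>The coefficient at the identity is a symmetric trace, which gives the structure
  constants of the basis \<open>T\<close> a cyclic symmetry. It moves a leading coefficient from one
  element to another and so reverses relations in the lowest cell.\<close>

lemma lookup_T_T_cyclic: assumes "x : WW" "y : WW" "z : WW"
 shows "coef (T x**T y) z = coef (T (inv z)**T x) (inv y)"
proof -
 have "coef (T x**T y) z = coef (T x**T y**T (inv z)) \<one>"
 using assms by (simp add: lookup_one_mult_T)
 also have "\<dots> = coef (T (inv z)**(T x**T y)) \<one>" using assms by (intro trace_commute) simp_all
 also have "T (inv z)**(T x**T y) = T (inv z)**T x**T y" using assms by (simp add: hm_assoc)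
 also have "coef \<dots> \<one> = coef (T (inv z)**T x) (inv y)"
 using assms by (simp add: lookup_one_mult_T)
 finally show ?thesis .
qed
lemma dleH_scale_dle: "dle m c ==> dleH n h ==> dleH (m + n) (scale c h)"
 by (simp add: dleH_def dle_mult)
lemma dleH_sum: "(!!x. x : A ==> dleH n (f x)) ==> dleH n (\<Sum>x\<in>A. f x)"
 by (simp add: dleH_def lookup_sum dle_sum)
lemma dleH_add: "dleH n g ==> dleH n h ==> dleH n (g + h)"
 by (simp add: dleH_def lookup_add dle_add)
lemma dleH_mono: "dleH n h ==> n <= m ==> dleH m h"
 unfolding dleH_def using dle_mono by blast

text \<open>Replacing \<open>T x\<close> and \<open>T y\<close> by \<open>C x\<close> and
  \<open>C y\<close> adds terms with coefficients of negative degree; under a uniform bound for all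
  products these do not reach the top degree.\<close>

lemma top_struct_const:
 assumes bound: "!!x y. x : WW ==> y : WW ==> dleH (int n) (T x**T y)"
 and x: "x : WW" and y: "y : WW"
 shows "dle (int n) (struct_const x y z)"
 "coef (struct_const x y z) (int n) = coef (coef (T x**T y) z) (int n)"
proof -
 define g where "g = C x - T x"
 define h where "h = C y - T y"
 have H: "g : HC" "h : HC" using x y by (simp_all add: g_def h_def)
 have neg: "dle (-1) (coef g v)" "dle (-1) (coef h v)" for v
 using C_neg[OF x, of v] C_neg[OF y, of v] x y
 by (cases "v = x"; cases "v = y"; simp add: g_def h_def lookup_minus lookup_T)+
 have c: "w : WW" if "w : supp f" "f : HC" for w f using that by (auto simp: HC_def)
 have L: "dleH (-1 + int n) (f**T v)" if f: "f : HC" "!!v. dle (-1) (coef f v)" and v: "v : WW" for f v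
 unfolding hm_lincomb_left[OF f(1) hecke_carrier_T[THEN iffD2, OF v]] lincomb_def
 using f v c by (intro dleH_sum dleH_scale_dle bound) auto
 have 1: "dleH (-1 + int n) (g**T y)" using L H neg y by blast
 have 2: "dleH (-1 + int n) (T x**h)"
 unfolding hm_lincomb_right[OF hecke_carrier_T[THEN iffD2, OF x] H(2)] lincomb_def
 using neg H x c by (intro dleH_sum dleH_scale_dle bound) auto
 have 3: "dleH (-1 + int n) (g**h)"
 proof -
 have "dleH (-1 + (-1 + int n)) (lincomb h (%v. g**T v))" unfolding lincomb_def
 using neg H c L by (intro dleH_sum dleH_scale_dle) auto
 thus ?thesis using hm_lincomb_right[OF H] dleH_mono[of "-1 + (-1 + int n)" _ "-1 + int n"] by simp
 qed
 define r where "r = g**T y + (T x**h + g**h)"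
 have r: "dleH (-1 + int n) r" unfolding r_def by (intro dleH_add 1 2 3)
 have e: "C x**C y = T x**T y + r"
 proof -
 have "C x**C y = (T x + g)**(T y + h)" by (simp add: g_def h_def)
 also have "\<dots> = T x**T y + r" using x y H by (simp add: hm_add_left hm_add_right r_def)
 finally show ?thesis .
 qed
 have d: "dleH (int n) (C x**C y)" unfolding e by (intro dleH_add bound x y dleH_mono[OF r]) simp
 have CC: "C x**C y : HC" using x y by simp
 show "dle (int n) (struct_const x y z)" unfolding struct_const_KLc using dleH_KLc[OF CC d] by (simp add: dleH_def)
 show "coef (struct_const x y z) (int n) = coef (coef (T x**T y) z) (int n)"
 unfolding struct_const_KLc top_KLc[OF CC d, of z] unfolding e using r by (simp add: lookup_add dleH_def dle_def)
qed

text \<open>When multiplying by a descent s of w, the coefficient at w gains the factor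
  \<open>xi s\<close> with leading term q^L(s), while all other coefficients stay strictly lower in
  degree.\<close>

lemma top_mult_descents: assumes w: "w : WW"
 and "set ss <= S" "set ss <= N w" "length ss = len (wprod ss)"
 shows "dle (\<Sum>s\<leftarrow>ss. int (L s)) (coef (T w**T (wprod ss)) w) &
 coef (coef (T w**T (wprod ss)) w) (\<Sum>s\<leftarrow>ss. int (L s)) = 1 &
 (ALL u. u ~= w --> dle ((\<Sum>s\<leftarrow>ss. int (L s)) - 1) (coef (T w**T (wprod ss)) u))"
 using assms(2-)
proof (induction ss rule: rev_induct)
 case Nil
 thus ?case using w dle_single[of 0 0 1] by (auto simp: lookup_T single_one[symmetric] simp del: single_one)
next
 case (snoc s ss)
 have m: "s : S" "set ss <= S" "s : N w" "set ss <= N w" using snoc.prems by auto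
 let ?v = "wprod ss"
 have v: "?v : WW" "wprod (ss @ [s]) = ?v<*>s" using m by (simp_all add: wprod_snoc del: foldr_append)
 have l: "length ss = len ?v" "s ~: N ?v"
 proof -
 have "len (?v<*>s) = Suc (length ss)" using snoc.prems(3) unfolding v(2) by simp
 moreover have "len ?v <= length ss" using len_le m by simp
 ultimately show "s ~: N ?v" "length ss = len ?v" using len_mult_S(1)[OF v(1) m(1)] by (auto split: if_splits)
 qed
 define n where "n = (\<Sum>s\<leftarrow>ss. int (L s))"
 define h where "h = T w**T ?v"
 have h: "h : HC" "T w**T (wprod (ss @ [s])) = h**T s"
 using w v m l by (simp_all add: h_def hm_assoc hm_T_S)
 note IH = snoc.IH[OF m(2,4) l(1), folded n_def h_def]
 have Ls: "0 < L s" using L_pos m by simp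
 have xi: "dle (int (L s)) (xi s)" "coef (xi s) (int (L s)) = 1"
 using Ls by (auto simp: xi_def qpow_def dle_def lookup_minus lookup_single when_def)
 have e: "(\<Sum>s\<leftarrow>ss @ [s]. int (L s)) = int (L s) + n" by (simp add: n_def)
 have ws: "w<*>s ~= w" using N_mult_S[OF w m(1)] m(3) by auto
 have dw: "dle (n - 1) (coef h (w<*>s))" using IH ws by blast
 have at_w: "coef (h**T s) w = coef h (w<*>s) + xi s * coef h w"
 using lookup_mult_T_S[OF h(1) m(1) w] m(3) by simp
 have d2: "dle (int (L s) + n) (xi s * coef h w)" using xi(1) IH by (intro dle_mult) auto
 have A: "dle (int (L s) + n) (coef (h**T s) w)"
 unfolding at_w by (intro dle_add d2 dle_mono[OF dw]) simp
 have B: "coef (coef (h**T s) w) (int (L s) + n) = 1"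
 proof -
 have "coef (xi s * coef h w) (int (L s) + n) = 1"
 using lookup_mult_top[OF xi(1), of n "coef h w"] IH xi(2) by simp
 thus ?thesis unfolding at_w using dw by (simp add: lookup_add dle_def)
 qed
 have C: "dle (int (L s) + n - 1) (coef (h**T s) u)" if u: "u ~= w" for u
 proof (cases "u : WW")
 case True
 have 1: "dle n (coef h (u<*>s))"
 proof (cases "u<*>s = w")
 case False thus ?thesis using IH dle_mono[of "n - 1" "coef h (u<*>s)" n] by simp
 qed (use IH in simp)
 have 2: "dle (int (L s) + (n - 1)) (xi s * coef h u)" using xi(1) IH u by (intro dle_mult) auto
 have 3: "dle (int (L s) + n - 1) (coef h (u<*>s))" by (rule dle_mono[OF 1]) (use Ls in simp)
 show ?thesis unfolding lookup_mult_T_S[OF h(1) m(1) True] using 2 3 by (auto intro!: dle_add simp: algebra_simps)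
 next
 case False
 hence "u ~: supp (h**T s)" using h m hm_closed[of h "T s"] by (auto simp: HC_def)
 thus ?thesis by (simp add: in_keys_iff)
 qed
 show ?case unfolding h(2) e using A B C by blast
qed

lemma C_mult_descent: assumes "w : WW" "s : S" "s : N w"
 shows "C w**Cs s = scale (qpow (int (L s)) + qpow (- int (L s))) (C w)"
proof (rule poly_mapping_eqI)
 fix y
 let ?q = "qpow (int (L s))" and ?q' = "qpow (- int (L s))"
 have qq: "?q * ?q' = 1" by (simp add: qpow_mult qpow_0)
 have c: "C w**Cs s : HC" using assms by simp
 show "coef (C w**Cs s) y = coef (scale (?q + ?q') (C w)) y"
 proof (cases "y : WW")
 case True
 show ?thesis
 proof (cases "s : N y")
 case T: True
 thus ?thesis using assms True C_descent[of w s y] by (simp add: lookup_mult_Cs algebra_simps)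
 next
 case F: False
 have ys: "y<*>s : WW" "s : N (y<*>s)" "y<*>s<*>s = y" using True F assms N_mult_S by auto
 have "coef (C w) y = ?q' * coef (C w) (y<*>s)"
 using C_descent[OF assms ys(1,2)] ys(3) by simp
 hence "?q * coef (C w) y = coef (C w) (y<*>s)"
 using qq by (simp add: mult.assoc[symmetric])
 thus ?thesis using assms True F by (simp add: lookup_mult_Cs algebra_simps)
 qed
 next
 case False
 hence "y ~: supp (C w**Cs s)" "y ~: supp (C w)"
 using c C_closed[OF assms(1)] by (auto simp: HC_def)
 thus ?thesis by (simp add: in_keys_iff)
 qed
qed

end

section \<open>The affine Weyl group as a Coxeter group\<close>

abbreviation g2mult (infixl \<open><.>\<close> 70) where "x <.> y \<equiv> x \<otimes>\<^bsub>G2t\<^esub> y"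

interpretation G2: group G2t by (rule group_G2t)

lemma elt_eq_iff: "elt u = elt v <-> word_eq G2t_relators u v"
 by (simp add: elt_def word_class_eq_iff)
lemma elt_Nil: "elt [] = \<one>\<^bsub>G2t\<^esub>"
 by (simp add: elt_def G2t_def presented_def)
lemma carrier_G2t: "GW = range elt"
 by (simp add: elt_def[abs_def] G2t_def presented_def)
lemma elt_carrier [simp]: "elt u : GW"
 by (simp add: carrier_G2t)

lemma elt_relator: "r : G2t_relators ==> elt r = \<one>\<^bsub>G2t\<^esub>"
 unfolding elt_Nil[symmetric] elt_eq_iff by (rule word_eq.relator)

lemma elt_gen_sq: "elt [g] <.> elt [g] = \<one>\<^bsub>G2t\<^esub>"
 unfolding elt_append[symmetric] by (rule elt_relator) (cases g, auto simp: G2t_relators_def)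

lemma elt_Cons: "elt (g # u) = elt [g] <.> elt u"
 using elt_append[of "[g]" u] by simp

lemma elt_rev: "elt (rev u) = ginv (elt u)"
proof -
 have "elt (rev u)<.>elt u = \<one>\<^bsub>G2t\<^esub>"
 proof (induction u)
 case (Cons g u)
 have "elt (rev (g # u))<.>elt (g # u) = elt (rev u)<.>(elt [g] <.> elt [g])<.>elt u"
 by (simp add: elt_append elt_Cons[of g u] G2.m_assoc)
 thus ?case using Cons by (simp add: elt_gen_sq)
 qed (simp add: elt_Nil)
 thus ?thesis by (simp add: G2.inv_equality)
qed
lemma elt_relator_append: "r : G2t_relators ==> elt (rev r @ w) = elt w"
 by (simp add: elt_append elt_rev elt_relator)

lemma elt_cancel:
 "elt (g # g # w) = elt w"
 "elt (G2 # G1 # G2 # G1 # G2 # G1 # G2 # G1 # G2 # G1 # G2 # G1 # w) = elt w"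
 "elt (G2 # G0 # G2 # G0 # G2 # G0 # w) = elt w"
 "elt (G1 # G0 # G1 # G0 # w) = elt w"
proof -
 show "elt (g # g # w) = elt w"
 using elt_relator_append[of "[g, g]" w] by (cases g) (auto simp: G2t_relators_def)
qed (use elt_relator_append[of "concat (replicate 6 [G1, G2])" w] elt_relator_append[of "concat (replicate 3 [G0, G2])" w]
 elt_relator_append[of "concat (replicate 2 [G0, G1])" w] in \<open>simp_all add: G2t_relators_def eval_nat_numeral\<close>)

fun refl_list :: "gen list => gen list set list" where
 "refl_list [] = []"
| "refl_list (g # u) = elt (rev u @ g # u) # refl_list u"

text \<open>The cocycle on words: the parity of occurrences makes equal reflections cancel in pairs,
  which is how independence of the word is obtained before lengths or roots are available.\<close>

definition Nw :: "gen list => gen list set set" where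
 "Nw u = {x. odd (count_list (refl_list u) x)}"

lemma Nw_simps [simp]: "Nw [] = {}" "Nw (g # u) = {x. (x : Nw u) ~= (x = elt (rev u @ g # u))}"
 by (auto simp: Nw_def)
lemma Nw_carrier: "Nw u <= GW"
 by (induction u) auto

lemma Nw_append: "x : GW ==>
 x : Nw (u @ v) <-> (x : Nw v) ~= (elt v<.>x<.>ginv (elt v) : Nw u)"
proof (induction u)
 case (Cons g u)
 have "x = elt (rev v @ (rev u @ g # u) @ v) <-> elt v<.>x<.>ginv (elt v) = elt (rev u @ g # u)"
 (is "x = ?l <-> ?c = ?e")
 proof -
 have l: "?l = ginv (elt v) <.> ?e<.>elt v" by (simp only: elt_append elt_rev) (simp add: G2.m_assoc)
 have "elt v<.>(ginv (elt v) <.> ?e<.>elt v)<.>ginv (elt v) = ?e"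
 by (simp add: G2.m_assoc G2.r_inv) (simp add: G2.m_assoc[symmetric])
 moreover have "ginv (elt v) <.> ?c<.>elt v = x" using Cons.prems
 by (simp add: G2.m_assoc) (simp add: G2.m_assoc[symmetric])
 ultimately show ?thesis unfolding l by metis
 qed
 thus ?case using Cons by auto
qed auto

lemma relators: "G2t_relators = {[G0, G0], [G1, G1], [G2, G2], [G0, G1, G0, G1], [G0, G2, G0, G2, G0, G2],
 [G1, G2, G1, G2, G1, G2, G1, G2, G1, G2, G1, G2]}"
 unfolding G2t_relators_def by (auto simp: eval_nat_numeral)

lemma refl_list_relator:
 "take 1 (refl_list [g, g]) = drop 1 (refl_list [g, g])"
 "take 2 (refl_list [G0, G1, G0, G1]) = drop 2 (refl_list [G0, G1, G0, G1])"
 "take 3 (refl_list [G0, G2, G0, G2, G0, G2]) = drop 3 (refl_list [G0, G2, G0, G2, G0, G2])"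
 "take 6 (refl_list [G1, G2, G1, G2, G1, G2, G1, G2, G1, G2, G1, G2]) = drop 6 (refl_list [G1, G2, G1, G2, G1, G2, G1, G2, G1, G2, G1, G2])"
 by (simp_all add: elt_cancel)

text \<open>The reflections met along a relator form a list repeated twice, so each of them occurs
  an even number of times.\<close>

lemma Nw_relator: assumes "r : G2t_relators" shows "Nw r = {}"
proof -
 have "EX n. take n (refl_list r) = drop n (refl_list r)"
 using assms refl_list_relator unfolding relators by blast
 then obtain l where "refl_list r = l @ l" by (metis append_take_drop_id)
 thus ?thesis by (auto simp: Nw_def)
qed

lemma Nw_word_eq: "word_eq G2t_relators u v ==> Nw u = Nw v"
proof (induction rule: word_eq.induct)
 case (append u v u' v')
 hence "elt u' = elt v'" by (simp add: elt_eq_iff)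
 hence "x : Nw (u @ u') <-> x : Nw (v @ v')" if "x : GW" for x
 using Nw_append[OF that] append by simp
 thus ?case using Nw_carrier by blast
qed (simp_all add: Nw_relator)

definition NG :: "gen list set => gen list set set" where
 "NG x = Nw (SOME u. x = elt u)"

lemma NG_elt: "NG (elt u) = Nw u"
proof -
 have "elt u = elt (SOME v. elt u = elt v)" by (rule someI) simp
 thus ?thesis unfolding NG_def elt_eq_iff using Nw_word_eq by metis
qed

lemma gens_eq: "G2t_gens = range (%g. elt [g])"
proof -
 have 1: "UNIV = {G0, G1, G2}" using gen.exhaust by auto
 show ?thesis unfolding G2t_gens_def 1 by (simp only: image_insert image_empty)
qed
text \<open>Every relator contains \<open>G1\<close> an even number of times. So s_1 is conjugate
  neither to s_0 nor to s_2, and \<open>L_conj\<close> holds for a and b chosen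
  independently.\<close>

lemma word_eq_parity: "word_eq G2t_relators u v ==> even (count_list u G1) = even (count_list v G1)"
 by (induction rule: word_eq.induct) (auto simp: relators)

lemma elt_gen_conj: assumes "elt [g] <.> w = w<.>elt [h]" "w : GW" shows "g = G1 <-> h = G1"
proof -
 obtain u where "w = elt u" using assms(2) by (auto simp: carrier_G2t)
 hence "elt ([g] @ u) = elt (u @ [h])" using assms(1) by (simp only: elt_append)
 hence "even (count_list ([g] @ u) G1) = even (count_list (u @ [h]) G1)" using word_eq_parity by (simp only: elt_eq_iff)
 thus ?thesis by (auto split: if_splits)
qed
lemma foldr_elt: "foldr (<.>) (map (%g. elt [g]) u) \<one>\<^bsub>G2t\<^esub> = elt u"
 by (induction u) (simp_all add: elt_Nil elt_Cons[symmetric])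

locale g2_weights =
 fixes L :: "gen list set => nat" and a b :: nat
 assumes ab: "a \<ge> 1" "b \<ge> 1"
 and L_gen: "L (elt [G1]) = a" "L (elt [G0]) = b" "L (elt [G2]) = b"

sublocale g2_weights < coxeter G2t G2t_gens L NG
proof (unfold_locales)
 show "G2t_gens <= GW" by (auto simp: gens_eq)
 show "s<.>s = \<one>\<^bsub>G2t\<^esub>" if "s : G2t_gens" for s using that by (auto simp: gens_eq elt_gen_sq)
 show "EX ss. set ss <= G2t_gens & foldr (<.>) ss \<one>\<^bsub>G2t\<^esub> = x" if x: "x : GW" for x
 proof -
 obtain u where "x = elt u" using x by (auto simp: carrier_G2t)
 thus ?thesis using foldr_elt[of u] by (intro exI[of _ "map (%g. elt [g]) u"]) (auto simp: gens_eq)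
 qed
 show "NG (x<.>y) = sym_diff (NG y) ((%t. ginv y<.>t<.>y) ` NG x)" if xy: "x : GW" "y : GW" for x y
 proof -
 obtain u v where uv: "x = elt u" "y = elt v" using xy by (auto simp: carrier_G2t)
 have "t : (%t. ginv y<.>t<.>y) ` NG x <-> y<.>t<.>ginv y : NG x" if t: "t : GW" for t
 proof
 assume "t : (%t. ginv y<.>t<.>y) ` NG x"
 then obtain r where r: "r : NG x" "t = ginv y<.>r<.>y" by blast
 hence "r : GW" using Nw_carrier uv by (auto simp: NG_elt)
 hence "y<.>t<.>ginv y = r" using xy unfolding r(2)
 by (simp add: G2.m_assoc) (simp add: G2.m_assoc[symmetric])
 thus "y<.>t<.>ginv y : NG x" using r by simp
 next
 assume r: "y<.>t<.>ginv y : NG x"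
 have "ginv y<.>(y<.>t<.>ginv y)<.>y = t" using xy t
 by (simp add: G2.m_assoc) (simp add: G2.m_assoc[symmetric])
 thus "t : (%t. ginv y<.>t<.>y) ` NG x" using r by (metis imageI)
 qed
 hence 1: "t : NG (x<.>y) <-> t : sym_diff (NG y) ((%t. ginv y<.>t<.>y) ` NG x)"
 if "t : GW" for t
 using Nw_append[OF that, of u v] that unfolding uv elt_append[symmetric] NG_elt Un_iff Diff_iff by (simp, argo)
 have 2: "NG x <= GW" "NG y <= GW" "NG (x<.>y) <= GW"
 using Nw_carrier unfolding uv elt_append[symmetric] NG_elt by simp_all
 have 3: "(%t. ginv y<.>t<.>y) ` NG x <= GW"
 using 2(1) xy by (auto intro!: G2.m_closed)
 show ?thesis
 proof (rule Set.set_eqI)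
 fix t
 show "t : NG (x<.>y) <-> t : sym_diff (NG y) ((%t. ginv y<.>t<.>y) ` NG x)"
 using 1[of t] 2 3 by (cases "t : GW") auto
 qed
 qed
 show "NG s = {s}" if "s : G2t_gens" for s using that by (auto simp: gens_eq NG_elt)
 show "NG x <= GW" if x: "x : GW" for x 
 proof -
 obtain u where "x = elt u" using x by (auto simp: carrier_G2t)
 thus ?thesis using Nw_carrier by (simp add: NG_elt)
 qed
 show "0 < L s" if "s : G2t_gens" for s using that ab L_gen by (auto simp: G2t_gens_def)
 show "L s = L t" if st: "s : G2t_gens" "t : G2t_gens" "w : GW" "s<.>w = w<.>t" for s t w
 proof -
 obtain g h where "s = elt [g]" "t = elt [h]" using st by (auto simp: gens_eq)
 thus ?thesis using elt_gen_conj[of g w h] st L_gen by (cases g; cases h) auto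
 qed
qed

section \<open>Alcove coordinates\<close>

text \<open>The coordinates of \<open>w\<close> locate the alcove \<open>w\<^sup>-\<^sup>1 A\<^sub>0\<close> relative to the hyperplanes of the positive
 roots \<open>\<alpha>\<^sub>1\<close> (short), \<open>\<alpha>\<^sub>2\<close>, \<open>\<alpha>\<^sub>1 + \<alpha>\<^sub>2\<close>, \<open>2 \<alpha>\<^sub>1 + \<alpha>\<^sub>2\<close>, \<open>3 \<alpha>\<^sub>1 + \<alpha>\<^sub>2\<close>, \<open>3 \<alpha>\<^sub>1 + 2 \<alpha>\<^sub>2\<close>, in this order.\<close>

type_synonym kvec = "int \<times> int \<times> int \<times> int \<times> int \<times> int"

text \<open>The reflections of alcoves that correspond to right multiplication. Coordinates are
  floors, so that negating a root sends k to - 1 - k. The generator s_0 reflects in the hyperplane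
  on which the highest root, the last one, equals 1.\<close>

fun kact :: "gen => kvec => kvec" where
 "kact G1 (k1, k2, k3, k4, k5, k6) = (- 1 - k1, k5, k4, k3, k2, k6)"
| "kact G2 (k1, k2, k3, k4, k5, k6) = (k3, - 1 - k2, k1, k4, k6, k5)"
| "kact G0 (k1, k2, k3, k4, k5, k6) = (k1, - k5, - k4, - k3, - k2, 1 - k6)"

fun kdesc :: "gen => kvec => bool" where
 "kdesc G1 (k1, k2, k3, k4, k5, k6) <-> k1 < 0"
| "kdesc G2 (k1, k2, k3, k4, k5, k6) <-> k2 < 0"
| "kdesc G0 (k1, k2, k3, k4, k5, k6) <-> 0 < k6"

text \<open>For each of the five pairs of positive roots whose sum is a root: the floor of a sum is
  the sum of the floors or one more.\<close>

fun kcons :: "kvec => bool" where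
 "kcons (k1, k2, k3, k4, k5, k6) <-> k1 + k2 <= k3 & k3 <= k1 + k2 + 1 & k1 + k3 <= k4 & k4 <= k1 + k3 + 1 &
 k1 + k4 <= k5 & k5 <= k1 + k4 + 1 & k2 + k5 <= k6 & k6 <= k2 + k5 + 1 & k3 + k4 <= k6 & k6 <= k3 + k4 + 1"

abbreviation kzero :: kvec where "kzero \<equiv> (0, 0, 0, 0, 0, 0)"

lemma kcons_kact: "kcons k ==> kcons (kact g k)"
 by (cases k; cases g) auto
lemma kact_kact [simp]: "kact g (kact g k) = k"
 by (cases k; cases g) auto
lemma kdesc_kact: "kdesc g (kact g k) <-> ~ kdesc g k"
 by (cases k; cases g) auto

lemma kact_word_eq: "word_eq G2t_relators u v ==> fold kact u k = fold kact v k"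
proof (induction arbitrary: k rule: word_eq.induct)
 case (relator r)
 thus ?case by (cases k) (auto simp: relators)
qed auto

definition Ke :: "gen list set => kvec" where
 "Ke x = fold kact (SOME u. x = elt u) kzero"

lemma Ke_elt: "Ke (elt u) = fold kact u kzero"
proof -
 have "elt u = elt (SOME v. elt u = elt v)" by (rule someI) simp
 thus ?thesis unfolding Ke_def elt_eq_iff using kact_word_eq by metis
qed
lemma Ke_mult: "x : GW ==> Ke (x<.>elt v) = fold kact v (Ke x)"
 by (auto simp: carrier_G2t elt_append[symmetric] Ke_elt)

lemma Ke_one [simp]: "Ke \<one>\<^bsub>G2t\<^esub> = kzero"
 using Ke_elt[of "[]"] by (simp add: elt_Nil)

lemma kcons_Ke: "x : GW ==> kcons (Ke x)"
proof -
 have "kcons (fold kact u kzero)" for u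
 by (induction u rule: rev_induct) (simp_all add: kcons_kact)
 thus "x : GW ==> kcons (Ke x)" by (auto simp: carrier_G2t Ke_elt)
qed

fun mgen :: "gen => gen => nat" where
 "mgen G1 G2 = 6" | "mgen G2 G1 = 6" | "mgen G0 G2 = 3" | "mgen G2 G0 = 3" | "mgen G0 G1 = 2" | "mgen G1 G0 = 2" | "mgen _ _ = 1"

text \<open>An alternating word ending in h and shorter than the order of the product of g and h
  cannot create the descent g. Both \<open>descent\<close> and the braid hypothesis of Matsumoto's
  theorem rest on this.\<close>

lemma kdesc_alt: assumes "kcons k" "~ kdesc g k" "~ kdesc h k" "j < mgen g h"
 shows "~ kdesc g (fold kact (alt j h g) k)"
proof -
 obtain k1 k2 k3 k4 k5 k6 where k: "k = (k1, k2, k3, k4, k5, k6)" by (cases k)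
 have "j = 0 | j = 1 | j = 2 | j = 3 | j = 4 | j = 5" using assms(4) by (cases g; cases h) auto
 thus ?thesis using assms unfolding k
 by (cases g; cases h) (elim disjE; simp add: eval_nat_numeral; linarith)+
qed
lemma map_alt: "map f (alt k g h) = alt k (f g) (f h)"
 by (induction k arbitrary: g h) auto

lemma elt_alt_mgen: "g ~= h ==> elt (alt (mgen g h) g h) = elt (alt (mgen g h) h g)"
proof -
 have rr: "elt u = elt v" if "elt (rev v @ u) = \<one>\<^bsub>G2t\<^esub>" for u v
 proof -
 have "ginv (elt v)<.>elt u = \<one>\<^bsub>G2t\<^esub>" using that by (simp add: elt_append elt_rev)
 hence "elt v<.>(ginv (elt v)<.>elt u) = elt v" by simp
 thus ?thesis by (simp add: G2.m_assoc[symmetric])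
 qed
 have c: "elt [G1, G2, G1, G2, G1, G2, G1, G2, G1, G2, G1, G2] = \<one>\<^bsub>G2t\<^esub>" "elt [G0, G2, G0, G2, G0, G2] = \<one>\<^bsub>G2t\<^esub>"
 "elt [G0, G1, G0, G1] = \<one>\<^bsub>G2t\<^esub>"
 by (rule elt_relator, simp add: relators)+
 assume "g ~= h"
 thus ?thesis
 by (intro rr; cases g; cases h) (simp_all add: eval_nat_numeral c elt_cancel elt_Nil)
qed

section \<open>Descents, degrees and injectivity in alcove coordinates\<close>

context g2_weights begin

lemma gen_S [simp]: "elt [g] : G2t_gens"
 by (simp add: gens_eq)
lemma wprod_elt: "foldr (<.>) (map (%g. elt [g]) u) \<one>\<^bsub>G2t\<^esub> = elt u"
 by (rule foldr_elt)

lemma wprod_alt_elt: "foldr (<.>) (alt k (elt [g]) (elt [h])) \<one>\<^bsub>G2t\<^esub> = elt (alt k g h)"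
 unfolding map_alt[of "%g. elt [g]", symmetric] by (rule wprod_elt)

lemma word_gens: assumes "set ss <= G2t_gens" obtains u where "ss = map (%g. elt [g]) u"
proof -
 have "EX u. ss = map (%g. elt [g]) u" using assms
 proof (induction ss)
 case (Cons s ss)
 then obtain u g where "ss = map (%g. elt [g]) u" "s = elt [g]" by (auto simp: gens_eq)
 thus ?case by (intro exI[of _ "g # u"]) simp
 qed simp
 thus ?thesis using that by blast
qed

lemma len_elt_le: "len (elt u) <= length u"
 using len_le[of "map (%g. elt [g]) u"] by (simp add: wprod_elt gens_eq image_subset_iff)

lemma reduced_elt: assumes "x : GW" obtains u where "x = elt u" "length u = len x"
proof -
 obtain ss where "set ss <= G2t_gens" "length ss = len x" "foldr (<.>) ss \<one>\<^bsub>G2t\<^esub> = x" using reduced_word[OF assms] .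
 moreover then obtain u where "ss = map (%g. elt [g]) u" using word_gens by blast
 ultimately show ?thesis using that[of u] wprod_elt[of u] by simp
qed

lemma ex_descent: assumes "x : GW" "x ~= \<one>\<^bsub>G2t\<^esub>" obtains h where "elt [h] : NG x"
proof -
 obtain y s where ys: "y : GW" "s : G2t_gens" "s ~: NG y" "x = y<.>s" using ex_right_factor[OF assms] by blast
 hence "s : NG x" using N_mult_S by simp
 moreover obtain h where "s = elt [h]" using ys(2) by (auto simp: gens_eq)
 ultimately show ?thesis using that by blast
qed

text \<open>If g is not a descent of x but h is, then x is u times an alternating word ending in h
  and shorter than \<open>mgen g h\<close>, with u free of both descents. By induction the
  coordinates of u show this, and \<open>kdesc_alt\<close> carries it to x. The converse follows by
  passing from x to x g.\<close>

lemma descent: assumes "x : GW" shows "elt [g] : NG x <-> kdesc g (Ke x)"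
proof -
 have *: "ALL g. elt [g] ~: NG x --> ~ kdesc g (Ke x)" if "x : GW" for x
 using that
 proof (induction "len x" arbitrary: x rule: less_induct)
 case less
 note x = less.prems
 show ?case
 proof (intro allI impI)
 fix g assume g: "elt [g] ~: NG x"
 show "~ kdesc g (Ke x)"
 proof (cases "x = \<one>\<^bsub>G2t\<^esub>")
 case True thus ?thesis by (cases g) auto
 next
 case False
 then obtain h where h: "elt [h] : NG x" using ex_descent[OF x] by blast
 let ?s = "elt [g]" and ?t = "elt [h]"
 have gh: "g ~= h" using g h by auto
 obtain u k where u: "u : GW" "?s ~: NG u" "?t ~: NG u" "len x = len u + k"
 "x = u<.>elt (alt k g h) | x = u<.>elt (alt k h g)"
 using dihedral_decomp[OF x gen_S gen_S, of g h] unfolding wprod_alt_elt by blast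
 have k: "k > 0" using u h by (cases k) (auto simp: elt_Nil)
 have ends: "~ (EX v. x = u<.>elt (v @ [g]) & length v < k)"
 proof
 assume "EX v. x = u<.>elt (v @ [g]) & length v < k"
 then obtain v where v: "x = u<.>elt (v @ [g])" "length v < k" by blast
 have "x <.> ?s = u<.>elt v" using u(1) unfolding v(1)
 by (simp add: elt_append G2.m_assoc elt_gen_sq)
 hence "len (x <.> ?s) <= len u + length v"
 using len_mult_le[OF u(1), of "elt v"] len_elt_le[of v] by simp
 hence "len (x <.> ?s) < len x" using v u by simp
 thus False using g N_reflection_iff(1)[OF x] S_reflections gen_S by blast
 qed
 have xe: "x = u<.>elt (alt k h g)"
 proof (rule ccontr)
 assume "~ ?thesis"
 hence "x = u<.>elt (alt k g h)" using u(5) by blast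
 thus False using ends k by (cases k) auto
 qed
 have km: "k < mgen g h"
 proof (rule ccontr)
 let ?m = "mgen g h"
 have mpos: "?m > 0" by (cases g; cases h) auto
 assume "~ ?thesis"
 then obtain p where p: "alt k h g = p @ alt ?m h g" using alt_split[of h g "k - ?m" ?m] by auto
 have "elt (alt k h g) = elt (p @ alt ?m g h)" unfolding p using elt_alt_mgen[OF gh] by (simp add: elt_append)
 moreover obtain m' where m': "?m = Suc m'" using mpos by (cases ?m) auto
 ultimately have "x = u<.>elt ((p @ alt m' h g) @ [g])" using xe by simp
 moreover have "length (p @ alt m' h g) < k" using arg_cong[OF p, of length] m' by simp
 ultimately show False using ends by blast
 qed
 have "len u < len x" using u(4) k by simp
 hence "~ kdesc g (Ke u)" "~ kdesc h (Ke u)" using less.hyps[of u] u by blast+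
 hence "~ kdesc g (fold kact (alt k h g) (Ke u))" using kdesc_alt kcons_Ke u(1) km by blast
 thus ?thesis unfolding xe Ke_mult[OF u(1)] .
 qed
 qed
 qed
 have "kdesc g (Ke x)" if "elt [g] : NG x"
 proof (rule ccontr)
 assume n: "~ kdesc g (Ke x)"
 have y: "x<.>elt [g] : GW" using assms by simp
 have "elt [g] ~: NG (x<.>elt [g])" using N_mult_S[OF assms gen_S] that by simp
 hence "~ kdesc g (Ke (x<.>elt [g]))" using *[OF y] by blast
 thus False using n kdesc_kact by (simp add: Ke_mult[OF assms])
 qed
 thus ?thesis using *[OF assms] by blast
qed

text \<open>Multiplying by the inverse of y reduces to coordinates 0, where no generator is a
  descent; only the identity has no descent.\<close>

lemma Ke_inj: assumes "x : GW" "y : GW" "Ke x = Ke y" shows "x = y"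
proof -
 obtain v where v: "y = elt v" using assms(2) by (auto simp: carrier_G2t)
 let ?z = "x<.>elt (rev v)"
 have z: "?z : GW" using assms by simp
 have "Ke ?z = fold kact (rev v) (Ke y)" using assms by (simp add: Ke_mult)
 also have "\<dots> = Ke (y<.>elt (rev v))" using assms by (simp add: Ke_mult)
 also have "y<.>elt (rev v) = \<one>\<^bsub>G2t\<^esub>" by (simp add: v elt_rev)
 finally have K: "Ke ?z = kzero" by simp
 have "?z = \<one>\<^bsub>G2t\<^esub>"
 proof (rule ccontr)
 assume "?z ~= \<one>\<^bsub>G2t\<^esub>"
 then obtain h where "elt [h] : NG ?z" using ex_descent[OF z] by blast
 thus False using descent[OF z] K by (cases h) auto
 qed
 hence "x<.>elt (rev v)<.>y = y" using assms by simp
 thus ?thesis using assms(1) by (simp add: G2.m_assoc v elt_rev)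
qed

text \<open>The degree of \<open>T\<^sub>x T\<^sub>y\<close> is bounded by the total weight of the directions in which the
 alcoves of \<open>x\<^sup>-\<^sup>1\<close> and \<open>y\<close> lie on the same side.\<close>

fun kdeg :: "kvec => kvec => int" where
 "kdeg (x1, x2, x3, x4, x5, x6) (y1, y2, y3, y4, y5, y6) =
 int a * (of_bool (0 < x1 * y1) + of_bool (0 < x3 * y3) + of_bool (0 < x4 * y4)) +
 int b * (of_bool (0 < x2 * y2) + of_bool (0 < x5 * y5) + of_bool (0 < x6 * y6))"

section \<open>Degree bounds for products of standard basis elements\<close>

lemma kdeg_le: "kdeg k l <= 3 * int a + 3 * int b"
proof -
 obtain x1 x2 x3 x4 x5 x6 y1 y2 y3 y4 y5 y6 where kl: "k = (x1, x2, x3, x4, x5, x6)" "l = (y1, y2, y3, y4, y5, y6)"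
 by (cases k; cases l)
 have "int a * (of_bool p + of_bool q + of_bool r) <= int a * 3" "int b * (of_bool p + of_bool q + of_bool r) <= int b * 3" for p q r
 by (intro mult_left_mono; simp add: of_bool_def)+
 thus ?thesis unfolding kl kdeg.simps by (smt (verit))
qed
lemma pos_mult_iff: "(0 :: int) < x * y <-> (0 < x & 0 < y) | (x < 0 & y < 0)"
 by (auto simp: zero_less_mult_iff)

text \<open>A rearrangement inequality: signs agree at least as often when the larger coordinate is
  paired with the larger one.\<close>

lemma of_bool_exchange: fixes x x' y y' :: int
 assumes "x' <= x" "y <= y'"
 shows "(of_bool (0 < x * y) + of_bool (0 < x' * y') :: int) <= of_bool (0 < x * y') + of_bool (0 < x' * y)"
 using assms by (auto simp: pos_mult_iff)

lemma kdeg_nonneg: "0 <= kdeg k l"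
 by (cases k; cases l) simp

lemma kdeg_kact_le: "~ kdesc g l ==> kdeg (kact g k) l <= kdeg k (kact g l)"
proof -
 assume g: "~ kdesc g l"
 obtain x1 x2 x3 x4 x5 x6 y1 y2 y3 y4 y5 y6 where kl: "k = (x1, x2, x3, x4, x5, x6)" "l = (y1, y2, y3, y4, y5, y6)"
 by (cases k; cases l)
 show ?thesis
 proof (cases g)
 case G1
 have "of_bool (0 < (- 1 - x1) * y1) <= (of_bool (0 < x1 * (- 1 - y1)) :: int)"
 using g unfolding kl G1 by (auto simp: pos_mult_iff)
 hence "int a * of_bool (0 < (- 1 - x1) * y1) <= int a * of_bool (0 < x1 * (- 1 - y1))" by (intro mult_left_mono) auto
 thus ?thesis unfolding kl G1 kact.simps kdeg.simps distrib_left by linarith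
 next
 case G2
 have "of_bool (0 < (- 1 - x2) * y2) <= (of_bool (0 < x2 * (- 1 - y2)) :: int)"
 using g unfolding kl G2 by (auto simp: pos_mult_iff)
 hence "int b * of_bool (0 < (- 1 - x2) * y2) <= int b * of_bool (0 < x2 * (- 1 - y2))" by (intro mult_left_mono) auto
 thus ?thesis unfolding kl G2 kact.simps kdeg.simps distrib_left by linarith
 next
 case G0
 have "of_bool (0 < (1 - x6) * y6) <= (of_bool (0 < x6 * (1 - y6)) :: int)"
 using g unfolding kl G0 by (auto simp: pos_mult_iff)
 hence "int b * of_bool (0 < (1 - x6) * y6) <= int b * of_bool (0 < x6 * (1 - y6))" by (intro mult_left_mono) auto
 thus ?thesis unfolding kl G0 kact.simps kdeg.simps distrib_left minus_mult_minus mult_minus_left mult_minus_right by linarith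
 qed
qed

text \<open>The direction of g itself passes from disagreement to agreement and contributes its
  weight. The others are fixed or exchanged in pairs of equal weight, and
  \<open>of_bool_exchange\<close> shows that no pair loses.\<close>

lemma kdeg_kact_ge: assumes k: "kcons k" "kdesc g k" and l: "kcons l" "~ kdesc g l"
 shows "int (L (elt [g])) + kdeg k l <= kdeg k (kact g l)"
proof -
 obtain x1 x2 x3 x4 x5 x6 y1 y2 y3 y4 y5 y6 where kl: "k = (x1, x2, x3, x4, x5, x6)" "l = (y1, y2, y3, y4, y5, y6)"
 by (cases k; cases l)
 let ?B = "%p. of_bool p :: int"
 show ?thesis
 proof (cases g)
 case G1
 have o: "x5 <= x2" "x4 <= x3" "y2 <= y5" "y3 <= y4" "x1 < 0" "0 <= y1" using k l unfolding kl G1 by auto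
 have 1: "?B (0 < x1 * y1) = 0" "?B (0 < x1 * (- 1 - y1)) = 1" using o by (auto simp: pos_mult_iff)
 have "int b * (?B (0 < x2 * y2) + ?B (0 < x5 * y5)) <= int b * (?B (0 < x2 * y5) + ?B (0 < x5 * y2))"
 "int a * (?B (0 < x3 * y3) + ?B (0 < x4 * y4)) <= int a * (?B (0 < x3 * y4) + ?B (0 < x4 * y3))"
 using o by (intro mult_left_mono of_bool_exchange; simp)+
 thus ?thesis unfolding kl G1 kact.simps kdeg.simps 1 L_gen distrib_left mult_1_right mult_zero_right by linarith
 next
 case G2
 have o: "x3 <= x1" "x6 <= x5" "y1 <= y3" "y5 <= y6" "x2 < 0" "0 <= y2" using k l unfolding kl G2 by auto
 have 1: "?B (0 < x2 * y2) = 0" "?B (0 < x2 * (- 1 - y2)) = 1" using o by (auto simp: pos_mult_iff)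
 have "int b * (?B (0 < x5 * y5) + ?B (0 < x6 * y6)) <= int b * (?B (0 < x5 * y6) + ?B (0 < x6 * y5))"
 "int a * (?B (0 < x1 * y1) + ?B (0 < x3 * y3)) <= int a * (?B (0 < x1 * y3) + ?B (0 < x3 * y1))"
 using o by (intro mult_left_mono of_bool_exchange; simp)+
 thus ?thesis unfolding kl G2 kact.simps kdeg.simps 1 L_gen distrib_left mult_1_right mult_zero_right by linarith
 next
 case G0
 have o: "- x5 <= x2" "- x4 <= x3" "y2 <= - y5" "y3 <= - y4" "0 < x6" "y6 <= 0" using k l unfolding kl G0 by auto
 have 1: "?B (0 < x6 * y6) = 0" "?B (0 < x6 * (1 - y6)) = 1" using o by (auto simp: pos_mult_iff)
 have "int b * (?B (0 < x2 * y2) + ?B (0 < - x5 * - y5)) <= int b * (?B (0 < x2 * - y5) + ?B (0 < - x5 * y2))"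
 "int a * (?B (0 < x3 * y3) + ?B (0 < - x4 * - y4)) <= int a * (?B (0 < x3 * - y4) + ?B (0 < - x4 * y3))"
 using o by (intro mult_left_mono of_bool_exchange; simp)+
 thus ?thesis unfolding kl G0 kact.simps kdeg.simps 1 L_gen distrib_left mult_1_right mult_zero_right
 minus_mult_minus mult_minus_left mult_minus_right minus_minus by linarith
 qed
qed

lemma Ke_inv_left: "y : GW ==> Ke (ginv (elt [g] <.> y)) = kact g (Ke (ginv y))"
proof -
 assume y: "y : GW"
 have "ginv (elt [g]) = elt [g]" using elt_rev[of "[g]"] by simp
 hence "ginv (elt [g] <.> y) = ginv y<.>elt [g]" using y by (simp add: G2.inv_mult_group)
 thus ?thesis using y by (simp add: Ke_mult)
qed

text \<open>Moving a letter s from y to x gives T_xs T_y and, at a descent, the extra term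
  \<open>xi s\<close> times T_x T_y. The two inequalities \<open>kdeg_kact_le\<close> and
  \<open>kdeg_kact_ge\<close> bound exactly these two terms.\<close>

lemma dleH_T_T: assumes "x : GW" "y : GW"
 shows "dleH (kdeg (Ke x) (Ke (ginv y))) (T x**T y)"
 using assms(2,1)
proof (induction y arbitrary: x rule: left_induct)
 case one
 have "kdeg (Ke x) kzero = 0" by (cases "Ke x") simp
 thus ?case using one dle_single[of 0 0 "1 :: int"]
 by (auto simp: dleH_def lookup_T single_one[symmetric] simp del: single_one)
next
 case (step y s)
 obtain g where g: "s = elt [g]" using step(2) by (auto simp: gens_eq)
 let ?l = "Ke (ginv y)"
 have nd: "~ kdesc g ?l" using step descent[of "ginv y" g] g by simp
 have e: "T x**T (s<.>y) = T x**T s**T y" using step by (simp add: T_left hm_assoc)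
 have Kxs: "Ke (x<.>s) = kact g (Ke x)" using step g by (simp add: Ke_mult)
 have 1: "dleH (kdeg (Ke x) (kact g ?l)) (T (x<.>s)**T y)"
 using step.IH[of "x<.>s"] step kdeg_kact_le[OF nd, of "Ke x"] unfolding Kxs by (auto elim: dleH_mono)
 have "dleH (kdeg (Ke x) (kact g ?l)) (T x**T s**T y)"
 proof (cases "s : NG x")
 case False thus ?thesis using 1 step by (simp add: hm_T_S)
 next
 case True
 hence d: "kdesc g (Ke x)" using descent step.prems g by simp
 have "T x**T s**T y = T (x<.>s)**T y + scale (xi s) (T x**T y)"
 using True step by (simp add: hm_T_S hm_add_left hm_scale_left)
 moreover have "dleH (int (L s) + kdeg (Ke x) ?l) (scale (xi s) (T x**T y))"
 using step by (intro dleH_scale_dle) (auto simp: xi_def intro!: dle_diff simp: dle_qpow)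
 hence "dleH (kdeg (Ke x) (kact g ?l)) (scale (xi s) (T x**T y))"
 using kdeg_kact_ge[of "Ke x" g ?l] d nd kcons_Ke step g by (auto elim!: dleH_mono)
 ultimately show ?thesis using 1 dleH_add by simp
 qed
 thus ?case using e step g by (simp add: Ke_inv_left)
qed

text \<open>As letters are moved from y to x the quantity \<open>kdeg\<close> stays 0; a descent met
  on the way would make it positive, so every letter lengthens.\<close>

lemma len_additive: assumes "x : GW" "y : GW" "kdeg (Ke x) (Ke (ginv y)) = 0"
 shows "len (x<.>y) = len x + len y"
 using assms(2,1,3)
proof (induction y arbitrary: x rule: left_induct)
 case (step y s)
 obtain g where g: "s = elt [g]" using step(2) by (auto simp: gens_eq)
 let ?l = "Ke (ginv y)"
 have nd: "~ kdesc g ?l" using step descent[of "ginv y" g] g by simp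
 have 0: "kdeg (Ke x) (kact g ?l) = 0" using step g by (simp add: Ke_inv_left)
 have "s ~: NG x"
 proof
 assume "s : NG x"
 hence "kdesc g (Ke x)" using descent step.prems g by simp
 hence "0 < int (L (elt [g])) + kdeg (Ke x) ?l" "int (L (elt [g])) + kdeg (Ke x) ?l <= kdeg (Ke x) (kact g ?l)"
 using kdeg_kact_ge[of "Ke x" g ?l] nd kcons_Ke step kdeg_nonneg[of "Ke x" ?l] L_pos[of "elt [g]"] by auto
 thus False using 0 by simp
 qed
 hence l: "len (x<.>s) = Suc (len x)" using len_up step by simp
 have "kdeg (Ke (x<.>s)) ?l = 0"
 using kdeg_kact_le[OF nd, of "Ke x"] 0 kdeg_nonneg[of "kact g (Ke x)" ?l] step g by (simp add: Ke_mult)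
 hence "len (x<.>s<.>y) = len (x<.>s) + len y" using step by simp
 thus ?case using l step len_mult_left(2)[of y s] by (simp add: G2.m_assoc)
qed simp

end

section \<open>The lowest two-sided cell\<close>

text \<open>Twelve words whose alcoves lie in the box where both simple coordinates are 0.\<close>

definition box_words :: "gen list list" where
 "box_words = [[], [G0], [G2, G0], [G1, G2, G0], [G2, G1, G2, G0], [G0, G2, G1, G2, G0], [G1, G2, G1, G2, G0],
 [G0, G1, G2, G1, G2, G0], [G2, G0, G1, G2, G1, G2, G0], [G1, G2, G0, G1, G2, G1, G2, G0],
 [G2, G1, G2, G0, G1, G2, G1, G2, G0], [G0, G2, G1, G2, G0, G1, G2, G1, G2, G0]]"

text \<open>The alcove lies outside all strips between a hyperplane through the origin and its
  neighbour, the classical description of the lowest two-sided cell.\<close>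

fun kregular :: "kvec => bool" where
 "kregular (k1, k2, k3, k4, k5, k6) <-> k1 ~= 0 & k2 ~= 0 & k3 ~= 0 & k4 ~= 0 & k5 ~= 0 & k6 ~= 0"

fun kbox :: "kvec => bool" where
 "kbox (k1, k2, k3, k4, k5, k6) <-> k1 = 0 & k2 = 0"

text \<open>Each regular alcove is moved by one of the box words into the chamber where s_1 and s_2
  are both descents; this yields the factorisation through \<open>w0\<close>.\<close>

lemma kregular_box: assumes "kcons k" "kregular k"
 shows "EX r:set box_words. kdesc G1 (fold kact r k) & kdesc G2 (fold kact r k)"
proof -
 obtain k1 k2 k3 k4 k5 k6 where k: "k = (k1, k2, k3, k4, k5, k6)" by (cases k)
 show ?thesis using assms unfolding k box_words_def by (simp, smt (verit))
qed

lemma kbox_box_words: "r : set box_words ==> kbox (fold kact r kzero)"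
 unfolding box_words_def by auto

fun Lword :: "nat => nat => gen list => int" where
 "Lword a b u = (\<Sum>g\<leftarrow>u. if g = G1 then int a else int b)"

fun kreduced :: "kvec => gen list => bool" where
 "kreduced k [] <-> True"
| "kreduced k (g # u) <-> ~ kdesc g k & kreduced (kact g k) u"

context g2_weights begin

abbreviation "w0 \<equiv> elt [G1, G2, G1, G2, G1, G2]"

lemma w0_alt: "elt (alt 6 G2 G1) = w0" "elt (alt 6 G1 G2) = w0"
 using elt_alt_mgen[of G1 G2] by (simp_all add: eval_nat_numeral)

text \<open>The factor z has the form x w_0 by \<open>both_descents\<close>, and the inverse of y
  lies in the box. The coordinates of the two factors have no sign in common, so lengths
  add.\<close>

definition Gamma0 :: "gen list set set" where
 "Gamma0 = {z<.>y | z y. z : GW & y : GW & elt [G1] : NG z & elt [G2] : NG z & kbox (Ke (ginv y))}"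

lemma Gamma0_carrier: "w : Gamma0 ==> w : GW"
 by (auto simp: Gamma0_def)

lemma kregular_Gamma0: assumes w: "w : GW" "kregular (Ke w)" shows "w : Gamma0"
proof -
 obtain r where r: "r : set box_words" "kdesc G1 (fold kact r (Ke w))" "kdesc G2 (fold kact r (Ke w))"
 using kregular_box[OF kcons_Ke[OF w(1)] w(2)] by blast
 have 1: "w = w<.>elt r<.>elt (rev r)" using w by (simp add: elt_rev G2.m_assoc)
 have 2: "elt [G1] : NG (w<.>elt r)" "elt [G2] : NG (w<.>elt r)"
 using r w descent[of "w<.>elt r"] by (simp_all add: Ke_mult)
 have 3: "kbox (Ke (ginv (elt (rev r))))" using kbox_box_words[OF r(1)] by (simp add: elt_rev Ke_elt)
 show ?thesis unfolding Gamma0_def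
 by (rule CollectI, rule exI[of _ "w<.>elt r"], rule exI[of _ "elt (rev r)"], intro conjI) (use 1 2 3 w in simp_all)
qed

lemma kdeg_opposite: assumes "kcons k" "kdesc G1 k" "kdesc G2 k" "kcons l" "kbox l" shows "kdeg k l = 0"
proof -
 obtain x1 x2 x3 x4 x5 x6 y1 y2 y3 y4 y5 y6 where kl: "k = (x1, x2, x3, x4, x5, x6)" "l = (y1, y2, y3, y4, y5, y6)"
 by (cases k; cases l)
 have "x1 < 0" "x2 < 0" "x3 < 0" "x4 < 0" "x5 < 0" "x6 < 0" "0 <= y1" "0 <= y2" "0 <= y3" "0 <= y4" "0 <= y5" "0 <= y6"
 using assms unfolding kl by simp_all
 thus ?thesis unfolding kl by (simp add: pos_mult_iff)
qed

text \<open>An element with both descents \<open>s\<^sub>1, s\<^sub>2\<close> is \<open>x w\<^sub>0\<close> with \<open>x\<close> dominant.\<close>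

lemma both_descents: assumes z: "z : GW" "elt [G1] : NG z" "elt [G2] : NG z"
 obtains x where "x : GW" "elt [G1] ~: NG x" "elt [G2] ~: NG x" "z = x<.>w0" "len z = len x + 6"
proof -
 obtain u k where u: "u : GW" "elt [G1] ~: NG u" "elt [G2] ~: NG u" "len z = len u + k"
 "z = u<.>elt (alt k G1 G2) | z = u<.>elt (alt k G2 G1)"
 using dihedral_decomp[OF z(1) gen_S gen_S, of G1 G2] unfolding wprod_alt_elt by blast
 have nd: "~ kdesc G1 (Ke u)" "~ kdesc G2 (Ke u)" using u descent by blast+
 have k1: "6 <= k"
 proof (rule ccontr)
 assume "~ 6 <= k"
 hence "~ kdesc G1 (fold kact (alt k G2 G1) (Ke u))" "~ kdesc G2 (fold kact (alt k G1 G2) (Ke u))"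
 using kdesc_alt kcons_Ke u(1) nd by auto
 thus False using u(5) z descent[OF z(1)] by (auto simp: Ke_mult u(1))
 qed
 have k2: "k <= 6"
 proof (rule ccontr)
 assume k: "~ k <= 6"
 have *: "EX v. elt (alt k g h) = elt v & length v < k" if gh: "{g, h} = {G1, G2}" for g h
 proof -
 obtain p where p: "alt k g h = p @ alt 7 g h" using alt_split[of g h "k - 7" 7] k by auto
 have "elt (alt 6 h g) = elt (alt 6 g h)" using w0_alt gh by (auto simp: doubleton_eq_iff)
 moreover have "alt 7 g h = alt 6 h g @ [g]" "alt 6 g h = alt 5 h g @ [g]" by (simp_all add: eval_nat_numeral)
 ultimately have "elt (alt 7 g h) = elt (alt 5 h g)" by (simp add: elt_append G2.m_assoc elt_gen_sq)
 hence "elt (alt k g h) = elt (p @ alt 5 h g)" unfolding p by (simp add: elt_append)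
 moreover have "length (p @ alt 5 h g) < k" using arg_cong[OF p, of length] by simp
 ultimately show ?thesis by blast
 qed
 have "{G2, G1} = {G1, G2}" by auto
 then obtain v where "z = u<.>elt v" "length v < k" using u(5) *[of G1 G2] *[of G2 G1] by metis
 thus False using len_mult_le[OF u(1), of "elt v"] len_elt_le[of v] u(4) by simp
 qed
 have "k = 6" using k1 k2 by simp
 thus ?thesis using that[OF u(1-3)] u(4,5) w0_alt by auto
qed

text \<open>If g destroyed a descent t of z, then g z = z t, so g w = z t y would be shorter than w,
  contrary to the choice of g. The stability under length-increasing left multiplication feeds the
  induction in \<open>cover\<close>.\<close>

lemma Gamma0_left: assumes w: "w : Gamma0" and g: "elt [g] ~: NG (ginv w)" shows "elt [g] <.> w : Gamma0"
proof -
 obtain z y where zy: "w = z<.>y" "z : GW" "y : GW" "elt [G1] : NG z" "elt [G2] : NG z" "kbox (Ke (ginv y))"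
 using w by (auto simp: Gamma0_def)
 have l: "len w = len z + len y"
 unfolding zy(1) by (rule len_additive[OF zy(2,3) kdeg_opposite]) (use zy descent kcons_Ke in auto)
 have up: "len (elt [g] <.> w) = Suc (len w)" using len_mult_left(2)[OF Gamma0_carrier[OF w] gen_S g] .
 have e: "elt [g] <.> w = elt [g] <.> z<.>y" unfolding zy(1) using zy by (simp add: G2.m_assoc)
 have d: "t : NG (elt [g] <.> z)" if t: "t : NG z" "t : G2t_gens" for t
 proof (rule ccontr)
 assume "t ~: NG (elt [g] <.> z)"
 hence "z<.>t<.>ginv z = elt [g]"
 using N_mult_mem[of "elt [g]" z t] t zy N_gen[OF gen_S, of g] by auto
 hence "elt [g] <.> z = z<.>t" using t zy by (metis G2.inv_solve_right S_in elt_carrier G2.m_closed)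
 hence "elt [g] <.> w = z<.>t<.>y" using e by simp
 hence "len (elt [g] <.> w) <= len (z<.>t) + len y" using len_mult_le t zy by simp
 moreover have "len (z<.>t) < len z" using len_less_if_N[OF zy(2) t(1)] .
 ultimately show False using up l by simp
 qed
 show ?thesis unfolding Gamma0_def e
 by (rule CollectI, rule exI[of _ "elt [g] <.> z"], rule exI[of _ y], intro conjI) (use zy d in simp_all)
qed
lemma w0_descents: "elt [G1] : NG w0" "elt [G2] : NG w0"
 by (simp_all add: descent Ke_elt)

lemma kreduced_len: assumes "x : GW" "kreduced (Ke x) u" shows "len (x<.>elt u) = len x + length u"
 using assms
proof (induction u arbitrary: x)
 case Nil thus ?case by (simp add: elt_Nil)
next
 case (Cons g u)
 have "elt [g] ~: NG x" using Cons.prems descent by simp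
 hence "len (x<.>elt [g]) = Suc (len x)" using len_up Cons.prems by simp
 moreover have "len (x<.>elt [g] <.> elt u) = len (x<.>elt [g]) + length u"
 using Cons by (simp add: Ke_mult)
 ultimately show ?case using Cons.prems by (simp add: elt_Cons[of g u] G2.m_assoc)
qed

lemma len_w0: "len w0 = 6"
 using kreduced_len[of "\<one>\<^bsub>G2t\<^esub>" "[G1, G2, G1, G2, G1, G2]"] by simp

text \<open>Descending from w_0, where the coefficient is 1, each removal of a right descent s
  multiplies by q^-L(s), by \<open>C_descent\<close>.\<close>

lemma C_w0_coeff: assumes "k <= 6" "{g, h} = {G1, G2}"
 shows "coef (C w0) (elt (alt k g h)) = qpow (Lword a b (alt k g h) - 3 * int a - 3 * int b)"
 using assms
proof (induction "6 - k" arbitrary: k g h)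
 case 0
 hence "k = 6" by simp
 thus ?case using 0 w0_alt by (auto simp: doubleton_eq_iff eval_nat_numeral qpow_0)
next
 case (Suc m)
 have IH: "coef (C w0) (elt (alt (Suc k) h g)) = qpow (Lword a b (alt (Suc k) h g) - 3 * int a - 3 * int b)"
 using Suc.hyps(2) Suc.prems by (intro Suc.hyps(1)) auto
 let ?y = "elt (alt (Suc k) h g)" and ?s = "elt [h]"
 have hw: "?s : NG w0" using w0_descents Suc.prems(2) by (auto simp: doubleton_eq_iff)
 have km: "k < 6" using Suc.hyps(2) by simp
 have "~ kdesc h (Ke (elt (alt k g h)))"
 using kdesc_alt[of kzero h g k] km Suc.prems(2) by (auto simp: doubleton_eq_iff Ke_elt)
 hence "?s ~: NG (elt (alt k g h))" using descent by simp
 moreover have y: "?y = elt (alt k g h) <.> ?s" by (simp add: elt_append)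
 ultimately have "?s : NG ?y" "?y <.> ?s = elt (alt k g h)" using N_mult_S[of "elt (alt k g h)" ?s] by simp_all
 hence "coef (C w0) (elt (alt k g h)) = qpow (- int (L ?s)) * coef (C w0) ?y"
 using C_descent[of w0 ?s ?y] hw by simp
 also have "\<dots> = qpow (Lword a b (alt k g h) - 3 * int a - 3 * int b)"
 unfolding IH qpow_mult using L_gen by (cases h) (auto simp: algebra_simps)
 finally show ?case .
qed

definition W12 :: "gen list set set" where
 "W12 = {elt (alt k g h) | k g h. k <= 6 & {g, h} = {G1, G2}}"

lemma W12_cases: assumes "v : W12"
 obtains k g h where "v = elt (alt k g h)" "k < 6" "{g, h} = {G1, G2}" | "v = w0"
proof -
 obtain k g h where v: "v = elt (alt k g h)" "k <= 6" "{g, h} = {G1, G2}" using assms by (auto simp: W12_def)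
 show ?thesis
 proof (cases "k = 6")
 case True
 hence "v = w0" using v w0_alt by (auto simp: doubleton_eq_iff)
 thus ?thesis using that by blast
 next
 case False thus ?thesis using v that by force
 qed
qed

lemma W12_mult: assumes "v : W12" "s : {G1, G2}" shows "v<.>elt [s] : W12"
proof -
 have down: "elt (alt k g h)<.>elt [g] : W12" if k: "0 < k" "k <= 6" and gh: "{g, h} = {G1, G2}" for k g h
 proof -
 obtain k' where "k = Suc k'" using k by (cases k) auto
 hence "elt (alt k g h)<.>elt [g] = elt (alt k' h g)" by (simp add: elt_append G2.m_assoc elt_gen_sq)
 moreover have "k' <= 6" "{h, g} = {G1, G2}" using k \<open>k = Suc k'\<close> gh by auto
 ultimately show ?thesis unfolding W12_def by blast
 qed
 have up: "elt (alt k g h)<.>elt [h] : W12" if k: "k < 6" and gh: "{g, h} = {G1, G2}" for k g h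
 proof -
 have "elt (alt k g h)<.>elt [h] = elt (alt (Suc k) h g)" by (simp add: elt_append)
 moreover have "Suc k <= 6" "{h, g} = {G1, G2}" using k gh by auto
 ultimately show ?thesis unfolding W12_def by blast
 qed
 show ?thesis
 using assms(1)
 proof (cases rule: W12_cases)
 case (1 k g h)
 consider "s = h" | "s = g" "k = 0" | "s = g" "0 < k" using 1 assms(2) by blast
 thus ?thesis
 proof cases
 assume "s = h" thus ?thesis using up 1 by simp
 next
 assume "s = g" "k = 0" thus ?thesis using up[of 0 h g] 1 by (simp add: insert_commute)
 next
 assume "s = g" "0 < k" thus ?thesis using down 1 by simp
 qed
 next
 case 2
 thus ?thesis using down[of 6 G1 G2] down[of 6 G2 G1] w0_alt assms(2) by (auto simp: insert_commute)
 qed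
qed

lemma W12_one: "\<one>\<^bsub>G2t\<^esub> : W12"
 unfolding W12_def by (rule CollectI, rule exI[of _ 0], rule exI[of _ G1], rule exI[of _ G2]) (simp add: elt_Nil)

lemma W12_word: "set u <= {G1, G2} ==> elt u : W12"
proof (induction u rule: rev_induct)
 case Nil thus ?case using W12_one by (simp add: elt_Nil)
next
 case (snoc g u) thus ?case using W12_mult[of "elt u" g] by (simp add: elt_append)
qed

lemma generate_word: assumes "J <= UNIV" "x : generate G2t ((%g. elt [g]) ` J)" shows "EX u. set u <= J & x = elt u"
 using assms(2)
proof (induction x rule: generate.induct)
 case one thus ?case by (intro exI[of _ "[]"]) (simp add: elt_Nil)
next
 case (incl h) thus ?case by (metis (no_types, lifting) imageE list.set(1) list.set(2) empty_subsetI insert_subset)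
next
 case (inv h)
 then obtain g where g: "g : J" "h = elt [g]" by auto
 hence "ginv h = elt [g]" using elt_rev[of "[g]"] by simp
 thus ?case using g by (intro exI[of _ "[g]"]) simp
next
 case (eng h1 h2)
 then obtain u v where "set u <= J" "h1 = elt u" "set v <= J" "h2 = elt v" by blast
 thus ?case by (intro exI[of _ "u @ v"]) (simp add: elt_append)
qed

lemma word_generate: "set u <= J ==> elt u : generate G2t ((%g. elt [g]) ` J)"
proof (induction u)
 case Nil thus ?case by (simp add: elt_Nil generate.one)
next
 case (Cons g u)
 thus ?case unfolding elt_Cons[of g u] by (intro generate.eng) (auto intro: generate.incl)
qed

lemma generate_W12: "generate G2t {elt [G1], elt [G2]} = W12"
proof
 show "generate G2t {elt [G1], elt [G2]} <= W12" using generate_word[of "{G1, G2}"] W12_word by auto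
 show "W12 <= generate G2t {elt [G1], elt [G2]}"
 proof
 fix x assume "x : W12"
 then obtain k g h where x: "x = elt (alt k g h)" "{g, h} = {G1, G2}" by (auto simp: W12_def)
 have "set (alt k g h) <= {G1, G2}" using set_alt[of k g h] x(2) by simp
 thus "x : generate G2t {elt [G1], elt [G2]}" using word_generate[of _ "{G1, G2}"] x(1) by simp
 qed
qed

lemma W12_len: assumes "v : W12" "v ~= w0" shows "len v < 6"
 using assms(1)
proof (cases rule: W12_cases)
 case (1 k g h) thus ?thesis using len_elt_le[of "alt k g h"] by simp
qed (use assms in simp)

lemma w0_G2_eq: "w0_G2 = w0"
 unfolding w0_G2_def longest_element_def generate_W12
proof (rule the_equality)
 have "w0 : W12" using W12_word[of "[G1, G2, G1, G2, G1, G2]"] by simp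
 thus *: "w0 : W12 & (ALL v:W12. len v <= len w0)" using W12_len len_w0 by fastforce
 fix w assume "w : W12 & (ALL v:W12. len v <= len w)"
 hence "w : W12" "len w0 <= len w" using * by blast+
 thus "w = w0" using W12_len[of w] len_w0 by (cases "w = w0") simp_all
qed

text \<open>Starting from nonnegative coordinates k, each letter makes one more direction negative,
  where l contributes nothing, and so costs its weight. As l vanishes at the simple roots, a simple
  direction that is not negative costs its weight as well. Fewer than six letters leave such a
  direction, which gives the - 1.\<close>

lemma kdeg_dominant: assumes "kcons k" "~ kdesc G1 k" "~ kdesc G2 k" "kcons l" "kbox l" "j < 6" "{g, h} = {G1, G2}"
 shows "kdeg (fold kact (alt j g h) k) l + Lword a b (alt j g h) <= 3 * int a + 3 * int b - 1"
 "kdeg k (fold kact (rev (alt j g h)) kzero) = 0"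
proof -
 obtain x1 x2 x3 x4 x5 x6 y1 y2 y3 y4 y5 y6 where kl: "k = (x1, x2, x3, x4, x5, x6)" "l = (y1, y2, y3, y4, y5, y6)"
 by (cases k; cases l)
 have s: "0 <= x1" "0 <= x2" "0 <= x3" "0 <= x4" "0 <= x5" "0 <= x6" "y1 = 0" "y2 = 0" "0 <= y3" "0 <= y4" "0 <= y5" "0 <= y6"
 using assms(1-5) unfolding kl by simp_all
 have j: "j = 0 | j = 1 | j = 2 | j = 3 | j = 4 | j = 5" using assms(6) by auto
 have ab1: "1 <= int a" "1 <= int b" using ab by simp_all
 have gh: "g = G1 & h = G2 | g = G2 & h = G1" using assms(7) by (auto simp: doubleton_eq_iff)
 let ?M = "fold kact (alt j g h) k"
 obtain z1 z2 z3 z4 z5 z6 where M: "?M = (z1, z2, z3, z4, z5, z6)" by (cases ?M)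
 let ?B = "%z y. of_bool (0 < z * y) :: int" and ?c = "int (count_list (alt j g h) G1)"
 have "?B z1 y1 + ?B z3 y3 + ?B z4 y4 <= 3 - ?c - of_bool (0 <= z1)"
 "?B z2 y2 + ?B z5 y5 + ?B z6 y6 <= 3 - (int j - ?c) - of_bool (0 <= z2)"
 proof -
 have 0: "?B z 0 = 0" "z < 0 ==> 0 <= y ==> ?B z y = 0" "?B z y <= 1" for z y :: int
 by (auto simp: pos_mult_iff)
 have Z: "(z1, z2, z3, z4, z5, z6) = fold kact (alt j g h) (x1, x2, x3, x4, x5, x6)" using M kl(1) by simp
 show "?B z1 y1 + ?B z3 y3 + ?B z4 y4 <= 3 - ?c - of_bool (0 <= z1)"
 using j gh Z 0(3)[of z3 y3] 0(3)[of z4 y4] 0(2)[of z3 y3] 0(2)[of z4 y4] s(7,9,10) s(1-6)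
 by (elim disjE conjE; simp add: eval_nat_numeral del: of_bool_less_eq_iff)
 show "?B z2 y2 + ?B z5 y5 + ?B z6 y6 <= 3 - (int j - ?c) - of_bool (0 <= z2)"
 using j gh Z 0(3)[of z5 y5] 0(3)[of z6 y6] 0(2)[of z5 y5] 0(2)[of z6 y6] s(8,11,12) s(1-6)
 by (elim disjE conjE; simp add: eval_nat_numeral del: of_bool_less_eq_iff)
 qed
 from mult_left_mono[OF this(1), of "int a"] mult_left_mono[OF this(2), of "int b"]
 have "kdeg ?M l <= int a * (3 - ?c - of_bool (0 <= z1)) + int b * (3 - (int j - ?c) - of_bool (0 <= z2))"
 unfolding M kl(2) kdeg.simps by linarith
 moreover have "Lword a b (alt j g h) = int a * ?c + int b * (int j - ?c)"
 proof -
 have "Lword a b u = int a * int (count_list u G1) + int b * (int (length u) - int (count_list u G1))" for u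
 by (induction u) (auto simp: algebra_simps)
 from this[of "alt j g h"] show ?thesis by simp
 qed
 moreover have "1 <= int a * of_bool (0 <= z1) + int b * of_bool (0 <= z2)"
 proof -
 have "0 <= z1 | 0 <= z2"
 using j gh M s unfolding kl(1) by (elim disjE conjE) (auto simp: eval_nat_numeral)
 thus ?thesis using ab1 by (cases "0 <= z1"; cases "0 <= z2") simp_all
 qed
 ultimately show "kdeg ?M l + Lword a b (alt j g h) <= 3 * int a + 3 * int b - 1"
 unfolding right_diff_distrib by linarith
 show "kdeg k (fold kact (rev (alt j g h)) kzero) = 0"
 using j gh s unfolding kl by (elim disjE conjE) (simp_all add: eval_nat_numeral pos_mult_iff)
qed

lemma T_T_low: assumes "x : GW" "y : GW" shows "T x**T y : low (Suc (len x + len y))"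
 using assms(2)
proof (induction y rule: right_induct)
 case one thus ?case using assms by (simp add: low_T)
next
 case (step y s)
 have "T x**T (y<.>s) = T x**T y**T s" using step assms by (simp add: hm_T_S hm_assoc)
 thus ?case using low_mult_S[OF step.IH step(2)] len_up[of y s] step by simp
qed

abbreviation "nu \<equiv> 3 * a + 3 * b"

lemma dleH_T_T_nu: "x : GW ==> y : GW ==> dleH (int nu) (T x**T y)"
 using dleH_mono[OF dleH_T_T kdeg_le] by simp

lemma Gamma0_factor: assumes "w : Gamma0"
 obtains x y where "x : GW" "y : GW" "~ kdesc G1 (Ke x)" "~ kdesc G2 (Ke x)"
 "kbox (Ke (ginv y))" "w = x<.>w0<.>y" "len w = len x + 6 + len y" "len (x<.>w0) = len x + 6"
proof -
 obtain z y where zy: "w = z<.>y" "z : GW" "y : GW" "elt [G1] : NG z" "elt [G2] : NG z" "kbox (Ke (ginv y))"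
 using assms by (auto simp: Gamma0_def)
 have l: "len w = len z + len y"
 unfolding zy(1) by (rule len_additive[OF zy(2,3) kdeg_opposite]) (use zy descent kcons_Ke in auto)
 obtain x where "x : GW" "elt [G1] ~: NG x" "elt [G2] ~: NG x" "z = x<.>w0" "len z = len x + 6"
 using both_descents[OF zy(2,4,5)] .
 thus ?thesis using that[of x y] zy l descent by simp
qed

text \<open>Since \<open>C\<^bsub>w\<^sub>0\<^esub> = \<Sum>\<^sub>v q\<^bsup>L(v) - L(w\<^sub>0)\<^esup> T\<^sub>v\<close>, the element \<open>T\<^sub>w\<close> with \<open>w = x w\<^sub>0 y\<close> agrees with
 \<open>T\<^sub>x C\<^bsub>w\<^sub>0\<^esub> T\<^sub>y\<close> up to shorter terms with coefficients of negative degree.\<close>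

lemma Gamma0_expansion: assumes w: "w : Gamma0"
 obtains x y r where "x : GW" "y : GW" "T x**C w0**T y = T w + r" "r : low (len w)" "dleH (- 1) r"
proof -
 obtain x y where xy: "x : GW" "y : GW" "~ kdesc G1 (Ke x)" "~ kdesc G2 (Ke x)"
 "kbox (Ke (ginv y))" "w = x<.>w0<.>y" "len w = len x + 6 + len y" "len (x<.>w0) = len x + 6"
 using Gamma0_factor[OF w] .
 have Kxy: "kcons (Ke x)" "kcons (Ke (ginv y))" using kcons_Ke xy by simp_all
 have keys: "supp (C w0) <= W12"
 using parabolic_struct_const(2)[of "{elt [G1], elt [G2]}" w0 w0] generate_W12 W12_word[of "[G1, G2, G1, G2, G1, G2]"] by simp
 have W12c: "v : GW" if "v : W12" for v using that by (rule W12_cases) (simp_all only: elt_carrier)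
 let ?K = "supp (C w0)"
 let ?f = "%v. scale (coef (C w0) v) (T x**T v**T y)"
 have e: "T x**C w0**T y = (\<Sum>v\<in>?K. ?f v)"
 proof -
 have "T x**C w0 = lincomb (C w0) (%v. T x**T v)" using xy by (intro hm_lincomb_right) simp_all
 hence "T x**C w0**T y = (\<Sum>v\<in>?K. scale (coef (C w0) v) (T x**T v))**T y"
 by (simp add: lincomb_def)
 also have "\<dots> = (\<Sum>v\<in>?K. scale (coef (C w0) v) (T x**T v)**T y)"
 using xy keys W12c by (intro hm_sum_left) auto
 also have "\<dots> = (\<Sum>v\<in>?K. ?f v)" using xy keys W12c by (intro sum.cong) (auto simp: hm_scale_left)
 finally show ?thesis .
 qed
 have top: "?f w0 = T w"
 using xy hm_T_T[of x w0] hm_T_T[of "x<.>w0" y] len_w0 by simp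
 have other: "?f v : low (len w) & dleH (- 1) (?f v)" if v: "v : ?K" "v ~= w0" for v
 proof -
 obtain k g h where k: "v = elt (alt k g h)" "k < 6" "{g, h} = {G1, G2}"
 using W12_cases[OF subsetD[OF keys v(1)]] v(2) by blast
 note kd = kdeg_dominant[OF Kxy(1) xy(3,4) Kxy(2) xy(5) k(2,3)]
 have vi: "Ke (ginv v) = fold kact (rev (alt k g h)) kzero" unfolding k(1) elt_rev[symmetric] Ke_elt ..
 have vc: "v : GW" "len v <= 5" using k len_elt_le[of "alt k g h"] by auto
 have l: "len (x<.>v) = len x + len v" using len_additive[OF xy(1) vc(1)] kd(2) vi by simp
 have Txv: "T x**T v = T (x<.>v)" using hm_T_T[OF xy(1) vc(1) l] .
 have "T (x<.>v)**T y : low (Suc (len (x<.>v) + len y))" using xy vc by (intro T_T_low) simp_all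
 hence A: "?f v : low (len w)" unfolding Txv using xy(7) l vc by (intro low_scale) (auto elim: low_mono)
 have "dle (Lword a b (alt k g h) - 3 * int a - 3 * int b) (coef (C w0) v)"
 using C_w0_coeff[of k g h] k by (simp add: dle_qpow)
 moreover have "dleH (kdeg (Ke (x<.>v)) (Ke (ginv y))) (T (x<.>v)**T y)" using xy vc by (intro dleH_T_T) simp_all
 ultimately have "dleH (Lword a b (alt k g h) - 3 * int a - 3 * int b + kdeg (Ke (x<.>v)) (Ke (ginv y))) (?f v)"
 unfolding Txv by (rule dleH_scale_dle)
 moreover have "Ke (x<.>v) = fold kact (alt k g h) (Ke x)" using k(1) xy by (simp add: Ke_mult)
 ultimately have "dleH (- 1) (?f v)" using kd(1) by (auto elim!: dleH_mono)
 thus ?thesis using A by blast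
 qed
 define r where "r = (\<Sum>v\<in>?K - {w0}. ?f v)"
 have w0K: "w0 : ?K" by (simp add: in_keys_iff)
 have "T x**C w0**T y = T w + r"
 unfolding e r_def using sum.remove[OF finite_keys w0K, of ?f] top by simp
 moreover have "r : low (len w)" "dleH (- 1) r"
 unfolding r_def using other by (intro low_sum dleH_sum; blast)+
 ultimately show ?thesis using that xy by blast
qed

text \<open>The product is T_x h T_y with h the square of \<open>T w0\<close>. Only the component of
  h at w_0 reaches the length of x w_0 y, and its leading coefficient is 1 by
  \<open>top_mult_descents\<close> along a reduced word of w_0.\<close>

lemma top_coeff_w0: assumes x: "x : GW" and y: "y : GW"
 and l: "len (x<.>w0<.>y) = len x + 6 + len y"
 shows "coef (coef (T (x<.>w0)**T (w0<.>y)) (x<.>w0<.>y)) (int nu) = 1"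
proof -
 let ?w = "x<.>w0<.>y"
 have l1: "len (x<.>w0) = len x + 6"
 using len_mult_le[of "x<.>w0" y] len_mult_le[of x w0] x y l len_w0 by simp
 have e: "?w = x<.>(w0<.>y)" using x y by (simp add: G2.m_assoc)
 have l2: "len (w0<.>y) = 6 + len y"
 using len_mult_le[of x "w0<.>y"] len_mult_le[of w0 y] x y l len_w0 unfolding e by simp
 define h where "h = T w0**T w0"
 have h: "h : HC" by (simp add: h_def)
 have "T (x<.>w0) = T x**T w0" "T (w0<.>y) = T w0**T y" using hm_T_T x y l1 l2 len_w0 by simp_all
 hence E: "T (x<.>w0)**T (w0<.>y) = T x**h**T y" using x y by (simp add: h_def hm_assoc)
 have keys: "supp (T w0**T (elt u)) <= W12" if "set u <= {G1, G2}" "len (elt u) = length u" for u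
 using that
 proof (induction u rule: rev_induct)
 case Nil thus ?case using W12_word[of "[G1, G2, G1, G2, G1, G2]"] by (simp add: elt_Nil)
 next
 case (snoc s u)
 have up: "elt [s] ~: NG (elt u)" and lu: "len (elt u) = length u"
 using len_mult_S(1)[of "elt u" "elt [s]"] snoc.prems(2) len_elt_le[of u] by (auto simp: elt_append split: if_splits)
 let ?g = "T w0**T (elt u)"
 have IH: "supp ?g <= W12" using snoc lu by simp
 have "T w0**T (elt (u @ [s])) = ?g**T (elt [s])" using up by (simp add: elt_append hm_T_S hm_assoc)
 moreover have "y : W12" if y: "y : supp (?g**T (elt [s]))" for y
 proof -
 have "?g**T (elt [s]) : HC" by (intro hm_closed) simp_all
 hence yc: "y : GW" using y by (auto simp: HC_def)
 have "coef ?g (y<.>elt [s]) ~= 0 | coef ?g y ~= 0"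
 using y lookup_mult_T_S[of ?g "elt [s]" y] yc by (auto simp: in_keys_iff split: if_splits)
 hence "y<.>elt [s] : W12 | y : W12" using IH by (auto simp: in_keys_iff)
 moreover have "y<.>elt [s] <.> elt [s] = y" using yc by simp
 ultimately show ?thesis using W12_mult[of "y<.>elt [s]" s] snoc.prems(1) by auto
 qed
 ultimately show ?case by auto
 qed
 have K: "supp h <= W12" unfolding h_def by (rule keys) (simp_all add: len_w0)
 let ?f = "%v. scale (coef h v) (T x**T v**T y)"
 have Kc: "v : GW" if "v : supp h" for v using h that by (auto simp: HC_def)
 have "T x**h**T y = (\<Sum>v\<in>supp h. ?f v)"
 proof -
 have "T x**h = lincomb h (%v. T x**T v)" using x h by (intro hm_lincomb_right) simp_all
 hence "T x**h**T y = (\<Sum>v\<in>supp h. scale (coef h v) (T x**T v))**T y"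
 by (simp add: lincomb_def)
 also have "\<dots> = (\<Sum>v\<in>supp h. scale (coef h v) (T x**T v)**T y)"
 using x y Kc by (intro hm_sum_left) auto
 also have "\<dots> = (\<Sum>v\<in>supp h. ?f v)" using x y Kc by (intro sum.cong) (auto simp: hm_scale_left)
 finally show ?thesis .
 qed
 moreover have "coef (?f v) ?w = (if v = w0 then coef h w0 else 0)" if v: "v : supp h" for v
 proof (cases "v = w0")
 case True
 have "T x**T w0**T y = T ?w" using hm_T_T[of x w0] hm_T_T[of "x<.>w0" y] x y l l1 len_w0 by simp
 thus ?thesis using True by (simp add: lookup_T)
 next
 case False
 have lv: "len v < 6" using W12_len K v False by blast
 have "T x**T v : low (Suc (len x + len v))" using x Kc[OF v] by (rule T_T_low)
 have "g**T y : low (n + len y)" if "g : low n" for g n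
 using y
 proof (induction y rule: right_induct)
 case one thus ?case using that low_closed by simp
 next
 case (step y s)
 have "g**T (y<.>s) = g**T y**T s" using step that low_closed by (simp add: hm_T_S hm_assoc)
 thus ?case using low_mult_S[OF step.IH step(2)] len_up[of y s] step by simp
 qed
 from this[OF \<open>T x**T v : _\<close>] have "?w ~: supp (T x**T v**T y)" using lv l by (auto simp: low_def)
 thus ?thesis using False by (simp add: in_keys_iff)
 qed
 ultimately have "coef (T x**h**T y) ?w = coef h w0"
 by (simp add: lookup_sum in_keys_iff)
 moreover have "coef (coef h w0) (int nu) = 1"
 proof -
 let ?ss = "map (%g. elt [g]) [G1, G2, G1, G2, G1, G2]"
 have w: "foldr (<.>) ?ss \<one>\<^bsub>G2t\<^esub> = w0" by (rule wprod_elt)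
 show ?thesis using top_mult_descents[of w0 ?ss, unfolded w] w0_descents L_gen len_w0 by (simp add: h_def algebra_simps)
 qed
 ultimately show ?thesis unfolding E by simp
qed

lemma Gamma0_a: assumes "w : Gamma0" shows "lusztig_a w = nu"
proof -
 obtain x y where xy: "x : GW" "y : GW" "w = x<.>w0<.>y" "len w = len x + 6 + len y"
 using Gamma0_factor[OF assms] .
 show ?thesis
 using top_struct_const[OF dleH_T_T_nu, of "x<.>w0" "w0<.>y" w] top_coeff_w0[of x y] xy
 by (intro lusztig_a_eqI[of nu w "x<.>w0" "w0<.>y"] top_struct_const(1)[OF dleH_T_T_nu]) auto
qed

lemma Gamma0_le_LR: assumes "w : Gamma0" shows "(w, w0) : le_LR" "(w0, w) : le_LR"
proof -
 obtain x y where xy: "x : GW" "y : GW" "w = x<.>w0<.>y" "len w = len x + 6 + len y"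
 using Gamma0_factor[OF assms] .
 show "(w, w0) : le_LR" using le_LR_factor[of x w0 y] xy len_w0 by simp
 let ?i = "%x. ginv x"
 have iw0: "?i w0 = w0" using elt_rev[of "[G1, G2, G1, G2, G1, G2]"] w0_alt by (simp add: eval_nat_numeral)
 have l2: "len (w0<.>y) = 6 + len y"
 proof -
 have "w = x<.>(w0<.>y)" using xy by (simp add: G2.m_assoc)
 thus ?thesis using len_mult_le[of x "w0<.>y"] len_mult_le[of w0 y] xy len_w0 by simp
 qed
 \<comment> \<open>Cyclic symmetry turns the coefficient at w_0 v of the product for w_0 u^-1 and u
   w_0 v into the coefficient at v^-1 w_0 u^-1 of the product for v^-1 w_0 and w_0 u^-1, whose
   leading term is known.\<close>
 have step: "(w0<.>v, u<.>w0<.>v) : le_LR"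
 if uv: "u : GW" "v : GW" "len (u<.>w0<.>v) = len u + 6 + len v" for u v
 proof -
 let ?w = "u<.>w0<.>v" and ?A = "w0 <.> ?i u"
 have i: "?i ?w = ?i v<.>w0 <.> ?i u" "?i (w0<.>v) = ?i v<.>w0"
 using uv by (simp_all add: G2.inv_mult_group iw0 G2.m_assoc)
 have "len (?i v<.>w0 <.> ?i u) = len (?i v) + 6 + len (?i u)"
 using len_inv[of ?w] uv unfolding i(1) by simp
 hence "coef (coef (T ?A**T ?w) (w0<.>v)) (int nu) = 1"
 using lookup_T_T_cyclic[of ?A ?w "w0<.>v"] top_coeff_w0[of "?i v" "?i u"] uv by (simp add: i)
 hence "struct_const ?A ?w (w0<.>v) ~= 0"
 using top_struct_const(2)[OF dleH_T_T_nu, of ?A ?w "w0<.>v"] uv by auto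
 thus ?thesis using le_LR_struct(2)[of ?A ?w] uv by simp
 qed
 have 1: "(w0<.>y, w) : le_LR" using step[of x y] xy by simp
 let ?B = "w0<.>y" and ?D = "?i y<.>w0"
 have "coef (coef (T ?B**T ?D) w0) (int nu) = 1"
 using lookup_T_T_cyclic[of ?B ?D w0] top_coeff_w0[of "\<one>\<^bsub>G2t\<^esub>" y] xy l2
 by (simp add: iw0 G2.inv_mult_group)
 hence "struct_const ?B ?D w0 ~= 0" using top_struct_const(2)[OF dleH_T_T_nu, of ?B ?D w0] xy by auto
 hence "(w0, w0<.>y) : le_LR" using le_LR_struct(1)[of ?B ?D w0] xy by simp
 thus "(w0, w) : le_LR" using 1 le_LR_trans by blast
qed

lemma w0_Gamma0: "w0 : Gamma0"
 unfolding Gamma0_def by (rule CollectI, rule exI[of _ w0], rule exI[of _ "elt []"]) (simp add: w0_descents elt_Nil)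

lemma Gamma0_infinite: "infinite Gamma0"
proof
 assume "finite Gamma0"
 then obtain w where w: "w : Gamma0" "!!v. v : Gamma0 ==> len v <= len w"
 using finite_max_elt[of Gamma0 len] w0_Gamma0 by blast
 have c: "ginv w : GW" using Gamma0_carrier[OF w(1)] by simp
 obtain k1 k2 k3 k4 k5 k6 where k: "Ke (ginv w) = (k1, k2, k3, k4, k5, k6)" by (cases "Ke (ginv w)")
 \<comment> \<open>Negative simple coordinates force the last coordinate to be negative, so the
   three descents never occur together and a longest element cannot exist.\<close>
 have "EX g. ~ kdesc g (Ke (ginv w))"
 proof (rule ccontr)
 assume "~ ?thesis"
 hence "kdesc G0 (Ke (ginv w))" "kdesc G1 (Ke (ginv w))" "kdesc G2 (Ke (ginv w))" by blast+
 thus False using kcons_Ke[OF c] unfolding k by simp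
 qed
 then obtain g where g: "elt [g] ~: NG (ginv w)" using descent[OF c] by blast
 thus False using w(2)[OF Gamma0_left[OF w(1) g]] len_mult_left(2)[OF Gamma0_carrier[OF w(1)] gen_S g] by simp
qed

end

section \<open>Certified matrix computations\<close>

text \<open>A term \<open>(c, x, y, z)\<close> stands for \<open>c q\<^bsup>x a + y b\<^esup> \<zeta>\<^bsup>z\<^esup>\<close>, where \<open>\<zeta>\<close> is the parameter of the coefficient ring.\<close>

type_synonym mon = "int \<times> int \<times> int"
type_synonym pol = "(int \<times> mon) list"
type_synonym gmat = "(nat \<times> pol) list list"

fun cmpm :: "mon => mon => int" where
 "cmpm (x, y, z) (x', y', z') =
 (if x < x' then - 1 else if x' < x then 1 else if y < y' then - 1 else if y' < y then 1 else z - z')"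

text \<open>Merging sorted term lists keeps normal forms, so that equality of lists can serve as the
  test of equality in the checks.\<close>

fun padd :: "pol => pol => pol" where
 "padd [] q = q"
| "padd p [] = p"
| "padd ((c, m) # p) ((d, m') # q) =
 (let k = cmpm m m' in
 if k < 0 then (c, m) # padd p ((d, m') # q)
 else if 0 < k then (d, m') # padd ((c, m) # p) q
 else (let e = c + d in if e = 0 then padd p q else (e, m) # padd p q))"

fun tmul :: "int \<times> mon => int \<times> mon => int \<times> mon" where
 "tmul (c, (x, y, z)) (c', (x', y', z')) = (c * c', (x + x', y + y', z + z'))"

fun pmul :: "pol => pol => pol" where
 "pmul p [] = []"
| "pmul p (m # q) = padd (map (tmul m) p) (pmul p q)"

text \<open>Matrices are sparse and stored by columns: entry j of a \<open>gmat\<close> lists the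
  rows and values of column j, and row vectors are multiplied from the right.\<close>

fun dotc :: "pol list => (nat \<times> pol) list => pol" where
 "dotc v [] = []"
| "dotc v ((m, p) # c) = padd (pmul (v ! m) p) (dotc v c)"

definition vmul :: "pol list => gmat => pol list" where
 "vmul v M = map (dotc v) M"

definition mmul :: "pol list list => gmat => pol list list" where
 "mmul R M = map (%v. vmul v M) R"

definition unit_rows :: "nat => pol list list" where
 "unit_rows d = map (%i. map (%j. if i = j then [(1, (0, 0, 0))] else []) [0..<d]) [0..<d]"

type_synonym grep = "nat \<times> gmat \<times> gmat \<times> gmat"

fun gen_mat :: "grep => gen => gmat" where
 "gen_mat (d, M0, M1, M2) g = (case g of G0 => M0 | G1 => M1 | G2 => M2)"

definition wact :: "grep => gen list => pol list list => pol list list" where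
 "wact rp u R = fold (%g R. mmul R (gen_mat rp g)) u R"

fun gen_mon :: "gen => int => mon" where
 "gen_mon G1 n = (n, 0, 0)"
| "gen_mon G0 n = (0, n, 0)"
| "gen_mon G2 n = (0, n, 0)"

definition smul_rows :: "pol => pol list list => pol list list" where
 "smul_rows p R = map (map (%q. pmul q p)) R"

definition add_rows :: "pol list list => pol list list => pol list list" where
 "add_rows R Q = map2 (map2 padd) R Q"

definition gmat_ok :: "nat => gmat => bool" where
 "gmat_ok d M <-> length M = d & list_all (list_all (%(m, p). m < d)) M"

definition rep_ok :: "grep => bool" where
 "rep_ok rp <-> (let I = unit_rows (fst rp) in
 list_all (%g. gmat_ok (fst rp) (gen_mat rp g) &
 wact rp [g, g] I = add_rows I (smul_rows (padd [(1, gen_mon g 1)] [(- 1, gen_mon g (- 1))]) (wact rp [g] I))) [G0, G1, G2] &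
 list_all (%(g, h). wact rp (alt (mgen g h) g h) I = wact rp (alt (mgen g h) h g) I) [(G0, G1), (G0, G2), (G1, G2)])"

section \<open>Semantics of polynomials and matrices; representations from braid and quadratic
  relations\<close>

context g2_weights begin

definition tsem :: "int \<times> mon => int hk" where
 "tsem t = (case t of (c, (x, y, z)) => sgl (x * int a + y * int b) (sgl z c))"

definition psem :: "pol => int hk" where
 "psem p = (\<Sum>t\<leftarrow>p. tsem t)"

lemma psem_Nil [simp]: "psem [] = 0" and psem_Cons: "psem (t # p) = tsem t + psem p"
 by (simp_all add: psem_def)

lemma psem_padd: "psem (padd p q) = psem p + psem q"
proof (induction p q rule: padd.induct)
 case (3 c m p d m' q)
 show ?case
 proof (cases "cmpm m m' = 0")
 case True
 hence "m = m'" by (cases m; cases m') (auto split: if_splits)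
 moreover have "tsem (c, m) + tsem (d, m) = tsem (c + d, m)"
 by (cases m) (simp add: tsem_def single_add)
 moreover have "c + d = 0 ==> tsem (c + d, m) = 0" by (cases m) (simp add: tsem_def)
 ultimately show ?thesis using 3 True by (auto simp: psem_Cons Let_def algebra_simps simp del: cmpm.simps)
 qed (use 3 in \<open>auto simp: psem_Cons Let_def algebra_simps simp del: cmpm.simps\<close>)
qed auto

lemma tsem_tmul: "tsem (tmul s t) = tsem s * tsem t"
proof -
 obtain c x y z c' x' y' z' where "s = (c, (x, y, z))" "t = (c', (x', y', z'))" by (metis prod_cases4)
 thus ?thesis by (simp add: tsem_def mult_single algebra_simps)
qed
lemma psem_map_tmul: "psem (map (tmul m) p) = tsem m * psem p"
 by (induction p) (simp_all add: psem_Cons tsem_tmul distrib_left)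
lemma psem_pmul: "psem (pmul p q) = psem p * psem q"
 by (induction p q rule: pmul.induct) (simp_all add: psem_padd psem_map_tmul psem_Cons algebra_simps)

definition gsem :: "gmat => nat => nat => int hk" where
 "gsem M m j = (\<Sum>(k, p)\<leftarrow>M ! j. if k = m then psem p else 0)"

lemma psem_dotc: assumes "list_all (%(m, p). m < d) c"
 shows "psem (dotc v c) = (\<Sum>m<d. psem (v ! m) * (\<Sum>(k, p)\<leftarrow>c. if k = m then psem p else 0))"
 using assms
proof (induction v c rule: dotc.induct)
 case (2 v m p c)
 have "(\<Sum>i<d. psem (v ! i) * (if m = i then psem p else 0)) = (\<Sum>i<d. if i = m then psem (v ! m) * psem p else 0)"
 by (rule sum.cong) auto
 also have "\<dots> = psem (v ! m) * psem p" using 2 by simp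
 finally show ?case using 2 by (simp add: psem_padd psem_pmul distrib_left sum.distrib)
qed simp

type_synonym smat = "nat => nat => int hk"

definition repd :: "nat => pol list list => (nat => nat => int hk) => bool" where
 "repd d R A <-> length R = d & (ALL p<d. length (R ! p) = d & (ALL j<d. psem (R ! p ! j) = A p j))"

definition sact :: "grep => gen => (nat => nat => int hk) => nat => nat => int hk" where
 "sact rp g A p j = (if j < fst rp then \<Sum>m<fst rp. A p m * gsem (gen_mat rp g) m j else 0)"

definition sid :: "nat => nat => int hk" where
 "sid p j = (if p = j then 1 else 0)"

lemma tsem_1: "tsem (1, (0, 0, 0)) = 1"
 by (simp add: tsem_def)
lemma repd_unit: "repd d (unit_rows d) sid"
 by (auto simp: repd_def unit_rows_def sid_def psem_Cons tsem_1)

lemma repd_mmul: assumes "repd d R A" "gmat_ok d (gen_mat rp g)" "d = fst rp"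
 shows "repd d (mmul R (gen_mat rp g)) (sact rp g A)"
 using assms unfolding repd_def mmul_def vmul_def gmat_ok_def sact_def
 by (auto simp: psem_dotc[of d] gsem_def list_all_length)

lemma repd_wact: assumes "repd d R A" "!!g. gmat_ok d (gen_mat rp g)" "d = fst rp"
 shows "repd d (wact rp u R) (fold (sact rp) u A)"
 using assms(1)
proof (induction u arbitrary: R A)
 case (Cons g u) thus ?case using repd_mmul[OF Cons.prems assms(2,3)] by (simp add: wact_def)
qed (simp add: wact_def)

lemma repd_unique: "repd d R A ==> repd d R B ==> p < d ==> j < d ==> A p j = B p j"
 unfolding repd_def by metis

lemma repd_smul: "repd d R A ==> repd d (smul_rows p R) (%i j. psem p * A i j)"
 unfolding repd_def smul_rows_def by (auto simp: psem_pmul mult.commute)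

lemma repd_add: "repd d R A ==> repd d Q B ==> repd d (add_rows R Q) (%i j. A i j + B i j)"
 unfolding repd_def add_rows_def by (auto simp: psem_padd)

lemma fold_sact_linear: assumes "u ~= []"
 shows "fold (sact rp) u A p j = (if j < fst rp then \<Sum>m<fst rp. A p m * fold (sact rp) u sid m j else 0)"
 using assms
proof (induction u arbitrary: j rule: rev_induct)
 case (snoc g u)
 show ?case
 proof (cases "u = []")
 case True
 have "sact rp g sid m j = gsem (gen_mat rp g) m j" if "m < fst rp" "j < fst rp" for m
 proof -
 have "sact rp g sid m j = (\<Sum>k<fst rp. if k = m then gsem (gen_mat rp g) m j else 0)"
 unfolding sact_def sid_def if_P[OF that(2)] by (rule sum.cong) auto
 thus ?thesis using that by simp
 qed
 thus ?thesis using True by (simp add: sact_def[of rp g A])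
 next
 case False
 let ?d = "fst rp" and ?T = "gsem (gen_mat rp g)"
 have "fold (sact rp) (u @ [g]) A p j = (if j < ?d then \<Sum>k<?d. (\<Sum>m<?d. A p m * fold (sact rp) u sid m k) * ?T k j else 0)"
 unfolding fold_append comp_def fold.simps id_apply sact_def[of rp g] using snoc.IH[OF False] by (auto intro!: sum.cong)
 also have "\<dots> = (if j < ?d then \<Sum>m<?d. A p m * (\<Sum>k<?d. fold (sact rp) u sid m k * ?T k j) else 0)"
 unfolding sum_distrib_left sum_distrib_right mult.assoc by (subst sum.swap) simp
 finally show ?thesis by (simp add: sact_def[of rp g])
 qed
qed simp

lemma gen_elt_inj: "elt [g] = elt [h] <-> g = h"
proof
 assume "elt [g] = elt [h]"
 hence "Ke (elt [g]) = Ke (elt [h])" by simp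
 thus "g = h" by (cases g; cases h) (auto simp: Ke_elt)
qed simp

definition gen_of :: "gen list set => gen" where "gen_of s = (THE g. s = elt [g])"

lemma gen_of_elt [simp]: "gen_of (elt [g]) = g"
 unfolding gen_of_def by (rule the_equality) (simp_all add: gen_elt_inj)

definition Rm :: "grep => gen list set => nat => nat => int hk" where
 "Rm rp x = fold (sact rp) (SOME u. x = elt u & length u = len x) sid"

lemma rep_ok_braid: assumes "rep_ok rp" "g ~= h"
 shows "fold (sact rp) (alt (mgen g h) g h) A = fold (sact rp) (alt (mgen g h) h g) A"
proof -
 let ?d = "fst rp" and ?I = "unit_rows (fst rp)"
 have ok: "gmat_ok ?d (gen_mat rp g)" for g using assms(1) by (cases g) (simp_all add: rep_ok_def Let_def)
 have m: "mgen g h = mgen h g" "0 < mgen g h" by (cases g; cases h; simp)+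
 have e: "wact rp (alt (mgen g h) g h) ?I = wact rp (alt (mgen g h) h g) ?I"
 using assms by (cases g; cases h) (simp_all add: rep_ok_def Let_def)
 have 1: "fold (sact rp) (alt (mgen g h) g h) sid p j = fold (sact rp) (alt (mgen g h) h g) sid p j" if "p < ?d" "j < ?d" for p j
 by (rule repd_unique[OF repd_wact[OF repd_unit ok HOL.refl] _ that]) (unfold e, rule repd_wact[OF repd_unit ok HOL.refl])
 have ne: "alt (mgen g h) g h ~= []" "alt (mgen g h) h g ~= []" using m(2) by (cases "mgen g h"; simp)+
 show ?thesis
 by (intro ext, subst (1 2) fold_sact_linear) (use ne 1 in \<open>auto intro!: sum.cong\<close>)
qed

text \<open>The braid relations tested by \<open>rep_ok\<close> let Matsumoto's theorem apply, so
  the reduced word chosen in \<open>Rm\<close> does not matter.\<close>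

lemma Rm_elt: assumes ok: "rep_ok rp" and l: "len (elt u) = length u" shows "Rm rp (elt u) = fold (sact rp) u sid"
proof -
 define v where "v = (SOME v. elt u = elt v & length v = len (elt u))"
 have v: "elt u = elt v" "length v = len (elt u)"
 using someI[of "%v. elt u = elt v & length v = len (elt u)" u] l unfolding v_def by simp_all
 let ?f = "%g. elt [g]" and ?act = "%s. sact rp (gen_of s)"
 have fm: "fold ?act (map ?f w) A = fold (sact rp) w A" for w A
 by (induction w arbitrary: A) simp_all
 have "fold ?act (map ?f v) sid = fold ?act (map ?f u) sid"
 proof (rule matsumoto)
 fix s t assume "s : G2t_gens" "t : G2t_gens" "s ~= t"
 then obtain g h where gh: "s = elt [g]" "t = elt [h]" "g ~= h" by (auto simp: gens_eq)
 let ?m = "mgen g h"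
 have "ALL A. fold ?act (alt ?m s t) A = fold ?act (alt ?m t s) A"
 unfolding gh(1,2) map_alt[of ?f, symmetric] fm using rep_ok_braid[OF ok gh(3)] by simp
 moreover have "foldr (<.>) (alt ?m s t) \<one>\<^bsub>G2t\<^esub> = foldr (<.>) (alt ?m t s) \<one>\<^bsub>G2t\<^esub>"
 unfolding gh(1,2) wprod_alt_elt using elt_alt_mgen[OF gh(3)] .
 moreover have "t ~: NG (x<.>foldr (<.>) (alt k s t) \<one>\<^bsub>G2t\<^esub>) & s ~: NG (x<.>foldr (<.>) (alt k t s) \<one>\<^bsub>G2t\<^esub>)"
 if "x : GW" "k < ?m" "s ~: NG x" "t ~: NG x" for x k
 proof -
 have "mgen h g = ?m" by (cases g; cases h) simp_all
 thus ?thesis using that descent kdesc_alt[of "Ke x" g h k] kdesc_alt[of "Ke x" h g k] kcons_Ke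
 unfolding gh(1,2) wprod_alt_elt by (simp add: Ke_mult)
 qed
 moreover have "0 < ?m" by (cases g; cases h) simp_all
 ultimately show "EX m>0. (ALL A. fold ?act (alt m s t) A = fold ?act (alt m t s) A) &
 foldr (<.>) (alt m s t) \<one>\<^bsub>G2t\<^esub> = foldr (<.>) (alt m t s) \<one>\<^bsub>G2t\<^esub> &
 (ALL u:GW. ALL k<m. s ~: NG u --> t ~: NG u -->
 t ~: NG (u<.>foldr (<.>) (alt k s t) \<one>\<^bsub>G2t\<^esub>) & s ~: NG (u<.>foldr (<.>) (alt k t s) \<one>\<^bsub>G2t\<^esub>))" by blast
 qed (use v l in \<open>auto simp: wprod_elt gens_eq\<close>)
 thus ?thesis unfolding fm Rm_def v_def[symmetric] .
qed

lemma xi_psem: "emb (xi (elt [g])) = psem (padd [(1, gen_mon g 1)] [(- 1, gen_mon g (- 1))])"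
proof -
 have "sgl k (- 1 :: laurent) = - sgl k 1" for k :: int
 by (simp add: single_uminus)
 moreover have "sgl (0::int) (- 1 :: int) = - 1" by (simp add: single_uminus)
 ultimately show ?thesis
 by (cases g) (simp_all add: xi_def emb_diff qpow_def emb_single L_gen psem_padd psem_Cons tsem_def)
qed

lemma rep_ok_hecke_rep: assumes ok: "rep_ok rp" shows "hecke_rep G2t G2t_gens L NG (Rm rp) (fst rp)"
proof -
 let ?d = "fst rp" and ?I = "unit_rows (fst rp)"
 have gok: "gmat_ok ?d (gen_mat rp g)" for g using ok by (cases g) (simp_all add: rep_ok_def Let_def)
 have lin: "sact rp g A p j = (\<Sum>m<?d. A p m * sact rp g sid m j)" if "j < ?d" for g A p j
 using fold_sact_linear[of "[g]" rp A p j] that by simp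
 have one: "Rm rp \<one>\<^bsub>G2t\<^esub> = sid" using Rm_elt[OF ok, of "[]"] by (simp add: elt_Nil)
 have len1: "len (elt [g]) = 1" for g
 using kreduced_len[of "\<one>\<^bsub>G2t\<^esub>" "[g]"] by (cases g) simp_all
 have gen: "Rm rp (elt [g]) = sact rp g sid" for g using Rm_elt[OF ok, of "[g]"] len1 by simp
 show ?thesis
 proof (intro hecke_rep.intro hecke_rep_axioms.intro coxeter_axioms)
 show "Rm rp \<one>\<^bsub>G2t\<^esub> p j = (if p = j then 1 else 0)" for p j by (simp add: one sid_def)
 show "Rm rp (w<.>s) p j = (\<Sum>m<?d. Rm rp w p m * Rm rp s m j)"
 if w: "w : GW" "s : G2t_gens" "s ~: NG w" "p < ?d" "j < ?d" for w s p j
 proof -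
 obtain g where g: "s = elt [g]" using w(2) by (auto simp: gens_eq)
 obtain u where u: "w = elt u" "length u = len w" using reduced_elt[OF w(1)] .
 have "Rm rp (elt (u @ [g])) = sact rp g (fold (sact rp) u sid)"
 using Rm_elt[OF ok, of "u @ [g]"] len_up[OF w(1-3)] u g by (simp add: elt_append)
 thus ?thesis using Rm_elt[OF ok, of u] u g gen w lin[of j g "Rm rp w" p] by (simp add: elt_append)
 qed
 show "(\<Sum>m<?d. Rm rp s p m * Rm rp s m j) = (if p = j then 1 else 0) + emb (xi s) * Rm rp s p j"
 if s: "s : G2t_gens" "p < ?d" "j < ?d" for s p j
 proof -
 obtain g where g: "s = elt [g]" using s(1) by (auto simp: gens_eq)
 let ?x = "padd [(1, gen_mon g 1)] [(- 1, gen_mon g (- 1))]"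
 have "wact rp [g, g] ?I = add_rows ?I (smul_rows ?x (wact rp [g] ?I))"
 using ok by (cases g) (simp_all add: rep_ok_def Let_def)
 hence "repd ?d (wact rp [g, g] ?I) (%i j. sid i j + psem ?x * fold (sact rp) [g] sid i j)"
 using repd_add[OF repd_unit repd_smul[OF repd_wact[OF repd_unit gok HOL.refl, where u = "[g]"], where p = ?x]] by (simp only:)
 hence "fold (sact rp) [g, g] sid p j = sid p j + psem ?x * fold (sact rp) [g] sid p j"
 by (rule repd_unique[OF repd_wact[OF repd_unit gok HOL.refl] _ s(2,3)])
 thus ?thesis using lin[OF s(3), of g "sact rp g sid" p] gen g by (simp add: sid_def xi_psem)
 qed
 qed
qed

end

section \<open>Leading coefficient matrices\<close>

text \<open>Sparse matrices over \<open>\<int>[\<zeta>, \<zeta>\<^sup>-\<^sup>1]\<close>: the term \<open>((i, j, e), c)\<close> contributes \<open>c \<zeta>\<^sup>e\<close> to the entry \<open>(i, j)\<close>.\<close>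

type_synonym zkey = "nat \<times> nat \<times> int"
type_synonym zmat = "(zkey \<times> int) list"

fun zins :: "zkey \<times> int => zmat => zmat" where
 "zins t [] = [t]"
| "zins (k, c) ((k', d) # M) = (if k = k' then (let e = c + d in if e = 0 then M else (k, e) # M) else (k', d) # zins (k, c) M)"

definition zadd :: "zmat => zmat => zmat" where
 "zadd M N = foldr zins M N"

fun zrow :: "zkey \<times> int => zmat => zmat => zmat" where
 "zrow t [] R = R"
| "zrow ((i, j, e), c) (((k, l, f), d) # N) R =
 (if j = k then zins ((i, l, e + f), c * d) (zrow ((i, j, e), c) N R) else zrow ((i, j, e), c) N R)"

definition zprod :: "zmat => zmat => zmat" where
 "zprod M N = foldr (%t R. zrow t N R) M []"

definition zscale :: "int => int => zmat => zmat" where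
 "zscale g s M = map (%((i, j, e), c). ((i, j, e + s), g * c)) M"

definition zeq :: "zmat => zmat => bool" where
 "zeq M N <-> zadd M (zscale (- 1) 0 N) = []"

definition zcoef :: "zmat => zkey => int" where
 "zcoef M k = (case map_of M k of None => 0 | Some c => c)"

fun zpow :: "zmat => nat => zmat => zmat" where
 "zpow G 0 V = V"
| "zpow G (Suc n) V = zprod G (zpow G n V)"

definition zsem :: "zmat => nat => nat => laurent" where
 "zsem M i j = (\<Sum>((k, l, e), c)\<leftarrow>M. if k = i & l = j then sgl e c else 0)"

lemma zsem_Nil [simp]: "zsem [] i j = 0"
 and zsem_Cons: "zsem (((k, l, e), c) # M) i j = (if k = i & l = j then sgl e c else 0) + zsem M i j"
 by (simp_all add: zsem_def)
lemma zsem_append: "zsem (M @ N) i j = zsem M i j + zsem N i j"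
 by (simp add: zsem_def)

lemma zsem_zins: "zsem (zins t M) i j = zsem [t] i j + zsem M i j"
proof (induction t M rule: zins.induct)
 case (1 t) thus ?case by simp
next
 case (2 k c k' d M)
 obtain p l e p' l' e' where k: "k = (p, l, e)" "k' = (p', l', e')" by (cases k; cases k') auto
 show ?case
 proof (cases "k = k'")
 case True
 have "sgl e c + sgl e d = sgl e (c + d)" by (simp add: single_add)
 moreover have "c + d = 0 ==> sgl e c + sgl e d = 0" by (simp flip: single_add)
 ultimately show ?thesis using True unfolding k by (auto simp: zsem_Cons Let_def add.assoc[symmetric])
 next
 case False thus ?thesis using 2 unfolding k by (auto simp: zsem_Cons)
 qed
qed

lemma zsem_zadd: "zsem (zadd M N) i j = zsem M i j + zsem N i j"
proof -
 have 1: "zsem (t # M) i j = zsem [t] i j + zsem M i j" for t M using zsem_append[of "[t]" M i j] by simp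
 show ?thesis unfolding zadd_def by (induction M) (simp_all add: zsem_zins 1[of _ "_ # _"] 1[of _ M] add.assoc, metis 1 add.assoc)
qed

lemma zsem_zrow: "zsem (zrow ((p, m, e), c) N R) i j =
 (if p = i then sgl e c * zsem N m j else 0) + zsem R i j"
proof (induction N)
 case (Cons t N)
 obtain k l f d where t: "t = ((k, l, f), d)" by (cases t, cases "fst t") auto
 show ?case using Cons unfolding t by (auto simp: zsem_zins zsem_Cons mult_single distrib_left add.assoc)
qed simp

lemma zsem_zprod: assumes "!!p m e c. ((p, m, e), c) : set M ==> m < d"
 shows "zsem (zprod M N) i j = (\<Sum>m<d. zsem M i m * zsem N m j)"
 using assms unfolding zprod_def
proof (induction M)
 case (Cons t M)
 obtain p m e c where t: "t = ((p, m, e), c)" by (cases t, cases "fst t") auto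
 have m: "m < d" using Cons.prems t by force
 have "(\<Sum>k<d. (if p = i & m = k then sgl e c else 0) * zsem N k j) =
 (\<Sum>k<d. if k = m then (if p = i then sgl e c * zsem N m j else 0) else 0)"
 by (rule sum.cong) auto
 also have "\<dots> = (if p = i then sgl e c * zsem N m j else 0)" using m by simp
 moreover have "zsem (foldr (%t R. zrow t N R) M []) i j = (\<Sum>m<d. zsem M i m * zsem N m j)"
 by (rule Cons.IH) (use Cons.prems in \<open>meson list.set_intros(2)\<close>)
 ultimately show ?case unfolding t by (simp add: zsem_zrow zsem_Cons distrib_right sum.distrib)
qed simp

lemma zsem_zscale: "zsem (zscale g s M) i j = sgl s g * zsem M i j"
 unfolding zscale_def by (induction M) (auto simp: zsem_Cons mult_single distrib_left add.commute split: prod.splits)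

lemma zeq_zsem: "zeq M N ==> zsem M i j = zsem N i j"
proof -
 assume "zeq M N"
 hence "zsem (zadd M (zscale (- 1) 0 N)) i j = 0" by (simp add: zeq_def)
 moreover have "sgl (0 :: int) (- 1 :: int) = - 1" by (simp add: single_uminus)
 ultimately show ?thesis by (simp add: zsem_zadd zsem_zscale)
qed

lemma lookup_zsem: assumes "distinct (map fst M)" shows "coef (zsem M i j) e = zcoef M (i, j, e)"
 using assms
proof (induction M)
 case (Cons t M)
 obtain k l f d where t: "t = ((k, l, f), d)" by (cases t, cases "fst t") auto
 have IH: "coef (zsem M i j) e = zcoef M (i, j, e)" using Cons by simp
 have d: "(k, l, f) ~: fst ` set M" using Cons.prems t by simp
 show ?case
 proof (cases "(k, l, f) = (i, j, e)")
 case True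
 hence "map_of M (i, j, e) = None" using d by (simp add: map_of_eq_None_iff)
 thus ?thesis using True IH unfolding t by (simp add: zsem_Cons lookup_add zcoef_def)
 next
 case False
 thus ?thesis using IH unfolding t by (auto simp: zsem_Cons lookup_add lookup_single when_def zcoef_def)
 qed
qed (simp add: zcoef_def)

section \<open>Degree bounds tested on the rays of a face\<close>

type_synonym ray = "int \<times> int"

definition rval :: "int \<times> int => ray => int" where
 "rval x l = fst x * fst l + snd x * snd l"

text \<open>A monomial is compared with its bound on each ray. Started with \<open>True\<close>, the
  result is \<open>None\<close> if it exceeds the bound somewhere, \<open>Some True\<close> if it
  attains it everywhere, and \<open>Some False\<close> otherwise.\<close>

fun tcmp :: "(ray \<times> int) list => int => int => bool => bool option" where
 "tcmp [] x y t = Some t"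
| "tcmp (((l, l'), B) # bs) x y t =
 (let v = x * l + y * l' in if v = B then tcmp bs x y t else if v < B then tcmp bs x y False else None)"

fun dscan :: "(ray \<times> int) list => pol => (int \<times> int) list option" where
 "dscan bs [] = Some []"
| "dscan bs ((c, (x, y, z)) # p) = (case tcmp bs x y True of None => None
 | Some t => (case dscan bs p of None => None | Some T => Some (if t then (c, z) # T else T)))"

fun rscan :: "ray list => nat => nat => int list => int list list => pol list => zmat => zmat option" where
 "rscan rays i j rv [] [] Z = Some Z"
| "rscan rays i j rv (sv # ss) (p # ps) Z = (case rscan rays i (Suc j) rv ss ps Z of None => None
 | Some Z' => if p = [] then Some Z' else
 (case dscan (zip rays (map2 (+) rv sv)) p of None => None
 | Some T => Some (foldr (%(c, z). zins ((i, j, z), c)) T Z')))"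
| "rscan rays i j rv ss ps Z = None"

fun sscan :: "ray list => nat => int list list => int list list => pol list list => zmat option" where
 "sscan rays i [] cvs [] = Some []"
| "sscan rays i (rv # rvs) cvs (v # R) = (case sscan rays (Suc i) rvs cvs R of None => None
 | Some Z => rscan rays i 0 rv cvs v Z)"
| "sscan rays i rvs cvs R = None"

definition pneg2 :: "int \<times> int => int \<times> int" where
 "pneg2 x = (- fst x, - snd x)"

definition rvals :: "ray list => (int \<times> int) list => int list list" where
 "rvals rays xs = map (%x. map (rval x) rays) xs"

text \<open>Dual form of the statement that (a, b) lies in the relative interior of the cone spanned
  by the rays.\<close>

definition cone :: "ray list => nat => nat => bool" where
 "cone rays a b <-> (ALL x. (ALL l:set rays. rval x l <= 0) -->
 rval x (int a, int b) <= 0 & ((EX l:set rays. rval x l ~= 0) --> rval x (int a, int b) < 0))"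

lemma rval_pneg2: "rval (pneg2 x) l = - rval x l"
 by (simp add: rval_def pneg2_def)

lemma cone_le: assumes "cone rays a b" "!!l. l : set rays ==> rval x l <= rval y l"
 shows "rval x (int a, int b) <= rval y (int a, int b)"
 "(EX l:set rays. rval x l ~= rval y l) ==> rval x (int a, int b) < rval y (int a, int b)"
proof -
 have 1: "rval (fst x - fst y, snd x - snd y) l = rval x l - rval y l" for l by (simp add: rval_def algebra_simps)
 have 2: "ALL l:set rays. rval (fst x - fst y, snd x - snd y) l <= 0" using assms(2) by (simp add: 1)
 note c = mp[OF spec[OF assms(1)[unfolded cone_def]] 2, unfolded 1]
 show "rval x (int a, int b) <= rval y (int a, int b)" using c by simp
 show "(EX l:set rays. rval x l ~= rval y l) ==> rval x (int a, int b) < rval y (int a, int b)" using c by auto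
qed

lemma cone_eq: assumes "cone rays a b" "!!l. l : set rays ==> rval x l = rval y l"
 shows "rval x (int a, int b) = rval y (int a, int b)"
 using cone_le(1)[OF assms(1), of x y] cone_le(1)[OF assms(1), of y x] assms(2) by force

locale g2_cone = g2_weights +
 fixes rays :: "ray list"
 assumes cone: "cone rays a b"
begin

abbreviation ev :: "int \<times> int => int" where "ev x \<equiv> rval x (int a, int b)"

lemma tcmp_Some: "tcmp (map (%l. (l, f l)) ls) x y t = Some t' ==>
 (ALL l:set ls. rval (x, y) l <= f l) & (t' <-> t & (ALL l:set ls. rval (x, y) l = f l))"
proof (induction ls arbitrary: t)
 case (Cons l ls) thus ?case by (cases l) (auto simp: Let_def rval_def split: if_splits)
qed simp

lemma dscan_sound: assumes "dscan (map (%l. (l, rval B l + rval B' l)) rays) p = Some Q"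
 shows "dle (ev B + ev B') (psem p) & coef (psem p) (ev B + ev B') = (\<Sum>(c, z)\<leftarrow>Q. sgl z c)"
 using assms
proof (induction p arbitrary: Q)
 case (Cons m p)
 obtain c x y z where m: "m = (c, (x, y, z))" by (metis prod_cases4)
 obtain t Q' where t: "tcmp (map (%l. (l, rval B l + rval B' l)) rays) x y True = Some t"
 "dscan (map (%l. (l, rval B l + rval B' l)) rays) p = Some Q'" "Q = (if t then (c, z) # Q' else Q')"
 using Cons.prems m by (auto split: option.splits)
 let ?B = "(fst B + fst B', snd B + snd B')"
 have B: "rval ?B l = rval B l + rval B' l" for l by (simp add: rval_def algebra_simps)
 have le: "!!l. l : set rays ==> rval (x, y) l <= rval ?B l" and tt: "t <-> (ALL l:set rays. rval (x, y) l = rval ?B l)"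
 using tcmp_Some[OF t(1)] by (auto simp: B)
 note IH = Cons.IH[OF t(2)]
 have ts: "tsem m = sgl (ev (x, y)) (sgl z c)" by (simp add: tsem_def m rval_def)
 have 1: "dle (ev ?B) (tsem m)" unfolding ts using cone_le(1)[OF cone le] by (simp add: dle_single)
 have 2: "coef (tsem m) (ev ?B) = (if t then sgl z c else 0)"
 proof (cases t)
 case True
 hence "ev (x, y) = ev ?B" using tt by (intro cone_eq[OF cone]) auto
 thus ?thesis unfolding ts using True by (simp add: lookup_single)
 next
 case False
 hence "ev (x, y) < ev ?B" using tt by (intro cone_le(2)[OF cone le]) auto
 thus ?thesis unfolding ts using False by (simp add: lookup_single when_def)
 qed
 show ?case using IH 1 2 unfolding psem_Cons lookup_add B by (auto simp: t(3) intro!: dle_add)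
qed simp

lemma zsem_foldr_zins: "zsem (foldr (%(c, z). zins ((i, j, z), c)) Q Z) k l =
 (if k = i & l = j then \<Sum>(c, z)\<leftarrow>Q. sgl z c else 0) + zsem Z k l"
 by (induction Q) (auto simp: zsem_zins zsem_Cons add.assoc)

lemma rscan_sound: assumes "rscan rays i j (map (rval r) rays) (rvals rays cb) ps Z = Some Z'"
 shows "length cb = length ps & (ALL l<length ps. dle (ev r + ev (cb ! l)) (psem (ps ! l))) &
 (ALL k l. zsem Z' k l = (if k = i & j <= l & l < j + length ps
 then coef (psem (ps ! (l - j))) (ev r + ev (cb ! (l - j))) else 0) + zsem Z k l)"
 using assms
proof (induction ps arbitrary: cb j Z')
 case Nil thus ?case by (cases cb) (auto simp: rvals_def)
next
 case (Cons p ps)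
 obtain s cb' where cb: "cb = s # cb'" using Cons.prems by (cases cb) (auto simp: rvals_def)
 obtain Y where Y: "rscan rays i (Suc j) (map (rval r) rays) (rvals rays cb') ps Z = Some Y"
 using Cons.prems cb by (auto simp: rvals_def split: option.splits)
 have zb: "zip rays (map2 (+) (map (rval r) rays) (map (rval s) rays)) = map (%l. (l, rval r l + rval s l)) rays"
 by (induction rays) auto
 have p: "dle (ev r + ev s) (psem p) &
 (ALL k l. zsem Z' k l = (if k = i & l = j then coef (psem p) (ev r + ev s) else 0) + zsem Y k l)"
 proof (cases "p = []")
 case True thus ?thesis using Cons.prems Y cb by (auto simp: rvals_def)
 next
 case False
 then obtain Q where T: "dscan (map (%l. (l, rval r l + rval s l)) rays) p = Some Q"
 "Z' = foldr (%(c, z). zins ((i, j, z), c)) Q Y"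
 using Cons.prems Y cb by (auto simp: rvals_def zb split: option.splits)
 show ?thesis using dscan_sound[OF T(1)] unfolding T(2) zsem_foldr_zins by auto
 qed
 note IH = Cons.IH[OF Y]
 have d: "dle (ev r + ev (cb ! l)) (psem ((p # ps) ! l))" if "l < length (p # ps)" for l
 using that IH p cb by (cases l) auto
 have "zsem Z' k l = (if k = i & j <= l & l < j + length (p # ps)
 then coef (psem ((p # ps) ! (l - j))) (ev r + ev (cb ! (l - j))) else 0) + zsem Z k l" for k l
 proof (cases "l = j")
 case True thus ?thesis using IH p cb by auto
 next
 case False
 show ?thesis
 proof (cases "j < l")
 case True
 hence "l - j = Suc (l - Suc j)" by simp
 thus ?thesis using IH p cb False True by auto
 qed (use IH p cb False in auto)
 qed
 thus ?case using d IH cb by auto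
qed

lemma sscan_sound: assumes "sscan rays i (rvals rays rb) (rvals rays cb) R = Some Z"
 shows "length rb = length R &
 (ALL p<length R. length cb = length (R ! p) & (ALL j<length cb. dle (ev (rb ! p) + ev (cb ! j)) (psem (R ! p ! j)))) &
 (ALL k j. zsem Z k j = (if i <= k & k < i + length R & j < length cb
 then coef (psem (R ! (k - i) ! j)) (ev (rb ! (k - i)) + ev (cb ! j)) else 0))"
 using assms
proof (induction R arbitrary: rb i Z)
 case Nil thus ?case by (cases rb) (auto simp: rvals_def)
next
 case (Cons v R)
 obtain r rb' where rb: "rb = r # rb'" using Cons.prems by (cases rb) (auto simp: rvals_def)
 obtain Y where Y: "sscan rays (Suc i) (rvals rays rb') (rvals rays cb) R = Some Y"
 "rscan rays i 0 (map (rval r) rays) (rvals rays cb) v Y = Some Z"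
 using Cons.prems rb by (auto simp: rvals_def split: option.splits)
 note IH = Cons.IH[OF Y(1)] and r = rscan_sound[OF Y(2)]
 have "length cb = length ((v # R) ! p) & (ALL j<length cb. dle (ev (rb ! p) + ev (cb ! j)) (psem ((v # R) ! p ! j)))"
 if "p < length (v # R)" for p
 using that IH r rb by (cases p) auto
 moreover have "zsem Z k j = (if i <= k & k < i + length (v # R) & j < length cb
 then coef (psem ((v # R) ! (k - i) ! j)) (ev (rb ! (k - i)) + ev (cb ! j)) else 0)" for k j
 proof (cases "k = i")
 case True thus ?thesis using IH r rb by auto
 next
 case False
 show ?thesis
 proof (cases "i < k")
 case True
 hence "k - i = Suc (k - Suc i)" by simp
 thus ?thesis using IH r rb False True by auto
 qed (use IH r False in auto)
 qed
 ultimately show ?case using IH rb by auto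
qed

lemma scan_sound: assumes R: "repd d R A" and ok: "sscan rays 0 (rvals rays rb) (rvals rays cb) R = Some Z" and pj: "p < d" "j < d"
 shows "dle (ev (rb ! p) + ev (cb ! j)) (A p j)" "coef (A p j) (ev (rb ! p) + ev (cb ! j)) = zsem Z p j"
 using sscan_sound[OF ok] R pj unfolding repd_def by auto

end

text \<open>The index bounds and the distinctness of keys that the lemmas on \<open>zprod\<close> and \<open>zcoef\<close> need.\<close>

definition zwf :: "nat => zmat => bool" where
 "zwf d M <-> distinct (map fst M) & (ALL ((p, j, e), c):set M. p < d & j < d)"

lemma zins_keys: "fst ` set (zins t M) <= insert (fst t) (fst ` set M)"
 by (induction t M rule: zins.induct) (auto simp: Let_def)

lemma zins_distinct: "distinct (map fst M) ==> distinct (map fst (zins t M))"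
proof (induction t M rule: zins.induct)
 case (2 k c k' d M)
 show ?case
 proof (cases "k = k'")
 case False
 hence "k' ~: fst ` set (zins (k, c) M)" using zins_keys[of "(k, c)" M] 2(2) by auto
 thus ?thesis using False 2 by simp
 qed (use 2 in \<open>auto simp: Let_def\<close>)
qed simp

lemma zwf_keys: "zwf d M <-> distinct (map fst M) & fst ` set M <= {(p, j, e). p < d & j < d}"
 unfolding zwf_def by (rule conj_cong) (auto simp: case_prod_beta)

lemma zwf_zins: "zwf d M ==> p < d ==> j < d ==> zwf d (zins ((p, j, e), c) M)"
 unfolding zwf_keys using zins_keys[of "((p, j, e), c)" M] zins_distinct by fastforce

lemma rscan_zwf: "rscan rays i j rv ss ps Z = Some Z' ==> zwf d Z ==> i < d ==> j + length ps <= d ==> zwf d Z'"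
proof (induction rays i j rv ss ps Z arbitrary: Z' rule: rscan.induct)
 case (2 rays i j rv sv ss p ps Z)
 obtain Y where Y: "rscan rays i (Suc j) rv ss ps Z = Some Y" using 2(2) by (auto split: option.splits)
 have wY: "zwf d Y" using 2(1)[OF Y 2(3,4)] 2(5) by simp
 have "zwf d (foldr (%(c, z). zins ((i, j, z), c)) Q Y)" for Q
 using 2(4,5) wY by (induction Q) (auto intro: zwf_zins)
 thus ?case using 2(2) Y wY by (auto split: if_splits option.splits)
qed auto

lemma sscan_zwf: "sscan rays i rvs cvs R = Some Z ==> length cvs <= d ==> i + length R <= d ==> zwf d Z"
proof (induction rays i rvs cvs R arbitrary: Z rule: sscan.induct)
 case (2 rays i rv rvs cvs v R)
 obtain Y where Y: "sscan rays (Suc i) rvs cvs R = Some Y" "rscan rays i 0 rv cvs v Y = Some Z"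
 using 2(2) by (auto split: option.splits)
 have "rscan rays i j rv ss ps X = Some X' ==> length ps = length ss" for j ss ps X X'
 by (induction rays i j rv ss ps X arbitrary: X' rule: rscan.induct) (auto split: option.splits)
 hence "length v = length cvs" using Y(2) .
 thus ?case using rscan_zwf[OF Y(2), of d] 2(1)[OF Y(1)] 2(3,4) by simp
qed (auto simp: zwf_def)

section \<open>The elements outside the lowest two-sided cell\<close>

text \<open>Outside the lowest two-sided cell there are the elements of a finite tree of words and two families of
 words \<open>u\<^sup>-\<^sup>1 d t\<^sup>n v\<close>.\<close>

text \<open>The tree is traversed in preorder; \<open>(k, g)\<close> leaves \<open>k\<close> nodes and then follows the edge \<open>g\<close>.\<close>

fun walk :: "('x => gen => 'x) => ('x => 'y) => 'x list => (nat \<times> gen) list => 'y list" where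
 "walk f r st [] = [r (hd st)]"
| "walk f r st ((k, g) # ts) = r (hd st) # walk f r (f (hd (drop k st)) g # drop k st) ts"

definition fin_tree :: "(nat \<times> gen) list" where
 "fin_tree = [(0,G0), (0,G1), (0,G2), (0,G0), (1,G1), (0,G2), (0,G0), (1,G1), (0,G0), (0,G2), (0,G1), (0,G2), (0,G0),
 (10,G2), (0,G0), (0,G1), (0,G2), (0,G0), (1,G1), (0,G2), (0,G0), (6,G1), (0,G2), (0,G0), (0,G1), (0,G2),
 (0,G0), (1,G1), (0,G2), (0,G0), (1,G1), (0,G0), (0,G2), (0,G1), (0,G2), (0,G0), (11,G1), (0,G2), (0,G0),
 (7,G1), (0,G2), (0,G0), (0,G1), (0,G2), (0,G0), (1,G1), (0,G2), (0,G0), (1,G1), (0,G0), (0,G2), (0,G1),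
 (0,G2), (0,G0), (11,G1), (0,G2), (0,G0), (1,G1), (0,G0), (0,G2), (0,G1), (0,G2), (0,G0), (10,G2), (0,G0),
 (0,G1), (0,G2), (0,G0), (1,G1), (0,G2), (0,G0), (1,G1), (0,G0), (0,G2), (0,G1), (0,G2), (0,G0), (11,G1),
 (0,G2), (0,G0), (0,G1), (0,G2), (0,G0), (1,G1), (0,G2), (0,G0), (1,G1), (0,G0), (0,G2), (0,G1), (0,G2),
 (0,G0), (11,G1), (0,G2), (0,G0)]"

definition fam_d :: "nat => gen list" where
 "fam_d k = (if k = 0 then [G0, G1] else [G1, G2, G1, G2, G1])"

definition fam_t :: "nat => gen list" where
 "fam_t k = (if k = 0 then [G2, G0, G1] else [G0, G2, G1, G2, G1])"

definition fam_V :: "nat => gen list list" where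
 "fam_V k = (if k = 0 then [[], [G2], [G2, G0], [G2, G1], [G2, G1, G2], [G2, G1, G2, G0]]
 else [[], [G0], [G0, G2], [G0, G2, G1], [G0, G2, G1, G2], [G0, G2, G1, G2, G0]])"

definition fin_words :: "gen list list" where
 "fin_words = walk (%w g. w @ [g]) (%w. w) [[]] fin_tree"

datatype code = Fn nat | Fm nat nat nat nat

definition fam_pre :: "nat => nat => gen list" where
 "fam_pre k u = rev (fam_V k ! u) @ fam_d k"

fun code_word :: "code => gen list" where
 "code_word (Fn i) = fin_words ! i"
| "code_word (Fm k u n v) = fam_pre k u @ concat (replicate n (fam_t k)) @ fam_V k ! v"

fun valid :: "code => bool" where
 "valid (Fn i) <-> i < length fin_words"
| "valid (Fm k u n v) <-> k < 2 & u < 6 & v < 6 & 1 <= n"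

section \<open>Coordinates that depend affinely on a parameter n, the pair (c, m) standing for c + m
  n\<close>

type_synonym lin = "int \<times> int"
type_synonym lvec = "lin \<times> lin \<times> lin \<times> lin \<times> lin \<times> lin"

fun lsub :: "int => lin => lin" where "lsub e (c, m) = (e - c, - m)"

fun lact :: "gen => lvec => lvec" where
 "lact G1 (k1, k2, k3, k4, k5, k6) = (lsub (- 1) k1, k5, k4, k3, k2, k6)"
| "lact G2 (k1, k2, k3, k4, k5, k6) = (k3, lsub (- 1) k2, k1, k4, k6, k5)"
| "lact G0 (k1, k2, k3, k4, k5, k6) = (k1, lsub 0 k5, lsub 0 k4, lsub 0 k3, lsub 0 k2, lsub 1 k6)"

text \<open>Conditions on constant and slope that guarantee the sign for all n \<ge> 0 at
  once.\<close>

fun lnonneg :: "lin => bool" where "lnonneg (c, m) <-> 0 <= c & 0 <= m"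
fun lpos :: "lin => bool" where "lpos (c, m) <-> 0 < c & 0 <= m"

fun lup :: "gen => lvec => bool" where
 "lup G1 (k1, k2, k3, k4, k5, k6) = lnonneg k1"
| "lup G2 (k1, k2, k3, k4, k5, k6) = lnonneg k2"
| "lup G0 (k1, k2, k3, k4, k5, k6) = lnonneg (lsub 0 k6)"

fun ldown :: "gen => lvec => bool" where
 "ldown G1 (k1, k2, k3, k4, k5, k6) = lpos (lsub 0 k1)"
| "ldown G2 (k1, k2, k3, k4, k5, k6) = lpos (lsub 0 k2)"
| "ldown G0 (k1, k2, k3, k4, k5, k6) = lpos k6"

fun lregular :: "lvec => bool" where
 "lregular (k1, k2, k3, k4, k5, k6) = list_all (%k. lpos k | lpos (lsub 0 k)) [k1, k2, k3, k4, k5, k6]"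

fun lreduced :: "lvec => gen list => bool" where
 "lreduced k [] <-> True"
| "lreduced k (g # u) <-> lup g k & lreduced (lact g k) u"

fun lpair :: "kvec => kvec => lvec" where
 "lpair (c1, c2, c3, c4, c5, c6) (m1, m2, m3, m4, m5, m6) = ((c1, m1), (c2, m2), (c3, m3), (c4, m4), (c5, m5), (c6, m6))"

fun leval :: "int => lvec => kvec" where
 "leval n ((c1, m1), (c2, m2), (c3, m3), (c4, m4), (c5, m5), (c6, m6)) =
 (c1 + m1 * n, c2 + m2 * n, c3 + m3 * n, c4 + m4 * n, c5 + m5 * n, c6 + m6 * n)"

lemma leval_lact: "leval n (lact g k) = kact g (leval n k)"
 by (cases k; cases g) (auto simp: algebra_simps)
lemma leval_fold: "leval n (fold lact u k) = fold kact u (leval n k)"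
 by (induction u arbitrary: k) (simp_all add: leval_lact)

lemma lnonneg_eval: "lnonneg (c, m) ==> 0 <= n ==> 0 <= c + m * n" by simp
lemma lpos_eval: "lpos (c, m) ==> 0 <= n ==> 0 < c + m * n" by (simp add: add_pos_nonneg)

lemma lup_eval: assumes "lup g k" "0 <= n" shows "~ kdesc g (leval n k)"
proof -
 obtain c1 m1 c2 m2 c3 m3 c4 m4 c5 m5 c6 m6 where k: "k = ((c1, m1), (c2, m2), (c3, m3), (c4, m4), (c5, m5), (c6, m6))"
 by (cases k) auto
 show ?thesis using assms lnonneg_eval[of c1 m1 n] lnonneg_eval[of c2 m2 n] lnonneg_eval[of "- c6" "- m6" n] unfolding k
 by (cases g) (auto simp: not_less)
qed

lemma ldown_eval: assumes "ldown g k" "0 <= n" shows "kdesc g (leval n k)"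
proof -
 obtain c1 m1 c2 m2 c3 m3 c4 m4 c5 m5 c6 m6 where k: "k = ((c1, m1), (c2, m2), (c3, m3), (c4, m4), (c5, m5), (c6, m6))"
 by (cases k) auto
 show ?thesis using assms lpos_eval[of "- c1" "- m1" n] lpos_eval[of "- c2" "- m2" n] lpos_eval[of c6 m6 n] unfolding k
 by (cases g) auto
qed

lemma lregular_eval: "lregular k ==> 0 <= n ==> kregular (leval n k)"
proof -
 have 1: "c + m * n ~= 0" if "lpos (c, m) | lpos (lsub 0 (c, m))" "0 <= n" for c m n
 using that lpos_eval[of c m n] lpos_eval[of "- c" "- m" n] by auto
 show "lregular k ==> 0 <= n ==> kregular (leval n k)"
 using 1 by (cases k) (auto simp del: lpos.simps lsub.simps)
qed
lemma lreduced_eval: "lreduced k u ==> 0 <= n ==> kreduced (leval n k) u"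
 by (induction u arbitrary: k) (auto simp: lup_eval leval_lact[symmetric])
lemma kreduced_append: "kreduced k (u @ v) <-> kreduced k u & kreduced (fold kact u k) v"
 by (induction u arbitrary: k) auto

definition fam_base :: "nat => gen list => lvec" where
 "fam_base k p = lpair (fold kact p kzero) (fold kact (fam_t k @ fam_t k) kzero)"

definition fam_rbase :: "nat => gen list => lvec" where
 "fam_rbase k p = lpair (fold kact p kzero) (fold kact (rev (fam_t k) @ rev (fam_t k)) kzero)"

fun kplus :: "kvec => kvec => kvec" where
 "kplus (c1, c2, c3, c4, c5, c6) (m1, m2, m3, m4, m5, m6) = (c1 + m1, c2 + m2, c3 + m3, c4 + m4, c5 + m5, c6 + m6)"

text \<open>The word t has odd length and reverses orientation, so only its square is a translation.
  For this reason exponents are split into an even part 2 m and a small remainder.\<close>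

lemma fam_t_translation:
 "fold kact (fam_t k @ fam_t k) x = kplus x (fold kact (fam_t k @ fam_t k) kzero)"
 "fold kact (rev (fam_t k) @ rev (fam_t k)) x = kplus x (fold kact (rev (fam_t k) @ rev (fam_t k)) kzero)"
 by (cases x; simp add: fam_t_def)+

lemma leval_lpair: "leval (int n) (lpair x y) = ((%z. kplus z y) ^^ n) x"
proof (induction n)
 case 0 thus ?case by (cases x; cases y) simp
next
 case (Suc n)
 have "leval (int (Suc n)) (lpair x y) = kplus (leval (int n) (lpair x y)) y"
 by (cases x; cases y) (simp add: algebra_simps)
 thus ?case using Suc by simp
qed
lemma fold_even: "fold kact (concat (replicate (2 * n) t)) x = ((%z. fold kact (t @ t) z) ^^ n) x"
 by (induction n arbitrary: x) (simp_all add: funpow_swap1)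

lemma fam_base_eval: "leval (int n) (fam_base k p) = fold kact (p @ concat (replicate (2 * n) (fam_t k))) kzero"
 unfolding fam_base_def leval_lpair fold_append comp_def fold_even
 by (subst fam_t_translation(1)[unfolded fold_append comp_def, abs_def]) simp

lemma fam_rbase_eval: "leval (int n) (fam_rbase k p) = fold kact (p @ concat (replicate (2 * n) (rev (fam_t k)))) kzero"
 unfolding fam_rbase_def leval_lpair fold_append comp_def fold_even
 by (subst fam_t_translation(2)[unfolded fold_append comp_def, abs_def]) simp

definition fam_reduced_ok :: bool where
 "fam_reduced_ok <-> list_all (%k. list_all (%u. kreduced kzero (fam_pre k u) & (let B = fam_base k (fam_pre k u) in
 lreduced B (fam_t k @ fam_t k) & list_all (%v. lreduced B v & lreduced B (fam_t k @ v)) (fam_V k))) [0..<6]) [0..<2]"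

text \<open>Left multiplication of a family word by g, with exponent 2 m + e of t: g is a left
  descent, or the alcove becomes regular, or the coordinates are those of a family word with the
  same v and exponent 2 m + j. Comparing affine forms settles all m together.\<close>

definition fam_cover_ok :: bool where
 "fam_cover_ok <-> list_all (%k. list_all (%u. list_all (%v. list_all (%e. list_all (%g.
 ldown g (fold lact (rev (fam_pre k u)) (fam_rbase k (rev v @ concat (replicate e (rev (fam_t k)))))) |
 (let K = fold lact (concat (replicate e (fam_t k)) @ v) (fam_base k (g # fam_pre k u)) in
 lregular K | list_ex (%u'. list_ex (%j.
 K = fold lact (concat (replicate j (fam_t k)) @ v) (fam_base k (fam_pre k u'))) [e, Suc e]) [0..<6]))
 [G0, G1, G2]) [1, 2]) (fam_V k)) [0..<6]) [0..<2]"

definition fin_vecs :: "kvec list" where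
 "fin_vecs = map (%w. fold kact w kzero) fin_words @
 concat (map (%k. concat (map (%u. map (%v. fold kact (fam_pre k u @ fam_t k @ v) kzero) (fam_V k)) [0..<6])) [0..<2])"

definition fin_cover_ok :: "kvec list => bool" where
 "fin_cover_ok vs <-> list_all (%w. kreduced kzero w & list_all (%g. kdesc g (fold kact (rev w) kzero) |
 (let K = fold kact (g # w) kzero in kregular K | list_ex (%v. v = K) vs)) [G0, G1, G2]) fin_words"

lemma fam_reduced_ok: fam_reduced_ok by code_simp
lemma fam_cover_ok: fam_cover_ok by code_simp
lemma fin_cover_ok: "fin_cover_ok fin_vecs" by code_simp

lemma replicate_concat_add: "concat (replicate (m + n) t) = concat (replicate m t) @ concat (replicate n t)"
 by (simp add: replicate_add)

lemma rev_concat_replicate: "rev (concat (replicate n t)) = concat (replicate n (rev t))"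
proof (induction n)
 case (Suc n)
 have "concat (replicate n (rev t)) @ rev t = concat (replicate (n + 1) (rev t))" by (simp only: replicate_concat_add) simp
 thus ?case using Suc by simp
qed simp

lemma length_fam_V: "length (fam_V k) = 6" by (simp add: fam_V_def)

lemma kreduced_fam_pre_pow: assumes "k < 2" "u < 6"
 shows "kreduced kzero (fam_pre k u @ concat (replicate (2 * m) (fam_t k)))"
proof (induction m)
 case 0 thus ?case using assms fam_reduced_ok by (simp add: fam_reduced_ok_def list_all_iff)
next
 case (Suc m)
 have r: "lreduced (fam_base k (fam_pre k u)) (fam_t k @ fam_t k)"
 using assms fam_reduced_ok by (simp add: fam_reduced_ok_def list_all_iff Let_def)
 have "2 * Suc m = 2 * m + 2" by simp
 hence "fam_pre k u @ concat (replicate (2 * Suc m) (fam_t k)) =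
 (fam_pre k u @ concat (replicate (2 * m) (fam_t k))) @ (fam_t k @ fam_t k)"
 by (simp only: replicate_concat_add) (simp add: eval_nat_numeral)
 thus ?case using Suc lreduced_eval[OF r, of "int m"] by (simp only: kreduced_append fam_base_eval)
qed

lemma kreduced_fam: assumes "k < 2" "u < 6" "v < 6"
 shows "kreduced kzero (fam_pre k u @ concat (replicate n (fam_t k)) @ fam_V k ! v)"
proof -
 define m where "m = n div 2"
 have V: "length (fam_V k) = 6" by (simp add: fam_V_def)
 have r: "lreduced (fam_base k (fam_pre k u)) (fam_V k ! v)" "lreduced (fam_base k (fam_pre k u)) (fam_t k @ fam_V k ! v)"
 using assms fam_reduced_ok V by (simp_all add: fam_reduced_ok_def list_all_iff Let_def)
 have "n = 2 * m | n = 2 * m + 1" by (auto simp: m_def)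
 hence e: "fam_pre k u @ concat (replicate n (fam_t k)) @ fam_V k ! v =
 (fam_pre k u @ concat (replicate (2 * m) (fam_t k))) @ fam_V k ! v |
 fam_pre k u @ concat (replicate n (fam_t k)) @ fam_V k ! v =
 (fam_pre k u @ concat (replicate (2 * m) (fam_t k))) @ fam_t k @ fam_V k ! v"
 proof (elim disjE)
 assume "n = 2 * m + 1"
 hence "concat (replicate n (fam_t k)) = concat (replicate (2 * m) (fam_t k)) @ fam_t k"
 by (simp only: replicate_concat_add) simp
 thus ?thesis by simp
 qed simp
 show ?thesis
 using e kreduced_fam_pre_pow[OF assms(1,2), of m] lreduced_eval[OF r(1), of "int m"] lreduced_eval[OF r(2), of "int m"]
 by (elim disjE; simp only: kreduced_append fam_base_eval)
qed

lemma kreduced_code: "valid c ==> kreduced kzero (code_word c)"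
proof (cases c)
 case (Fn i)
 thus "valid c ==> ?thesis" using fin_cover_ok by (simp add: fin_cover_ok_def list_all_length)
next
 case (Fm k u n v)
 thus "valid c ==> ?thesis" using kreduced_fam by simp
qed

context g2_weights begin

lemma len_kreduced: "kreduced kzero u ==> len (elt u) = length u"
 using kreduced_len[of "\<one>\<^bsub>G2t\<^esub>" u] by simp

lemma cover_fin: assumes "i < length fin_words" "elt [g] ~: NG (ginv (elt (fin_words ! i)))"
 shows "elt (g # fin_words ! i) : Gamma0 | (EX c. valid c & elt (g # fin_words ! i) = elt (code_word c))"
proof -
 let ?w = "fin_words ! i"
 let ?K = "fold kact (g # ?w) kzero"
 have nd: "~ kdesc g (fold kact (rev ?w) kzero)" using assms(2) descent[of "elt (rev ?w)" g] by (simp add: elt_rev[symmetric] Ke_elt)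
 have "kregular ?K | ?K : set fin_vecs"
 proof -
 have 1: "?w : set fin_words" "g : set [G0, G1, G2]" using assms(1) by (simp, cases g, auto)
 note B = fin_cover_ok[unfolded fin_cover_ok_def list_all_iff list_ex_iff Let_def, rule_format, OF 1(1)]
 show ?thesis using conjunct2[OF B, rule_format, OF 1(2)] nd by blast
 qed
 moreover have "kregular ?K ==> elt (g # ?w) : Gamma0" by (rule kregular_Gamma0) (simp_all add: Ke_elt)
 moreover have "EX c. valid c & elt (g # ?w) = elt (code_word c)" if "?K : set fin_vecs"
 proof -
 have "EX c. valid c & ?K = fold kact (code_word c) kzero"
 using that unfolding fin_vecs_def
 proof (simp only: set_append Un_iff, elim disjE)
 assume "?K : set (map (%w. fold kact w kzero) fin_words)"
 then obtain j where "j < length fin_words" "?K = fold kact (fin_words ! j) kzero" by (auto simp: in_set_conv_nth)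
 thus ?thesis by (intro exI[of _ "Fn j"]) simp
 next
 assume "?K : set (concat (map (%k. concat (map (%u. map (%v. fold kact (fam_pre k u @ fam_t k @ v) kzero) (fam_V k)) [0..<6])) [0..<2]))"
 then obtain k u v where k: "k < 2" "u < 6" "v : set (fam_V k)" "?K = fold kact (fam_pre k u @ fam_t k @ v) kzero" by auto
 then obtain j where "j < 6" "v = fam_V k ! j" by (auto simp: in_set_conv_nth length_fam_V)
 thus ?thesis using k by (intro exI[of _ "Fm k u 1 j"]) simp
 qed
 thus ?thesis using Ke_inj[of "elt (g # ?w)"] by (metis Ke_elt elt_carrier)
 qed
 ultimately show ?thesis by blast
qed

lemma cover_fam: assumes c: "valid (Fm k u n v)" and g: "elt [g] ~: NG (ginv (elt (code_word (Fm k u n v))))"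
 shows "elt (g # code_word (Fm k u n v)) : Gamma0 |
 (EX c. valid c & elt (g # code_word (Fm k u n v)) = elt (code_word c))"
proof -
 let ?t = "fam_t k" and ?V = "fam_V k ! v" and ?p = "fam_pre k u"
 \<comment> \<open>With n - 1 in place of n the remainder e is 1 or 2, so that exponents stay
   positive, as valid codes require.\<close>
 define m where "m = (n - 1) div 2"
 define e where "e = n - 2 * m"
 have n: "n = 2 * m + e" "e : set [1, 2]" using c by (auto simp: m_def e_def)
 have V: "?V : set (fam_V k)" using c by (simp add: fam_V_def)
 let ?L = "fold lact (concat (replicate e ?t) @ ?V) (fam_base k (g # ?p))"
 have ev: "leval (int m) (fold lact (concat (replicate f ?t) @ ?V) (fam_base k q)) =
 fold kact (q @ concat (replicate (2 * m + f) ?t) @ ?V) kzero" for f q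
 unfolding leval_fold fam_base_eval by (simp add: replicate_concat_add)
 have w: "g # code_word (Fm k u n v) = (g # ?p) @ concat (replicate (2 * m + e) ?t) @ ?V" using n by simp
 have nd: "~ ldown g (fold lact (rev ?p) (fam_rbase k (rev ?V @ concat (replicate e (rev ?t)))))"
 proof
 assume "ldown g (fold lact (rev ?p) (fam_rbase k (rev ?V @ concat (replicate e (rev ?t)))))"
 hence "kdesc g (leval (int m) (fold lact (rev ?p) (fam_rbase k (rev ?V @ concat (replicate e (rev ?t))))))"
 by (rule ldown_eval) simp
 hence "kdesc g (fold kact (rev ?V @ concat (replicate (e + 2 * m) (rev ?t)) @ rev ?p) kzero)"
 unfolding leval_fold fam_rbase_eval by (simp add: replicate_concat_add)
 moreover have "rev ?V @ concat (replicate (e + 2 * m) (rev ?t)) @ rev ?p = rev (code_word (Fm k u n v))"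
 using n by (simp add: rev_concat_replicate add.commute)
 ultimately show False
 using g descent[of "elt (rev (code_word (Fm k u n v)))" g] by (simp add: elt_rev[symmetric] Ke_elt del: code_word.simps)
 qed
 have "lregular ?L | (EX u'<6. EX j:{e, Suc e}. ?L = fold lact (concat (replicate j ?t) @ ?V) (fam_base k (fam_pre k u')))"
 proof -
 have 1: "k : set [0..<2]" "u : set [0..<6]" "g : set [G0, G1, G2]" using c by (auto, cases g, auto)
 note B = fam_cover_ok[unfolded fam_cover_ok_def list_all_iff list_ex_iff Let_def, rule_format, OF 1(1,2) V n(2) 1(3)]
 thus ?thesis using nd by auto
 qed
 thus ?thesis
 proof (elim disjE exE conjE bexE)
 assume "lregular ?L"
 hence "kregular (leval (int m) ?L)" by (rule lregular_eval) simp
 hence "elt (g # code_word (Fm k u n v)) : Gamma0"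
 unfolding w ev by (intro kregular_Gamma0) (simp_all only: elt_carrier Ke_elt)
 thus ?thesis ..
 next
 fix u' j assume u': "u' < 6" and j: "j : {e, Suc e}" and L: "?L = fold lact (concat (replicate j ?t) @ ?V) (fam_base k (fam_pre k u'))"
 let ?c = "Fm k u' (2 * m + j) v"
 have "Ke (elt (g # code_word (Fm k u n v))) = Ke (elt (code_word ?c))"
 unfolding Ke_elt w using arg_cong[OF L, of "leval (int m)"] by (simp only: ev code_word.simps)
 hence "elt (g # code_word (Fm k u n v)) = elt (code_word ?c)" by (intro Ke_inj) (simp_all only: elt_carrier)
 moreover have "valid ?c" using c u' j n(2) by auto
 ultimately show ?thesis by blast
 qed
qed

text \<open>A length-increasing left multiplication leads from a listed word to a listed word or
  into the lowest cell, which it never leaves; so the list, starting from the empty word, is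
  exhaustive.\<close>

lemma cover: assumes "w : GW" shows "w : Gamma0 | (EX c. valid c & w = elt (code_word c))"
 using assms
proof (induction w rule: left_induct)
 case one
 have "fin_words ! 0 = []" "0 < length fin_words" by code_simp+
 thus ?case by (intro disjI2 exI[of _ "Fn 0"]) (simp add: elt_Nil)
next
 case (step w s)
 obtain g where g: "s = elt [g]" using step(2) by (auto simp: gens_eq)
 from step.IH show ?case
 proof (elim disjE exE conjE)
 assume "w : Gamma0" thus ?thesis using Gamma0_left step(3) g by blast
 next
 fix c assume c: "valid c" "w = elt (code_word c)"
 have e: "s<.>w = elt (g # code_word c)" by (simp add: c g elt_Cons[of g "code_word c"])
 show ?thesis unfolding e using cover_fin cover_fam c step(3) g by (cases c) (auto simp del: code_word.simps(2))
 qed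
qed

end

section \<open>Checking the leading coefficients\<close>

definition fin_mats :: "grep => pol list list list" where
 "fin_mats rp = walk (%R g. mmul R (gen_mat rp g)) (%R. R) [unit_rows (fst rp)] fin_tree"

type_synonym 'x trip = "'x list \<times> 'x \<times> 'x list"

definition wmat :: "grep => gen list => pol list list" where
 "wmat rp w = wact rp w (unit_rows (fst rp))"

definition fam_mats :: "grep => nat => pol list list trip" where
 "fam_mats rp k = (map (%u. wmat rp (rev u @ fam_d k)) (fam_V k), wmat rp (fam_t k), map (wmat rp) (fam_V k))"

type_synonym weight = "int \<times> int"

fun omap :: "('x => 'y option) => 'x list => 'y list option" where
 "omap f [] = Some []"
| "omap f (x # xs) = (case f x of None => None | Some y => (case omap f xs of None => None | Some ys => Some (y # ys)))"

definition fin_scan :: "ray list => nat => weight => pol list list => zmat option" where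
 "fin_scan rays d al R = sscan rays 0 (rvals rays (replicate d al)) (rvals rays (replicate d (0, 0))) R"

text \<open>The weights \<sigma> amount to a conjugation by a diagonal matrix of powers of q after
  which t has degree at most 0. Bounds then telescope in u^-1 d t^n v to the single bound
  \<open>al\<close>, for every n.\<close>

fun fam_scan :: "ray list => nat => weight => weight list => pol list list trip => zmat trip option" where
 "fam_scan rays d al \<sigma> (U, G, V) =
 (case omap (sscan rays 0 (rvals rays (replicate d al)) (rvals rays \<sigma>)) U of None => None | Some U' =>
 (case sscan rays 0 (rvals rays (map pneg2 \<sigma>)) (rvals rays \<sigma>) G of None => None | Some G' =>
 (case omap (sscan rays 0 (rvals rays (map pneg2 \<sigma>)) (rvals rays (replicate d (0, 0)))) V of None => None | Some V' =>
 Some (U', G', V'))))"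

fun fam_zero :: "zmat trip => bool" where
 "fam_zero (U, G, V) <-> list_all (%x. zprod G x = [] & list_all (%u. zprod u x = []) U) (map (zprod G) V)"

text \<open>\<open>\<Sum>\<^sub>i \<zeta>\<^bsup>e - s i\<^esup>\<close> over \<open>i < m\<close>, the exponents being centred at \<open>c / 2\<close>.\<close>

definition seg_top :: "int => int => nat => int" where
 "seg_top s c m = (c + s * (int m - 1)) div 2"

definition segz :: "int => int => nat \<times> nat \<times> nat => zmat" where
 "segz s c = (%(p, j, m). map (%i. ((p, j, seg_top s c m - s * int i), 1)) [0..<m])"

text \<open>\<open>Fin\<close> certifies a finite cell: a base element, functionals for
  independence, product identities. \<open>Own k s h M xs\<close> certifies the infinite cell of the
  family k, whose leading matrices are matrix units (p, j) times a sum of powers of \<zeta> spaced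
  by s and centred at (h_p - h_j) / 2.\<close>

datatype kind =
 Fin nat "(nat \<times> zmat) list" "(nat \<times> nat \<times> (int \<times> nat) list) list"
| Own nat int "int list" nat "nat list"

definition own_size :: "nat => nat list => nat => nat => nat" where
 "own_size M xs p j = M + xs ! p + xs ! j"

definition seg_ok :: "int => int list => nat \<times> nat \<times> nat => zmat => bool" where
 "seg_ok s h = (%(p, j, m) M. p < 6 & j < 6 & 0 < m & even (h ! p - h ! j + s * (int m - 1)) &
 zeq M (segz s (h ! p - h ! j) (p, j, m)))"

text \<open>For x = G v and y = v the equation is G^3 v = (\<zeta> + \<zeta>^-1) G^2 v - G v; the
  additional factor G means that the recursion is claimed only from the first power of t on. The
  other two conditions are the initial values n = 1 and n = 2.\<close>

fun fam_own :: "int => int list => nat => nat list => zmat trip => bool" where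
 "fam_own s h M xs (U, G, V) <-> list_all (%(j, x, y).
 zprod G (zadd (zadd (zprod G x) (zadd (zscale (- 1) 1 x) (zscale (- 1) (- 1) x))) y) = [] &
 list_all (%(p, u). seg_ok s h (p, j, own_size M xs p j) (zprod u x) &
 seg_ok s h (p, j, own_size M xs p j + nat (2 div s)) (zprod u (zprod G x))) (enumerate 0 U))
 (enumerate 0 (map (%v. (zprod G v, v)) V))"

definition zkey_of :: "zmat => nat \<times> nat \<times> nat" where
 "zkey_of M = (fst (fst (hd M)), fst (snd (fst (hd M))), length M)"

text \<open>The finite words of the cell must fill, without repetition, exactly the sizes of
  admissible parity that lie below those occurring in the family.\<close>

fun own_fins :: "int => int list => nat => nat list => zmat list => bool" where
 "own_fins s h M xs zs <-> list_all (%z. seg_ok s h (zkey_of z) z) zs &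
 list_all (%(p, j, m). m < own_size M xs p j) (map zkey_of zs) & distinct (map zkey_of zs) &
 list_all (%p. list_all (%j. list_all (%m. even (h ! p - h ! j + s * (int m - 1)) --> (p, j, m) : set (map zkey_of zs))
 [1..<own_size M xs p j]) [0..<6]) [0..<6]"

text \<open>A functional on leading matrices, given as a combination of entries; an empty list
  abbreviates the position of the first entry of the matrix itself.\<close>

definition key_of :: "zmat list => nat \<times> zmat => zmat" where
 "key_of L = (%(i, \<kappa>). if \<kappa> = [] then [(fst (hd (L ! i)), 1)] else \<kappa>)"

definition zpair :: "zmat => zmat => int" where
 "zpair M \<kappa> = (\<Sum>(k, c)\<leftarrow>\<kappa>. c * zcoef M k)"

text \<open>Triangularity: each functional is nonzero on its own matrix and vanishes on all later
  ones.\<close>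

fun tri_ok :: "zmat list => nat => (nat \<times> zmat) list => bool" where
 "tri_ok L d [] <-> True"
| "tri_ok L d (t # ts) <-> list_all (%((p, j, e), c). p < d & j < d) (key_of L t) &
 zpair (L ! fst t) (key_of L t) ~= 0 & list_all (%(j, \<kappa>). zpair (L ! j) (key_of L t) = 0) ts & tri_ok L d ts"

type_synonym cert = "nat \<times> nat \<times> (int \<times> nat) list"

definition cert_ok :: "zmat list => nat list => cert => bool" where
 "cert_ok L is = (%(x, y, zs). x : set is & y : set is & list_all (%(g, z). g ~= 0 & z : set is) zs & distinct (map snd zs) &
 zeq (zprod (L ! x) (L ! y)) (zadd (concat (map (%(g, z). zscale g 0 (L ! z)) zs)) []))"

text \<open>A certificate places each z on its right below x and y in the preorder. This closure
  therefore collects elements below those of A, and \<open>grow_down\<close> elements above.\<close>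

definition grow_up :: "cert list => nat list => nat list" where
 "grow_up cs A = A @ concat (map (%(x, y, zs). if x : set A | y : set A then map snd zs else []) cs)"

definition grow_down :: "cert list => nat list => nat list" where
 "grow_down cs A = A @ concat (map (%(x, y, zs). if list_ex (%z. z : set A) (map snd zs) then [x, y] else []) cs)"

definition covered :: "cert list => nat list => bool" where
 "covered cs A <-> set A <= set (concat (map (%(x, y, zs). if x : set A & y : set A then map snd zs else []) cs))"

definition pars :: "gen list list" where "pars = [[G1, G2], [G0, G2], [G0, G1]]"

definition par_idx :: "nat list list" where
 "par_idx = [[0, 40, 41, 55, 56, 58, 64, 78, 79, 93, 94], [0, 1, 14, 15, 64, 65], [0, 1, 2, 40]]"

text \<open>Coverage of the cell shows that the degree bound is attained, the two closures connect
  every element with e in both directions, and coverage within each dihedral subgroup gives the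
  parabolic a-function.\<close>

definition certs_ok :: "zmat list => nat => nat list => cert list => bool" where
 "certs_ok L e is cs <-> list_all (cert_ok L is) cs & list_ex (%I. e : set I) par_idx & covered cs is &
 set is <= set (grow_up cs (grow_up cs [e])) & set is <= set (grow_down cs (grow_down cs [e])) &
 list_all (%I. covered cs (filter (%i. i : set I) is)) par_idx"

text \<open>One entry per cell outside the lowest: number of the representation, linear form of the
  a-value, indices into \<open>bases\<close>, diagonal weights for the two families, certificate. A
  face adds its rays in front and the cell number of each word of \<open>fin_words\<close>.\<close>

type_synonym spec = "nat \<times> weight \<times> nat list \<times> weight list \<times> weight list \<times> kind"
type_synonym face = "ray list \<times> nat list \<times> spec list"

definition filt :: "nat list => nat => 'x list => 'x list" where
 "filt cl i xs = map snd (filter (%(c, x). c = i) (zip cl xs))"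

fun kind_ok :: "kind => nat => nat list => nat => zmat list => zmat trip => zmat trip => bool" where
 "kind_ok (Fin e tab cs) d cl i L F0 F1 <-> fam_zero F0 & fam_zero F1 & tri_ok L d tab &
 list_all (%(n, c). (c = i) = (n : set (map fst tab))) (enumerate 0 cl) &
 list_all (%(n, \<kappa>). n < length cl) tab & certs_ok L e (map fst tab) cs"
| "kind_ok (Own k s h M xs) d cl i L F0 F1 <-> d = 6 & (s = 1 | s = 2) &
 fam_zero (if k = 0 then F1 else F0) & fam_own s h M xs (if k = 0 then F0 else F1) & own_fins s h M xs (filt cl i L)"

fun comp_ok :: "nat => zmat list option => pol list list trip => pol list list trip => ray list \<times> nat list \<times> nat \<times> spec => bool" where
 "comp_ok d Lo m0 m1 (rays, cl, i, (r, al, bs, s0, s1, kd)) <->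
 (case Lo of None => False | Some L =>
 (case fam_scan rays d al s0 m0 of None => False | Some F0 =>
 (case fam_scan rays d al s1 m1 of None => False | Some F1 =>
 list_all (%(c, z). c ~= i --> z = []) (zip cl L) & kind_ok kd d cl i L F0 F1)))"

fun scans :: "(ray list \<times> nat list \<times> nat \<times> spec) list => nat => pol list list => zmat option list" where
 "scans [] d R = []"
| "scans ((rays, cl, i, sp) # ts) d R = fin_scan rays d (fst (snd sp)) R # scans ts d R"

fun specs_ok :: "nat => zmat option list list => pol list list trip => pol list list trip => nat =>
 (ray list \<times> nat list \<times> nat \<times> spec) list => bool" where
 "specs_ok d res m0 m1 n [] <-> True"
| "specs_ok d res m0 m1 n (t # ts) <-> comp_ok d (omap (%x. x ! n) res) m0 m1 t & specs_ok d res m0 m1 (Suc n) ts"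

definition mstep :: "grep => pol list list => gen => pol list list" where
 "mstep rp R g = mmul R (gen_mat rp g)"

text \<open>The matrices of a representation are the same on all faces; each one is computed once
  and scanned for every face that uses the representation.\<close>

definition rep_specs_ok :: "grep => (ray list \<times> nat list \<times> nat \<times> spec) list => bool" where
 "rep_specs_ok rp ts <->
 specs_ok (fst rp) (walk (mstep rp) (scans ts (fst rp)) [unit_rows (fst rp)] fin_tree) (fam_mats rp 0) (fam_mats rp 1) 0 ts"

definition select :: "face list => nat => (ray list \<times> nat list \<times> nat \<times> spec) list" where
 "select fs r = concat (map (%(rays, cl, sps). map (%(i, sp). (rays, cl, i, sp)) (filter (%(i, sp). fst sp = r) (enumerate 0 sps))) fs)"

definition rep_faces_ok :: "face list => nat => grep => bool" where
 "rep_faces_ok fs r rp <-> rep_ok rp & rep_specs_ok rp (select fs r)"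

section \<open>Soundness of the certificate checks\<close>

lemma omap_Some: "omap f xs = Some ys ==> length ys = length xs & (ALL i<length xs. f (xs ! i) = Some (ys ! i))"
proof (induction xs arbitrary: ys)
 case (Cons x xs)
 obtain y zs where y: "f x = Some y" "omap f xs = Some zs" "ys = y # zs"
 using Cons.prems by (auto split: option.splits)
 show ?case using Cons.IH[OF y(2)] y by (auto simp: less_Suc_eq_0_disj)
qed simp

lemma walk_map: "walk f h st ts = map h (walk f (%x. x) st ts)"
 by (induction f h st ts rule: walk.induct) auto

fun walk_ok :: "nat => (nat \<times> gen) list => bool" where
 "walk_ok n [] <-> True"
| "walk_ok n ((k, g) # ts) <-> k < n & walk_ok (Suc (n - k)) ts"

lemma walk_ok_fin: "walk_ok (Suc 0) fin_tree" by code_simp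

lemma walk_rel: assumes "!!x y g. P x y ==> P (f x g) (f' y g)"
 shows "list_all2 P st st' ==> st ~= [] ==> walk_ok (length st) ts ==> list_all2 P (walk f (%x. x) st ts) (walk f' (%x. x) st' ts)"
proof (induction ts arbitrary: st st')
 case Nil thus ?case by (cases st; cases st') auto
next
 case (Cons t ts)
 obtain k g where t: "t = (k, g)" by (cases t)
 have hd: "P (hd st) (hd st')" using Cons.prems by (cases st; cases st') auto
 have dr: "list_all2 P (drop k st) (drop k st')" using Cons.prems(1) by (rule list_all2_dropI)
 moreover have "drop k st ~= []" using Cons.prems t by simp
 ultimately have "P (hd (drop k st)) (hd (drop k st'))" by (cases "drop k st"; cases "drop k st'") auto
 hence "list_all2 P (f (hd (drop k st)) g # drop k st) (f' (hd (drop k st')) g # drop k st')" using dr assms by simp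
 moreover have "walk_ok (length (f (hd (drop k st)) g # drop k st)) ts" using Cons.prems t by simp
 ultimately show ?case using Cons.IH hd t by auto
qed

section \<open>Characters of SL_2 as sums of equally spaced powers of \<zeta>\<close>

definition seg :: "int => int => nat => laurent" where
 "seg s c m = (\<Sum>i<m. sgl (seg_top s c m - s * int i) 1)"

lemma zsem_segz: "zsem (segz s c (p, j, m)) p' j' = (if p = p' & j = j' then seg s c m else 0)"
proof -
 have "zsem (map (%i. ((p, j, f i), 1)) xs) p' j' = (if p = p' & j = j' then \<Sum>i\<leftarrow>xs. sgl (f i) 1 else 0)" for f and xs :: "nat list"
 by (induction xs) (auto simp: zsem_Cons)
 moreover have "(\<Sum>i\<leftarrow>[0..<m]. f i) = (\<Sum>i<m. f i)" for f :: "nat => laurent" by (simp add: interv_sum_list_conv_sum_set_nat lessThan_atLeast0)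
 ultimately show ?thesis by (simp add: segz_def seg_def)
qed

text \<open>The recursion satisfied by the characters when tensored with the two-dimensional
  representation; k = 2 / s is the number of terms gained when the top exponent rises by 1.\<close>

lemma seg_rec: assumes s: "s * int k = 2"
 shows "seg s c (m + k + k) = (sgl 1 1 + sgl (- 1) 1) * seg s c (m + k) - seg s c m"
proof -
 let ?f = "%e m. \<Sum>i<m. sgl (e - s * int i) (1 :: int)"
 let ?e = "seg_top s c m"
 have e: "seg_top s c (m + k) = ?e + 1" "seg_top s c (m + k + k) = ?e + 2"
 proof -
 have "c + s * (int (m + k) - 1) = c + s * (int m - 1) + 2" "c + s * (int (m + k + k) - 1) = c + s * (int m - 1) + 2 * 2"
 using s by (simp_all add: algebra_simps)
 thus "seg_top s c (m + k) = ?e + 1" "seg_top s c (m + k + k) = ?e + 2" unfolding seg_top_def by linarith+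
 qed
 have add: "?f x (n + l) = ?f x n + ?f (x - s * int n) l" for x n l
 by (induction l) (simp_all add: algebra_simps)
 have sh: "sgl d 1 * ?f x n = ?f (x + d) n" for d x n
 by (simp add: sum_distrib_left mult_single algebra_simps)
 have "?f (?e + 2) (m + k + k) + ?f ?e m = ?f (?e + 2) (m + k) + (?f ?e m + ?f (?e + 2 - s * int (m + k)) k)"
 using add[of "?e + 2" "m + k" k] by simp
 also have "?e + 2 - s * int (m + k) = ?e - s * int m" using s by (simp add: algebra_simps)
 also have "?f ?e m + ?f (?e - s * int m) k = ?f ?e (m + k)" by (rule add[symmetric])
 finally have "?f (?e + 2) (m + k + k) + ?f ?e m = sgl 1 1 * ?f (?e + 1) (m + k) + sgl (- 1) 1 * ?f (?e + 1) (m + k)"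
 using sh[of 1 "?e + 1" "m + k"] sh[of "- 1" "?e + 1" "m + k"] by (simp add: add.assoc)
 thus ?thesis unfolding seg_def e by (simp add: algebra_simps)
qed

text \<open>Clebsch--Gordan for a representation of dimension m and its dual: the constituents have
  dimensions 1, 3, ..., 2m - 1. The shifts by c and - c cancel, and parity makes the division in
  \<open>seg_top\<close> exact.\<close>

lemma seg_mult: assumes "even (c + s * (int m - 1))"
 shows "seg s c m * seg s (- c) m = (\<Sum>k<m. seg s 0 (2 * k + 1))"
proof -
 let ?z = "%e. sgl e (1 :: int)"
 let ?T = "%m. \<Sum>i<m. \<Sum>l<m. ?z (s * (int l - int i))"
 have top: "seg_top s c m + seg_top s (- c) m = s * (int m - 1)"
 proof -
 obtain x where x: "c + s * (int m - 1) = 2 * x" using assms by (rule evenE)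
 hence "- c + s * (int m - 1) = 2 * (x - c)" by simp
 thus ?thesis unfolding seg_top_def x using x by simp
 qed
 have "seg s (- c) m = (\<Sum>l<m. ?z (seg_top s (- c) m - s * (int m - 1) + s * int l))"
 unfolding seg_def by (rule sum.reindex_bij_witness[of _ "%l. m - 1 - l" "%l. m - 1 - l"]) (auto simp: algebra_simps of_nat_diff)
 hence "seg s c m * seg s (- c) m = (\<Sum>i<m. \<Sum>l<m. ?z (seg_top s c m - s * int i) * ?z (seg_top s (- c) m - s * (int m - 1) + s * int l))"
 by (simp add: seg_def sum_product)
 also have "\<dots> = ?T m"
 proof -
 have "seg_top s c m - s * int i + (seg_top s (- c) m - s * (int m - 1) + s * int l) = s * (int l - int i)" for i l
 using top by (simp add: algebra_simps)
 thus ?thesis by (simp only: mult_single mult_1)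
 qed
 also have "?T m = (\<Sum>k<m. seg s 0 (2 * k + 1))"
 proof (induction m)
 case (Suc m)
 have "?T (Suc m) = ?T m + ((\<Sum>l<m. ?z (s * (int l - int m))) + (\<Sum>i<m. ?z (s * (int m - int i))) + ?z 0)"
 by (simp add: sum.distrib algebra_simps)
 moreover have "seg s 0 (2 * m + 1) = (\<Sum>i<m + Suc m. ?z (s * (int m - int i)))"
 unfolding seg_def seg_top_def by (intro sum.cong) (auto simp: algebra_simps)
 moreover have "\<dots> = (\<Sum>i<m. ?z (s * (int m - int i))) + (\<Sum>i<Suc m. ?z (s * (int m - int (m + i))))"
 proof -
 have "(\<Sum>i<m + n. g i) = (\<Sum>i<m. g i) + (\<Sum>i<n. g (m + i))" for n and g :: "nat => laurent" by (induction n) (simp_all add: add.assoc)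
 from this[of "%i. ?z (s * (int m - int i))" "Suc m"] show ?thesis .
 qed
 moreover have "(\<Sum>i<Suc m. ?z (s * (int m - int (m + i)))) = ?z 0 + (\<Sum>l<m. ?z (s * (int l - int m)))"
 proof -
 have "(\<Sum>i<m. ?z (s * (int m - int (m + Suc i)))) = (\<Sum>l<m. ?z (s * (int l - int m)))"
 by (rule sum.reindex_bij_witness[of _ "%l. m - 1 - l" "%l. m - 1 - l"]) (auto simp: algebra_simps of_nat_diff)
 thus ?thesis by (subst sum.lessThan_Suc_shift) simp
 qed
 ultimately show ?case using Suc by simp
 qed simp
 finally show ?thesis .
qed

lemma lookup_seg: assumes "0 < s" shows "coef (seg s c m) e ~= 0 ==> e <= seg_top s c m"
 "0 < m ==> coef (seg s c m) (seg_top s c m) = 1"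
proof -
 have l: "coef (seg s c m) e = (\<Sum>i<m. if seg_top s c m - s * int i = e then 1 else 0)" for e
 unfolding seg_def lookup_sum lookup_single when_def ..
 show "coef (seg s c m) e ~= 0 ==> e <= seg_top s c m"
 proof (rule ccontr)
 assume "coef (seg s c m) e ~= 0" "~ e <= seg_top s c m"
 moreover have "seg_top s c m - s * int i <= seg_top s c m" for i using assms by simp
 ultimately have "seg_top s c m - s * int i ~= e" for i by (metis)
 hence "coef (seg s c m) e = 0" unfolding l by simp
 thus False using \<open>coef (seg s c m) e ~= 0\<close> by simp
 qed
 assume "0 < m"
 have "(\<Sum>i<m. if seg_top s c m - s * int i = seg_top s c m then 1 else 0) = (\<Sum>i<m. if i = 0 then 1 else (0 :: int))"
 using assms by (intro sum.cong) auto
 thus "coef (seg s c m) (seg_top s c m) = 1" unfolding l using \<open>0 < m\<close> by simp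
qed

fun fam_top :: "zmat trip => nat => nat => nat => zmat" where
 "fam_top (U, G, V) u n v = zprod (U ! u) (zpow G n (V ! v))"

fun code_top :: "zmat list => (nat => zmat trip) => code => zmat" where
 "code_top L F (Fn i) = L ! i"
| "code_top L F (Fm k u n v) = fam_top (F k) u n v"

definition comp_data :: "ray list => nat list => grep => nat => spec => zmat list => (nat => zmat trip) => bool" where
 "comp_data rays cl rp i sp L F <-> (case sp of (r, al, bs, s0, s1, kd) =>
 length L = length fin_words & (ALL n<length L. fin_scan rays (fst rp) al (fin_mats rp ! n) = Some (L ! n)) &
 (ALL k<2. fam_scan rays (fst rp) al (if k = 0 then s0 else s1) (fam_mats rp k) = Some (F k)) &
 list_all (%(c, z). c ~= i --> z = []) (zip cl L) & kind_ok kd (fst rp) cl i L (F 0) (F 1))"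

lemma length_walk: "length (walk f h st ts) = Suc (length ts)"
 by (induction f h st ts rule: walk.induct) auto
lemma length_fin_mats: "length (fin_mats rp) = length fin_words"
 by (simp add: fin_mats_def fin_words_def length_walk)
lemma nth_scans: "n < length ts ==> ts ! n = (rays, cl, i, sp) ==> scans ts d R ! n = fin_scan rays d (fst (snd sp)) R"
 by (induction ts d R arbitrary: n rule: scans.induct) (auto simp: less_Suc_eq_0_disj)

lemma specs_ok_nth: "specs_ok d res m0 m1 l ts ==> n < length ts ==> comp_ok d (omap (%x. x ! (l + n)) res) m0 m1 (ts ! n)"
proof (induction ts arbitrary: l n)
 case (Cons t ts) thus ?case using Cons.IH[of "Suc l" "n - 1"] by (cases n) auto
qed simp

lemma rep_specs: assumes ok: "rep_specs_ok rp ts" and n: "n < length ts" "ts ! n = (rays, cl, i, sp)"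
 shows "EX L F. comp_data rays cl rp i sp L F"
proof -
 obtain r al bs s0 s1 kd where sp: "sp = (r, al, bs, s0, s1, kd)" by (metis prod_cases6)
 let ?d = "fst rp"
 have res: "walk (mstep rp) (scans ts ?d) [unit_rows ?d] fin_tree = map (scans ts ?d) (fin_mats rp)"
 unfolding fin_mats_def mstep_def[abs_def] by (rule walk_map)
 have "comp_ok ?d (omap (%x. x ! n) (map (scans ts ?d) (fin_mats rp))) (fam_mats rp 0) (fam_mats rp 1) (rays, cl, i, sp)"
 using specs_ok_nth[of ?d _ _ _ 0 ts n] ok n unfolding rep_specs_ok_def res by simp
 then obtain L F0 F1 where *: "omap (%x. x ! n) (map (scans ts ?d) (fin_mats rp)) = Some L"
 "fam_scan rays ?d al s0 (fam_mats rp 0) = Some F0" "fam_scan rays ?d al s1 (fam_mats rp 1) = Some F1"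
 "list_all (%(c, z). c ~= i --> z = []) (zip cl L)" "kind_ok kd ?d cl i L F0 F1"
 unfolding sp comp_ok.simps by (auto split: option.splits)
 have L: "length L = length fin_words" "!!m. m < length L ==> fin_scan rays ?d al (fin_mats rp ! m) = Some (L ! m)"
 using omap_Some[OF *(1)] nth_scans[OF n] by (auto simp: length_fin_mats sp)
 have "comp_data rays cl rp i sp L (%k. if k = 0 then F0 else F1)"
 using * L by (auto simp: comp_data_def sp less_2_cases_iff)
 thus ?thesis by blast
qed

context g2_weights begin

lemma fold_sact_append: assumes "p < fst rp" "j < fst rp"
 shows "fold (sact rp) (x @ y) sid p j = (\<Sum>m<fst rp. fold (sact rp) x sid p m * fold (sact rp) y sid m j)"
proof (cases "y = []")
 case True
 have "(\<Sum>m<fst rp. fold (sact rp) x sid p m * sid m j) = (\<Sum>m<fst rp. if m = j then fold (sact rp) x sid p j else 0)"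
 by (rule sum.cong) (auto simp: sid_def)
 thus ?thesis using True assms by simp
next
 case False thus ?thesis using fold_sact_linear[OF False, of rp "fold (sact rp) x sid" p j] assms by simp
qed
lemma code_len: "valid c ==> len (elt (code_word c)) = length (code_word c)"
 by (intro len_kreduced kreduced_code)
lemma Rm_code: "rep_ok rp ==> valid c ==> Rm rp (elt (code_word c)) = fold (sact rp) (code_word c) sid"
 by (intro Rm_elt code_len)
lemma rep_ok_gmat: "rep_ok rp ==> gmat_ok (fst rp) (gen_mat rp g)"
 by (cases g) (simp_all add: rep_ok_def Let_def)

lemma fin_mats_repd: assumes ok: "rep_ok rp" and i: "i < length fin_words"
 shows "repd (fst rp) (fin_mats rp ! i) (fold (sact rp) (fin_words ! i) sid)"
proof -
 let ?P = "%R w. repd (fst rp) R (fold (sact rp) w sid)"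
 have step: "?P (mmul R (gen_mat rp g)) (w @ [g])" if "?P R w" for R w g
 using repd_mmul[OF that rep_ok_gmat[OF ok] HOL.refl, of g] by simp
 have "list_all2 ?P (fin_mats rp) fin_words" unfolding fin_mats_def fin_words_def
 by (rule walk_rel[where P = ?P]; (erule step | simp add: repd_unit walk_ok_fin))
 thus ?thesis using i by (simp add: list_all2_conv_all_nth)
qed

lemma wmat_repd: "rep_ok rp ==> repd (fst rp) (wmat rp w) (fold (sact rp) w sid)"
 unfolding wmat_def by (rule repd_wact[OF repd_unit rep_ok_gmat HOL.refl])

end

context g2_cone begin

definition hastop :: "nat => (nat => int) => (nat => int) => zmat => (nat => nat => int hk) => bool" where
 "hastop d r s Z A <-> (ALL p<d. ALL j<d. dle (r p + s j) (A p j) & coef (A p j) (r p + s j) = zsem Z p j)"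

lemma hastop_scan: assumes "repd d R A" "sscan rays 0 (rvals rays rb) (rvals rays cb) R = Some Z" "length cb = d"
 "!!p. p < d ==> ev (rb ! p) = r p" "!!p. p < d ==> ev (cb ! p) = s p"
 shows "hastop d r s Z A" "zwf d Z"
proof -
 show "hastop d r s Z A" using scan_sound[OF assms(1,2)] assms(4,5) by (simp add: hastop_def)
 show "zwf d Z" using sscan_zwf[OF assms(2), of d] assms(1,3) by (simp add: rvals_def repd_def)
qed

text \<open>The column weights of the first factor are opposite to the row weights of the second, so
  the bounds telescope and the top parts multiply as matrices.\<close>

lemma hastop_mult: assumes A: "hastop d r s Z A" "zwf d Z" and B: "hastop d (%p. - s p) t Y B"
 shows "hastop d r t (zprod Z Y) (%p j. \<Sum>m<d. A p m * B m j)"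
 unfolding hastop_def
proof (intro allI impI)
 fix p j assume pj: "p < d" "j < d"
 have m: "dle (r p + t j) (A p m * B m j) & coef (A p m * B m j) (r p + t j) = zsem Z p m * zsem Y m j"
 if "m < d" for m
 proof -
 have a: "dle (r p + s m) (A p m)" "coef (A p m) (r p + s m) = zsem Z p m"
 and b: "dle (- s m + t j) (B m j)" "coef (B m j) (- s m + t j) = zsem Y m j"
 using A(1) B pj that by (auto simp: hastop_def)
 have "r p + s m + (- s m + t j) = r p + t j" by simp
 thus ?thesis using dle_mult[OF a(1) b(1)] lookup_mult_top[OF a(1) b(1)] a(2) b(2) by simp
 qed
 have "!!q l e c. ((q, l, e), c) : set Z ==> l < d" using A(2) by (auto simp: zwf_def)
 from zsem_zprod[OF this, where N = Y and i = p and j = j]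
 show "dle (r p + t j) (\<Sum>m<d. A p m * B m j) & coef (\<Sum>m<d. A p m * B m j) (r p + t j) = zsem (zprod Z Y) p j"
 using m by (auto intro!: dle_sum simp: lookup_sum)
qed
lemma hastop_cong: "(!!p j. p < d ==> j < d ==> A p j = B p j) ==> hastop d r s Z A <-> hastop d r s Z B"
 by (simp add: hastop_def)

lemma fam_scan_sound: assumes ok: "rep_ok rp" and F: "fam_scan rays (fst rp) al \<sigma> (fam_mats rp k) = Some (U, G, V)" and uv: "u < 6" "v < 6"
 shows "hastop (fst rp) (%_. ev al) (%_. 0) (zprod (U ! u) (zpow G n (V ! v)))
 (fold (sact rp) (fam_pre k u @ concat (replicate n (fam_t k)) @ fam_V k ! v) sid)"
 "zwf (fst rp) (U ! u)" "zwf (fst rp) G" "length U = 6" "length V = 6"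
proof -
 let ?d = "fst rp" and ?s = "%p. ev (\<sigma> ! p)"
 let ?al = "replicate (fst rp) al" and ?z = "replicate (fst rp) (0, 0)" and ?m = "map pneg2 \<sigma>"
 have c: "omap (sscan rays 0 (rvals rays ?al) (rvals rays \<sigma>)) (map (%u. wmat rp (rev u @ fam_d k)) (fam_V k)) = Some U"
 "sscan rays 0 (rvals rays ?m) (rvals rays \<sigma>) (wmat rp (fam_t k)) = Some G"
 "omap (sscan rays 0 (rvals rays ?m) (rvals rays ?z)) (map (wmat rp) (fam_V k)) = Some V"
 using F by (auto simp: fam_mats_def split: option.splits)
 have uv': "u < length (fam_V k)" "v < length (fam_V k)" using uv by (simp_all add: length_fam_V)
 have U: "sscan rays 0 (rvals rays ?al) (rvals rays \<sigma>) (wmat rp (fam_pre k u)) = Some (U ! u)"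
 and V: "sscan rays 0 (rvals rays ?m) (rvals rays ?z) (wmat rp (fam_V k ! v)) = Some (V ! v)"
 using omap_Some[OF c(1)] omap_Some[OF c(3)] uv' by (auto simp: fam_pre_def)
 show "length U = 6" "length V = 6" using omap_Some[OF c(1)] omap_Some[OF c(3)] by (simp_all add: length_fam_V)
 have ls: "length \<sigma> = ?d" using sscan_sound[OF c(2)] wmat_repd[OF ok, of "fam_t k"] by (simp add: repd_def)
 have e: "ev (?m ! p) = - ?s p" "ev (?al ! p) = ev al" "ev (?z ! p) = 0" if "p < ?d" for p
 using that ls by (simp_all add: rval_pneg2) (simp add: rval_def)
 note hU = hastop_scan[OF wmat_repd[OF ok] U ls e(2) HOL.refl]
 and hG = hastop_scan[OF wmat_repd[OF ok] c(2) ls e(1) HOL.refl]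
 and hV = hastop_scan[OF wmat_repd[OF ok] V _ e(1) e(3), simplified]
 show "zwf ?d (U ! u)" "zwf ?d G" using hU(2) hG(2) by blast+
 have P: "hastop ?d (%p. - ?s p) (%_. 0) (zpow G n (V ! v)) (fold (sact rp) (concat (replicate n (fam_t k)) @ fam_V k ! v) sid)" for n
 proof (induction n)
 case 0 thus ?case using hV(1) by simp
 next
 case (Suc n)
 show ?case using hastop_mult[OF hG Suc]
 by (subst hastop_cong[where B = "%p j. \<Sum>m<?d. fold (sact rp) (fam_t k) sid p m * fold (sact rp) (concat (replicate n (fam_t k)) @ fam_V k ! v) sid m j"])
 (use fold_sact_append[of _ rp _ "fam_t k" "concat (replicate n (fam_t k)) @ fam_V k ! v"] in simp_all)
 qed
 show "hastop ?d (%_. ev al) (%_. 0) (zprod (U ! u) (zpow G n (V ! v)))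
 (fold (sact rp) (fam_pre k u @ concat (replicate n (fam_t k)) @ fam_V k ! v) sid)"
 using hastop_mult[OF hU P[of n]]
 by (subst hastop_cong[where B = "%p j. \<Sum>m<?d. fold (sact rp) (fam_pre k u) sid p m * fold (sact rp) (concat (replicate n (fam_t k)) @ fam_V k ! v) sid m j"])
 (use fold_sact_append[of _ rp _ "fam_pre k u" "concat (replicate n (fam_t k)) @ fam_V k ! v"] in simp_all)
qed

lemma comp_tops: assumes ok: "rep_ok rp" and D: "comp_data rays cl rp i (r, al, bs, s0, s1, kd) Lz F" and c: "valid c"
 shows "hastop (fst rp) (%_. ev al) (%_. 0) (code_top Lz F c) (Rm rp (elt (code_word c)))"
proof (cases c)
 case (Fn n)
 hence n: "n < length fin_words" using c by simp
 let ?al = "replicate (fst rp) al" and ?z = "replicate (fst rp) (0, 0)"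
 have "sscan rays 0 (rvals rays ?al) (rvals rays ?z) (fin_mats rp ! n) = Some (Lz ! n)"
 using D n by (simp add: comp_data_def fin_scan_def)
 from hastop_scan(1)[OF fin_mats_repd[OF ok n] this, of "%_. ev al" "%_. 0"]
 show ?thesis using Rm_code[OF ok c] Fn by (simp add: rval_def)
next
 case (Fm k u n v)
 obtain U G V where F: "F k = (U, G, V)" by (metis prod_cases3)
 have "fam_scan rays (fst rp) al (if k = 0 then s0 else s1) (fam_mats rp k) = Some (U, G, V)"
 using D c Fm by (auto simp: comp_data_def F)
 from fam_scan_sound(1)[OF ok this, of u v n] show ?thesis using Rm_code[OF ok c] Fm c F by simp
qed

end

lemma fam_zero_top: assumes "fam_zero F" "u < length (fst F)" "v < length (snd (snd F))" "1 <= n"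
 shows "fam_top F u n v = []"
proof -
 obtain U G V where F: "F = (U, G, V)" by (metis prod_cases3)
 have x: "zprod G (zprod G (V ! v)) = []" "zprod (U ! u) (zprod G (V ! v)) = []"
 using assms(1-3) by (auto simp: F list_all_length)
 have e: "zprod Z [] = []" for Z by (induction Z) (auto simp: zprod_def)
 obtain n' where n: "n = Suc n'" using assms(4) by (cases n) auto
 show ?thesis
 proof (cases n')
 case 0 thus ?thesis using x n F by simp
 next
 case (Suc l)
 have "zpow G (Suc (Suc l)) (V ! v) = []" using x e by (induction l) auto
 thus ?thesis using n Suc F e by simp
 qed
qed

lemma seg_okD: assumes "seg_ok s h (p, j, m) Z"
 shows "p < 6" "j < 6" "0 < m" "even (h ! p - h ! j + s * (int m - 1))"
 "zsem Z p' j' = (if p = p' & j = j' then seg s (h ! p - h ! j) m else 0)"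
 using assms zeq_zsem[of Z] by (auto simp: seg_ok_def zsem_segz)

text \<open>The recursion \<open>W\<close> holds after one application of G; further powers of G and
  the final factor u carry it to every n.\<close>

lemma fam_rec: assumes F: "zwf d G" "zwf d u"
 and W: "zprod G (zadd (zadd (zprod G (zprod G v)) (zadd (zscale (- 1) 1 (zprod G v)) (zscale (- 1) (- 1) (zprod G v)))) v) = []"
 shows "zsem (zprod u (zpow G (Suc n + 2) v)) p j =
 (sgl 1 1 + sgl (- 1) 1) * zsem (zprod u (zpow G (Suc n + 1) v)) p j - zsem (zprod u (zpow G (Suc n) v)) p j"
proof -
 let ?X = "%n i. zsem (zpow G n v) i j" and ?\<zeta> = "sgl 1 1 + sgl (- 1) (1 :: int)"
 have pr: "zsem (zprod G Y) i l = (\<Sum>m<d. zsem G i m * zsem Y m l)" "zsem (zprod u Y) i l = (\<Sum>m<d. zsem u i m * zsem Y m l)" for Y i l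
 proof -
 show "zsem (zprod G Y) i l = (\<Sum>m<d. zsem G i m * zsem Y m l)" by (rule zsem_zprod) (use F in \<open>auto simp: zwf_def\<close>)
 show "zsem (zprod u Y) i l = (\<Sum>m<d. zsem u i m * zsem Y m l)" by (rule zsem_zprod) (use F in \<open>auto simp: zwf_def\<close>)
 qed
 have lin: "(\<Sum>m<d. f m * (?\<zeta> * ?X (Suc n) m - ?X n m)) = ?\<zeta> * (\<Sum>m<d. f m * ?X (Suc n) m) - (\<Sum>m<d. f m * ?X n m)" for f n
 by (simp add: sum_distrib_left algebra_simps sum_subtractf sum.distrib)
 have rec: "?X (Suc n + 2) i = ?\<zeta> * ?X (Suc n + 1) i - ?X (Suc n) i" for n i
 proof (induction n arbitrary: i)
 case 0
 have s: "sgl x (- 1 :: int) = - sgl x 1" for x :: int by (simp add: single_uminus)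
 have "0 = (\<Sum>m<d. zsem G i m * zsem (zadd (zadd (zprod G (zprod G v)) (zadd (zscale (- 1) 1 (zprod G v)) (zscale (- 1) (- 1) (zprod G v)))) v) m j)"
 unfolding pr(1)[symmetric] W by simp
 also have "\<dots> = (\<Sum>m<d. zsem G i m * (?X 2 m - (?\<zeta> * ?X 1 m - ?X 0 m)))"
 unfolding zsem_zadd zsem_zscale s by (simp add: numeral_2_eq_2 algebra_simps)
 also have "\<dots> = (\<Sum>m<d. zsem G i m * ?X 2 m) - (\<Sum>m<d. zsem G i m * (?\<zeta> * ?X (Suc 0) m - ?X 0 m))"
 unfolding right_diff_distrib sum_subtractf by simp
 finally show ?case unfolding lin by (simp add: pr(1)[symmetric] numeral_2_eq_2 del: One_nat_def)
 next
 case (Suc n)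
 have "?X (Suc (Suc n) + 2) i = (\<Sum>m<d. zsem G i m * ?X (Suc n + 2) m)" using pr(1)[of "zpow G (Suc n + 2) v"] by simp
 also have "\<dots> = (\<Sum>m<d. zsem G i m * (?\<zeta> * ?X (Suc (Suc n)) m - ?X (Suc n) m))" unfolding Suc by simp
 finally show ?case unfolding lin pr(1)[symmetric] by simp
 qed
 show ?thesis unfolding pr(2) rec using lin[of _ "Suc n"] by simp
qed

fun ccell :: "nat list => nat => code => nat" where
 "ccell cl m (Fn n) = cl ! n"
| "ccell cl m (Fm k u n v) = m + k"

text \<open>Position of the matrix unit and number of terms of the character. On the infinite cell
  this is a bijection with the triples of admissible parity; the family adds
  \<open>nat (2 div s)\<close> terms for each further t.\<close>

fun own_key :: "int => nat => nat list => zmat list => code => nat \<times> nat \<times> nat" where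
 "own_key s M xs L (Fn i) = zkey_of (L ! i)"
| "own_key s M xs L (Fm k u n v) = (u, v, own_size M xs u v + (n - 1) * nat (2 div s))"

lemma fam_own_top: assumes F: "fam_own s h M xs (U, G, V)" "length U = 6" "length V = 6" "zwf d G" "zwf d (U ! u)" and uv: "u < 6" "v < 6"
 and s: "s * int k = 2" "nat (2 div s) = k"
 shows "(u, v, own_size M xs u v + n * k) = (p, j, m) ==> p < 6 & j < 6 & 0 < m & even (h ! p - h ! j + s * (int m - 1)) &
 zsem (fam_top (U, G, V) u (Suc n) v) p' j' = (if p = p' & j = j' then seg s (h ! p - h ! j) m else 0)"
proof -
 let ?x = "zprod G (V ! v)" and ?m = "own_size M xs u v"
 have "(v, ?x, V ! v) : set (enumerate 0 (map (%v. (zprod G v, v)) V))" "(u, U ! u) : set (enumerate 0 U)"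
 using uv F(2,3) by (auto simp: in_set_enumerate_eq)
 hence *: "zprod G (zadd (zadd (zprod G ?x) (zadd (zscale (- 1) 1 ?x) (zscale (- 1) (- 1) ?x))) (V ! v)) = []"
 "seg_ok s h (u, v, ?m) (zprod (U ! u) ?x)" "seg_ok s h (u, v, ?m + k) (zprod (U ! u) (zprod G ?x))"
 using F(1) unfolding fam_own.simps list_all_iff s(2) by fast+
 have S: "zsem (fam_top (U, G, V) u (Suc n) v) p' j' = (if u = p' & v = j' then seg s (h ! u - h ! v) (?m + n * k) else 0) &
 zsem (fam_top (U, G, V) u (Suc (Suc n)) v) p' j' = (if u = p' & v = j' then seg s (h ! u - h ! v) (?m + Suc n * k) else 0)" for n
 proof (induction n)
 case 0 thus ?case using seg_okD(5)[OF *(2)] seg_okD(5)[OF *(3)] by simp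
 next
 case (Suc n)
 have "zsem (fam_top (U, G, V) u (Suc n + 2) v) p' j' = (if u = p' & v = j' then seg s (h ! u - h ! v) (?m + n * k + k + k) else 0)"
 proof (cases "u = p' & v = j'")
 case True
 have "?m + Suc n * k = ?m + n * k + k" by simp
 thus ?thesis using Suc fam_rec[OF F(4,5) *(1), of n p' j'] seg_rec[OF s(1), of "h ! u - h ! v" "?m + n * k"] True
 by (simp add: add.assoc del: zpow.simps mult_Suc)
 next
 case False
 thus ?thesis using Suc fam_rec[OF F(4,5) *(1), of n p' j'] by (auto simp del: zpow.simps)
 qed
 thus ?case using Suc by (simp add: algebra_simps del: zpow.simps)
 qed
 have e: "even (h ! u - h ! v + s * (int (?m + n * k) - 1))" for n
 proof -
 have "s * (int (?m + n * k) - 1) = s * (int ?m - 1) + int n * (s * int k)" by (simp add: algebra_simps)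
 thus ?thesis using seg_okD(4)[OF *(2)] s(1) by (simp add: add.assoc[symmetric])
 qed
 assume "(u, v, own_size M xs u v + n * k) = (p, j, m)"
 hence q: "p = u" "j = v" "m = ?m + n * k" by auto
 show "p < 6 & j < 6 & 0 < m & even (h ! p - h ! j + s * (int m - 1)) &
 zsem (fam_top (U, G, V) u (Suc n) v) p' j' = (if p = p' & j = j' then seg s (h ! p - h ! j) m else 0)"
 unfolding q by (intro conjI uv e conjunct1[OF S]) (use seg_okD(3)[OF *(2)] in simp)
qed

lemma filt_nth: "length xs = length cl ==> filt cl i xs = map (%n. xs ! n) (filter (%n. cl ! n = i) [0..<length cl])"
proof -
 assume l: "length xs = length cl"
 have "zip cl xs = map (%n. (cl ! n, xs ! n)) [0..<length cl]" using l by (intro nth_equalityI) auto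
 thus ?thesis by (simp add: filt_def filter_map comp_def)
qed

context g2_cone begin

context
 fixes rays' cl rp i r al bs s0 s1 k s h M xs Lz F m
 assumes ok: "rep_ok rp" and D: "comp_data rays cl rp i (r, al, bs, s0, s1, Own k s h M xs) Lz F"
 and cl: "length cl = length fin_words" and i: "i = m + k" and k: "k < 2"
begin

lemma own_kind: "fst rp = 6" "s = 1 | s = 2" "fam_own s h M xs (F k)" "own_fins s h M xs (filt cl i Lz)"
 "length Lz = length cl"
 using D k cl by (auto simp: comp_data_def less_2_cases_iff)

lemma own_step: "s * int (nat (2 div s)) = 2" "0 < s" "0 < nat (2 div s)"
 using own_kind(2) by auto

lemma own_key_sound: assumes c: "valid c" "ccell cl m c = i" and e: "own_key s M xs Lz c = (p, j, l)"
 shows "p < 6 & j < 6 & 0 < l & even (h ! p - h ! j + s * (int l - 1)) &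
 (ALL p' j'. zsem (code_top Lz F c) p' j' = (if p = p' & j = j' then seg s (h ! p - h ! j) l else 0))"
proof (cases c)
 case (Fn n)
 have "Lz ! n : set (filt cl i Lz)" using c Fn cl own_kind(5) by (auto simp: filt_nth)
 hence "seg_ok s h (zkey_of (Lz ! n)) (Lz ! n)" using own_kind(4) by (simp add: list_all_iff)
 thus ?thesis using e Fn seg_okD by fastforce
next
 case (Fm k' u n v)
 hence k': "k' = k" "u < 6" "v < 6" "n = Suc (n - 1)" using c i by auto
 obtain U G V where F: "F k = (U, G, V)" by (metis prod_cases3)
 have sc: "fam_scan rays (fst rp) al (if k = 0 then s0 else s1) (fam_mats rp k) = Some (U, G, V)"
 using D k F by (auto simp: comp_data_def)
 note z = fam_scan_sound[OF ok sc k'(2,3)]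
 show ?thesis using fam_own_top[OF own_kind(3)[unfolded F] z(4,5) z(3,2) k'(2,3) own_step(1) HOL.refl, of "n - 1"] e Fm k' F by auto
qed

lemma own_key_inj: assumes c: "valid c" "ccell cl m c = i" and c': "valid c'" "ccell cl m c' = i"
 and e: "own_key s M xs Lz c = own_key s M xs Lz c'"
 shows "c = c'"
proof -
 have small: "l < own_size M xs p j" if "n < length cl" "cl ! n = i" "zkey_of (Lz ! n) = (p, j, l)" for n p j l
 proof -
 have "Lz ! n : set (filt cl i Lz)" using that own_kind(5) by (auto simp: filt_nth)
 hence "zkey_of (Lz ! n) : set (map zkey_of (filt cl i Lz))" by simp
 thus ?thesis using own_kind(4) that(3) unfolding own_fins.simps list_all_iff by fastforce
 qed
 have ff: "n = n'" if "n < length cl" "cl ! n = i" "n' < length cl" "cl ! n' = i" "zkey_of (Lz ! n) = zkey_of (Lz ! n')" for n n'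
 proof -
 have "distinct (map (%n. zkey_of (Lz ! n)) (filter (%n. cl ! n = i) [0..<length cl]))"
 using own_kind(4) by (simp add: filt_nth own_kind(5) comp_def)
 hence "inj_on (%n. zkey_of (Lz ! n)) {n. n < length cl & cl ! n = i}" by (simp add: distinct_map)
 thus ?thesis using that by (auto dest: inj_onD)
 qed
 have fm: False if "n < length cl" "cl ! n = i" "zkey_of (Lz ! n) = own_key s M xs Lz (Fm k' u n' v)" for n k' u n' v
 using small[OF that(1,2), of u v] that(3) by simp
 show ?thesis
 proof (cases c; cases c')
 fix n n' assume "c = Fn n" "c' = Fn n'"
 thus ?thesis using ff c c' e cl by simp
 next
 fix n k' u n' v assume "c = Fn n" "c' = Fm k' u n' v"
 thus ?thesis using fm[of n k' u n' v] c e cl by simp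
 next
 fix n k' u n' v assume "c' = Fn n" "c = Fm k' u n' v"
 thus ?thesis using fm[of n k' u n' v] c' e cl by simp
 next
 fix k1 u n v k2 u' n' v' assume "c = Fm k1 u n v" "c' = Fm k2 u' n' v'"
 thus ?thesis using c c' e own_step(3) by auto
 qed
qed

text \<open>Below \<open>own_size\<close> the finite words supply the element. Beyond it the family
  does: two admissible sizes differ by a multiple of the step, which is 2 for s = 1, where parity
  matters, and 1 for s = 2.\<close>

lemma own_key_surj: assumes "p < 6" "j < 6" "0 < l" and ev: "even (h ! p - h ! j + s * (int l - 1))"
 shows "EX c. valid c & ccell cl m c = i & own_key s M xs Lz c = (p, j, l)"
proof (cases "l < own_size M xs p j")
 case True
 hence "(p, j, l) : set (map zkey_of (filt cl i Lz))"
 using own_kind(4) assms unfolding own_fins.simps list_all_iff by (auto simp: Suc_le_eq)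
 then obtain n where "n < length cl" "cl ! n = i" "zkey_of (Lz ! n) = (p, j, l)" by (auto simp: filt_nth own_kind(5))
 thus ?thesis using cl by (intro exI[of _ "Fn n"]) simp
next
 case False
 let ?m = "own_size M xs p j" and ?q = "nat (2 div s)"
 have "own_key s M xs Lz (Fm k p 1 j) = (p, j, ?m)" by simp
 hence e: "even (h ! p - h ! j + s * (int ?m - 1))" using own_key_sound[of "Fm k p 1 j" p j ?m] assms k i by simp
 have "even (s * (int l - int ?m))"
 proof -
 have "s * (int l - int ?m) = (h ! p - h ! j + s * (int l - 1)) - (h ! p - h ! j + s * (int ?m - 1))" by (simp add: algebra_simps)
 thus ?thesis using e ev by simp
 qed
 hence "s = 1 ==> even (l - ?m)" using False by (simp add: of_nat_diff[symmetric] del: of_nat_diff)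
 hence "?q dvd l - ?m" using own_kind(2) by auto
 then obtain n where n: "l - ?m = ?q * n" by blast
 hence "own_key s M xs Lz (Fm k p (Suc n) j) = (p, j, l)" using False by (simp add: mult.commute)
 thus ?thesis using assms k i by (intro exI[of _ "Fm k p (Suc n) j"]) simp
qed

end
end

section \<open>Bar-invariant elements killed by the representations\<close>

definition cact :: "grep => gen list => pol list list => pol list list" where
 "cact rp u R = fold (%g R. add_rows (mmul R (gen_mat rp g)) (smul_rows [(1, gen_mon g (- 1))] R)) u R"

type_synonym comb = "(pol \<times> gen list) list"

fun comb_mat :: "grep => comb => pol list list" where
 "comb_mat rp [] = map (map (%p. [])) (unit_rows (fst rp))"
| "comb_mat rp ((p, u) # l) = add_rows (smul_rows p (cact rp u (unit_rows (fst rp)))) (comb_mat rp l)"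

definition kill_ok :: "grep => comb => bool" where
 "kill_ok rp l <-> list_all (list_all (%p. p = [])) (comb_mat rp l)"

text \<open>Negating exponents reverses the order of a sorted list, so invariance under bar becomes
  an equality with the reversed list; \<zeta> must not occur because the coefficients are scalars of
  the Hecke algebra.\<close>

definition sym_pol :: "pol => bool" where
 "sym_pol p <-> map (%(c, (x, y, z)). (c, (- x, - y, z))) p = rev p & list_all (%(c, (x, y, z)). z = 0) p"

definition comb_ok :: "comb => bool" where
 "comb_ok l <-> l ~= [] & fst (hd l) = [(1, (0, 0, 0))] & list_all (%(p, u). sym_pol p & kreduced kzero u) l &
 list_all (%(p, u). length u < length (snd (hd l))) (tl l)"

text \<open>On \<open>C w0\<close> each factor \<open>Cs s\<close> with s = s_1 or s_2 acts from the
  right by q^L(s) + q^-L(s); this is the scalar by which the whole combination acts.\<close>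

fun comb_value :: "comb => pol" where
 "comb_value [] = []"
| "comb_value ((p, u) # l) = padd (pmul p (foldr (%g q. pmul q [(1, gen_mon g (- 1)), (1, gen_mon g 1)]) (rev u) [(1, (0, 0, 0))])) (comb_value l)"

lemma mult_monic_0: fixes P X :: "int \<Rightarrow>\<^sub>0 'c :: comm_ring_1"
 assumes "dle n P" "coef P n = 1" "P * X = 0" shows "X = 0"
proof (rule ccontr)
 assume X: "X ~= 0"
 let ?m = "Max (supp X)"
 have m: "?m : supp X" using X by simp
 have "dle ?m X" by (auto simp: dle_keys)
 from lookup_mult_top[OF assms(1) this] assms(2,3) have "coef X ?m = 0" by simp
 thus False using m by (simp add: in_keys_iff)
qed

context g2_weights begin

definition lp :: "pol => laurent" where
 "lp p = (\<Sum>(c, (x, y, z))\<leftarrow>p. sgl (x * int a + y * int b) c)"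

lemma emb_lp: "list_all (%(c, (x, y, z)). z = 0) p ==> emb (lp p) = psem p"
proof (induction p)
 case (Cons t p)
 obtain c x y z where t: "t = (c, (x, y, z))" by (metis prod_cases4)
 have "(of_int c :: laurent) = sgl 0 c" by (simp flip: single_of_int)
 thus ?case using Cons by (simp add: t lp_def emb_add emb_single psem_Cons tsem_def)
next
 case Nil
 have "emb 0 = 0" by (rule poly_mapping_eqI) simp
 thus ?case by (simp add: lp_def)
qed

lemma bar_lp: assumes "sym_pol p" shows "lbar (lp p) = lp p"
proof (rule poly_mapping_eqI)
 fix k
 have l: "coef (lp p) k = (\<Sum>(c, (x, y, z))\<leftarrow>p. if x * int a + y * int b = k then c else 0)" for p k
 unfolding lp_def by (induction p) (auto simp: lookup_add lookup_single when_def)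
 have "coef (lbar (lp p)) k = (\<Sum>(c, (x, y, z))\<leftarrow>map (%(c, (x, y, z)). (c, (- x, - y, z))) p. if x * int a + y * int b = k then c else 0)"
 unfolding lookup_laurent_bar l
 proof (induction p)
 case (Cons t p)
 obtain c x y z where t: "t = (c, (x, y, z))" by (metis prod_cases4)
 have "x * int a + y * int b = - k <-> - x * int a + - y * int b = k" by auto
 thus ?case using Cons by (simp add: t)
 qed simp
 also have "\<dots> = coef (lp p) k" using assms by (simp add: sym_pol_def l rev_map[symmetric] sum_list_rev)
 finally show "coef (lbar (lp p)) k = coef (lp p) k" .
qed

definition CW :: "gen list => (gen list set \<Rightarrow>\<^sub>0 laurent)" where
 "CW u = fold (%g h. h**Cs (elt [g])) u (T \<one>\<^bsub>G2t\<^esub>)"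

lemma CW_Nil: "CW [] = T \<one>\<^bsub>G2t\<^esub>" and CW_snoc: "CW (u @ [g]) = CW u**Cs (elt [g])"
 by (simp_all add: CW_def)
lemma CW_closed: "CW u : HC"
 by (induction u rule: rev_induct) (simp_all add: CW_Nil CW_snoc gen_S)

lemma top_elt_CW: "kreduced kzero u ==> top_elt (elt u) (CW u)"
proof (induction u rule: rev_induct)
 case Nil thus ?case using top_elt_one by (simp add: CW_Nil elt_Nil)
next
 case (snoc g u)
 have "top_elt (elt u) (CW u)" "elt [g] ~: NG (elt u)"
 using snoc descent[of "elt u" g] by (auto simp: kreduced_append Ke_elt)
 from top_elt_right[OF this(1) gen_S this(2)] show ?case by (simp add: CW_snoc elt_append)
qed

definition comb_elt :: "comb => (gen list set \<Rightarrow>\<^sub>0 laurent)" where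
 "comb_elt l = (\<Sum>(p, u)\<leftarrow>l. scale (lp p) (CW u))"

lemma comb_elt_Nil: "comb_elt [] = 0" and comb_elt_Cons: "comb_elt ((p, u) # l) = scale (lp p) (CW u) + comb_elt l"
 by (simp_all add: comb_elt_def)
lemma comb_elt_closed: "comb_elt l : HC"
 by (induction l) (auto simp: comb_elt_Nil comb_elt_Cons CW_closed)

lemma top_elt_comb: assumes "comb_ok l" shows "top_elt (elt (snd (hd l))) (comb_elt l)"
proof -
 obtain w l' where l: "l = ([(1, (0, 0, 0))], w) # l'" using assms by (cases l) (auto simp: comb_ok_def)
 have w: "kreduced kzero w" and l': "!!p u. (p, u) : set l' ==> sym_pol p & kreduced kzero u & length u < length w"
 using assms by (auto simp: l comb_ok_def list_all_iff)
 have t: "top_elt (elt w) (CW w)" by (rule top_elt_CW[OF w])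
 have "bar (comb_elt l') = comb_elt l' & comb_elt l' : low (len (elt w))" using l'
 proof (induction l')
 case Nil thus ?case by (simp add: comb_elt_Nil low_def)
 next
 case (Cons t l')
 obtain p u where pu: "t = (p, u)" by (cases t)
 hence u: "sym_pol p" "kreduced kzero u" "length u < length w" using Cons.prems by auto
 have tu: "top_elt (elt u) (CW u)" by (rule top_elt_CW[OF u(2)])
 have "CW u - T (elt u) : low (Suc (len (elt u)))" "T (elt u) : low (Suc (len (elt u)))"
 using tu low_mono[of "CW u - T (elt u)" "len (elt u)" "Suc (len (elt u))"] by (auto simp: top_elt_def intro: low_T)
 from low_add[OF this] have "CW u : low (Suc (len (elt u)))" by simp
 hence "CW u : low (len (elt w))" by (rule low_mono) (use u w in \<open>simp add: len_kreduced\<close>)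
 thus ?case using Cons tu bar_lp[OF u(1)] by (auto simp: pu comb_elt_Cons bar_add bar_scale top_elt_def intro!: low_add low_scale)
 qed
 moreover have "comb_elt l = CW w + comb_elt l'" by (simp add: l comb_elt_Cons lp_def)
 ultimately have e: "bar (comb_elt l) = comb_elt l" "comb_elt l - T (elt w) = (CW w - T (elt w)) + comb_elt l'"
 "comb_elt l' : low (len (elt w))"
 using t by (simp_all add: bar_add top_elt_def)
 hence "comb_elt l - T (elt w) : low (len (elt w))" using t by (simp only: top_elt_def low_add)
 thus ?thesis using e(1) by (simp add: l top_elt_def comb_elt_closed)
qed

context
 fixes rp assumes ok: "rep_ok rp"
begin

interpretation r: hecke_rep G2t G2t_gens L NG "Rm rp" "fst rp" by (rule rep_ok_hecke_rep[OF ok])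

lemma repr_CW: "repd (fst rp) (cact rp u (unit_rows (fst rp))) (repr (Rm rp) (CW u))"
proof (induction u rule: rev_induct)
 case Nil
 have "repr (Rm rp) (CW []) p j = sid p j" if "p < fst rp" "j < fst rp" for p j
 using r.R_one[OF that] by (simp add: CW_Nil sid_def)
 thus ?case using repd_unit[of "fst rp"] by (simp add: cact_def repd_def)
next
 case (snoc g u)
 let ?d = "fst rp" and ?A = "repr (Rm rp) (CW u)" and ?M = "[(1, gen_mon g (- 1))]"
 have g: "elt [g] : G2t_gens" by (cases g) (auto simp: gens_eq)
 have G: "Rm rp (elt [g]) = sact rp g sid"
 using Rm_elt[OF ok, of "[g]"] len_kreduced[of "[g]"] by (cases g) auto
 have q: "emb (qpow (- int (L (elt [g])))) = psem ?M"
 by (cases g) (simp_all add: qpow_def emb_single L_gen psem_Cons tsem_def)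
 have "repr (Rm rp) (CW (u @ [g])) p j = sact rp g ?A p j + psem ?M * ?A p j" if pj: "p < ?d" "j < ?d" for p j
 proof -
 have "repr (Rm rp) (CW (u @ [g])) p j = (\<Sum>m<?d. ?A p m * repr (Rm rp) (Cs (elt [g])) m j)"
 unfolding CW_snoc by (rule r.repr_mult[OF CW_closed _ pj]) (use g in simp)
 also have "\<dots> = (\<Sum>m<?d. ?A p m * sact rp g sid m j + (if m = j then psem ?M * ?A p j else 0))"
 using pj r.R_one by (intro sum.cong) (auto simp: Cs_def repr_add repr_scale G q distrib_left)
 finally show ?thesis using fold_sact_linear[of "[g]" rp ?A p j] pj by (simp add: sum.distrib)
 qed
 moreover have "repd ?d (cact rp (u @ [g]) (unit_rows ?d)) (%p j. sact rp g ?A p j + psem ?M * ?A p j)"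
 using repd_add[OF repd_mmul[OF snoc rep_ok_gmat[OF ok] HOL.refl] repd_smul[OF snoc], of g ?M] by (simp add: cact_def)
 ultimately show ?case by (simp add: repd_def)
qed

lemma kill_ok_sound: assumes "kill_ok rp l" "list_all (%(p, u). sym_pol p) l" shows "r.kills (comb_elt l)"
proof -
 have "repd (fst rp) (comb_mat rp l) (repr (Rm rp) (comb_elt l))" using assms(2)
 proof (induction l)
 case Nil thus ?case by (simp add: comb_elt_Nil repd_def unit_rows_def)
 next
 case (Cons t l)
 obtain p u where t: "t = (p, u)" by (cases t)
 have "emb (lp p) = psem p" using Cons.prems by (intro emb_lp) (simp add: t sym_pol_def)
 thus ?case using repd_add[OF repd_smul[OF repr_CW[of u], of p] Cons.IH] Cons.prems
 by (simp add: t comb_elt_Cons repr_add[abs_def] repr_scale)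
 qed
 thus ?thesis using assms(1) by (auto simp: r.kills_def repd_def kill_ok_def list_all_length)
qed

end

lemma C_w0_CW: assumes "set u <= {G1, G2}"
 shows "EX c. C w0**CW u = scale c (C w0) & emb c = psem (foldr (%g q. pmul q [(1, gen_mon g (- 1)), (1, gen_mon g 1)]) (rev u) [(1, (0, 0, 0))])"
 using assms
proof (induction u rule: rev_induct)
 case Nil thus ?case by (intro exI[of _ 1]) (simp add: CW_Nil psem_Cons tsem_1)
next
 case (snoc g u)
 then obtain c where c: "C w0**CW u = scale c (C w0)"
 "emb c = psem (foldr (%g q. pmul q [(1, gen_mon g (- 1)), (1, gen_mon g 1)]) (rev u) [(1, (0, 0, 0))])" by auto
 have g: "elt [g] : G2t_gens" "elt [g] : NG w0" using snoc.prems w0_descents by (auto simp: gens_eq)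
 let ?q = "qpow (int (L (elt [g]))) + qpow (- int (L (elt [g])))"
 have "C w0**CW (u @ [g]) = (C w0**CW u)**Cs (elt [g])" unfolding CW_snoc using g CW_closed by (simp add: hm_assoc)
 also have "\<dots> = scale c (scale ?q (C w0))" using g C_mult_descent[of w0 "elt [g]"] by (simp add: c hm_scale_left)
 finally have "C w0**CW (u @ [g]) = scale (c * ?q) (C w0)" by simp
 moreover have "emb ?q = psem [(1, gen_mon g (- 1)), (1, gen_mon g 1)]"
 by (cases g) (simp_all add: emb_add qpow_def emb_single L_gen psem_Cons tsem_def add.commute)
 ultimately show ?case using c(2) by (intro exI[of _ "c * ?q"]) (simp add: emb_mult psem_pmul del: pmul.simps)
qed

text \<open>Modulo what is killed, \<open>T w\<close> is minus the shorter terms in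
  \<open>Gamma0_expansion\<close>, whose coefficients have negative degree. A bound N outside the
  lowest cell thus improves to N - 1 on it, and leading matrices vanish there.\<close>

lemma Gamma0_bound: assumes ok: "rep_ok rp" and k: "hecke_rep.kills (Rm rp) (fst rp) (C w0)"
 and bd: "!!w p j. w : GW ==> w ~: Gamma0 ==> p < fst rp ==> j < fst rp ==> dle N (Rm rp w p j)"
 shows "w : Gamma0 ==> p < fst rp ==> j < fst rp ==> dle (N - 1) (Rm rp w p j)"
proof (induction "len w" arbitrary: w p j rule: less_induct)
 case less
 interpret r: hecke_rep G2t G2t_gens L NG "Rm rp" "fst rp" by (rule rep_ok_hecke_rep[OF ok])
 obtain x y f where f: "x : GW" "y : GW" "T x**C w0**T y = T w + f" "f : low (len w)" "dleH (- 1) f"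
 using Gamma0_expansion[OF less.prems(1)] .
 have "r.kills (T x**C w0**T y)" using f k by (intro r.kills_mult hm_closed disjI1 disjI2) simp_all
 hence "Rm rp w p j + repr (Rm rp) f p j = 0" using less.prems by (simp add: f r.kills_def repr_add)
 moreover have "dle (- 1 + N) (repr (Rm rp) f p j)"
 proof (rule repr_top(1))
 show "dle (- 1) (coef f v)" for v using f(5) by (simp add: dleH_def)
 fix v assume "v : supp f"
 hence v: "v : GW" "len v < len w" using f(4) by (auto simp: low_def HC_def)
 show "dle N (Rm rp v p j)"
 proof (cases "v : Gamma0")
 case True thus ?thesis using dle_mono[OF less.hyps[OF v(2)], of p j N] less.prems by simp
 qed (use bd v less.prems in blast)
 qed
 ultimately show ?case by (simp add: eq_neg_iff_add_eq_0[symmetric] dle_uminus)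
qed

end

context g2_weights begin

lemma C_w0_comb: assumes "list_all (%(p, u). sym_pol p & set u <= {G1, G2}) l"
 shows "EX c. C w0**comb_elt l = scale c (C w0) & emb c = psem (comb_value l)"
 using assms
proof (induction l)
 case Nil
 have "emb 0 = 0" by (rule poly_mapping_eqI) simp
 thus ?case using hm_add_right[of "C w0" 0 0] by (intro exI[of _ 0]) (simp add: comb_elt_Nil)
next
 case (Cons t l)
 obtain p u where t: "t = (p, u)" by (cases t)
 obtain c where c: "C w0**comb_elt l = scale c (C w0)" "emb c = psem (comb_value l)"
 using Cons.IH Cons.prems by (simp only: list.pred_inject) blast
 have u: "set u <= {G1, G2}" using Cons.prems t by simp
 obtain c' where c': "C w0**CW u = scale c' (C w0)"
 "emb c' = psem (foldr (%g q. pmul q [(1, gen_mon g (- 1)), (1, gen_mon g 1)]) (rev u) [(1, (0, 0, 0))])"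
 using C_w0_CW[OF u] by blast
 have "emb (lp p) = psem p" using Cons.prems by (intro emb_lp) (simp add: t sym_pol_def)
 moreover have "C w0**comb_elt (t # l) = scale (lp p * c' + c) (C w0)"
 using CW_closed comb_elt_closed by (simp add: t comb_elt_Cons hm_add_right hm_scale_right c c' scale_add_left)
 ultimately show ?case using c(2) c'(2)
 by (intro exI[of _ "lp p * c' + c"]) (simp add: t emb_add emb_mult psem_padd psem_pmul del: pmul.simps)
qed

text \<open>The value of \<open>comb_value\<close> is \<open>q\<^bsup>3a + 3b\<^esup>\<close> plus lower terms, so it can be cancelled.\<close>

lemma kills_C_w0: assumes ok: "rep_ok rp" and l: "list_all (%(p, u). sym_pol p & set u <= {G1, G2}) l"
 and k: "hecke_rep.kills (Rm rp) (fst rp) (comb_elt l)"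
 and t: "dscan [((1, 0), 3), ((0, 1), 3)] (comb_value l) = Some [(1, 0)]"
 shows "hecke_rep.kills (Rm rp) (fst rp) (C w0)"
proof -
 interpret r: hecke_rep G2t G2t_gens L NG "Rm rp" "fst rp" by (rule rep_ok_hecke_rep[OF ok])
 interpret q: g2_cone L a b "[(1, 0), (0, 1)]"
 proof (intro g2_cone.intro g2_weights_axioms g2_cone_axioms.intro)
 have "x * int a + y * int b <= 0 & (x ~= 0 | y ~= 0 --> x * int a + y * int b < 0)" if "x <= 0" "y <= 0" for x y
 proof -
 have "x * int a <= 0" "y * int b <= 0" "x ~= 0 --> x * int a < 0" "y ~= 0 --> y * int b < 0"
 using that ab by (auto simp: mult_le_0_iff mult_less_0_iff)
 thus ?thesis by auto
 qed
 from this[of "fst z" "snd z" for z] show "cone [(1, 0), (0, 1)] a b"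
 unfolding cone_def rval_def by simp
 qed
 obtain c where c: "C w0**comb_elt l = scale c (C w0)" "emb c = psem (comb_value l)" using C_w0_comb[OF l] by blast
 have P: "dle (3 * int a + 3 * int b) (emb c)" "coef (emb c) (3 * int a + 3 * int b) = 1"
 proof -
 have "map (%l. (l, rval (3, 3) l + rval (0, 0) l)) [(1, 0), (0, 1)] = [((1, 0), 3), ((0, 1), 3)]" by (simp add: rval_def)
 hence "dscan (map (%l. (l, rval (3, 3) l + rval (0, 0) l)) [(1, 0), (0, 1)]) (comb_value l) = Some [(1, 0)]" using t by (simp only:)
 from q.dscan_sound[OF this] show "dle (3 * int a + 3 * int b) (emb c)" "coef (emb c) (3 * int a + 3 * int b) = 1"
 unfolding c(2) by (simp_all add: rval_def)
 qed
 have "r.kills (C w0**comb_elt l)" using k comb_elt_closed by (intro r.kills_mult) simp_all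
 hence "emb c * repr (Rm rp) (C w0) p j = 0" if "p < fst rp" "j < fst rp" for p j
 using that by (simp add: c(1) r.kills_def repr_scale)
 thus ?thesis unfolding r.kills_def using mult_monic_0[OF P] by blast
qed

end

text \<open>Among the elements with nonzero coefficient one of highest rank is chosen; its
  functional vanishes on all the others and isolates its coefficient.\<close>

lemma rank_indep: fixes c :: "'w => int" and ld :: "'w => 'k => int" and rk :: "'w => nat"
 assumes A: "finite A" and s: "!!w. w : A ==> (\<Sum>v\<in>A. c v * ld v (f w)) = 0"
 and nz: "!!w. w : A ==> ld w (f w) ~= 0"
 and z: "!!v w. v : A ==> w : A ==> v ~= w ==> rk v <= rk w ==> ld v (f w) = 0"
 shows "w : A ==> c w = 0"
proof (rule ccontr)
 assume w: "w : A" "c w ~= 0"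
 let ?B = "{v : A. c v ~= 0}"
 obtain u where u: "u : ?B" "!!v. v : ?B ==> rk v <= rk u"
 using finite_max_elt[of ?B rk] A w by force
 have "(\<Sum>v\<in>A. c v * ld v (f u)) = (\<Sum>v\<in>A. if v = u then c u * ld u (f u) else 0)"
 using z u by (intro sum.cong) auto
 also have "\<dots> = c u * ld u (f u)" using A u by simp
 finally show False using s[of u] nz[of u] u by auto
qed

definition zval :: "zmat => (nat => nat => laurent) => int" where
 "zval f A = (\<Sum>((p, j, e), g)\<leftarrow>f. g * coef (A p j) e)"

definition key_in :: "nat => zmat => bool" where
 "key_in d f <-> (ALL ((p, j, e), g):set f. p < d & j < d)"

lemma zval_cong: "key_in d f ==> (!!p j. p < d ==> j < d ==> A p j = B p j) ==> zval f A = zval f B"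
 unfolding zval_def key_in_def by (intro arg_cong[where f = sum_list] map_cong) auto

lemma zval_0: "zval f (%p j. 0) = 0"
 unfolding zval_def by (induction f) auto

lemma lookup_of_int_mult: "coef (of_int k * x :: laurent) e = k * coef x e"
 by (induction k rule: int_induct[of _ 0]) (simp_all add: algebra_simps lookup_add lookup_minus)

lemma zval_sum: "zval f (%p j. \<Sum>w\<in>A. of_int (c w) * ld w p j) = (\<Sum>w\<in>A. c w * zval f (ld w))"
proof (induction f)
 case Nil thus ?case by (simp add: zval_def)
next
 case (Cons t f)
 obtain p j e g where t: "t = ((p, j, e), g)" by (cases t, cases "fst t") auto
 have "g * coef (\<Sum>w\<in>A. of_int (c w) * ld w p j) e = (\<Sum>w\<in>A. c w * (g * coef (ld w p j) e))"
 by (simp add: lookup_sum lookup_of_int_mult sum_distrib_left mult.left_commute)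
 thus ?case using Cons unfolding zval_def t by (simp add: sum.distrib distrib_left)
qed

section \<open>The cells of a face\<close>

text \<open>What the certificates yield on one face. Cells outside the lowest have numbers below n,
  and m + k is that of the family k; \<open>tp\<close> holds the leading matrices,
  \<open>key\<close> and \<open>rk\<close> the functionals and ranks for their independence.\<close>

locale g2_face = g2_cone +
 fixes n m :: nat and cl :: "nat list" and rho :: "nat => grep" and al :: "nat => weight" and tp :: "nat => code => zmat"
 and key :: "code => zmat" and rk :: "code => nat"
 assumes rok: "i < n ==> rep_ok (rho i)"
 and al0: "i < n ==> 0 <= ev (al i)"
 and tops: "i < n ==> valid c ==> hastop (fst (rho i)) (%_. ev (al i)) (%_. 0) (tp i c) (Rm (rho i) (elt (code_word c)))"
 and tops_0: "i < n ==> valid c ==> ccell cl m c ~= i ==> zsem (tp i c) = (%p j. 0)"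
 and ccell_less: "valid c ==> ccell cl m c < n"
 and key_in: "valid c ==> key_in (fst (rho (ccell cl m c))) (key c)"
 and key_nz: "valid c ==> zval (key c) (zsem (tp (ccell cl m c) c)) ~= 0"
 and key_0: "valid c ==> valid c' ==> ccell cl m c' = ccell cl m c ==> rk c' <= rk c ==> c' ~= c ==>
 zval (key c) (zsem (tp (ccell cl m c) c')) = 0"
 and kill_base: "valid c ==> EX x e y f. code_word c = x @ e @ y & top_elt (elt e) f &
 (ALL k<n. k ~= ccell cl m c --> ev (al k) <= ev (al (ccell cl m c)) --> hecke_rep.kills (Rm (rho k)) (fst (rho k)) f)"
 and kill_w0: "EX f. top_elt w0 f & (ALL k<n. hecke_rep.kills (Rm (rho k)) (fst (rho k)) f)"
 and kill_C_w0: "k < n ==> hecke_rep.kills (Rm (rho k)) (fst (rho k)) (C w0)"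
begin

abbreviation "cc \<equiv> ccell cl m"

definition alpha :: "nat => nat" where "alpha i = nat (ev (al i))"

lemma alpha: "i < n ==> int (alpha i) = ev (al i)"
 using al0 by (simp add: alpha_def)

definition code_of :: "gen list set => code" where
 "code_of w = (SOME c. valid c & w = elt (code_word c))"

text \<open>The lowest cell gets the number n, which lies outside the index set of the
  representations; hence all of them have to kill its elements.\<close>

definition cell :: "gen list set => nat" where
 "cell w = (if w : Gamma0 then n else cc (code_of w))"

lemma code_of: assumes "w : GW" "w ~: Gamma0" shows "valid (code_of w)" "w = elt (code_word (code_of w))"
 using someI_ex[of "%c. valid c & w = elt (code_word c)"] cover[OF assms(1)] assms(2) unfolding code_of_def by blast+

abbreviation "ld i w p j \<equiv> coef (Rm (rho i) w p j) (int (alpha i))"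

lemma ld_code: assumes "i < n" "valid c" "p < fst (rho i)" "j < fst (rho i)"
 shows "dle (int (alpha i)) (Rm (rho i) (elt (code_word c)) p j)" "ld i (elt (code_word c)) p j = zsem (tp i c) p j"
 using tops[OF assms(1,2)] assms(3,4) alpha[OF assms(1)] by (auto simp: hastop_def)

lemma ld_Gamma0: assumes "i < n" "w : Gamma0" "p < fst (rho i)" "j < fst (rho i)"
 shows "dle (int (alpha i) - 1) (Rm (rho i) w p j)"
proof (rule Gamma0_bound[OF rok[OF assms(1)] kill_C_w0[OF assms(1)] _ assms(2-4)])
 fix w p j assume w: "w : GW" "w ~: Gamma0" "p < fst (rho i)" "j < fst (rho i)"
 show "dle (int (alpha i)) (Rm (rho i) w p j)"
 using ld_code(1)[OF assms(1) code_of(1)[OF w(1,2)] w(3,4)] code_of(2)[OF w(1,2)] by simp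
qed

text \<open>The functional of c is nonzero on its leading matrix, whereas leading matrices vanish on
  the lowest cell and on every cell with another number. So the arbitrary choice in
  \<open>code_of\<close> does not affect the cell.\<close>

lemma cell_code: assumes c: "valid c" shows "elt (code_word c) ~: Gamma0" "cell (elt (code_word c)) = cc c"
proof -
 let ?i = "cc c" and ?w = "elt (code_word c)"
 have i: "?i < n" using ccell_less[OF c] .
 have False if z: "!!p j. p < fst (rho ?i) ==> j < fst (rho ?i) ==> ld ?i ?w p j = 0"
 proof -
 have "zval (key c) (zsem (tp ?i c)) = zval (key c) (%p j. 0)"
 by (rule zval_cong[OF key_in[OF c]]) (use z ld_code(2)[OF i c] in auto)
 thus False using key_nz[OF c] by (simp add: zval_0)
 qed
 then obtain p j where pj: "p < fst (rho ?i)" "j < fst (rho ?i)" "ld ?i ?w p j ~= 0" by blast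
 show G: "?w ~: Gamma0" using ld_Gamma0[OF i _ pj(1,2)] pj(3) by (auto simp: dle_def)
 have w: "valid (code_of ?w)" "?w = elt (code_word (code_of ?w))" using code_of[OF elt_carrier G] by auto
 have "cc (code_of ?w) = ?i"
 proof (rule ccontr)
 assume "cc (code_of ?w) ~= ?i"
 hence "ld ?i (elt (code_word (code_of ?w))) p j = 0" using ld_code(2)[OF i w(1) pj(1,2)] tops_0[OF i w(1)] by simp
 thus False using pj(3) w(2) by simp
 qed
 thus "cell ?w = ?i" using G by (simp add: cell_def)
qed

sublocale C: cell_reps G2t G2t_gens L NG "{..<n}" "%i. Rm (rho i)" "%i. fst (rho i)" alpha cell
proof (intro cell_reps.intro cell_reps_axioms.intro coxeter_axioms)
 show "hecke_rep G2t G2t_gens L NG (Rm (rho i)) (fst (rho i))" if "i : {..<n}" for i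
 using that by (intro rep_ok_hecke_rep rok) simp
next
 fix i w p j assume i: "i : {..<n}" "w : GW" "p < fst (rho i)" "j < fst (rho i)"
 show b: "dle (int (alpha i)) (Rm (rho i) w p j)"
 proof (cases "w : Gamma0")
 case True thus ?thesis using dle_mono[OF ld_Gamma0] i by simp
 next
 case False thus ?thesis using ld_code(1)[of i "code_of w"] code_of[of w] i by simp
 qed
 assume c: "cell w ~= i"
 show "ld i w p j = 0"
 proof (cases "w : Gamma0")
 case True thus ?thesis using ld_Gamma0[of i w p j] i by (simp add: dle_def)
 next
 case False
 thus ?thesis using ld_code(2)[of i "code_of w" p j] code_of[of w] tops_0[of i "code_of w"] c i by (simp add: cell_def)
 qed
next
 fix i A c w assume i: "i : {..<n}" and A: "finite A" "A <= {w : GW. cell w = i}"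
 and z: "!!p j. p < fst (rho i) ==> j < fst (rho i) ==> (\<Sum>w\<in>A. of_int (c w) * ld i w p j) = 0" and w: "w : A"
 have cd: "valid (code_of v)" "v = elt (code_word (code_of v))" "cc (code_of v) = i" if "v : A" for v
 proof -
 have v: "v : GW" "cell v = i" using that A by auto
 hence "v ~: Gamma0" using i by (auto simp: cell_def)
 thus "valid (code_of v)" "v = elt (code_word (code_of v))" "cc (code_of v) = i" using code_of[OF v(1)] v by (auto simp: cell_def)
 qed
 have k: "zval (key (code_of v)) (ld i u) = zval (key (code_of v)) (zsem (tp i (code_of u)))" if "v : A" "u : A" for u v
 using key_in[OF cd(1)[OF that(1)]] cd(3)[OF that(1)] ld_code(2)[OF _ cd(1)[OF that(2)]] cd(2)[OF that(2)] i
 by (intro zval_cong[of "fst (rho i)"]) auto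
 show "c w = 0"
 proof (rule rank_indep[of A c "%v f. zval f (ld i v)" "%v. key (code_of v)" "%v. rk (code_of v)"])
 fix v assume v: "v : A"
 have "(\<Sum>u\<in>A. c u * zval (key (code_of v)) (ld i u)) = zval (key (code_of v)) (%p j. 0)"
 unfolding zval_sum[symmetric] using z key_in[OF cd(1)[OF v]] cd(3)[OF v] by (intro zval_cong[of "fst (rho i)"]) auto
 thus "(\<Sum>u\<in>A. c u * zval (key (code_of v)) (ld i u)) = 0" by (simp add: zval_0)
 show "zval (key (code_of v)) (ld i v) ~= 0" using k[OF v v] key_nz[OF cd(1)[OF v]] cd(3)[OF v] by simp
 fix u assume u: "u : A" "u ~= v" "rk (code_of u) <= rk (code_of v)"
 have "code_of u ~= code_of v" using cd(2)[OF v] cd(2)[OF u(1)] u(2) by auto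
 thus "zval (key (code_of v)) (ld i u) = 0"
 using k[OF v u(1)] key_0[OF cd(1)[OF v] cd(1)[OF u(1)]] cd(3)[OF v] cd(3)[OF u(1)] u(3) by simp
 qed (use A w in auto)
next
 fix w assume w: "w : GW"
 show "EX x e y b. x : GW & e : GW & y : GW & w = x<.>e<.>y &
 len (x<.>e<.>y) = len x + len e + len y & top_elt e b &
 (ALL i:{..<n}. i ~= cell w --> (cell w : {..<n} --> alpha i <= alpha (cell w)) -->
 hecke_rep.kills (Rm (rho i)) (fst (rho i)) b)"
 proof (cases "w : Gamma0")
 case True
 obtain x y where xy: "x : GW" "y : GW" "w = x<.>w0<.>y" "len w = len x + 6 + len y"
 using Gamma0_factor[OF True] .
 obtain f where f: "top_elt w0 f" "ALL k<n. hecke_rep.kills (Rm (rho k)) (fst (rho k)) f" using kill_w0 by blast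
 show ?thesis
 by (rule exI[of _ x], rule exI[of _ w0], rule exI[of _ y], rule exI[of _ f]) (use xy f len_w0 in simp)
 next
 case False
 note cd = code_of[OF w False]
 obtain x e y f where f: "code_word (code_of w) = x @ e @ y" "top_elt (elt e) f"
 "ALL k<n. k ~= cc (code_of w) --> ev (al k) <= ev (al (cc (code_of w))) --> hecke_rep.kills (Rm (rho k)) (fst (rho k)) f"
 using kill_base[OF cd(1)] by blast
 have "kreduced kzero (x @ e @ y)" using kreduced_code[OF cd(1)] f(1) by simp
 hence l: "len (elt (x @ e @ y)) = length x + length e + length y" using len_kreduced by simp
 have "len (elt (x @ e @ y)) <= len (elt x) + len (elt e) + len (elt y)"
 using len_mult_le[of "elt x" "elt e<.>elt y"] len_mult_le[of "elt e" "elt y"] by (simp add: elt_append)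
 hence ll: "len (elt x) = length x" "len (elt e) = length e" "len (elt y) = length y"
 using l len_elt_le[of x] len_elt_le[of e] len_elt_le[of y] by simp_all
 have wx: "w = elt x<.>elt e<.>elt y" using cd(2) f(1) by (simp add: elt_append G2.m_assoc)
 have cw: "cell w = cc (code_of w)" "cell w < n" using False ccell_less[OF cd(1)] by (simp_all add: cell_def)
 have K: "hecke_rep.kills (Rm (rho i)) (fst (rho i)) f" if "i < n" "i ~= cell w" "cell w : {..<n} --> alpha i <= alpha (cell w)" for i
 using f(3) that cw alpha[of i] alpha[of "cell w"] by simp
 show ?thesis
 by (rule exI[of _ "elt x"], rule exI[of _ "elt e"], rule exI[of _ "elt y"], rule exI[of _ f])
 (use K f(2) wx l ll in \<open>simp add: elt_append G2.m_assoc\<close>)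
 qed
qed

end

text \<open>Words of length at most 6 suffice for the dihedral subgroups, of orders 12, 6 and 4;
  \<open>dih_ok\<close> tests that their coordinates are closed under the generators.\<close>

definition dih_vecs :: "gen list => kvec list" where
 "dih_vecs I = map (%u. fold kact u kzero)
 (concat (map (%k. [alt k (I ! 0) (I ! 1), alt k (I ! 1) (I ! 0)]) [0..<7]))"

definition dih_ok :: "gen list => kvec list => bool" where
 "dih_ok I vs <-> kzero : set vs & list_all (%v. list_all (%g. kact g v : set vs) I) vs &
 list_all (%w. set w <= set I | fold kact w kzero ~: set vs) fin_words"

lemma dih_ok: "list_all (%I. dih_ok I (dih_vecs I)) pars" by code_simp

lemma par_idx: "list_all (%(I, J). list_all (%(i, w). (i : set J) = (set w <= set I)) (enumerate 0 fin_words)) (zip pars par_idx)"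
 by code_simp

lemma par_idx_iff: assumes "k < length pars" "l < length fin_words"
 shows "l : set (par_idx ! k) <-> set (fin_words ! l) <= set (pars ! k)"
proof -
 have "length pars = length par_idx" by (simp add: pars_def par_idx_def)
 hence "(pars ! k, par_idx ! k) : set (zip pars par_idx)" using assms by (auto simp: in_set_zip)
 hence "list_all (%(i, w). (i : set (par_idx ! k)) = (set w <= set (pars ! k))) (enumerate 0 fin_words)"
 using par_idx unfolding list_all_iff by fast
 moreover have "(l, fin_words ! l) : set (enumerate 0 fin_words)" using assms by (simp add: in_set_enumerate_eq)
 ultimately show ?thesis unfolding list_all_iff by fast
qed

lemma length_par_idx: "length par_idx = length pars" by (simp add: pars_def par_idx_def)

lemma seg_0_1: "seg s 0 1 = 1"
 by (simp add: seg_def seg_top_def)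

lemma seg_0_inj: assumes "0 < s" "seg s 0 (2 * k + 1) = seg s 0 (2 * l + 1)" shows "k = l"
proof -
 have t: "seg_top s 0 (Suc (2 * k)) = s * int k" for k by (simp add: seg_top_def)
 have "s * int k <= s * int l"
 using lookup_seg(1)[OF assms(1), of 0 "2 * l + 1" "s * int k"] lookup_seg(2)[OF assms(1), of "2 * k + 1" 0] assms(2) by (simp add: t)
 moreover have "s * int l <= s * int k"
 using lookup_seg(1)[OF assms(1), of 0 "2 * k + 1" "s * int l"] lookup_seg(2)[OF assms(1), of "2 * l + 1" 0] assms(2) by (simp add: t)
 ultimately show ?thesis using assms(1) by simp
qed

context g2_weights begin

text \<open>Membership in the subgroup does not by itself constrain the letters of the given word;
  comparing coordinates with those of the whole dihedral subgroup does so for the listed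
  words.\<close>

lemma generate_fin_word: assumes I: "I : set pars" and i: "i < length fin_words"
 and w: "elt (fin_words ! i) : generate G2t ((%g. elt [g]) ` set I)"
 shows "set (fin_words ! i) <= set I"
proof -
 have "dih_ok I (dih_vecs I)" using dih_ok I unfolding list_all_iff by blast
 hence ok: "kzero : set (dih_vecs I)" "!!v g. v : set (dih_vecs I) ==> g : set I ==> kact g v : set (dih_vecs I)"
 "!!w. w : set fin_words ==> set w <= set I | fold kact w kzero ~: set (dih_vecs I)"
 unfolding dih_ok_def list_all_iff by blast+
 have "Ke w : set (dih_vecs I)" if wI: "w : generate G2t ((%g. elt [g]) ` set I)" for w
 proof -
 obtain u where u: "set u <= set I" "w = elt u" using generate_word[OF subset_UNIV wI] by blast
 have "fold kact u kzero : set (dih_vecs I)" using u(1)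
 proof (induction u rule: rev_induct)
 case Nil thus ?case using ok(1) by simp
 next
 case (snoc g u) thus ?case using ok(2) by simp
 qed
 thus ?thesis using u(2) by (simp add: Ke_elt)
 qed
 from this[OF w] have "fold kact (fin_words ! i) kzero : set (dih_vecs I)" by (simp add: Ke_elt)
 thus ?thesis using ok(3)[OF nth_mem[OF i]] by blast
qed

end

context g2_face begin

lemma cell_code_of: assumes "w : GW" "cell w = i" "i < n"
 shows "valid (code_of w)" "w = elt (code_word (code_of w))" "cc (code_of w) = i" "w ~: Gamma0"
proof -
 show G: "w ~: Gamma0" using assms by (auto simp: cell_def)
 show "valid (code_of w)" "w = elt (code_word (code_of w))" "cc (code_of w) = i" using code_of[OF assms(1) G] assms(2) G by (auto simp: cell_def)
qed

lemma code_inj: assumes c: "valid c" "valid c'" "elt (code_word c) = elt (code_word c')" shows "c = c'"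
proof -
 have i: "cc c = cc c'" using cell_code(2)[OF c(1)] cell_code(2)[OF c(2)] c(3) by simp
 have "c = c'" if c: "valid c" "valid c'" "elt (code_word c) = elt (code_word c')" "cc c = cc c'" "rk c' <= rk c" for c c'
 proof (rule ccontr)
 assume ne: "c ~= c'"
 have "zval (key c) (zsem (tp (cc c) c')) = zval (key c) (zsem (tp (cc c) c))"
 using ld_code(2)[OF ccell_less[OF c(1)] c(1)] ld_code(2)[OF ccell_less[OF c(1)] c(2)] c(3)
 by (intro zval_cong[OF key_in[OF c(1)]]) auto
 thus False using key_0[OF c(1,2) c(4)[symmetric] c(5)] key_nz[OF c(1)] ne by simp
 qed
 from this[OF c i] this[OF c(2,1) c(3)[symmetric] i[symmetric]] show ?thesis by (cases "rk c' <= rk c") auto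
qed

text \<open>The element e_p with trivial character at (p, p) acts as a unit on row and column p;
  this puts w at (p, j) below e_p and e_j and attains the a-value. Conversely a character times its
  dual contains the trivial one, so e_p and e_j lie below w. Elements at (p, j) then link all the
  e_p.\<close>

lemma own_cell: assumes i: "i < n" "fst (rho i) = 6" and s: "0 < s"
 and snd: "!!c p j l. valid c ==> cc c = i ==> \<tau> c = (p, j, l) ==> p < 6 & j < 6 & 0 < l &
 even (h p - h j + s * (int l - 1)) & (ALL p' j'. zsem (tp i c) p' j' = (if p = p' & j = j' then seg s (h p - h j) l else 0))"
 and surj: "!!p j l. p < 6 ==> j < 6 ==> 0 < l ==> even (h p - h j + s * (int l - 1)) ==> EX c. valid c & cc c = i & \<tau> c = (p, j, l)"
 and ex: "!!p j. p < 6 ==> j < 6 ==> EX c l. valid c & cc c = i & \<tau> c = (p, j, l)"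
 shows "w : GW ==> cell w = i ==> lusztig_a w = alpha i"
 "w : GW ==> cell w = i ==> w' : GW ==> cell w' = i ==> (w, w') : le_LR"
proof -
 define pos where "pos p j l w <-> w : GW & cell w = i & p < 6 & j < 6 & 0 < l & even (h p - h j + s * (int l - 1)) &
 (ALL p'<6. ALL j'<6. ld i w p' j' = (if p = p' & j = j' then seg s (h p - h j) l else 0))" for p j l w
 have code: "pos p j l (elt (code_word c))" if "valid c" "cc c = i" "\<tau> c = (p, j, l)" for c p j l
 using snd[OF that] cell_code[OF that(1)] ld_code(2)[OF i(1) that(1)] that(2) i(2) by (simp add: pos_def)
 have all: "EX p j l. pos p j l w" if "w : GW" "cell w = i" for w
 using code[of "code_of w"] cell_code_of[OF that i(1)] by (metis prod_cases3)
 have sj: "EX w. pos p j l w" if "p < 6" "j < 6" "0 < l" "even (h p - h j + s * (int l - 1))" for p j l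
 using surj[OF that] code by blast
 have "ALL p<6. EX w. pos p p 1 w" using sj by simp
 then obtain e where e: "!!p. p < 6 ==> pos p p 1 (e p)" by metis
 have mult: "(\<Sum>m<6. ld i x p' m * ld i y m j') = (if p = p' & k = j' then seg s (h p - h j) l * seg s (h j - h k) l' else 0)"
 if "pos p j l x" "pos j k l' y" "p' < 6" "j' < 6" for p j k l l' x y p' j'
 proof -
 have "(\<Sum>m<6. ld i x p' m * ld i y m j') =
 (\<Sum>m<6. if m = j then (if p = p' & k = j' then seg s (h p - h j) l * seg s (h j - h k) l' else 0) else 0)"
 using that by (intro sum.cong HOL.refl) (simp add: pos_def)
 thus ?thesis using that by (simp add: pos_def)
 qed
 have right: "lusztig_a w = alpha i" "(w, e j) : le_LR" and left: "(w, e p) : le_LR" if w: "pos p j l w" for p j l w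
 proof -
 have pj: "p < 6" "j < 6" "w : GW" "cell w = i" using w by (auto simp: pos_def)
 have c: "e p : GW" "e j : GW" using e pj by (auto simp: pos_def)
 have "(\<Sum>m<6. ld i w p' m * ld i (e j) m j') = ld i w p' j'" if "p' < 6" "j' < 6" for p' j'
 proof -
 have "(\<Sum>m<6. ld i w p' m * ld i (e j) m j') = (if p = p' & j = j' then seg s (h p - h j) l * seg s 0 1 else 0)"
 using mult[OF w e[OF pj(2)] that] by (simp only: diff_self)
 thus ?thesis using w that unfolding pos_def seg_0_1 by simp
 qed
 thus "lusztig_a w = alpha i" "(w, e j) : le_LR" using C.lead_mult_le[of w "e j" w] pj c i by simp_all
 have "(\<Sum>m<6. ld i (e p) p' m * ld i w m j') = ld i w p' j'" if "p' < 6" "j' < 6" for p' j'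
 proof -
 have "(\<Sum>m<6. ld i (e p) p' m * ld i w m j') = (if p = p' & j = j' then seg s 0 1 * seg s (h p - h j) l else 0)"
 using mult[OF e[OF pj(1)] w that] by (simp only: diff_self)
 thus ?thesis using w that unfolding pos_def seg_0_1 by simp
 qed
 thus "(w, e p) : le_LR" using C.lead_mult_le[of "e p" w w] pj c i by simp_all
 qed
 have conv: "(e p, w) : le_LR & (e j, w) : le_LR" if w: "pos p j l w" for p j l w
 proof -
 have pj: "p < 6" "j < 6" "0 < l" "w : GW" "even (h p - h j + s * (int l - 1))" using w by (auto simp: pos_def)
 have "even ((h p - h j + s * (int l - 1)) - 2 * (h p - h j))" by (rule dvd_diff[OF pj(5)]) simp
 hence "even (h j - h p + s * (int l - 1))" by (simp add: algebra_simps)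
 then obtain v where v: "pos j p l v" using sj pj by blast
 have key: "coef (struct_const x y (e p)) (int (alpha i)) = 1"
 if x: "pos p j l x" and y: "pos j p l y" for p j x y
 proof -
 have pp: "p < 6" and l: "0 < l" and evn: "even (h p - h j + s * (int l - 1))" using x by (auto simp: pos_def)
 \<comment> \<open>By \<open>seg_mult\<close> the product of the leading matrices of x and y is the
   sum of the characters with 1, 3, ..., 2l - 1 terms at (p, p), and each of them belongs to an
   element of the cell. The choice for k = 0 need not be \<open>e p\<close>, hence the adjusted
   function \<open>f'\<close>.\<close>
 have "ALL k. EX w. pos p p (2 * k + 1) w" using sj pp by simp
 then obtain f where f: "!!k. pos p p (2 * k + 1) (f k)" by metis
 define f' where "f' k = (if k = 0 then e p else f k)" for k
 have f': "pos p p (2 * k + 1) (f' k)" for k using f[of k] e[OF pp] by (simp add: f'_def)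
 have inj: "inj f'"
 proof (rule injI)
 fix k k' assume "f' k = f' k'"
 moreover have "ld i (f' k) p p = seg s 0 (2 * k + 1)" for k using f'[of k] pp unfolding pos_def by simp
 ultimately have "seg s 0 (2 * k + 1) = seg s 0 (2 * k' + 1)" by metis
 thus "k = k'" by (rule seg_0_inj[OF s])
 qed
 have "coef (struct_const x y (e p)) (int (alpha i)) = (%_. 1) (e p)"
 proof (rule C.lead_mult[where A = "f' ` {..<l}"])
 show "f' ` {..<l} <= {w : GW. cell w = i}" using f' by (auto simp: pos_def)
 show "e p : f' ` {..<l}" using l by (auto simp: f'_def image_iff intro!: bexI[of _ 0])
 fix p' j' assume pj': "p' < fst (rho i)" "j' < fst (rho i)"
 have "(\<Sum>z\<in>f' ` {..<l}. of_int 1 * ld i z p' j') = (\<Sum>k<l. ld i (f' k) p' j')"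
 using inj by (subst sum.reindex) (auto intro: inj_on_subset)
 also have "\<dots> = (if p = p' & p = j' then \<Sum>k<l. seg s 0 (2 * k + 1) else 0)"
 using f' pj' i(2) by (auto simp: pos_def intro!: sum.cong sum.neutral)
 also have "\<dots> = (\<Sum>m<fst (rho i). ld i x p' m * ld i y m j')"
 using mult[OF x y, of p' j'] pj' i(2) seg_mult[OF evn] by (cases "p = p' & p = j'") auto
 finally show "(\<Sum>m<fst (rho i). ld i x p' m * ld i y m j') = (\<Sum>z\<in>f' ` {..<l}. of_int 1 * ld i z p' j')" by simp
 qed (use x y i in \<open>auto simp: pos_def\<close>)
 thus ?thesis by simp
 qed
 have vc: "v : GW" using v by (simp add: pos_def)
 have "struct_const w v (e p) ~= 0" "struct_const v w (e j) ~= 0" using key[OF w v] key[OF v w] by auto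
 thus ?thesis using le_LR_struct[of w v] le_LR_struct[of v w] pj(4) vc by blast
 qed
 have eq: "(e p, e j) : le_LR" if pj: "p < 6" "j < 6" for p j
 proof -
 obtain c l where "valid c" "cc c = i" "\<tau> c = (p, j, l)" using ex[OF pj] by blast
 hence "pos p j l (elt (code_word c))" by (rule code)
 thus ?thesis using conv right(2) le_LR_trans by blast
 qed
 show "lusztig_a w = alpha i" if w: "w : GW" "cell w = i"
 proof -
 obtain p j l where "pos p j l w" using all[OF w] by blast
 thus ?thesis by (rule right(1))
 qed
 show "(w, w') : le_LR" if w: "w : GW" "cell w = i" "w' : GW" "cell w' = i"
 proof -
 obtain p j l where q: "pos p j l w" using all[OF w(1,2)] by blast
 obtain p' j' l' where q': "pos p' j' l' w'" using all[OF w(3,4)] by blast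
 have "j < 6" "j' < 6" using q q' by (simp_all add: pos_def)
 from eq[OF this] show ?thesis using right(2)[OF q] conv[OF q'] le_LR_trans by blast
 qed
qed

lemma sum_list_snd: fixes f :: "nat => laurent" and zs :: "(int \<times> nat) list"
 assumes "distinct (map snd zs)" and g: "!!g z. (g, z) : set zs ==> G z = g"
 shows "(\<Sum>(g, z)\<leftarrow>zs. of_int g * f z) = (\<Sum>z\<in>set (map snd zs). of_int (G z) * f z)"
proof -
 have "(\<Sum>(g, z)\<leftarrow>zs. of_int g * f z) = (\<Sum>z\<leftarrow>map snd zs. of_int (G z) * f z)"
 using g by (auto intro!: arg_cong[where f = sum_list])
 also have "\<dots> = (\<Sum>z\<in>set (map snd zs). of_int (G z) * f z)" by (rule sum_list_distinct_conv_sum_set[OF assms(1)])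
 finally show ?thesis .
qed

context
 fixes i Lz e0 js cs
 assumes i: "i < n" and js: "!!c. valid c & cc c = i <-> (EX j:set js. c = Fn j)"
 and Lz: "!!j. j : set js ==> tp i (Fn j) = Lz ! j" "!!j. j : set js ==> zwf (fst (rho i)) (Lz ! j)"
 and cs: "certs_ok Lz e0 js cs" and e0: "e0 : set js"
begin

abbreviation "fw j \<equiv> elt (fin_words ! j)"

lemma fin_js: assumes "j : set js" shows "j < length fin_words" "fw j : GW" "cell (fw j) = i"
 "p < fst (rho i) ==> k < fst (rho i) ==> ld i (fw j) p k = zsem (Lz ! j) p k"
proof -
 have v: "valid (Fn j)" "cc (Fn j) = i" using js[of "Fn j"] assms by auto
 thus "j < length fin_words" by simp
 show "fw j : GW" by simp
 show "cell (fw j) = i" using cell_code(2)[OF v(1)] v(2) by simp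
 show "p < fst (rho i) ==> k < fst (rho i) ==> ld i (fw j) p k = zsem (Lz ! j) p k"
 using ld_code(2)[OF i v(1)] Lz(1)[OF assms] by simp
qed

lemma fin_cell_js: assumes "w : GW" "cell w = i" shows "EX j:set js. w = fw j"
 using cell_code_of[OF assms i] js[of "code_of w"] by auto

text \<open>The certificate is an identity between leading matrices over indices of words;
  \<open>code_inj\<close> makes distinct indices distinct elements, after which
  \<open>C.lead_mult\<close> reads the structure constants from the identity.\<close>

lemma fin_cert: assumes c: "(x, y, zs) : set cs" "z : set (map snd zs)"
 shows "x : set js" "y : set js" "z : set js" "coef (struct_const (fw x) (fw y) (fw z)) (int (alpha i)) ~= 0"
proof -
 have ok: "cert_ok Lz js (x, y, zs)" using cs c(1) by (auto simp: certs_ok_def list_all_iff)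
 thus xy: "x : set js" "y : set js" by (auto simp: cert_ok_def)
 have zj: "z : set js" "g ~= 0" if "(g, z) : set zs" for g z using ok that by (auto simp: cert_ok_def list_all_iff)
 thus zj': "z : set js" using c(2) by auto
 have dz: "distinct (map snd zs)" using ok by (simp add: cert_ok_def)
 define G where "G z = the (map_of (map (%(g, z). (z, g)) zs) z)" for z
 have G: "G z = g" if "(g, z) : set zs" for g z
 proof -
 have "map_of (map (%(g, z). (z, g)) zs) z = Some g"
 using that dz by (intro map_of_is_SomeI) (force simp: comp_def case_prod_beta)+
 thus ?thesis by (simp add: G_def)
 qed
 have inj: "inj_on fw (set js)"
 proof (rule inj_onI)
 fix j k assume "j : set js" "k : set js" "fw j = fw k"
 thus "j = k" using code_inj[of "Fn j" "Fn k"] js[of "Fn j"] js[of "Fn k"] by auto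
 qed
 have sub: "set (map snd zs) <= set js" using zj by auto
 have injz: "inj_on fw (set (map snd zs))" using inj sub by (rule inj_on_subset)
 define G' where "G' w = G (inv_into (set (map snd zs)) fw w)" for w
 have G': "G' (fw z) = G z" if "z : set (map snd zs)" for z using inv_into_f_f[OF injz that] by (simp add: G'_def)
 have "coef (struct_const (fw x) (fw y) (fw z)) (int (alpha i)) = G' (fw z)"
 proof (rule C.lead_mult[where A = "fw ` set (map snd zs)"])
 show "fw ` set (map snd zs) <= {w : GW. cell w = i}" using fin_js(2,3) sub by blast
 fix p j assume pj: "p < fst (rho i)" "j < fst (rho i)"
 have "(\<Sum>m<fst (rho i). ld i (fw x) p m * ld i (fw y) m j) = (\<Sum>m<fst (rho i). zsem (Lz ! x) p m * zsem (Lz ! y) m j)"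
 using pj fin_js(4) xy by (intro sum.cong) auto
 also have "\<dots> = zsem (zprod (Lz ! x) (Lz ! y)) p j"
 by (rule zsem_zprod[symmetric]) (use Lz(2)[OF xy(1)] in \<open>auto simp: zwf_def\<close>)
 also have "\<dots> = zsem (zadd (concat (map (%(g, z). zscale g 0 (Lz ! z)) zs)) []) p j"
 by (rule zeq_zsem) (use ok in \<open>simp add: cert_ok_def\<close>)
 also have "\<dots> = (\<Sum>(g, z)\<leftarrow>zs. of_int g * zsem (Lz ! z) p j)"
 proof -
 have "sgl 0 g = (of_int g :: laurent)" for g by (simp flip: single_of_int)
 thus ?thesis unfolding zsem_zadd by (induction zs) (auto simp: zsem_append zsem_zscale)
 qed
 also have "\<dots> = (\<Sum>z\<in>set (map snd zs). of_int (G z) * zsem (Lz ! z) p j)" by (rule sum_list_snd[OF dz G])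
 also have "\<dots> = (\<Sum>w\<in>fw ` set (map snd zs). of_int (G' w) * ld i w p j)"
 unfolding sum.reindex[OF injz] comp_def using G' fin_js(4) sub pj by (intro sum.cong) (auto simp: subset_iff)
 finally show "(\<Sum>m<fst (rho i). ld i (fw x) p m * ld i (fw y) m j) = (\<Sum>w\<in>fw ` set (map snd zs). of_int (G' w) * ld i w p j)" .
 qed (use i c(2) fin_js(2) xy in auto)
 moreover have "G z ~= 0" using c(2) zj(2) G by auto
 ultimately show "coef (struct_const (fw x) (fw y) (fw z)) (int (alpha i)) ~= 0" using G' c(2) by simp
qed

lemma fin_le: assumes c: "(x, y, zs) : set cs" "z : set (map snd zs)" shows "(fw z, fw x) : le_LR" "(fw z, fw y) : le_LR"
proof -
 have "struct_const (fw x) (fw y) (fw z) ~= 0" using fin_cert(4)[OF c] by auto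
 thus "(fw z, fw x) : le_LR" "(fw z, fw y) : le_LR" using le_LR_struct[of "fw x" "fw y"] by simp_all
qed

lemma covered_cert: assumes "covered cs A" "z : set A"
 obtains x y zs where "(x, y, zs) : set cs" "z : set (map snd zs)" "x : set A" "y : set A"
proof -
 have "z : set (concat (map (%(x, y, zs). if x : set A & y : set A then map snd zs else []) cs))"
 using assms unfolding covered_def by blast
 thus ?thesis using that by (auto split: if_splits)
qed

lemma fin_cell_a: assumes "w : GW" "cell w = i" shows "lusztig_a w = alpha i"
proof -
 obtain j where j: "j : set js" "w = fw j" using fin_cell_js[OF assms] by blast
 have "covered cs js" using cs by (simp add: certs_ok_def)
 then obtain x y zs where c: "(x, y, zs) : set cs" "j : set (map snd zs)" "x : set js" "y : set js"
 by (rule covered_cert[OF _ j(1)])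
 note c = c(1,2)
 show ?thesis
 using C.struct_dle[of _ _ w] assms i fin_cert(4)[OF c] j
 by (intro lusztig_a_eqI[of "alpha i" w "fw x" "fw y"]) auto
qed

text \<open>The degree bound is inherited, as the structure constants of the subgroup are among
  those of W; a certificate whose factors x and y also lie in the subgroup shows that the bound is
  attained there.\<close>

lemma fin_cell_par: assumes w: "w : GW" "cell w = i" and I: "I : set pars" "w : generate G2t ((%g. elt [g]) ` set I)"
 shows "parabolic_a ((%g. elt [g]) ` set I) w = alpha i"
proof -
 obtain j where j: "j : set js" "w = fw j" using fin_cell_js[OF w] by blast
 obtain k where k: "k < length pars" "I = pars ! k" using I(1) by (auto simp: in_set_conv_nth)
 let ?J = "par_idx ! k"
 have pi: "l : set ?J <-> set (fin_words ! l) <= set I" if "l < length fin_words" for l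
 using par_idx_iff[OF k(1) that] k(2) by simp
 have "j : set ?J" using generate_fin_word[OF I(1) fin_js(1)[OF j(1)]] I(2) j pi fin_js(1) by simp
 hence jf: "j : set (filter (%l. l : set ?J) js)" using j by simp
 have "?J : set par_idx" using k length_par_idx by simp
 hence "covered cs (filter (%l. l : set ?J) js)" using cs by (simp add: certs_ok_def list_all_iff)
 then obtain x y zs where c: "(x, y, zs) : set cs" "j : set (map snd zs)"
 and xy': "x : set (filter (%l. l : set ?J) js)" "y : set (filter (%l. l : set ?J) js)"
 by (rule covered_cert[OF _ jf])
 hence xy: "x : set ?J" "y : set ?J" by simp_all
 have g: "fw x : generate G2t ((%g. elt [g]) ` set I)" "fw y : generate G2t ((%g. elt [g]) ` set I)"
 using xy pi fin_js(1) fin_cert(1,2)[OF c] by (auto intro: word_generate)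
 show ?thesis
 proof (rule parabolic_a_eqI[OF _ _ g])
 show "dle (int (alpha i)) (struct_const x y w)" if "x : GW" "y : GW" for x y
 using C.struct_dle[OF that, of w] w i by simp
 qed (use fin_cert(4)[OF c] j in \<open>auto simp: gens_eq\<close>)
qed

text \<open>Each certificate puts z below x and y. Two rounds of closure from e0 in each direction
  reach the whole cell, and \<open>le_LR\<close> is transitive.\<close>

lemma fin_cell_eq: assumes w: "w : GW" "cell w = i" shows "(w, fw e0) : le_LR" "(fw e0, w) : le_LR"
proof -
 obtain j where j: "j : set js" "w = fw j" using fin_cell_js[OF w] by blast
 have up: "ALL z:set (grow_up cs A). (fw z, fw e0) : le_LR" if "ALL z:set A. (fw z, fw e0) : le_LR" for A
 proof
 fix z assume "z : set (grow_up cs A)"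
 then consider "z : set A" | x y zs where "(x, y, zs) : set cs" "z : set (map snd zs)" "x : set A | y : set A"
 by (auto simp: grow_up_def split: if_splits)
 thus "(fw z, fw e0) : le_LR"
 proof cases
 case 2 thus ?thesis using that fin_le le_LR_trans by blast
 qed (use that in blast)
 qed
 have down: "ALL z:set (grow_down cs A). (fw e0, fw z) : le_LR" if "ALL z:set A. (fw e0, fw z) : le_LR" for A
 proof
 fix z assume "z : set (grow_down cs A)"
 hence "z : set A | (EX x y zs v. (x, y, zs) : set cs & (z = x | z = y) & v : set (map snd zs) & v : set A)"
 by (force simp: grow_down_def list_ex_iff split: if_splits)
 then consider "z : set A" | x y zs v where "(x, y, zs) : set cs" "z = x | z = y" "v : set (map snd zs)" "v : set A"
 by blast
 thus "(fw e0, fw z) : le_LR"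
 proof cases
 case 2 thus ?thesis using that fin_le le_LR_trans by blast
 qed (use that in blast)
 qed
 have r: "ALL z:set [e0]. (fw z, fw e0) : le_LR" "ALL z:set [e0]. (fw e0, fw z) : le_LR" by (simp_all add: le_LR_refl)
 have "set js <= set (grow_up cs (grow_up cs [e0]))" "set js <= set (grow_down cs (grow_down cs [e0]))" using cs by (auto simp: certs_ok_def)
 thus "(w, fw e0) : le_LR" "(fw e0, w) : le_LR" using up[OF up[OF r(1)]] down[OF down[OF r(2)]] j by blast+
qed

lemma fin_cell_dih: "EX I:set pars. fw e0 : generate G2t ((%g. elt [g]) ` set I)"
proof -
 have "list_ex (%I. e0 : set I) par_idx" using cs by (simp add: certs_ok_def)
 then obtain k where k: "k < length par_idx" "e0 : set (par_idx ! k)" unfolding list_ex_length by blast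
 hence "set (fin_words ! e0) <= set (pars ! k)" using par_idx_iff[OF _ fin_js(1)[OF e0], of k] length_par_idx by simp
 thus ?thesis using k length_par_idx word_generate by (intro bexI[of _ "pars ! k"]) auto
qed

end

end

section \<open>The representations and the faces\<close>

definition dsum_mat :: "nat => gmat => gmat => gmat" where
 "dsum_mat d M N = M @ map (map (%(i, p). (d + i, p))) N"

fun dsum :: "grep => grep => grep" where
 "dsum (d, M0, M1, M2) (e, N0, N1, N2) = (d + e, dsum_mat d M0 N0, dsum_mat d M1 N1, dsum_mat d M2 N2)"

definition rho_E :: grep where
 "rho_E = (1,
 [[(0,[(-1,0,-1,0)])]],
 [[(0,[(-1,-1,0,0)])]],
 [[(0,[(-1,0,-1,0)])]])"

definition rho_R :: grep where
 "rho_R = (2,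
 [[(1,[(1,0,0,0)])],[(0,[(1,0,0,0)]),(1,[(-1,0,-1,0),(1,0,1,0)])]],
 [[(0,[(-1,-1,0,0)])],[(1,[(-1,-1,0,0)])]],
 [[(0,[(1,0,1,0)]),(1,[(-1,0,-2,0)])],[(1,[(-1,0,-1,0)])]])"

definition rho_Sh :: grep where
 "rho_Sh = (6,
 [[(0,[(-1,0,-1,0)])],[(1,[(-1,0,-1,0)])],[(4,[(1,0,0,0)])],[(5,[(1,0,0,0)])],[(2,[(1,0,0,0)]),(4,[(-1,0,-1,0),(1,0,1,0)])],[(3,
 [(1,0,0,0)]),(5,[(-1,0,-1,0),(1,0,1,0)])]],
 [[(0,[(1,1,0,0)]),(2,[(-1,-1,-1,0),(1,-1,1,0)]),(3,[(1,0,0,0)]),(4,[(1,-1,-2,0),(-1,-1,0,0)]),(5,[(-1,0,-1,0)])],[(1,[(1,1,0,0)]),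
 (2,[(1,0,0,0)]),(3,[(-1,-1,-1,0),(1,-1,1,0)]),(4,[(-1,0,-1,0)]),(5,[(1,-1,-2,0),(-1,-1,0,0)])],[(2,[(-1,-1,0,0)])],[(3,[(-1,-1,0,
 0)])],[(4,[(-1,-1,0,0)])],[(5,[(-1,-1,0,0)])]],
 [[(2,[(1,0,0,0)])],[(3,[(1,0,0,0)])],[(0,[(1,0,0,0)]),(2,[(-1,0,-1,0),(1,0,1,0)])],[(1,[(1,0,0,0)]),(3,[(-1,0,-1,0),(1,0,1,0)])],
 [(4,[(-1,0,-1,0)])],[(5,[(-1,0,-1,0)])]])"

definition rho_Sl :: grep where
 "rho_Sl = (6,
 [[(2,[(1,0,0,0)]),(4,[(-1,-1,-1,0)])],[(3,[(1,0,0,0)]),(5,[(-1,-1,-1,0)])],[(0,[(1,0,0,0)]),(2,[(-1,0,-1,0),(1,0,1,0)]),(4,[(-1,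
 -1,0,0)])],[(1,[(1,0,0,0)]),(3,[(-1,0,-1,0),(1,0,1,0)]),(5,[(-1,-1,0,0)])],[(4,[(-1,0,-1,0)])],[(5,[(-1,0,-1,0)])]],
 [[(2,[(-1,-1,-1,0)]),(4,[(1,0,0,0)])],[(3,[(-1,-1,-1,0)]),(5,[(1,0,0,0)])],[(2,[(-1,-1,0,0)])],[(3,[(-1,-1,0,0)])],[(0,[(1,0,0,
 0)]),(2,[(-1,0,-1,0)]),(4,[(-1,-1,0,0),(1,1,0,0)])],[(1,[(1,0,0,0)]),(3,[(-1,0,-1,0)]),(5,[(-1,-1,0,0),(1,1,0,0)])]],
 [[(0,[(1,0,1,0)]),(2,[(-1,0,-2,0)]),(4,[(-1,-1,-1,0),(1,1,-1,0)]),(5,[(1,0,0,0)])],[(1,[(1,0,1,0)]),(3,[(-1,0,-2,0)]),(4,[(1,0,0,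
 0)]),(5,[(-1,-1,-1,0),(1,1,-1,0)])],[(2,[(-1,0,-1,0)])],[(3,[(-1,0,-1,0)])],[(4,[(-1,0,-1,0)])],[(5,[(-1,0,-1,0)])]])"

definition rho_F :: grep where
 "rho_F = (5,
 [[(0,[(1,0,1,0)]),(1,[(-1,0,-2,0)]),(2,[(-1,1,-2,0)])],[(1,[(-1,0,-1,0)])],[(2,[(-1,0,-1,0)])],[(4,[(1,0,0,0)])],[(3,[(1,0,0,0)]),
 (4,[(-1,0,-1,0),(1,0,1,0)])]],
 [[(0,[(1,1,0,0)]),(3,[(-1,-2,-2,0),(1,-2,0,0),(-1,-2,2,0)]),(4,[(1,-2,-3,0),(-2,-2,-1,0),(1,-2,1,0),(-1,-2,3,0),(1,0,-3,0),(-1,0,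
 -1,0)])],[(2,[(1,0,0,0)]),(3,[(-1,-2,-1,0),(1,-2,1,0)]),(4,[(1,-2,-2,0),(-1,-2,0,0)])],[(1,[(1,0,0,0)]),(2,[(-1,-1,0,0),(1,1,0,
 0)]),(3,[(-1,-1,-1,0),(1,-1,1,0)]),(4,[(1,-1,-2,0),(-1,-1,0,0)])],[(3,[(-1,-1,0,0)])],[(4,[(-1,-1,0,0)])]],
 [[(1,[(1,0,0,0)]),(4,[(1,1,-4,0)])],[(0,[(1,0,0,0)]),(1,[(-1,0,-1,0),(1,0,1,0)]),(4,[(1,1,-3,0)])],[(3,[(1,0,0,0)])],[(2,[(1,0,0,
 0)]),(3,[(-1,0,-1,0),(1,0,1,0)])],[(4,[(-1,0,-1,0)])]])"

definition rho_X1 :: grep where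
 "rho_X1 = (1,
 [[(0,[(-1,0,-1,0)])]],
 [[(0,[(1,1,0,0)])]],
 [[(0,[(-1,0,-1,0)])]])"

definition rho_X2 :: grep where
 "rho_X2 = (1,
 [[(0,[(1,0,1,0)])]],
 [[(0,[(-1,-1,0,0)])]],
 [[(0,[(1,0,1,0)])]])"

definition rho_A :: grep where
 "rho_A = (6,
 [[(0,[(-1,0,-1,0),(1,0,1,0)]),(3,[(1,0,0,0)])],[(2,[(1,0,0,1)])],[(1,[(1,0,0,-1)]),(2,[(-1,0,-1,0),(1,0,1,0)])],[(0,[(1,0,0,0)])],
 [(5,[(1,0,0,0)])],[(4,[(1,0,0,0)]),(5,[(-1,0,-1,0),(1,0,1,0)])]],
 [[(0,[(-1,-1,0,0),(1,1,0,0)]),(2,[(1,0,0,1)])],[(3,[(1,0,0,0)])],[(0,[(1,0,0,-1)])],[(1,[(1,0,0,0)]),(3,[(-1,-1,0,0),(1,1,0,0)])],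
 [(4,[(-1,-1,0,0)])],[(5,[(-1,-1,0,0)])]],
 [[(1,[(1,0,0,-1)])],[(0,[(1,0,0,1)]),(1,[(-1,0,-1,0),(1,0,1,0)])],[(2,[(-1,0,-1,0),(1,0,1,0)]),(5,[(1,0,0,0)])],[(4,[(1,0,0,0)])],
 [(3,[(1,0,0,0)]),(4,[(-1,0,-1,0),(1,0,1,0)])],[(2,[(1,0,0,0)])]])"

definition rho_B :: grep where
 "rho_B = (6,
 [[(1,[(1,0,0,0)])],[(0,[(1,0,0,0)]),(1,[(-1,0,-1,0),(1,0,1,0)])],[(2,[(-1,0,-1,0)])],[(3,[(-1,0,-1,0)])],[(5,[(1,0,0,0)])],[(4,
 [(1,0,0,0)]),(5,[(-1,0,-1,0),(1,0,1,0)])]],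
 [[(0,[(-1,-1,0,0),(1,1,0,0)]),(4,[(1,0,0,0)])],[(1,[(-1,-1,0,0),(1,1,0,0)]),(5,[(1,0,0,0)])],[(3,[(1,0,0,-1)])],[(2,[(1,0,0,1)]),
 (3,[(-1,-1,0,0),(1,1,0,0)])],[(0,[(1,0,0,0)])],[(1,[(1,0,0,0)])]],
 [[(0,[(-1,0,-1,0)])],[(2,[(1,0,0,0)])],[(1,[(1,0,0,0)]),(2,[(-1,0,-1,0),(1,0,1,0)])],[(4,[(1,0,0,0)])],[(3,[(1,0,0,0)]),(4,[(-1,0,
 -1,0),(1,0,1,0)])],[(5,[(-1,0,-1,0)])]])"

text \<open>Number 7 serves a = b, where the finite cells belonging to numbers 1, 2 and 5 for a > b
  have the common value b and merge. Numbers 8 and 9 involve \<zeta> and belong to the two families,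
  that is, to \<Gamma>_1 and \<Gamma>_2.\<close>

definition rep_no :: "nat => grep" where
 "rep_no r = [rho_E, rho_R, rho_Sh, rho_Sl, rho_F, rho_X1, rho_X2, dsum (dsum rho_R rho_Sh) rho_X1, rho_A, rho_B] ! r"

definition face_R1 :: face where
 "face_R1 = ([(1,0),(2,1)],[0,1,4,4,4,4,4,4,5,5,5,5,5,5,1,3,4,4,4,4,4,4,2,2,2,4,4,4,4,4,4,5,5,5,5,5,5,2,2,2,2,2,2,4,4,4,4,4,4,5,5,5,5,5,5,2,2,
 2,5,5,5,5,5,5,1,1,4,4,4,4,4,4,5,5,5,5,5,5,2,2,2,4,4,4,4,4,4,5,5,5,5,5,5,2,2,2],
 [(0,(0,0),[0],[(-1,-1)],[(-3,-2)],Fin 0 [(0,[])] [(0,0,[(1,0)])]),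
 (1,(0,1),[1,2],[(-1,-1),(-1,0)],[(-3,1),(-3,-2)],Fin 1 [(1,[]),(14,[]),(64,[]),(65,[])] [(1,1,[(1,1)]),(1,14,[(1,14)]),(64,64,
 [(1,64)]),(64,65,[(1,65)]),(14,65,[(1,1)]),(65,14,[(1,64)]),(65,1,[(1,65)])]),
 (2,(1,0),[3],[(0,-1),(0,-1),(-2,0),(-2,0),(-1,0),(-1,0)],[(-1,1),(-1,1),(-1,0),(-1,0),(-3,-2),(-3,-2)],Fin 40 [(22,[]),(23,
 []),(24,[]),(37,[]),(38,[]),(39,[]),(40,[]),(41,[]),(42,[]),(55,[]),(56,[]),(57,[]),(78,[]),(79,[]),(80,[]),(93,[]),(94,[]),(95,
 [])] [(40,40,[(1,40)]),(40,41,[(1,41)]),(40,55,[(1,55)]),(40,56,[(1,56)]),(78,40,[(1,78)]),(78,41,[(1,79)]),(78,55,[(1,93)]),(78,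
 56,[(1,94)]),(42,22,[(1,40)]),(22,40,[(1,22)]),(23,78,[(1,22)]),(22,41,[(1,23)]),(24,22,[(1,22)]),(22,42,[(1,24)]),(37,55,[(1,
 22)]),(22,55,[(1,37)]),(38,93,[(1,22)]),(22,56,[(1,38)]),(39,37,[(1,22)]),(22,57,[(1,39)]),(41,78,[(1,40)]),(40,42,[(1,42)]),(56,
 93,[(1,40)]),(57,37,[(1,40)]),(40,57,[(1,57)]),(41,79,[(1,41)]),(41,80,[(1,42)]),(78,42,[(1,80)]),(56,94,[(1,41)]),(56,95,[(1,
 42)]),(93,42,[(1,95)])]),
 (6,(0,3),[6,7],[(-1,0)],[(-3,1)],Fin 15 [(15,[])] [(15,15,[(1,15)])]),
 (8,(1,1),[4,5],[(0,0),(-1,-1),(-1,0),(0,-1),(-2,0),(-1,-1)],[(-1,0),(-1,-1),(-2,-1),(-1,1),(-1,0),(-2,-1)],Own 0 2 [0,-2,0,-2,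
 -2,-2] 0 [1,1,1,1,1,1]),
 (9,(3,-2),[8],[(-2,2),(-1,1),(-3,1),(-1,0),(-3,2),(-2,1)],[(0,0),(-2,2),(-2,1),(-1,1),(-1,0),(-3,2)],Own 1 2 [0,0,0,-2,-2,
 -2] 0 [1,1,1,1,1,1])])"

definition face_r2 :: face where
 "face_r2 = ([(2,1)],[0,1,3,3,3,3,3,3,4,4,4,4,4,4,1,3,3,3,3,3,3,3,2,2,2,3,3,3,3,3,3,4,4,4,4,4,4,2,2,2,2,2,2,3,3,3,3,3,3,4,4,4,4,4,4,2,2,2,4,4,
 4,4,4,4,1,1,3,3,3,3,3,3,4,4,4,4,4,4,2,2,2,3,3,3,3,3,3,4,4,4,4,4,4,2,2,2],
 [(0,(0,0),[0],[(0,-3)],[(0,-8)],Fin 0 [(0,[])] [(0,0,[(1,0)])]),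
 (1,(0,1),[1,2],[(0,-3),(0,-2)],[(0,-5),(0,-8)],Fin 1 [(1,[]),(14,[]),(64,[]),(65,[])] [(1,1,[(1,1)]),(1,14,[(1,14)]),(64,64,
 [(1,64)]),(64,65,[(1,65)]),(14,65,[(1,1)]),(65,14,[(1,64)]),(65,1,[(1,65)])]),
 (2,(1,0),[3],[(0,-1),(0,-1),(0,-4),(0,-4),(0,-2),(0,-2)],[(0,-1),(0,-1),(0,-2),(0,-2),(0,-8),(0,-8)],Fin 40 [(22,[]),(23,[]),
 (24,[]),(37,[]),(38,[]),(39,[]),(40,[]),(41,[]),(42,[]),(55,[]),(56,[]),(57,[]),(78,[]),(79,[]),(80,[]),(93,[]),(94,[]),(95,
 [])] [(40,40,[(1,40)]),(40,41,[(1,41)]),(40,55,[(1,55)]),(40,56,[(1,56)]),(78,40,[(1,78)]),(78,41,[(1,79)]),(78,55,[(1,93)]),(78,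
 56,[(1,94)]),(42,22,[(1,40)]),(22,40,[(1,22)]),(23,78,[(1,22)]),(22,41,[(1,23)]),(24,22,[(1,22)]),(22,42,[(1,24)]),(37,55,[(1,
 22)]),(22,55,[(1,37)]),(38,93,[(1,22)]),(22,56,[(1,38)]),(39,37,[(1,22)]),(22,57,[(1,39)]),(41,78,[(1,40)]),(40,42,[(1,42)]),(56,
 93,[(1,40)]),(57,37,[(1,40)]),(40,57,[(1,57)]),(41,79,[(1,41)]),(41,80,[(1,42)]),(78,42,[(1,80)]),(56,94,[(1,41)]),(56,95,[(1,
 42)]),(93,42,[(1,95)])]),
 (8,(0,3),[4,5,6,7],[(0,0),(0,-3),(0,-2),(0,-1),(0,-4),(0,-3)],[(0,-2),(0,-3),(0,-5),(0,-1),(0,-2),(0,-5)],Own 0 1 [0,-2,1,-2,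
 -2,-2] 1 [1,1,2,1,1,1]),
 (9,(3,-2),[8],[(0,-2),(0,-1),(0,-5),(0,-2),(0,-4),(0,-3)],[(0,0),(0,-2),(0,-3),(0,-1),(0,-2),(0,-4)],Own 1 2 [0,0,0,-2,-2,
 -2] 0 [1,1,1,1,1,1])])"

definition face_R2 :: face where
 "face_R2 = ([(2,1),(3,2)],[0,1,3,3,4,3,3,3,5,5,5,5,5,5,1,4,4,4,4,4,4,4,2,2,2,3,3,4,3,3,3,5,5,5,5,5,5,2,2,2,2,2,2,3,3,4,3,3,3,5,5,5,5,5,5,2,2,
 2,5,5,5,5,5,5,1,1,3,3,4,3,3,3,5,5,5,5,5,5,2,2,2,3,3,4,3,3,3,5,5,5,5,5,5,2,2,2],
 [(0,(0,0),[0],[(-1,-1)],[(-3,-2)],Fin 0 [(0,[])] [(0,0,[(1,0)])]),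
 (1,(0,1),[1,2],[(-1,-1),(-1,0)],[(-3,1),(-3,-2)],Fin 1 [(1,[]),(14,[]),(64,[]),(65,[])] [(1,1,[(1,1)]),(1,14,[(1,14)]),(64,64,
 [(1,64)]),(64,65,[(1,65)]),(14,65,[(1,1)]),(65,14,[(1,64)]),(65,1,[(1,65)])]),
 (2,(1,0),[3],[(0,-1),(0,-1),(-2,0),(-2,0),(-1,0),(-1,0)],[(-1,1),(-1,1),(-1,0),(-1,0),(-3,-2),(-3,-2)],Fin 40 [(22,[]),(23,
 []),(24,[]),(37,[]),(38,[]),(39,[]),(40,[]),(41,[]),(42,[]),(55,[]),(56,[]),(57,[]),(78,[]),(79,[]),(80,[]),(93,[]),(94,[]),(95,
 [])] [(40,40,[(1,40)]),(40,41,[(1,41)]),(40,55,[(1,55)]),(40,56,[(1,56)]),(78,40,[(1,78)]),(78,41,[(1,79)]),(78,55,[(1,93)]),(78,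
 56,[(1,94)]),(42,22,[(1,40)]),(22,40,[(1,22)]),(23,78,[(1,22)]),(22,41,[(1,23)]),(24,22,[(1,22)]),(22,42,[(1,24)]),(37,55,[(1,
 22)]),(22,55,[(1,37)]),(38,93,[(1,22)]),(22,56,[(1,38)]),(39,37,[(1,22)]),(22,57,[(1,39)]),(41,78,[(1,40)]),(40,42,[(1,42)]),(56,
 93,[(1,40)]),(57,37,[(1,40)]),(40,57,[(1,57)]),(41,79,[(1,41)]),(41,80,[(1,42)]),(78,42,[(1,80)]),(56,94,[(1,41)]),(56,95,[(1,
 42)]),(93,42,[(1,95)])]),
 (4,(1,1),[4,5],[(0,0),(-1,-2),(0,-1),(-2,-1),(-1,-1)],[(-2,2),(-2,1),(-1,1),(-1,0),(-3,-2)],Fin 2 [(2,[]),(3,[]),(5,[]),(6,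
 []),(7,[]),(25,[]),(26,[]),(28,[]),(29,[]),(30,[]),(43,[]),(44,[]),(46,[]),(47,[]),(48,[]),(66,[]),(67,[]),(69,[]),(70,[]),(71,
 []),(81,[]),(82,[]),(84,[]),(85,[]),(86,[])] [(2,2,[(1,2)]),(3,66,[(1,2)]),(2,3,[(1,3)]),(5,43,[(1,2)]),(2,5,[(1,5)]),(6,81,[(1,
 2)]),(2,6,[(1,6)]),(7,25,[(1,2)]),(2,7,[(1,7)]),(25,2,[(1,25)]),(7,26,[(1,3)]),(25,3,[(1,26)]),(7,28,[(1,5)]),(25,5,[(1,28)]),(7,
 29,[(1,6)]),(25,6,[(1,29)]),(7,30,[(1,7)]),(25,7,[(1,30)]),(43,2,[(1,43)]),(5,44,[(1,3)]),(43,3,[(1,44)]),(5,46,[(1,5)]),(43,5,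
 [(1,46)]),(5,47,[(1,6)]),(43,6,[(1,47)]),(5,48,[(1,7)]),(43,7,[(1,48)]),(66,2,[(1,66)]),(3,67,[(1,3)]),(66,3,[(1,67)]),(3,69,[(1,
 5)]),(66,5,[(1,69)]),(3,70,[(1,6)]),(66,6,[(1,70)]),(3,71,[(1,7)]),(66,7,[(1,71)]),(81,2,[(1,81)]),(6,82,[(1,3)]),(81,3,[(1,82)]),
 (6,84,[(1,5)]),(81,5,[(1,84)]),(6,85,[(1,6)]),(81,6,[(1,85)]),(6,86,[(1,7)]),(81,7,[(1,86)])]),
 (8,(0,3),[6,7],[(0,0),(0,-3),(0,-2),(0,-1),(-1,-2),(-1,-1)],[(0,-2),(0,-3),(-1,-3),(0,-1),(0,-2),(-1,-3)],Own 0 2 [0,-2,2,-2,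
 -2,-2] 1 [0,0,1,0,0,0]),
 (9,(3,-2),[8],[(-2,2),(-2,3),(-3,1),(-2,2),(-3,2),(-3,3)],[(0,0),(-2,2),(-2,1),(-1,1),(-1,0),(-3,2)],Own 1 2 [0,0,0,-2,-2,
 -2] 0 [1,1,1,1,1,1])])"

definition face_r32 :: face where
 "face_r32 = ([(3,2)],[0,1,4,4,3,4,4,4,4,4,4,4,4,4,1,3,3,3,3,3,3,3,2,2,2,4,4,3,4,4,4,4,4,4,4,4,4,2,2,2,2,2,2,4,4,3,4,4,4,4,4,4,4,4,4,2,2,2,4,4,
 4,4,4,4,1,1,4,4,3,4,4,4,4,4,4,4,4,4,2,2,2,4,4,3,4,4,4,4,4,4,4,4,4,2,2,2],
 [(0,(0,0),[0],[(-1,-1)],[(-1,-5)],Fin 0 [(0,[])] [(0,0,[(1,0)])]),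
 (1,(0,1),[1,2],[(-1,-1),(-1,0)],[(-1,-2),(-1,-5)],Fin 1 [(1,[]),(14,[]),(64,[]),(65,[])] [(1,1,[(1,1)]),(1,14,[(1,14)]),(64,
 64,[(1,64)]),(64,65,[(1,65)]),(14,65,[(1,1)]),(65,14,[(1,64)]),(65,1,[(1,65)])]),
 (2,(1,0),[3],[(0,-1),(0,-1),(0,-3),(0,-3),(-1,0),(-1,0)],[(-1,1),(-1,1),(-1,0),(-1,0),(-1,-5),(-1,-5)],Fin 40 [(22,[]),(23,
 []),(24,[]),(37,[]),(38,[]),(39,[]),(40,[]),(41,[]),(42,[]),(55,[]),(56,[]),(57,[]),(78,[]),(79,[]),(80,[]),(93,[]),(94,[]),(95,
 [])] [(40,40,[(1,40)]),(40,41,[(1,41)]),(40,55,[(1,55)]),(40,56,[(1,56)]),(78,40,[(1,78)]),(78,41,[(1,79)]),(78,55,[(1,93)]),(78,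
 56,[(1,94)]),(42,22,[(1,40)]),(22,40,[(1,22)]),(23,78,[(1,22)]),(22,41,[(1,23)]),(24,22,[(1,22)]),(22,42,[(1,24)]),(37,55,[(1,
 22)]),(22,55,[(1,37)]),(38,93,[(1,22)]),(22,56,[(1,38)]),(39,37,[(1,22)]),(22,57,[(1,39)]),(41,78,[(1,40)]),(40,42,[(1,42)]),(56,
 93,[(1,40)]),(57,37,[(1,40)]),(40,57,[(1,57)]),(41,79,[(1,41)]),(41,80,[(1,42)]),(78,42,[(1,80)]),(56,94,[(1,41)]),(56,95,[(1,
 42)]),(93,42,[(1,95)])]),
 (8,(0,3),[6,7],[(0,0),(0,-3),(0,-2),(0,-1),(-1,-2),(-1,-1)],[(0,-2),(0,-3),(-1,-3),(0,-1),(0,-2),(-1,-3)],Own 0 2 [0,-2,2,-2,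
 -2,-2] 1 [0,0,1,0,0,0]),
 (9,(1,1),[8,4,5],[(0,-1),(0,0),(-1,-2),(0,-1),(-1,-1),(-1,0)],[(0,0),(0,-1),(0,-2),(-1,1),(-1,0),(-1,-1)],Own 1 1 [0,1,1,-1,
 -1,-1] 1 [1,2,2,2,2,2])])"

definition face_R3 :: face where
 "face_R3 = ([(3,2),(1,1)],[0,1,5,5,4,5,5,5,5,5,5,5,5,5,1,4,4,4,4,4,4,4,2,2,2,5,5,4,5,5,5,5,5,5,5,5,5,2,2,2,2,2,2,5,5,4,5,5,5,5,5,5,5,5,5,2,2,
 2,3,5,5,5,5,5,1,1,5,5,4,5,5,5,5,5,5,5,5,5,2,2,2,5,5,4,5,5,5,5,5,5,5,5,5,2,2,2],
 [(0,(0,0),[0],[(-1,-1)],[(-3,-2)],Fin 0 [(0,[])] [(0,0,[(1,0)])]),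
 (1,(0,1),[1,2],[(-1,-1),(-1,0)],[(-3,1),(-3,-2)],Fin 1 [(1,[]),(14,[]),(64,[]),(65,[])] [(1,1,[(1,1)]),(1,14,[(1,14)]),(64,64,
 [(1,64)]),(64,65,[(1,65)]),(14,65,[(1,1)]),(65,14,[(1,64)]),(65,1,[(1,65)])]),
 (2,(1,0),[3],[(0,-1),(0,-1),(-2,0),(-2,0),(-1,0),(-1,0)],[(-1,1),(-1,1),(-1,0),(-1,0),(-3,-2),(-3,-2)],Fin 40 [(22,[]),(23,
 []),(24,[]),(37,[]),(38,[]),(39,[]),(40,[]),(41,[]),(42,[]),(55,[]),(56,[]),(57,[]),(78,[]),(79,[]),(80,[]),(93,[]),(94,[]),(95,
 [])] [(40,40,[(1,40)]),(40,41,[(1,41)]),(40,55,[(1,55)]),(40,56,[(1,56)]),(78,40,[(1,78)]),(78,41,[(1,79)]),(78,55,[(1,93)]),(78,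
 56,[(1,94)]),(42,22,[(1,40)]),(22,40,[(1,22)]),(23,78,[(1,22)]),(22,41,[(1,23)]),(24,22,[(1,22)]),(22,42,[(1,24)]),(37,55,[(1,
 22)]),(22,55,[(1,37)]),(38,93,[(1,22)]),(22,56,[(1,38)]),(39,37,[(1,22)]),(22,57,[(1,39)]),(41,78,[(1,40)]),(40,42,[(1,42)]),(56,
 93,[(1,40)]),(57,37,[(1,40)]),(40,57,[(1,57)]),(41,79,[(1,41)]),(41,80,[(1,42)]),(78,42,[(1,80)]),(56,94,[(1,41)]),(56,95,[(1,
 42)]),(93,42,[(1,95)])]),
 (5,(3,-2),[8],[(-1,0)],[(0,0)],Fin 58 [(58,[])] [(58,58,[(1,58)])]),
 (8,(0,3),[6,7],[(0,0),(0,-3),(0,-2),(0,-1),(-1,-2),(-1,-1)],[(0,-2),(0,-3),(-1,-3),(0,-1),(0,-2),(-1,-3)],Own 0 2 [0,-2,2,-2,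
 -2,-2] 1 [0,0,1,0,0,0]),
 (9,(1,1),[4,5],[(0,-1),(0,0),(-1,-2),(0,-1),(-1,-1),(-1,0)],[(0,0),(0,-1),(0,-2),(1,-2),(1,-3),(-1,-1)],Own 1 2 [0,2,2,0,0,
 0] 1 [0,1,1,1,1,1])])"

definition face_r1 :: face where
 "face_r1 = ([(1,1)],[0,1,3,3,2,3,3,3,3,3,3,3,3,3,1,2,2,2,2,2,2,2,1,1,1,3,3,2,3,3,3,3,3,3,3,3,3,1,1,1,1,1,1,3,3,2,3,3,3,3,3,3,3,3,3,1,1,1,1,3,
 3,3,3,3,1,1,3,3,2,3,3,3,3,3,3,3,3,3,1,1,1,3,3,2,3,3,3,3,3,3,3,3,3,1,1,1],
 [(0,(0,0),[0],[(0,-2)],[(0,-5)],Fin 0 [(0,[])] [(0,0,[(1,0)])]),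
 (7,(0,1),[1,2,3],[(0,-2),(0,-1),(0,-1),(0,-1),(0,-2),(0,-2),(0,-1),(0,-1),(0,-1)],[(0,-2),(0,-5),(0,0),(0,0),(0,-1),(0,-1),(0,
 -5),(0,-5),(0,0)],Fin 1 [(41,[]),(42,[]),(56,[]),(57,[]),(22,[((6,2,0),1),((6,3,0),-1),((7,3,0),1)]),(37,[((6,2,0),1)]),(23,[((1,
 0,0),1),((6,4,0),-1),((6,5,0),-1)]),(14,[((6,4,0),1)]),(38,[((1,0,0),1)]),(24,[((1,1,0),1),((6,6,0),-1),((6,7,0),-1)]),(1,[((6,6,
 0),1)]),(39,[((1,1,0),1)]),(55,[((2,2,0),1),((2,3,0),1),((8,8,0),-1)]),(40,[((2,2,0),1)]),(58,[((2,3,0),1)]),(78,[((4,2,0),1),((4,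
 3,0),-1),((5,3,0),1)]),(93,[((4,2,0),1)]),(79,[((0,0,0),1),((4,4,0),-1),((4,5,0),-1)]),(64,[((4,4,0),1)]),(94,[((0,0,0),1)]),(80,
 [((0,1,0),1),((4,6,0),-1),((4,7,0),-1)]),(65,[((4,6,0),1)]),(95,[((0,1,0),1)])] [(1,1,[(1,1)]),(1,14,[(1,14)]),(40,40,[(1,40)]),
 (40,41,[(1,41)]),(40,55,[(1,55)]),(40,56,[(1,56)]),(40,58,[(1,58)]),(64,64,[(1,64)]),(64,65,[(1,65)]),(64,78,[(1,78)]),(64,79,[(1,
 79)]),(64,93,[(1,93)]),(64,94,[(1,94)]),(14,65,[(1,1)]),(22,42,[(1,24),(1,1)]),(1,22,[(1,22)]),(23,80,[(1,1),(1,24),(1,39)]),(1,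
 23,[(1,23)]),(24,24,[(1,1),(1,24),(1,39)]),(37,57,[(1,24),(1,1)]),(1,37,[(1,37)]),(38,95,[(1,1)]),(1,38,[(1,38)]),(39,39,[(1,1)]),
 (22,40,[(1,22)]),(42,22,[(1,40),(1,55)]),(22,41,[(1,23),(1,14)]),(42,14,[(1,41)]),(42,1,[(1,42)]),(22,55,[(1,22),(1,37)]),(37,56,
 [(1,23),(1,14)]),(57,14,[(1,56)]),(57,1,[(1,57)]),(37,58,[(1,22)]),(57,22,[(1,55),(1,58)]),(65,14,[(1,64)]),(65,1,[(1,65)]),(14,
 78,[(1,22)]),(65,22,[(1,78)]),(23,79,[(1,14),(1,23),(1,38)]),(80,14,[(1,79)]),(80,1,[(1,80)]),(23,93,[(1,22),(1,37)]),(80,22,[(1,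
 78),(1,93)]),(38,94,[(1,14)]),(95,14,[(1,94)]),(95,1,[(1,95)])]),
 (8,(0,3),[6,7],[(0,0),(0,-3),(0,-2),(0,-1),(0,-3),(0,-2)],[(0,-2),(0,-3),(0,-4),(0,-1),(0,-2),(0,-4)],Own 0 2 [0,-2,2,-2,-2,
 -2] 1 [0,0,1,0,0,0]),
 (9,(1,1),[4,5],[(0,-1),(0,0),(0,-3),(0,-1),(0,-2),(0,-1)],[(0,0),(0,-1),(0,-2),(0,-1),(0,-2),(0,-2)],Own 1 2 [0,2,2,0,0,
 0] 1 [0,1,1,1,1,1])])"

definition face_R4 :: face where
 "face_R4 = ([(1,1),(0,1)],[0,2,5,5,4,5,5,5,5,5,5,5,5,5,2,4,4,4,4,4,4,4,2,2,2,5,5,4,5,5,5,5,5,5,5,5,5,2,1,1,3,2,2,5,5,4,5,5,5,5,5,5,5,5,5,2,2,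
 2,2,5,5,5,5,5,2,2,5,5,4,5,5,5,5,5,5,5,5,5,2,2,2,5,5,4,5,5,5,5,5,5,5,5,5,2,1,1],
 [(0,(0,0),[0],[(-1,-1)],[(-3,-2)],Fin 0 [(0,[])] [(0,0,[(1,0)])]),
 (1,(-2,3),[9],[(0,-2),(0,-1)],[(-1,-1),(-2,-3)],Fin 94 [(38,[]),(39,[]),(94,[]),(95,[])] [(94,94,[(1,94)]),(95,38,[(1,94)]),
 (38,94,[(1,38)]),(39,38,[(1,38)]),(38,95,[(1,39)]),(94,95,[(1,95)])]),
 (3,(0,1),[1,2],[(-1,-1),(-1,-1),(-1,0),(-1,0),(0,-1),(0,-1)],[(0,-1),(0,-1),(-3,-2),(-3,-2),(0,0),(0,0)],Fin 1 [(1,[]),(14,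
 []),(22,[]),(23,[]),(24,[]),(37,[]),(41,[]),(42,[]),(55,[]),(56,[]),(57,[]),(58,[]),(64,[]),(65,[]),(78,[]),(79,[]),(80,[]),(93,
 [])] [(1,1,[(1,1)]),(1,14,[(1,14)]),(41,64,[(1,41)]),(41,78,[(1,55)]),(41,79,[(1,56)]),(41,93,[(1,58)]),(64,64,[(1,64)]),(64,65,
 [(1,65)]),(64,78,[(1,78)]),(64,79,[(1,79)]),(64,93,[(1,93)]),(14,65,[(1,1)]),(22,42,[(1,1)]),(1,22,[(1,22)]),(23,80,[(1,1)]),(1,
 23,[(1,23)]),(24,24,[(1,1)]),(1,24,[(1,24)]),(37,57,[(1,1)]),(1,37,[(1,37)]),(22,41,[(1,14)]),(42,14,[(1,41)]),(42,1,[(1,42)]),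
 (22,55,[(1,22)]),(42,22,[(1,55)]),(37,56,[(1,14)]),(57,14,[(1,56)]),(57,1,[(1,57)]),(37,58,[(1,22)]),(57,22,[(1,58)]),(65,14,[(1,
 64)]),(65,1,[(1,65)]),(14,78,[(1,22)]),(65,22,[(1,78)]),(23,79,[(1,14)]),(80,14,[(1,79)]),(80,1,[(1,80)]),(23,93,[(1,22)]),(80,22,
 [(1,93)])]),
 (5,(1,0),[3],[(0,-1)],[(2,-2)],Fin 40 [(40,[])] [(40,40,[(1,40)])]),
 (8,(0,3),[6,7],[(0,0),(0,-3),(0,-2),(0,-1),(-1,-2),(-1,-1)],[(0,-2),(-1,-2),(-1,-3),(0,-1),(-1,-1),(-1,-3)],Own 0 2 [0,-2,2,
 -2,-2,-2] 1 [0,0,1,0,0,0]),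
 (9,(1,1),[4,5],[(0,-1),(0,0),(-1,-2),(0,-1),(-1,-1),(-1,0)],[(0,0),(0,-1),(0,-2),(-1,0),(-1,-1),(-1,-1)],Own 1 2 [0,2,2,0,0,
 0] 1 [0,1,1,1,1,1])])"

definition faces :: "face list" where
 "faces = [face_R1, face_r2, face_R2, face_r32, face_R3, face_r1, face_R4]"

text \<open>With C_i the element \<open>Cs\<close> of s_i, X = C_1 C_2 and u = q^(a-b) + q^(b-a),
  the last entry is X (X - u - 1)(X - u + 1). On the two-dimensional representations of the Hecke
  algebra of the dihedral group of order 12, X has the eigenvalue 0 and one of u + 1, u - 1, so
  these are annihilated.\<close>

definition bases :: "comb list" where
 "bases = [[([(1,(0,0,0))], [])],
 [([(1,(0,0,0))], [G0])],
 [([(1,(0,0,0))], [G2])],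
 [([(1,(0,0,0))], [G1])],
 [([(1,(0,0,0))], [G0,G1])],
 [([(1,(0,0,0))], [G1,G0])],
 [([(1,(0,0,0))], [G0,G2,G0]), ([(-1,(0,0,0))], [G0])],
 [([(1,(0,0,0))], [G0,G1,G2,G0]), ([(-1,(0,0,0))], [G1,G0])],
 [([(1,(0,0,0))], [G1,G2,G1,G2,G1]), ([(-2,(-1,1,0)),(-2,(1,-1,0))], [G1,G2,G1]), ([(1,(-2,2,0)),(1,(0,0,0)),(1,(2,-2,0))], [G1])],
 [([(1,(0,0,0))], [G2,G1,G2,G1,G2]), ([(-2,(-1,1,0)),(-2,(1,-1,0))], [G2,G1,G2]), ([(1,(-2,2,0)),(1,(0,0,0)),(1,(2,-2,0))], [G2])],
 [([(1,(0,0,0))], [G1,G2,G1,G2,G1,G2]), ([(-2,(-1,1,0)),(-2,(1,-1,0))], [G1,G2,G1,G2]), ([(1,(-2,2,0)),(1,(0,0,0)),(1,(2,-2,0))], [G1,G2])]]"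

text \<open>Row r lists the entries of \<open>bases\<close> annihilated by the representation r.
  Entry 10, headed by w_0, is annihilated by all ten and is added in the checks.\<close>

definition kill_table :: "nat list list" where
 "kill_table = [[1, 2, 3, 4, 5, 6, 7, 8, 9], [3, 4, 5, 6, 7, 8], [4, 5, 6, 7, 8, 9], [4, 5, 6, 7, 8, 9], [6, 7, 8, 9], [1, 2, 4, 5, 6, 7, 9], [3, 4, 5, 8], [4, 5, 6, 7], [8], [6, 7, 9]]"

fun has_sub :: "gen list => gen list => bool" where
 "has_sub d [] <-> d = []"
| "has_sub d (g # w) <-> take (length d) (g # w) = d | has_sub d w"

definition above :: "ray list => weight => weight => bool" where
 "above rays x y <-> list_all (%l. rval x l <= rval y l) rays & list_ex (%l. rval x l ~= rval y l) rays"

definition sp_al :: "spec => weight" where "sp_al sp = fst (snd sp)"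
definition sp_bs :: "spec => nat list" where "sp_bs sp = fst (snd (snd sp))"
definition sp_kind :: "spec => kind" where "sp_kind sp = snd (snd (snd (snd (snd sp))))"

fun kind_no :: "kind => nat" where
 "kind_no (Fin e tab cs) = 2"
| "kind_no (Own k s h M xs) = (if k < 2 then k else 3)"

text \<open>Apart from bookkeeping: every word of a cell has a base word of that cell as a factor,
  and for each base every other representation kills it or has a strictly larger value on the face.
  This gives \<open>kill_base\<close>.\<close>

fun face_ok :: "face => bool" where
 "face_ok (rays, cl, sps) <-> 2 <= length sps & length cl = 96 & list_all (%c. c < length sps) cl &
 list_all (%(i, sp). kind_no (sp_kind sp) = (if Suc (Suc i) = length sps then 0 else if Suc i = length sps then 1 else 2)) (enumerate 0 sps) &
 list_all (%sp. fst sp < 10 & list_all (%l. 0 <= rval (sp_al sp) l) rays & list_all (%b. b < 11) (sp_bs sp)) sps &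
 list_all (%(c, w). list_ex (%b. has_sub (snd (hd (bases ! b))) w) (sp_bs (sps ! c))) (zip cl fin_words) &
 list_ex (%b. has_sub (snd (hd (bases ! b))) (fam_d 0 @ fam_t 0)) (sp_bs (sps ! (length sps - 2))) &
 list_ex (%b. has_sub (snd (hd (bases ! b))) (fam_d 1 @ fam_t 1)) (sp_bs (sps ! (length sps - 1))) &
 list_all (%(i, sp). list_all (%b. list_all (%(k, sp'). k = i | b : set (kill_table ! fst sp') | above rays (sp_al sp) (sp_al sp'))
 (enumerate 0 sps)) (sp_bs sp)) (enumerate 0 sps)"

lemma faces_ok: "list_all face_ok faces" by code_simp

lemma bases_ok: "list_all (%l. comb_ok l) bases & length bases = 11 & length fin_words = 96" by code_simp

lemma base_w0: "snd (hd (bases ! 10)) = [G1, G2, G1, G2, G1, G2]"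
 "list_all (%(p, u). sym_pol p & set u <= {G1, G2}) (bases ! 10)"
 "dscan [((1, 0), 3), ((0, 1), 3)] (comb_value (bases ! 10)) = Some [(1, 0)]"
 by code_simp+

lemma kill_0: "list_all (%b. kill_ok (rep_no 0) (bases ! b)) (10 # kill_table ! 0)" by code_simp
lemma kill_1: "list_all (%b. kill_ok (rep_no 1) (bases ! b)) (10 # kill_table ! 1)" by code_simp
lemma kill_2: "list_all (%b. kill_ok (rep_no 2) (bases ! b)) (10 # kill_table ! 2)" by code_simp
lemma kill_3: "list_all (%b. kill_ok (rep_no 3) (bases ! b)) (10 # kill_table ! 3)" by code_simp
lemma kill_4: "list_all (%b. kill_ok (rep_no 4) (bases ! b)) (10 # kill_table ! 4)" by code_simp
lemma kill_5: "list_all (%b. kill_ok (rep_no 5) (bases ! b)) (10 # kill_table ! 5)" by code_simp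
lemma kill_6: "list_all (%b. kill_ok (rep_no 6) (bases ! b)) (10 # kill_table ! 6)" by code_simp
lemma kill_7: "list_all (%b. kill_ok (rep_no 7) (bases ! b)) (10 # kill_table ! 7)" by code_simp
lemma kill_8: "list_all (%b. kill_ok (rep_no 8) (bases ! b)) (10 # kill_table ! 8)" by code_simp
lemma kill_9: "list_all (%b. kill_ok (rep_no 9) (bases ! b)) (10 # kill_table ! 9)" by code_simp

text \<open>The elements \<open>s\<^sub>0 s\<^sub>1\<close>, \<open>s\<^sub>0 s\<^sub>2 s\<^sub>0\<close> and \<open>s\<^sub>1 s\<^sub>2 s\<^sub>1 s\<^sub>2 s\<^sub>1\<close> that identify the infinite cells.\<close>

lemma markers: "fin_words ! 2 = [G0, G1]" "fin_words ! 15 = [G0, G2, G0]" "fin_words ! 58 = [G1, G2, G1, G2, G1]"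
 by code_simp+

lemma rep_0: "rep_faces_ok faces 0 (rep_no 0)" by code_simp
lemma rep_1: "rep_faces_ok faces 1 (rep_no 1)" by code_simp
lemma rep_2: "rep_faces_ok faces 2 (rep_no 2)" by code_simp
lemma rep_3: "rep_faces_ok faces 3 (rep_no 3)" by code_simp
lemma rep_4: "rep_faces_ok faces 4 (rep_no 4)" by code_simp
lemma rep_5: "rep_faces_ok faces 5 (rep_no 5)" by code_simp
lemma rep_6: "rep_faces_ok faces 6 (rep_no 6)" by code_simp
lemma rep_7: "rep_faces_ok faces 7 (rep_no 7)" by code_simp
lemma rep_8: "rep_faces_ok faces 8 (rep_no 8)" by code_simp
lemma rep_9: "rep_faces_ok faces 9 (rep_no 9)" by code_simp

section \<open>From the certificates to the hypotheses for a face\<close>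

lemma has_sub_split: "has_sub d w ==> EX x y. w = x @ d @ y"
proof (induction d w rule: has_sub.induct)
 case (1 d) thus ?case by simp
next
 case (2 d g w)
 show ?case
 proof (cases "take (length d) (g # w) = d")
 case True
 have "g # w = [] @ take (length d) (g # w) @ drop (length d) (g # w)" by simp
 thus ?thesis using True by metis
 next
 case False
 then obtain x y where "w = x @ d @ y" using 2 by auto
 hence "g # w = (g # x) @ d @ y" by simp
 thus ?thesis by blast
 qed
qed

lemma zval_zpair: assumes "distinct (map fst M)" shows "zval \<kappa> (zsem M) = zpair M \<kappa>"
 unfolding zval_def zpair_def by (intro arg_cong[where f = sum_list] map_cong) (auto simp: lookup_zsem[OF assms])

lemma tri_distinct: "tri_ok Lz d tab ==> distinct (map fst tab)"
 by (induction Lz d tab rule: tri_ok.induct) (auto simp: list_all_iff)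

lemma tri_rank: assumes "tri_ok Lz d tab" "distinct (map fst tab)"
 shows "EX \<kappa> rk. ALL j:set (map fst tab). key_in d (\<kappa> j) & zpair (Lz ! j) (\<kappa> j) ~= 0 & rk j <= length tab & 0 < rk j &
 (ALL j':set (map fst tab). rk j' <= rk j --> j' ~= j --> zpair (Lz ! j') (\<kappa> j) = 0)"
 using assms
proof (induction Lz d tab rule: tri_ok.induct)
 case (1 Lz d) thus ?case by simp
next
 case (2 Lz d t ts)
 obtain \<kappa> and rk :: "nat => nat" where IH: "ALL j:set (map fst ts). key_in d (\<kappa> j) & zpair (Lz ! j) (\<kappa> j) ~= 0 & rk j <= length ts & 0 < rk j &
 (ALL j':set (map fst ts). rk j' <= rk j --> j' ~= j --> zpair (Lz ! j') (\<kappa> j) = 0)" using 2 by auto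
 have nt: "fst t ~: set (map fst ts)" using 2(3) by simp
 have k: "key_in d (key_of Lz t)" "zpair (Lz ! fst t) (key_of Lz t) ~= 0"
 "!!j. j : set (map fst ts) ==> zpair (Lz ! j) (key_of Lz t) = 0"
 using 2(2) by (auto simp: key_in_def list_all_iff)
 let ?\<kappa> = "\<kappa>(fst t := key_of Lz t)" and ?rk = "rk(fst t := Suc (length ts))"
 show ?case
 by (rule exI[of _ ?\<kappa>], rule exI[of _ ?rk]) (use IH nt k in \<open>auto simp: le_Suc_eq\<close>)
qed

context g2_cone begin

lemma fin_zwf: assumes ok: "rep_ok rp" and D: "comp_data rays cl rp i sp Lz F" and j: "j < length fin_words"
 shows "zwf (fst rp) (Lz ! j)"
proof -
 obtain r al bs s0 s1 kd where sp: "sp = (r, al, bs, s0, s1, kd)" by (metis prod_cases6)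
 have "fin_scan rays (fst rp) al (fin_mats rp ! j) = Some (Lz ! j)" using D j by (simp add: comp_data_def sp)
 moreover have "length (fin_mats rp ! j) = fst rp" using fin_mats_repd[OF ok j] by (simp add: repd_def)
 ultimately show ?thesis using sscan_zwf[of rays 0 _ _ "fin_mats rp ! j" "Lz ! j" "fst rp"] by (simp add: fin_scan_def rvals_def)
qed

text \<open>On a finite cell, functionals and ranks come from the table. On an infinite cell the
  functional reads the coefficient of the top power of \<zeta> at (p, j), and the rank is the number
  of terms: at the same position a shorter character has a smaller top exponent.\<close>

lemma comp_keys: assumes ok: "rep_ok rp" and D: "comp_data rays cl rp i sp Lz F"
 and cl: "length cl = length fin_words" and i: "kind_no (sp_kind sp) = 2 & i < m | kind_no (sp_kind sp) < 2 & i = m + kind_no (sp_kind sp)"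
 shows "EX \<kappa> (rk :: code => nat). ALL c. valid c & ccell cl m c = i --> key_in (fst rp) (\<kappa> c) & zval (\<kappa> c) (zsem (code_top Lz F c)) ~= 0 &
 (ALL c'. valid c' & ccell cl m c' = i & rk c' <= rk c & c' ~= c --> zval (\<kappa> c) (zsem (code_top Lz F c')) = 0)"
proof -
 obtain r al bs s0 s1 kd where sp: "sp = (r, al, bs, s0, s1, kd)" by (metis prod_cases6)
 show ?thesis
 proof (cases kd)
 case (Fin e tab cs)
 have i: "i < m" using i Fin by (simp add: sp sp_kind_def)
 have t: "tri_ok Lz (fst rp) tab" "list_all (%(n, c). (c = i) = (n : set (map fst tab))) (enumerate 0 cl)"
 "list_all (%(n, \<kappa>). n < length cl) tab" "distinct (map fst tab)"
 using D tri_distinct[of Lz "fst rp" tab] by (simp_all add: comp_data_def sp Fin)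
 have own: "EX j:set (map fst tab). c = Fn j" if "valid c" "ccell cl m c = i" for c
 proof (cases c)
 case (Fn j)
 hence "(j, cl ! j) : set (enumerate 0 cl)" using that cl by (simp add: in_set_enumerate_eq)
 thus ?thesis using t(2) that Fn by (auto simp: list_all_iff)
 qed (use that i in simp)
 obtain \<kappa> rk where k: "ALL j:set (map fst tab). key_in (fst rp) (\<kappa> j) & zpair (Lz ! j) (\<kappa> j) ~= 0 & rk j <= length tab & 0 < rk j &
 (ALL j':set (map fst tab). rk j' <= rk j --> j' ~= j --> zpair (Lz ! j') (\<kappa> j) = 0)" using tri_rank[OF t(1,4)] by blast
 have z: "zval f (zsem (Lz ! j)) = zpair (Lz ! j) f" if "j : set (map fst tab)" for j f
 proof -
 have "j < length fin_words" using that t(3) cl by (auto simp: list_all_iff)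
 thus ?thesis using fin_zwf[OF ok D] by (simp add: zval_zpair zwf_def)
 qed
 let ?ix = "%c. case c of Fn j => j | _ => 0"
 show ?thesis
 proof (rule exI[of _ "%c. \<kappa> (?ix c)"], rule exI[of _ "%c. rk (?ix c)"], intro allI impI)
 fix c assume "valid c & ccell cl m c = i"
 then obtain j where j: "j : set (map fst tab)" "c = Fn j" using own by blast
 have "zval (\<kappa> j) (zsem (code_top Lz F c')) = 0" if c': "valid c' & ccell cl m c' = i & rk (?ix c') <= rk j & c' ~= c" for c'
 proof -
 obtain j' where j': "j' : set (map fst tab)" "c' = Fn j'" using own c' by blast
 thus ?thesis using k j c' z by auto
 qed
 thus "key_in (fst rp) (\<kappa> (?ix c)) & zval (\<kappa> (?ix c)) (zsem (code_top Lz F c)) ~= 0 &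
 (ALL c'. valid c' & ccell cl m c' = i & rk (?ix c') <= rk (?ix c) & c' ~= c --> zval (\<kappa> (?ix c)) (zsem (code_top Lz F c')) = 0)"
 using k j z by auto
 qed
 next
 case (Own k s h M xs)
 have i': "i = m + k" "k < 2" using i Own by (auto simp: sp sp_kind_def split: if_splits)
 note D' = D[unfolded sp Own]
 note O = own_key_sound[OF ok D' cl i'] own_key_inj[OF ok D' cl i'] and step = own_step(2)[OF ok D' cl i'] and d = own_kind(1)[OF ok D' cl i']
 let ?t = "own_key s M xs Lz"
 let ?\<kappa> = "%c. case ?t c of (p, j, l) => [((p, j, seg_top s (h ! p - h ! j) l), 1)]" and ?rk = "%c. case ?t c of (p, j, l) => l"
 show ?thesis
 proof (rule exI[of _ ?\<kappa>], rule exI[of _ ?rk], intro allI impI)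
 fix c assume c: "valid c & ccell cl m c = i"
 obtain p j l where t: "?t c = (p, j, l)" by (cases "?t c") auto
 have o: "p < 6 & j < 6 & 0 < l" "!!p' j'. zsem (code_top Lz F c) p' j' = (if p = p' & j = j' then seg s (h ! p - h ! j) l else 0)"
 using O(1)[of c p j l] c t by auto
 have "zval (?\<kappa> c) (zsem (code_top Lz F c')) = 0" if c': "valid c' & ccell cl m c' = i & ?rk c' <= ?rk c & c' ~= c" for c'
 proof -
 obtain p' j' l' where t': "?t c' = (p', j', l')" by (cases "?t c'") auto
 have o': "!!x y. zsem (code_top Lz F c') x y = (if p' = x & j' = y then seg s (h ! p' - h ! j') l' else 0)"
 using O(1)[of c' p' j' l'] c' t' by auto
 show ?thesis
 proof (cases "p' = p & j' = j")
 case True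
 hence "l' ~= l" using O(2)[of c c'] c c' t t' by auto
 hence l: "l' < l" using c' t t' by simp
 have "even (h ! p - h ! j + s * (int l - 1))" "even (h ! p - h ! j + s * (int l' - 1))"
 using O(1)[of c p j l] O(1)[of c' p' j' l'] c c' t t' True by auto
 moreover have "h ! p - h ! j + s * (int l' - 1) < h ! p - h ! j + s * (int l - 1)" using l step by simp
 moreover have "x div 2 < y div 2" if "even x" "even y" "x < y" for x y :: int using that by presburger
 ultimately have "seg_top s (h ! p - h ! j) l' < seg_top s (h ! p - h ! j) l" unfolding seg_top_def by blast
 hence "coef (seg s (h ! p - h ! j) l') (seg_top s (h ! p - h ! j) l) = 0"
 using lookup_seg(1)[OF step, of "h ! p - h ! j" l'] by force
 thus ?thesis using True by (simp add: zval_def t o')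
 qed (auto simp: zval_def t o')
 qed
 thus "key_in (fst rp) (?\<kappa> c) & zval (?\<kappa> c) (zsem (code_top Lz F c)) ~= 0 &
 (ALL c'. valid c' & ccell cl m c' = i & ?rk c' <= ?rk c & c' ~= c --> zval (?\<kappa> c) (zsem (code_top Lz F c')) = 0)"
 using o lookup_seg(2)[OF step, of l] d by (auto simp: t key_in_def zval_def)
 qed
 qed
qed

lemma comp_top_0: assumes ok: "rep_ok rp" and D: "comp_data rays cl rp i sp Lz F" and cl: "length cl = length fin_words"
 and i: "kind_no (sp_kind sp) = 2 & i < m | kind_no (sp_kind sp) < 2 & i = m + kind_no (sp_kind sp)"
 and c: "valid c" "ccell cl m c ~= i"
 shows "code_top Lz F c = []"
proof -
 obtain r al bs s0 s1 kd where sp: "sp = (r, al, bs, s0, s1, kd)" by (metis prod_cases6)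
 show ?thesis
 proof (cases c)
 case (Fn j)
 have "(cl ! j, Lz ! j) : set (zip cl Lz)" using c Fn D cl by (auto simp: set_zip comp_data_def sp)
 thus ?thesis using D c Fn by (auto simp: comp_data_def sp list_all_iff)
 next
 case (Fm k u n v)
 have k: "k < 2" "u < 6" "v < 6" "1 <= n" using c Fm by auto
 have z: "fam_zero (F k)"
 proof (cases kd)
 case (Fin e tab cs) thus ?thesis using D k by (auto simp: comp_data_def sp less_2_cases_iff)
 next
 case (Own k' s h M xs)
 hence "k' ~= k" "k' < 2" using i c Fm by (auto simp: sp sp_kind_def split: if_splits)
 thus ?thesis using D k Own by (auto simp: comp_data_def sp less_2_cases_iff)
 qed
 obtain U G V where F: "F k = (U, G, V)" by (metis prod_cases3)
 have "fam_scan rays (fst rp) al (if k = 0 then s0 else s1) (fam_mats rp k) = Some (U, G, V)" using D k F by (auto simp: comp_data_def sp)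
 note f = fam_scan_sound(4,5)[OF ok this k(2,3)]
 show ?thesis using fam_zero_top[OF z _ _ k(4), of u v] f k F Fm by simp
 qed
qed

lemma rep_all: "r < 10 ==> rep_faces_ok faces r (rep_no r)"
 and kill_all: "r < 10 ==> e : set (10 # kill_table ! r) ==> kill_ok (rep_no r) (bases ! e)"
proof -
 assume "r < 10"
 hence r: "r = 0 | r = 1 | r = 2 | r = 3 | r = 4 | r = 5 | r = 6 | r = 7 | r = 8 | r = 9" by presburger
 show "rep_faces_ok faces r (rep_no r)"
 using r by (elim disjE; hypsubst) (rule rep_0 rep_1 rep_2 rep_3 rep_4 rep_5 rep_6 rep_7 rep_8 rep_9)+
 have "list_all (%b. kill_ok (rep_no r) (bases ! b)) (10 # kill_table ! r)"
 using r by (elim disjE; hypsubst) (rule kill_0 kill_1 kill_2 kill_3 kill_4 kill_5 kill_6 kill_7 kill_8 kill_9)+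
 thus "e : set (10 # kill_table ! r) ==> kill_ok (rep_no r) (bases ! e)" unfolding list_all_iff by blast
qed

context
 fixes cl sps assumes face: "(rays, cl, sps) : set faces"
begin

abbreviation "rh i \<equiv> rep_no (fst (sps ! i))"

lemma face_D: "2 <= length sps" "length cl = length fin_words" "j < length cl ==> cl ! j < length sps"
 "i < length sps ==> kind_no (sp_kind (sps ! i)) = 2 & i < length sps - 2 |
 kind_no (sp_kind (sps ! i)) < 2 & i = length sps - 2 + kind_no (sp_kind (sps ! i))"
 "i < length sps ==> fst (sps ! i) < 10 & (ALL l:set rays. 0 <= rval (sp_al (sps ! i)) l) & (ALL b:set (sp_bs (sps ! i)). b < 11)"
 "j < length cl ==> EX b:set (sp_bs (sps ! (cl ! j))). has_sub (snd (hd (bases ! b))) (fin_words ! j)"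
 "k < 2 ==> EX b:set (sp_bs (sps ! (length sps - 2 + k))). has_sub (snd (hd (bases ! b))) (fam_d k @ fam_t k)"
 "i < length sps ==> k < length sps ==> k ~= i ==> e : set (sp_bs (sps ! i)) ==>
 e : set (kill_table ! fst (sps ! k)) | above rays (sp_al (sps ! i)) (sp_al (sps ! k))"
proof -
 have ok: "face_ok (rays, cl, sps)" using faces_ok face unfolding list_all_iff by blast
 show n: "2 <= length sps" and c: "length cl = length fin_words" using ok bases_ok by simp_all
 show "j < length cl ==> cl ! j < length sps" using ok by (simp add: list_all_length)
 have en: "i < length sps ==> (i, sps ! i) : set (enumerate 0 sps)" for i by (simp add: in_set_enumerate_eq)
 show "kind_no (sp_kind (sps ! i)) = 2 & i < length sps - 2 |
 kind_no (sp_kind (sps ! i)) < 2 & i = length sps - 2 + kind_no (sp_kind (sps ! i))" if "i < length sps"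
 proof -
 have "kind_no (sp_kind (sps ! i)) = (if Suc (Suc i) = length sps then 0 else if Suc i = length sps then 1 else 2)"
 proof -
 have "list_all (%(i, sp). kind_no (sp_kind sp) = (if Suc (Suc i) = length sps then 0 else if Suc i = length sps then 1 else 2)) (enumerate 0 sps)"
 using ok by (simp only: face_ok.simps)
 thus ?thesis using en[OF that] unfolding list_all_iff by fast
 qed
 thus ?thesis using that n by auto
 qed
 show "fst (sps ! i) < 10 & (ALL l:set rays. 0 <= rval (sp_al (sps ! i)) l) & (ALL b:set (sp_bs (sps ! i)). b < 11)" if i: "i < length sps"
 proof -
 have "list_all (%sp. fst sp < 10 & list_all (%l. 0 <= rval (sp_al sp) l) rays & list_all (%b. b < 11) (sp_bs sp)) sps"
 using ok by (simp only: face_ok.simps)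
 thus ?thesis using nth_mem[OF i] unfolding list_all_iff by blast
 qed
 show "EX b:set (sp_bs (sps ! (cl ! j))). has_sub (snd (hd (bases ! b))) (fin_words ! j)" if "j < length cl"
 proof -
 have "(cl ! j, fin_words ! j) : set (zip cl fin_words)" using that c by (auto simp: set_zip)
 moreover have "list_all (%(c, w). list_ex (%b. has_sub (snd (hd (bases ! b))) w) (sp_bs (sps ! c))) (zip cl fin_words)"
 using ok by (simp only: face_ok.simps)
 ultimately show ?thesis unfolding list_all_iff list_ex_iff by fast
 qed
 show "EX b:set (sp_bs (sps ! (length sps - 2 + k))). has_sub (snd (hd (bases ! b))) (fam_d k @ fam_t k)" if "k < 2"
 proof -
 have o: "list_ex (%b. has_sub (snd (hd (bases ! b))) (fam_d 0 @ fam_t 0)) (sp_bs (sps ! (length sps - 2)))"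
 "list_ex (%b. has_sub (snd (hd (bases ! b))) (fam_d 1 @ fam_t 1)) (sp_bs (sps ! (length sps - 1)))"
 using ok by (simp_all only: face_ok.simps)
 have k: "k = 0 | k = 1" "length sps - 2 + 1 = length sps - 1" "length sps - 2 + 0 = length sps - 2" using that n by auto
 from k(1) show ?thesis by (elim disjE; hypsubst) (unfold k(2,3), (rule o[unfolded list_ex_iff])+)
 qed
 show "e : set (kill_table ! fst (sps ! k)) | above rays (sp_al (sps ! i)) (sp_al (sps ! k))"
 if "i < length sps" "k < length sps" "k ~= i" "e : set (sp_bs (sps ! i))"
 proof -
 have "list_all (%(i, sp). list_all (%b. list_all (%(k, sp'). k = i | b : set (kill_table ! fst sp') | above rays (sp_al sp) (sp_al sp'))
 (enumerate 0 sps)) (sp_bs sp)) (enumerate 0 sps)" using ok by (simp only: face_ok.simps)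
 thus ?thesis using en[OF that(1)] en[OF that(2)] that(3,4) unfolding list_all_iff by fast
 qed
qed

lemma face_rep: assumes i: "i < length sps" shows "rep_ok (rh i)" "EX Lz F. comp_data rays cl (rh i) i (sps ! i) Lz F"
proof -
 have r: "rep_faces_ok faces (fst (sps ! i)) (rh i)" using rep_all face_D(5)[OF i] by blast
 thus "rep_ok (rh i)" by (simp add: rep_faces_ok_def)
 have "(rays, cl, i, sps ! i) : set (select faces (fst (sps ! i)))"
 proof -
 have "(i, sps ! i) : set (filter (%(k, sp). fst sp = fst (sps ! i)) (enumerate 0 sps))" using i by (simp add: in_set_enumerate_eq)
 hence "(rays, cl, i, sps ! i) : set (map (%(k, sp). (rays, cl, k, sp)) (filter (%(k, sp). fst sp = fst (sps ! i)) (enumerate 0 sps)))"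
 unfolding set_map by (rule rev_image_eqI) simp
 thus ?thesis unfolding select_def set_concat set_map by (intro UnionI[OF imageI[OF imageI[OF face]]]) simp
 qed
 then obtain n where "n < length (select faces (fst (sps ! i)))" "select faces (fst (sps ! i)) ! n = (rays, cl, i, sps ! i)"
 unfolding in_set_conv_nth by blast
 thus "EX Lz F. comp_data rays cl (rh i) i (sps ! i) Lz F" using rep_specs[of "rh i" "select faces (fst (sps ! i))" n rays cl i "sps ! i"] r by (simp only: rep_faces_ok_def)
qed

lemma face_kills: assumes "k < length sps" "e : set (10 # kill_table ! fst (sps ! k))" "e < 11"
 shows "hecke_rep.kills (Rm (rh k)) (fst (rh k)) (comb_elt (bases ! e))"
proof (rule kill_ok_sound[OF face_rep(1)[OF assms(1)]])
 show "kill_ok (rh k) (bases ! e)" using kill_all assms(2) face_D(5)[OF assms(1)] by blast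
 have "comb_ok (bases ! e)" using bases_ok assms(3) by (simp add: list_all_length)
 thus "list_all (%(p, u). sym_pol p) (bases ! e)" by (auto simp: comb_ok_def list_all_iff)
qed

lemma face_g2: "EX Lf Ff key rk. (ALL i<length sps. comp_data rays cl (rh i) i (sps ! i) (Lf i) (Ff i)) &
 g2_face L a b rays (length sps) (length sps - 2) cl rh (%i. sp_al (sps ! i)) (%i. code_top (Lf i) (Ff i)) key rk"
proof -
 let ?n = "length sps" and ?m = "length sps - 2"
 have "ALL i. EX Lz F. i < ?n --> comp_data rays cl (rh i) i (sps ! i) Lz F" using face_rep(2) by blast
 then obtain Lf Ff where D: "!!i. i < ?n ==> comp_data rays cl (rh i) i (sps ! i) (Lf i) (Ff i)" by metis
 let ?P = "%i \<kappa> (rk :: code => nat). ALL c. valid c & ccell cl ?m c = i --> key_in (fst (rh i)) (\<kappa> c) & zval (\<kappa> c) (zsem (code_top (Lf i) (Ff i) c)) ~= 0 &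
 (ALL c'. valid c' & ccell cl ?m c' = i & rk c' <= rk c & c' ~= c --> zval (\<kappa> c) (zsem (code_top (Lf i) (Ff i) c')) = 0)"
 have "ALL i. EX \<kappa> rk. i < ?n --> ?P i \<kappa> rk" using comp_keys[OF face_rep(1) D face_D(2,4)] by blast
 then obtain K where "ALL i. EX rk. i < ?n --> ?P i (K i) rk" by metis
 then obtain RK where P: "!!i. i < ?n ==> ?P i (K i) (RK i)" by metis
 have cc: "ccell cl ?m c < ?n" if "valid c" for c
 using that face_D(1-3) by (cases c) auto
 let ?key = "%c. K (ccell cl ?m c) c" and ?rk = "%c. RK (ccell cl ?m c) c"
 have "g2_face L a b rays ?n ?m cl rh (%i. sp_al (sps ! i)) (%i. code_top (Lf i) (Ff i)) ?key ?rk"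
 proof (intro g2_face.intro g2_face_axioms.intro g2_cone_axioms)
 fix i assume i: "i < ?n"
 show "rep_ok (rh i)" by (rule face_rep(1)[OF i])
 show "0 <= ev (sp_al (sps ! i))"
 using cone_le(1)[OF cone, of "(0, 0)" "sp_al (sps ! i)"] face_D(5)[OF i] by (simp add: rval_def[of "(0, 0)"])
 fix c assume c: "valid c"
 obtain r al bs s0 s1 kd where sp: "sps ! i = (r, al, bs, s0, s1, kd)" by (metis prod_cases6)
 show "hastop (fst (rh i)) (%_. ev (sp_al (sps ! i))) (%_. 0) (code_top (Lf i) (Ff i) c) (Rm (rh i) (elt (code_word c)))"
 using comp_tops[OF face_rep(1)[OF i, unfolded sp] D[OF i, unfolded sp] c] by (simp add: sp sp_al_def)
 assume "ccell cl ?m c ~= i"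
 hence "code_top (Lf i) (Ff i) c = []" by (rule comp_top_0[OF face_rep(1)[OF i] D[OF i] face_D(2) face_D(4)[OF i] c])
 thus "zsem (code_top (Lf i) (Ff i) c) = (%p j. 0)" by (simp add: fun_eq_iff)
 next
 fix c assume c: "valid c"
 let ?i = "ccell cl ?m c"
 show "?i < ?n" by (rule cc[OF c])
 show "key_in (fst (rh ?i)) (?key c)" "zval (?key c) (zsem (code_top (Lf ?i) (Ff ?i) c)) ~= 0" using P[OF cc[OF c]] c by blast+
 show "zval (?key c) (zsem (code_top (Lf ?i) (Ff ?i) c')) = 0"
 if "valid c'" "ccell cl ?m c' = ?i" "?rk c' <= ?rk c" "c' ~= c" for c'
 proof -
 have "RK ?i c' <= RK ?i c" using that(2,3) by simp
 thus ?thesis using P[OF cc[OF c]] c that(1,2,4) by blast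
 qed
 obtain b0 where b: "b0 : set (sp_bs (sps ! ?i))" "EX x y. code_word c = x @ snd (hd (bases ! b0)) @ y"
 proof (cases c)
 case (Fn j)
 hence "j < length cl" using c face_D(2) by simp
 from face_D(6)[OF this] show thesis using has_sub_split Fn that by fastforce
 next
 case (Fm k u l v)
 then obtain b0 x y where b0: "b0 : set (sp_bs (sps ! (?m + k)))" "fam_d k @ fam_t k = x @ snd (hd (bases ! b0)) @ y"
 using face_D(7)[of k] has_sub_split c by fastforce
 \<comment> \<open>A family word contains t at least once, hence the factor d t in which the base
   word was found.\<close>
 obtain l' where "l = Suc l'" using c Fm by (cases l) auto
 hence "code_word c = rev (fam_V k ! u) @ (fam_d k @ fam_t k) @ concat (replicate l' (fam_t k)) @ fam_V k ! v"
 using Fm by (simp add: fam_pre_def)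
 hence "code_word c = (rev (fam_V k ! u) @ x) @ snd (hd (bases ! b0)) @ y @ concat (replicate l' (fam_t k)) @ fam_V k ! v"
 unfolding b0(2) by simp
 hence "EX x y. code_word c = x @ snd (hd (bases ! b0)) @ y" by blast
 moreover have "b0 : set (sp_bs (sps ! ?i))" using b0(1) Fm by simp
 ultimately show thesis using that by blast
 qed
 then obtain x y where w: "code_word c = x @ snd (hd (bases ! b0)) @ y" by blast
 have b11: "b0 < 11" using face_D(5)[OF cc[OF c]] b(1) by blast
 hence cok: "comb_ok (bases ! b0)" using bases_ok by (simp add: list_all_length)
 have "hecke_rep.kills (Rm (rh k)) (fst (rh k)) (comb_elt (bases ! b0))"
 if k: "k < ?n" "k ~= ?i" "ev (sp_al (sps ! k)) <= ev (sp_al (sps ! ?i))" for k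
 proof -
 have "~ above rays (sp_al (sps ! ?i)) (sp_al (sps ! k))"
 proof
 assume "above rays (sp_al (sps ! ?i)) (sp_al (sps ! k))"
 hence "ev (sp_al (sps ! ?i)) < ev (sp_al (sps ! k))"
 by (intro cone_le(2)[OF cone]) (auto simp: above_def list_all_iff list_ex_iff)
 thus False using k(3) by simp
 qed
 hence "b0 : set (10 # kill_table ! fst (sps ! k))" using face_D(8)[OF cc[OF c] k(1,2) b(1)] by simp
 thus ?thesis by (rule face_kills[OF k(1) _ b11])
 qed
 thus "EX x e y f. code_word c = x @ e @ y & top_elt (elt e) f &
 (ALL k<?n. k ~= ?i --> ev (sp_al (sps ! k)) <= ev (sp_al (sps ! ?i)) --> hecke_rep.kills (Rm (rh k)) (fst (rh k)) f)"
 using w top_elt_comb[OF cok] by blast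
 next
 have c10: "comb_ok (bases ! 10)" using bases_ok by (simp add: list_all_length)
 show "EX f. top_elt w0 f & (ALL k<?n. hecke_rep.kills (Rm (rh k)) (fst (rh k)) f)"
 using top_elt_comb[OF c10] face_kills[of _ 10] unfolding base_w0(1) by (intro exI[of _ "comb_elt (bases ! 10)"]) simp
 show "hecke_rep.kills (Rm (rh k)) (fst (rh k)) (C w0)" if "k < ?n" for k
 using face_kills[OF that, of 10] by (intro kills_C_w0[OF face_rep(1)[OF that] base_w0(2) _ base_w0(3)]) simp
 qed
 thus ?thesis using D by blast
qed

end
end

section \<open>The two-sided cells\<close>

definition par_gens :: "gen list => gen list set set" where
 "par_gens I = (%g. elt [g]) ` set I"

fun base_in :: "nat list => nat => kind => bool" where
 "base_in cl i (Fin e tab cs) <-> e < 96 & cl ! e = i"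
| "base_in cl i (Own k s h M xs) <-> True"

lemma base_in_faces: "list_all (%(rays, cl, sps). list_all (%(i, sp). base_in cl i (sp_kind sp)) (enumerate 0 sps)) faces"
 by code_simp

lemma kred_w0: "list_all (%i. kreduced kzero (take i [G1, G2, G1, G2, G1, G2])) [0..<7]" by code_simp

context g2_weights begin

abbreviation "concl \<equiv> L w0_G2 = 3 * a + 3 * b & (ALL \<Gamma>:two_sided_cells.
 (is_Gamma0 \<Gamma> | is_Gamma1 a b \<Gamma> | is_Gamma2 a b \<Gamma> | finite \<Gamma>) &
 (ALL w:\<Gamma>. (is_Gamma0 \<Gamma> --> lusztig_a w = L w0_G2) &
 (is_Gamma1 a b \<Gamma> --> (a \<ge> 2 * b --> lusztig_a w = a + b) & (a <= 2 * b --> lusztig_a w = 3 * b)) &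
 (is_Gamma2 a b \<Gamma> --> (2 * a \<ge> 3 * b --> lusztig_a w = 3 * a - 2 * b) & (2 * a <= 3 * b --> lusztig_a w = a + b)) &
 (finite \<Gamma> --> lusztig_a w = a_tilde \<Gamma>)))"

lemma card_2_pars: "I <= G2t_gens & card I = 2 <-> (EX J:set pars. I = par_gens J)"
proof
 assume I: "I <= G2t_gens & card I = 2"
 then obtain x y where xy: "I = {x, y}" "x ~= y" unfolding card_2_iff by blast
 hence "x : G2t_gens" "y : G2t_gens" using I by auto
 thus "EX J:set pars. I = par_gens J" using xy(2) unfolding G2t_gens_def xy(1) by (auto simp: pars_def par_gens_def)
next
 assume "EX J:set pars. I = par_gens J"
 thus "I <= G2t_gens & card I = 2" by (auto simp: pars_def par_gens_def G2t_gens_def gen_elt_inj)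
qed

end

context g2_cone begin

lemma face_summary: assumes face: "(rays, cl, sps) : set faces"
 obtains cell where "!!w. w : Gamma0 ==> cell w = length sps" "!!w. w : GW ==> w ~: Gamma0 ==> cell w < length sps"
 "!!x y. (x, y) : le_LR ==> (y, x) : le_LR ==> cell x = cell y"
 "!!j. j < length cl ==> cell (elt (fin_words ! j)) = cl ! j"
 "!!i. i < length sps - 2 ==> finite {w : GW. cell w = i} & (EX e:GW. cell e = i & (EX I:set pars. e : generate G2t (par_gens I)) &
 (ALL w:GW. cell w = i --> (w, e) : le_LR & (e, w) : le_LR & lusztig_a w = nat (ev (sp_al (sps ! i))) &
 (ALL I:set pars. w : generate G2t (par_gens I) --> parabolic_a (par_gens I) w = nat (ev (sp_al (sps ! i))))))"
 "!!k. k < 2 ==> infinite {w : GW. cell w = length sps - 2 + k} &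
 (ALL w:GW. cell w = length sps - 2 + k --> lusztig_a w = nat (ev (sp_al (sps ! (length sps - 2 + k)))) &
 (ALL w':GW. cell w' = length sps - 2 + k --> (w, w') : le_LR))"
proof -
 let ?n = "length sps" and ?m = "length sps - 2"
 note fD = face_D[OF face] and fr = face_rep[OF face]
 obtain Lf Ff key rk where D: "!!i. i < ?n ==> comp_data rays cl (rep_no (fst (sps ! i))) i (sps ! i) (Lf i) (Ff i)"
 and G: "g2_face L a b rays ?n ?m cl (%i. rep_no (fst (sps ! i))) (%i. sp_al (sps ! i)) (%i. code_top (Lf i) (Ff i)) key rk"
 using face_g2[OF face] by blast
 interpret F: g2_face L a b rays ?n ?m cl "%i. rep_no (fst (sps ! i))" "%i. sp_al (sps ! i)" "%i. code_top (Lf i) (Ff i)" key rk by (rule G)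
 show ?thesis
 proof (rule that[of F.cell])
 show "w : Gamma0 ==> F.cell w = ?n" for w by (simp add: F.cell_def)
 show less: "w : GW ==> w ~: Gamma0 ==> F.cell w < ?n" for w using F.ccell_less F.code_of(1) by (simp add: F.cell_def)
 show "F.cell x = F.cell y" if xy: "(x, y) : le_LR" "(y, x) : le_LR" for x y
 proof (rule ccontr)
 assume ne: "F.cell x ~= F.cell y"
 \<comment> \<open>Of two different cell numbers one is always \<open>below\<close> an element of
   the other cell: every index is so for the lowest cell, and otherwise the smaller value of
   \<open>alpha\<close> decides.\<close>
 have b: "F.cell x ~: F.C.below y" "F.cell y ~: F.C.below x" using F.C.le_LR_cell xy by blast+
 have "F.cell w < ?n | F.cell w = ?n" if "w : GW" for w using less[OF that] by (auto simp: F.cell_def)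
 hence "F.cell x < ?n | F.cell x = ?n" "F.cell y < ?n | F.cell y = ?n" using le_LR_carrier[OF xy(1)] by blast+
 thus False using b ne unfolding F.C.below_def by auto
 qed
 show "F.cell (elt (fin_words ! j)) = cl ! j" if "j < length cl" for j
 using F.cell_code(2)[of "Fn j"] that fD(2) by simp
 next
 fix i assume i: "i < ?m"
 hence n: "i < ?n" by simp
 have k2: "kind_no (sp_kind (sps ! i)) = 2" using fD(4)[OF n] i by auto
 obtain r al bs s0 s1 kd where sp: "sps ! i = (r, al, bs, s0, s1, kd)" by (metis prod_cases6)
 then obtain e tab cs where kd: "kd = Fin e tab cs" using k2 by (cases kd) (auto simp: sp_kind_def split: if_splits)
 have d: "comp_data rays cl (rep_no (fst (sps ! i))) i (r, al, bs, s0, s1, Fin e tab cs) (Lf i) (Ff i)" using D[OF n] by (simp only: sp kd)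
 let ?js = "map fst tab"
 have t: "list_all (%(n, c). (c = i) = (n : set ?js)) (enumerate 0 cl)" "list_all (%(n, \<kappa>). n < length cl) tab" "certs_ok (Lf i) e ?js cs"
 using d by (simp_all add: comp_data_def)
 have js: "valid c & F.cc c = i <-> (EX j:set ?js. c = Fn j)" for c
 proof (cases c)
 case (Fn j)
 have "j < length fin_words" if "j : set ?js" using that t(2) fD(2) by (auto simp: list_all_iff)
 moreover have "(cl ! j = i) = (j : set ?js)" if "j < length fin_words"
 proof -
 have "(j, cl ! j) : set (enumerate 0 cl)" using that fD(2) by (simp add: in_set_enumerate_eq)
 thus ?thesis using t(1) unfolding list_all_iff by fast
 qed
 ultimately show ?thesis using Fn by auto
 qed (use i in auto)
 have Lz: "code_top (Lf i) (Ff i) (Fn j) = Lf i ! j" "j : set ?js ==> zwf (fst (rep_no (fst (sps ! i)))) (Lf i ! j)" for j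
 proof -
 show "code_top (Lf i) (Ff i) (Fn j) = Lf i ! j" by simp
 assume "j : set ?js"
 hence "j < length fin_words" using t(2) fD(2) by (auto simp: list_all_iff)
 thus "zwf (fst (rep_no (fst (sps ! i)))) (Lf i ! j)" by (rule fin_zwf[OF fr(1)[OF n] D[OF n]])
 qed
 have e: "e : set ?js"
 proof -
 have "list_all (%(i, sp). base_in cl i (sp_kind sp)) (enumerate 0 sps)" using base_in_faces face unfolding list_all_iff by fast
 moreover have "(i, sps ! i) : set (enumerate 0 sps)" using n by (simp add: in_set_enumerate_eq)
 ultimately have "base_in cl i (sp_kind (sps ! i))" unfolding list_all_iff by fast
 hence "valid (Fn e) & F.cc (Fn e) = i" using bases_ok by (simp add: sp kd sp_kind_def)
 thus ?thesis unfolding js by simp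
 qed
 note fin = n js Lz t(3) e
 have al: "F.alpha i = nat (ev (sp_al (sps ! i)))" by (simp add: F.alpha_def)
 obtain I where I: "I : set pars" "elt (fin_words ! e) : generate G2t (par_gens I)"
 using F.fin_cell_dih[OF fin] unfolding par_gens_def by blast
 have "finite ((%j. elt (fin_words ! j)) ` set ?js)" by simp
 moreover have "{w : GW. F.cell w = i} <= (%j. elt (fin_words ! j)) ` set ?js" using F.fin_cell_js[OF fin] by blast
 ultimately have fi: "finite {w : GW. F.cell w = i}" by (rule rev_finite_subset)
 show "finite {w : GW. F.cell w = i} & (EX e:GW. F.cell e = i & (EX I:set pars. e : generate G2t (par_gens I)) &
 (ALL w:GW. F.cell w = i --> (w, e) : le_LR & (e, w) : le_LR & lusztig_a w = nat (ev (sp_al (sps ! i))) &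
 (ALL I:set pars. w : generate G2t (par_gens I) --> parabolic_a (par_gens I) w = nat (ev (sp_al (sps ! i))))))"
 proof (intro conjI fi bexI[of _ "elt (fin_words ! e)"] ballI impI)
 show "F.cell (elt (fin_words ! e)) = i" by (rule F.fin_js(3)[OF fin e])
 show "EX I:set pars. elt (fin_words ! e) : generate G2t (par_gens I)" using I by blast
 fix w assume w: "w : GW" "F.cell w = i"
 show "(w, elt (fin_words ! e)) : le_LR" by (rule F.fin_cell_eq(1)[OF fin w])
 show "(elt (fin_words ! e), w) : le_LR" by (rule F.fin_cell_eq(2)[OF fin w])
 show "lusztig_a w = nat (ev (sp_al (sps ! i)))" unfolding al[symmetric] by (rule F.fin_cell_a[OF fin w])
 show "parabolic_a (par_gens I) w = nat (ev (sp_al (sps ! i)))" if "I : set pars" "w : generate G2t (par_gens I)" for I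
 unfolding al[symmetric] par_gens_def by (rule F.fin_cell_par[OF fin w that[unfolded par_gens_def]])
 qed simp
 next
 fix k :: nat assume k: "k < 2"
 let ?i = "?m + k"
 have n: "?i < ?n" using k fD(1) by simp
 obtain r al bs s0 s1 kd where sp: "sps ! ?i = (r, al, bs, s0, s1, kd)" by (metis prod_cases6)
 have "kind_no kd = k" using fD(4)[OF n] by (simp add: sp sp_kind_def)
 then obtain s h M xs where kd: "kd = Own k s h M xs" using k by (cases kd) (auto split: if_splits)
 have d: "comp_data rays cl (rep_no (fst (sps ! ?i))) ?i (r, al, bs, s0, s1, Own k s h M xs) (Lf ?i) (Ff ?i)" using D[OF n] by (simp only: sp kd)
 note own = fr(1)[OF n] d fD(2) HOL.refl k
 let ?t = "own_key s M xs (Lf ?i)"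
 have ex: "EX c l. valid c & F.cc c = ?i & ?t c = (p, j, l)" if "p < 6" "j < 6" for p j
 using that k by (intro exI[of _ "Fm k p 1 j"]) simp
 have *: "lusztig_a w = F.alpha ?i" if w: "w : GW" "F.cell w = ?i" for w
 by (rule F.own_cell(1)[OF n own_kind(1)[OF own] own_step(2)[OF own], of ?t "%p. h ! p"])
 (rule own_key_sound[OF own] own_key_surj[OF own] ex w; assumption)+
 have **: "(w, w') : le_LR" if w: "w : GW" "F.cell w = ?i" "w' : GW" "F.cell w' = ?i" for w w'
 by (rule F.own_cell(2)[OF n own_kind(1)[OF own] own_step(2)[OF own], of ?t "%p. h ! p"])
 (rule own_key_sound[OF own] own_key_surj[OF own] ex w; assumption)+
 have "infinite (range (%l. elt (code_word (Fm k 0 (Suc l) 0))))"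
 proof (rule notI, drule finite_imageD)
 show "inj (%l. elt (code_word (Fm k 0 (Suc l) 0)))"
 proof (rule injI)
 fix x y assume "elt (code_word (Fm k 0 (Suc x) 0)) = elt (code_word (Fm k 0 (Suc y) 0))"
 hence "Fm k 0 (Suc x) 0 = Fm k 0 (Suc y) 0" by (intro F.code_inj) (use k in simp_all)
 thus "x = y" by simp
 qed
 qed simp
 moreover have "range (%l. elt (code_word (Fm k 0 (Suc l) 0))) <= {w : GW. F.cell w = ?i}"
 proof (rule image_subsetI)
 fix l
 have "F.cell (elt (code_word (Fm k 0 (Suc l) 0))) = F.cc (Fm k 0 (Suc l) 0)" by (rule F.cell_code(2)) (use k in simp)
 thus "elt (code_word (Fm k 0 (Suc l) 0)) : {w : GW. F.cell w = ?i}" by simp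
 qed
 ultimately have inf: "infinite {w : GW. F.cell w = ?i}" using infinite_super by blast
 show "infinite {w : GW. F.cell w = ?i} &
 (ALL w:GW. F.cell w = ?i --> lusztig_a w = nat (ev (sp_al (sps ! ?i))) &
 (ALL w':GW. F.cell w' = ?i --> (w, w') : le_LR))"
 using inf * ** by (simp add: F.alpha_def)
 qed
qed

text \<open>The number k stands for \<Gamma>_0, \<Gamma>_1, \<Gamma>_2 or, if 3, a finite cell;
  \<open>JA\<close> and \<open>JB\<close> index words marking \<Gamma>_1 and \<Gamma>_2. A two-sided
  cell is a fibre of \<open>cell\<close>: the killing of lower parts separates fibres, and nonzero
  leading coefficients connect each fibre.\<close>

lemma face_cells: assumes face: "(rays, cl, sps) : set faces"
 and JA: "!!j. j : set JA ==> j < 96 & cl ! j = length sps - 2" and JB: "!!j. j : set JB ==> j < 96 & cl ! j = length sps - 1"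
 and \<Gamma>: "\<Gamma> : two_sided_cells"
 shows "EX k<4. (finite \<Gamma> <-> k = 3) & (w0 : \<Gamma> <-> k = 0) & (ALL j:set JA. elt (fin_words ! j) : \<Gamma> <-> k = 1) &
 (ALL j:set JB. elt (fin_words ! j) : \<Gamma> <-> k = 2) &
 (ALL w:\<Gamma>. lusztig_a w = [nu, nat (ev (sp_al (sps ! (length sps - 2)))), nat (ev (sp_al (sps ! (length sps - 1)))), a_tilde \<Gamma>] ! k)"
proof -
 let ?n = "length sps" and ?m = "length sps - 2"
 note fD = face_D[OF face]
 obtain cell where c: "!!w. w : Gamma0 ==> cell w = length sps" "!!w. w : GW ==> w ~: Gamma0 ==> cell w < length sps"
 and eq: "!!x y. (x, y) : le_LR ==> (y, x) : le_LR ==> cell x = cell y"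
 and cl: "!!j. j < length cl ==> cell (elt (fin_words ! j)) = cl ! j"
 and fin: "!!i. i < ?m ==> finite {w : GW. cell w = i} & (EX e:GW. cell e = i & (EX I:set pars. e : generate G2t (par_gens I)) &
 (ALL w:GW. cell w = i --> (w, e) : le_LR & (e, w) : le_LR & lusztig_a w = nat (ev (sp_al (sps ! i))) &
 (ALL I:set pars. w : generate G2t (par_gens I) --> parabolic_a (par_gens I) w = nat (ev (sp_al (sps ! i))))))"
 and inf: "!!k. k < 2 ==> infinite {w : GW. cell w = ?m + k} &
 (ALL w:GW. cell w = ?m + k --> lusztig_a w = nat (ev (sp_al (sps ! (?m + k)))) &
 (ALL w':GW. cell w' = ?m + k --> (w, w') : le_LR))"
 by (rule face_summary[OF face]) blast
 from \<Gamma> obtain x where x: "x : GW" "\<Gamma> = {(x, y). (x, y) : le_LR & (y, x) : le_LR} `` {x}"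
 unfolding two_sided_cells_def by (rule quotientE)
 have mem: "y : \<Gamma> <-> (x, y) : le_LR & (y, x) : le_LR" for y using x(2) by blast
 have n2: "2 <= ?n" "?m + 1 = ?n - 1" "?m + 0 = ?m" using fD(1) by auto
 have c0: "cell y = ?n <-> y : Gamma0" if "y : GW" for y using c that by (metis less_irrefl)
 have cx: "cell x <= ?n" using c[of x] x(1) by (cases "x : Gamma0") auto
 have rel: "(x, y) : le_LR" "(y, x) : le_LR" if y: "y : GW" "cell y = cell x" for y
 proof -
 consider "cell x = ?n" | "cell x < ?m" | k where "k < 2" "cell x = ?m + k"
 proof -
 assume 1: "cell x = ?n ==> thesis" and 2: "cell x < ?m ==> thesis" and 3: "!!k. k < 2 ==> cell x = ?m + k ==> thesis"
 show thesis using 1 2 3[of 0] 3[of 1] cx n2 by fastforce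
 qed
 hence "(x, y) : le_LR & (y, x) : le_LR"
 proof cases
 case 1
 hence "x : Gamma0" "y : Gamma0" using c0[OF x(1)] c0[OF y(1)] y(2) by simp_all
 thus ?thesis using Gamma0_le_LR le_LR_trans by blast
 next
 case 2
 then obtain e where "ALL w:GW. cell w = cell x --> (w, e) : le_LR & (e, w) : le_LR" using fin[of "cell x"] by blast
 thus ?thesis using x(1) y le_LR_trans by blast
 next
 case 3 thus ?thesis using inf[of k] x(1) y by (metis (no_types))
 qed
 thus "(x, y) : le_LR" "(y, x) : le_LR" by blast+
 qed
 have G: "\<Gamma> = {y : GW. cell y = cell x}"
 proof (rule equalityI; rule subsetI)
 fix y assume "y : \<Gamma>"
 hence y: "(x, y) : le_LR" "(y, x) : le_LR" using mem by blast+
 show "y : {y : GW. cell y = cell x}" using le_LR_carrier[OF y(1)] eq[OF y] by simp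
 next
 fix y assume "y : {y : GW. cell y = cell x}"
 thus "y : \<Gamma>" using rel[of y] mem[of y] by simp
 qed
 have w: "w0 : \<Gamma> <-> cell x = ?n" using c(1)[OF w0_Gamma0] Gamma0_carrier[OF w0_Gamma0] unfolding G by auto
 have j: "elt (fin_words ! j) : \<Gamma> <-> cl ! j = cell x" if "j < 96" for j using cl that fD(2) bases_ok unfolding G by simp
 have jA: "elt (fin_words ! j) : \<Gamma> <-> cell x = ?m" if "j : set JA" for j using j[of j] JA[OF that] by auto
 have jB: "elt (fin_words ! j) : \<Gamma> <-> cell x = ?m + 1" if "j : set JB" for j using j[of j] JB[OF that] unfolding n2 by auto
 consider "cell x = ?n" | "cell x = ?m" | "cell x = ?m + 1" | "cell x < ?m" using cx n2 by linarith
 thus ?thesis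
 proof cases
 case 1
 hence "\<Gamma> = Gamma0" using G c0 Gamma0_carrier by auto
 hence "infinite \<Gamma>" "ALL w:\<Gamma>. lusztig_a w = nu" using Gamma0_infinite Gamma0_a by auto
 thus ?thesis using 1 w jA jB n2 by (intro exI[of _ 0]) auto
 next
 case 2
 hence "infinite \<Gamma>" "ALL w:\<Gamma>. lusztig_a w = nat (ev (sp_al (sps ! ?m)))" using inf[of 0] unfolding G n2 by auto
 thus ?thesis using 2 w jA jB n2(1) by (intro exI[of _ 1]) auto
 next
 case 3
 hence "infinite \<Gamma>" "ALL w:\<Gamma>. lusztig_a w = nat (ev (sp_al (sps ! (?n - 1))))" using inf[of 1] unfolding G n2 by auto
 thus ?thesis using 3 w jA jB n2(1) by (intro exI[of _ 2]) auto
 next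
 case 4
 let ?v = "nat (ev (sp_al (sps ! cell x)))"
 have f: "finite \<Gamma>" "ALL w:\<Gamma>. lusztig_a w = ?v" using fin[OF 4] unfolding G by auto
 obtain e J where e: "e : \<Gamma>" "J : set pars" "e : generate G2t (par_gens J)" using fin[OF 4] unfolding G by auto
 have p: "parabolic_a (par_gens I) z = ?v" if "I : set pars" "z : \<Gamma> \<inter> generate G2t (par_gens I)" for I z
 using fin[OF 4] that unfolding G by auto
 have "a_tilde \<Gamma> = ?v" unfolding a_tilde_def
 proof (rule the_equality)
 show "EX I z. I <= G2t_gens & card I = 2 & z : \<Gamma> \<inter> generate G2t I & ?v = parabolic_a I z"
 using e p card_2_pars[of "par_gens J"] by (intro exI[of _ "par_gens J"] exI[of _ e]) auto
 fix k assume "EX I z. I <= G2t_gens & card I = 2 & z : \<Gamma> \<inter> generate G2t I & k = parabolic_a I z"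
 then obtain I z where I: "I <= G2t_gens & card I = 2" "z : \<Gamma> \<inter> generate G2t I" "k = parabolic_a I z" by (elim exE conjE) simp
 obtain J where J: "J : set pars" "I = par_gens J" using I(1) unfolding card_2_pars by (elim bexE)
 show "k = ?v" unfolding I(3) J(2) by (rule p[OF J(1) I(2)[unfolded J(2)]])
 qed
 thus ?thesis using 4 f w jA jB n2(1) by (intro exI[of _ 3]) auto
 qed
qed

text \<open>L is prescribed on the generators only; the weight function property extends it along
  the prefixes of a reduced word of w_0.\<close>

lemma L_w0: assumes wf: "weight_function" shows "L w0 = nu"
proof -
 define w where "w = [G1, G2, G1, G2, G1, G2]"
 have "list_all (%i. kreduced kzero (take i w)) [0..<7]" using kred_w0 by (simp only: w_def)
 hence kr: "kreduced kzero (take i w)" if "i < 7" for i using that by (simp add: list_all_iff del: upt_Suc)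
 have lw: "length w = 6" by (simp add: w_def)
 have len: "len (elt (take i w)) = i" if "i < 7" for i using len_kreduced[OF kr[OF that]] that lw by simp
 have len1: "len (elt [g]) = 1" for g using len_kreduced[of "[g]"] by (cases g) simp_all
 have step: "L (elt (take (Suc i) w)) = L (elt (take i w)) + L (elt [w ! i])" if i: "i < 6" for i
 proof -
 have "take (Suc i) w = take i w @ [w ! i]" using i lw by (simp add: take_Suc_conv_app_nth)
 hence e: "elt (take (Suc i) w) = elt (take i w)<.>elt [w ! i]" by (simp only: elt_append)
 have "len (elt (take i w)<.>elt [w ! i]) = len (elt (take i w)) + len (elt [w ! i])"
 unfolding e[symmetric] len1 using len[of i] len[of "Suc i"] i by simp
 moreover have "elt (take i w) : GW" "elt [w ! i] : GW" by simp_all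
 ultimately show ?thesis using wf unfolding weight_function_def e by blast
 qed
 have "L (elt [G1, G2]) = L (elt [G1]) + L (elt [G2])" using step[of 1] by (simp add: w_def eval_nat_numeral)
 moreover have "L (elt [G1, G2, G1]) = L (elt [G1, G2]) + L (elt [G1])" using step[of 2] by (simp add: w_def eval_nat_numeral)
 moreover have "L (elt [G1, G2, G1, G2]) = L (elt [G1, G2, G1]) + L (elt [G2])" using step[of 3] by (simp add: w_def eval_nat_numeral)
 moreover have "L (elt [G1, G2, G1, G2, G1]) = L (elt [G1, G2, G1, G2]) + L (elt [G1])" using step[of 4] by (simp add: w_def eval_nat_numeral)
 moreover have "L w0 = L (elt [G1, G2, G1, G2, G1]) + L (elt [G2])" using step[of 5] by (simp add: w_def eval_nat_numeral)
 ultimately show ?thesis using L_gen by simp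
qed

lemma face_conclusion: assumes face: "(rays, cl, sps) : set faces" and wf: weight_function
 and JA: "list_all (%j. j < 96 & cl ! j = length sps - 2) JA" and JB: "list_all (%j. j < 96 & cl ! j = length sps - 1) JB"
 and g: "!!\<Gamma>. is_Gamma1 a b \<Gamma> <-> (EX j:set JA. elt (fin_words ! j) : \<Gamma>)" "!!\<Gamma>. is_Gamma2 a b \<Gamma> <-> (EX j:set JB. elt (fin_words ! j) : \<Gamma>)"
 and ne: "JA ~= []" "JB ~= []"
 and vA: "a \<ge> 2 * b --> ev (sp_al (sps ! (length sps - 2))) = int a + int b" "a <= 2 * b --> ev (sp_al (sps ! (length sps - 2))) = 3 * int b"
 and vB: "2 * a \<ge> 3 * b --> ev (sp_al (sps ! (length sps - 1))) = 3 * int a - 2 * int b"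
 "2 * a <= 3 * b --> ev (sp_al (sps ! (length sps - 1))) = int a + int b"
 shows concl
proof (intro conjI ballI)
 show L: "L w0_G2 = 3 * a + 3 * b" using L_w0[OF wf] unfolding w0_G2_eq .
 fix \<Gamma> assume \<Gamma>: "\<Gamma> : two_sided_cells"
 have J: "j : set JA ==> j < 96 & cl ! j = length sps - 2" "j : set JB ==> j < 96 & cl ! j = length sps - 1" for j
 using JA JB by (simp_all only: list_all_iff)
 obtain k where k: "k < 4 & (finite \<Gamma> <-> k = 3) & (w0 : \<Gamma> <-> k = 0) & (ALL j:set JA. elt (fin_words ! j) : \<Gamma> <-> k = 1) &
 (ALL j:set JB. elt (fin_words ! j) : \<Gamma> <-> k = 2) &
 (ALL w:\<Gamma>. lusztig_a w = [nu, nat (ev (sp_al (sps ! (length sps - 2)))), nat (ev (sp_al (sps ! (length sps - 1)))), a_tilde \<Gamma>] ! k)"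
 using face_cells[OF face J \<Gamma>] ..
 note k = k[THEN conjunct1] k[THEN conjunct2, THEN conjunct1] k[THEN conjunct2, THEN conjunct2, THEN conjunct1]
 k[THEN conjunct2, THEN conjunct2, THEN conjunct2, THEN conjunct1] k[THEN conjunct2, THEN conjunct2, THEN conjunct2, THEN conjunct2, THEN conjunct1]
 k[THEN conjunct2, THEN conjunct2, THEN conjunct2, THEN conjunct2, THEN conjunct2]
 have i: "is_Gamma0 \<Gamma> <-> k = 0" "is_Gamma1 a b \<Gamma> <-> k = 1" "is_Gamma2 a b \<Gamma> <-> k = 2"
 proof -
 show "is_Gamma0 \<Gamma> <-> k = 0" unfolding is_Gamma0_def w0_G2_eq by (rule k(3))
 have "hd JA : set JA" "hd JB : set JB" using ne by simp_all
 thus "is_Gamma1 a b \<Gamma> <-> k = 1" "is_Gamma2 a b \<Gamma> <-> k = 2" unfolding g using k(4,5) by metis+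
 qed
 show "is_Gamma0 \<Gamma> | is_Gamma1 a b \<Gamma> | is_Gamma2 a b \<Gamma> | finite \<Gamma>" using k(1,2) i by linarith
 fix w assume w: "w : \<Gamma>"
 have lw: "lusztig_a w = [nu, nat (ev (sp_al (sps ! (length sps - 2)))), nat (ev (sp_al (sps ! (length sps - 1)))), a_tilde \<Gamma>] ! k" by (rule bspec[OF k(6) w])
 show "is_Gamma0 \<Gamma> --> lusztig_a w = L w0_G2" using lw i L by simp
 show "finite \<Gamma> --> lusztig_a w = a_tilde \<Gamma>" using lw k(2) by simp
 show "is_Gamma1 a b \<Gamma> --> (a \<ge> 2 * b --> lusztig_a w = a + b) & (a <= 2 * b --> lusztig_a w = 3 * b)"
 using lw i vA by (simp add: nat_add_distrib nat_mult_distrib)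
 show "is_Gamma2 a b \<Gamma> --> (2 * a \<ge> 3 * b --> lusztig_a w = 3 * a - 2 * b) & (2 * a <= 3 * b --> lusztig_a w = a + b)"
 using lw i vB by (auto simp: nat_add_distrib nat_mult_distrib nat_diff_distrib)
qed

end

section \<open>Choosing the face that contains (a, b)\<close>

lemma cone_ray: assumes "(int a, int b) = (k * fst l, k * snd l)" "0 < k" shows "cone [l] a b"
proof -
 have r: "rval x (int a, int b) = k * rval x l" for x using assms(1) by (simp add: rval_def algebra_simps)
 show ?thesis unfolding cone_def r using assms(2) by (auto simp: mult_le_0_iff mult_less_0_iff)
qed

lemma cone_rays: assumes "(int a, int b) = (k * fst l + k' * fst l', k * snd l + k' * snd l')" "0 < k" "0 < k'" shows "cone [l, l'] a b"
proof -
 have r: "rval x (int a, int b) = k * rval x l + k' * rval x l'" for x using assms(1) by (simp add: rval_def algebra_simps)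
 have "k * rval x l + k' * rval x l' <= 0 & (rval x l ~= 0 | rval x l' ~= 0 --> k * rval x l + k' * rval x l' < 0)"
 if "rval x l <= 0" "rval x l' <= 0" for x
 proof -
 have "k * rval x l <= 0" "k' * rval x l' <= 0" "rval x l ~= 0 ==> k * rval x l < 0" "rval x l' ~= 0 ==> k' * rval x l' < 0"
 using that assms by (auto simp: mult_le_0_iff mult_less_0_iff)
 thus ?thesis by fastforce
 qed
 thus ?thesis unfolding cone_def r by auto
qed

fun face_info :: "face => nat list => nat list => weight => weight => bool" where
 "face_info (rays, cl, sps) JA JB x y <-> list_all (%j. j < 96 & cl ! j = length sps - 2) JA &
 list_all (%j. j < 96 & cl ! j = length sps - 1) JB & sp_al (sps ! (length sps - 2)) = x & sp_al (sps ! (length sps - 1)) = y"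

text \<open>The indices 2, 15, 58 are the words of \<open>markers\<close>, and the pairs (1, 1), (0,
  3), (3, -2) stand for a + b, 3b, 3a - 2b. On the walls a = 2b and 2a = 3b two of the marking words
  lie in the same infinite cell.\<close>

lemma face_infos: "face_info face_R1 [2] [58] (1, 1) (3, -2)" "face_info face_r2 [2, 15] [58] (0, 3) (3, -2)"
 "face_info face_R2 [15] [58] (0, 3) (3, -2)" "face_info face_r32 [15] [58, 2] (0, 3) (1, 1)"
 "face_info face_R3 [15] [2] (0, 3) (1, 1)" "face_info face_r1 [15] [2] (0, 3) (1, 1)" "face_info face_R4 [15] [2] (0, 3) (1, 1)"
 by code_simp+

lemma face_rays: "fst face_R1 = [(1, 0), (2, 1)]" "fst face_r2 = [(2, 1)]" "fst face_R2 = [(2, 1), (3, 2)]" "fst face_r32 = [(3, 2)]"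
 "fst face_R3 = [(3, 2), (1, 1)]" "fst face_r1 = [(1, 1)]" "fst face_R4 = [(1, 1), (0, 1)]"
 by code_simp+

lemma (in g2_weights) face_final: assumes f: "F : set faces" and info: "face_info F JA JB x y" and c: "cone (fst F) a b" and wf: weight_function
 and g: "!!\<Gamma>. is_Gamma1 a b \<Gamma> <-> (EX j:set JA. elt (fin_words ! j) : \<Gamma>)" "!!\<Gamma>. is_Gamma2 a b \<Gamma> <-> (EX j:set JB. elt (fin_words ! j) : \<Gamma>)"
 and ne: "JA ~= []" "JB ~= []"
 and vA: "a \<ge> 2 * b --> rval x (int a, int b) = int a + int b" "a <= 2 * b --> rval x (int a, int b) = 3 * int b"
 and vB: "2 * a \<ge> 3 * b --> rval y (int a, int b) = 3 * int a - 2 * int b" "2 * a <= 3 * b --> rval y (int a, int b) = int a + int b"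
 shows concl
proof -
 obtain rays cl sps where F: "F = (rays, cl, sps)" by (cases F)
 interpret g2_cone L a b rays by unfold_locales (use c F in simp)
 have i: "list_all (%j. j < 96 & cl ! j = length sps - 2) JA" "list_all (%j. j < 96 & cl ! j = length sps - 1) JB"
 "sp_al (sps ! (length sps - 2)) = x" "sp_al (sps ! (length sps - 1)) = y" using info unfolding F by simp_all
 show ?thesis by (rule face_conclusion[OF f[unfolded F] wf i(1,2) g ne]) (use i vA vB in simp_all)
qed

theorem corollary7p19:
  fixes a b :: nat and L :: "gen list set \<Rightarrow> nat"
  assumes "a \<ge> 1" and "b \<ge> 1"
    and "weighted_group.weight_function G2t G2t_gens L"
    and "L (elt [G1]) = a" and "L (elt [G0]) = b" and "L (elt [G2]) = b"
  shows "L w0_G2 = 3 * a + 3 * b \<and>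
    (\<forall>\<Gamma> \<in> weighted_group.two_sided_cells G2t G2t_gens L.
      (is_Gamma0 \<Gamma> \<or> is_Gamma1 a b \<Gamma> \<or> is_Gamma2 a b \<Gamma> \<or> finite \<Gamma>) \<and>
      (\<forall>w\<in>\<Gamma>.
        (is_Gamma0 \<Gamma> \<longrightarrow> weighted_group.lusztig_a G2t G2t_gens L w = L w0_G2) \<and>
        (is_Gamma1 a b \<Gamma> \<longrightarrow>
          (a \<ge> 2 * b \<longrightarrow> weighted_group.lusztig_a G2t G2t_gens L w = a + b) \<and>
          (a \<le> 2 * b \<longrightarrow> weighted_group.lusztig_a G2t G2t_gens L w = 3 * b)) \<and>
        (is_Gamma2 a b \<Gamma> \<longrightarrow>
          (2 * a \<ge> 3 * b \<longrightarrow> weighted_group.lusztig_a G2t G2t_gens L w = 3 * a - 2 * b) \<and>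
          (2 * a \<le> 3 * b \<longrightarrow> weighted_group.lusztig_a G2t G2t_gens L w = a + b)) \<and>
        (finite \<Gamma> \<longrightarrow>
          weighted_group.lusztig_a G2t G2t_gens L w = weighted_group.a_tilde G2t G2t_gens L \<Gamma>)))"
proof -
 interpret g2_weights L a b by unfold_locales (rule assms)+
 note fin = face_final[OF _ face_infos(1) _ assms(3)] face_final[OF _ face_infos(2) _ assms(3)] face_final[OF _ face_infos(3) _ assms(3)]
 face_final[OF _ face_infos(4) _ assms(3)] face_final[OF _ face_infos(5) _ assms(3)] face_final[OF _ face_infos(6) _ assms(3)]
 face_final[OF _ face_infos(7) _ assms(3)]
 have f: "face_R1 : set faces" "face_r2 : set faces" "face_R2 : set faces" "face_r32 : set faces"
 "face_R3 : set faces" "face_r1 : set faces" "face_R4 : set faces" by (simp_all add: faces_def)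
 \<comment> \<open>Four open sectors and the three walls between them, by decreasing ratio of a to
   b.\<close>
 consider "a > 2 * b" | "a = 2 * b" | "3 * b < 2 * a" "a < 2 * b" | "2 * a = 3 * b" | "b < a" "2 * a < 3 * b" | "a = b" | "a < b" by linarith
 thus ?thesis
 proof cases
 case 1
 show ?thesis
 proof (rule fin(1)[OF f(1)])
 \<comment> \<open>The two multipliers are the coordinates of (a, b) with respect to the rays. In
   each sector the rays have determinant 1 up to sign, so these coordinates are integral.\<close>
 show "cone (fst face_R1) a b" unfolding face_rays by (rule cone_rays[of _ _ "int a - 2 * int b" _ "int b"]) (use 1 assms in auto)
 qed (use 1 assms in \<open>simp_all add: is_Gamma1_def is_Gamma2_def markers rval_def\<close>)
 next
 case 2
 show ?thesis
 proof (rule fin(2)[OF f(2)])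
 show "cone (fst face_r2) a b" unfolding face_rays by (rule cone_ray[of _ _ "int b"]) (use 2 assms in auto)
 qed (use 2 assms in \<open>simp_all add: is_Gamma1_def is_Gamma2_def markers rval_def\<close>)
 next
 case 3
 show ?thesis
 proof (rule fin(3)[OF f(3)])
 show "cone (fst face_R2) a b" unfolding face_rays by (rule cone_rays[of _ _ "2 * int a - 3 * int b" _ "2 * int b - int a"]) (use 3 assms in auto)
 qed (use 3 assms in \<open>simp_all add: is_Gamma1_def is_Gamma2_def markers rval_def\<close>)
 next
 case 4
 show ?thesis
 proof (rule fin(4)[OF f(4)])
 show "cone (fst face_r32) a b" unfolding face_rays by (rule cone_ray[of _ _ "int a - int b"]) (use 4 assms in auto)
 qed (use 4 assms in \<open>simp_all add: is_Gamma1_def is_Gamma2_def markers rval_def\<close>)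
 next
 case 5
 show ?thesis
 proof (rule fin(5)[OF f(5)])
 show "cone (fst face_R3) a b" unfolding face_rays by (rule cone_rays[of _ _ "int a - int b" _ "3 * int b - 2 * int a"]) (use 5 assms in auto)
 qed (use 5 assms in \<open>simp_all add: is_Gamma1_def is_Gamma2_def markers rval_def\<close>)
 next
 case 6
 show ?thesis
 proof (rule fin(6)[OF f(6)])
 show "cone (fst face_r1) a b" unfolding face_rays by (rule cone_ray[of _ _ "int a"]) (use 6 assms in auto)
 qed (use 6 assms in \<open>simp_all add: is_Gamma1_def is_Gamma2_def markers rval_def\<close>)
 next
 case 7
 show ?thesis
 proof (rule fin(7)[OF f(7)])
 show "cone (fst face_R4) a b" unfolding face_rays by (rule cone_rays[of _ _ "int a" _ "int b - int a"]) (use 7 assms in auto)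
 qed (use 7 assms in \<open>simp_all add: is_Gamma1_def is_Gamma2_def markers rval_def\<close>)
 qed
qed

end
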